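(* Let $T\in B(H)$ and let $\rho:C^*(T)\to M_k(\mathbb C)$ be an irreducible representation. (1) If $\rho$ is a boundary representation for $\mathcal S_T$, then $\rho(T)$ is a matrix extreme point of the matricial range $\mathbb W(T)$, and $\rho|_{\mathcal S_T}:\mathcal S_T\to M_k(\mathbb C)$ is a pure ucp map. (2) If $C^*(T)$ is $k$-subhomogeneous and $\rho|_{\mathcal S_T}:\mathcal S_T\to M_k(\mathbb C)$ is a pure ucp map, then $\rho$ is a boundary representation for $\mathcal S_T$.
   Context: $\mathcal S_T=\mathrm{span}\{1,T,T^*\}$, $C^*(T)=C^*(\mathcal S_T)$. A boundary representation for $\mathcal S_T$ is an irreducible unital $*$-representation $\rho$ of $C^*(T)$ such that $\rho$ is the only unital completely positive (ucp) extension of $\rho|_{\mathcal S_T}$ to $C^*(T)$. The matricial range is $\mathbb W(T)=(W_n(T))_{n\in\mathbb N}$ with $W_n(T)=\{\phi(T):\phi:\mathcal S_T\to M_n(\mathbb C)\text{ ucp}\}$. An element $X\in W_k(T)$ is a matrix extreme point of $\mathbb W(T)$ if whenever $X=\sum_{j=1}^m A_j^*X_jA_j$ with $X_j\in W_{n_j}(T)$, $A_j\in M_{n_j,k}(\mathbb C)$ of rank $n_j$ and $\sum_jA_j^*A_j=1_k$, then each $n_j=k$ and there are unitaries $U_j\in M_k(\mathbb C)$ with $X_j=U_j^*XU_j$. For completely positive maps $\phi,\psi$ between operator systems, $\psi\le_{cp}\phi$ means $\phi-\psi$ is completely positive; $\phi$ is pure if $\psi\le_{cp}\phi$ implies $\psi=t\phi$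 for some $t\in[0,1]$. A C$^*$-algebra is $k$-subhomogeneous if each of its irreducible representations acts on a space of dimension at most $k$. *)

theory Defs
  imports Complex_Main "Jordan_Normal_Form.Schur_Decomposition" "Jordan_Normal_Form.DL_Rank"
begin

class chilbert = ab_group_add +
  fixes scaleC :: "complex \<Rightarrow> 'a \<Rightarrow> 'a"
    and cinner :: "'a \<Rightarrow> 'a \<Rightarrow> complex"
  assumes scaleC_add_right: "scaleC a (x + y) = scaleC a x + scaleC a y"
    and scaleC_add_left: "scaleC (a + b) x = scaleC a x + scaleC b x"
    and scaleC_scaleC: "scaleC a (scaleC b x) = scaleC (a * b) x"
    and scaleC_one: "scaleC 1 x = x"
    and cinner_conj: "cinner x y = cnj (cinner y x)"
    and cinner_add_right: "cinner x (y + z) = cinner x y + cinner x z"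
    and cinner_scaleC_right: "cinner x (scaleC a y) = a * cinner x y"
    and cinner_nonneg: "0 \<le> Re (cinner x x)"
    and cinner_eq_zero: "cinner x x = 0 \<longleftrightarrow> x = 0"
    and cinner_complete:
      "(\<forall>e>0. \<exists>N. \<forall>m\<ge>N. \<forall>n\<ge>N. sqrt (Re (cinner (f m - f n) (f m - f n))) < e)
        \<Longrightarrow> \<exists>l. (\<lambda>n. sqrt (Re (cinner (f n - l) (f n - l)))) \<longlonglongrightarrow> 0"

definition cnorm :: "'h::chilbert \<Rightarrow> real" where
  "cnorm x = sqrt (Re (cinner x x))"

definition bounded_op :: "('h::chilbert \<Rightarrow> 'h) \<Rightarrow> bool" where
  "bounded_op T \<longleftrightarrow> (\<forall>x y. T (x + y) = T x + T y) \<and> (\<forall>a x. T (scaleC a x) = scaleC a (T x))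
     \<and> (\<exists>C. \<forall>x. cnorm (T x) \<le> C * cnorm x)"

definition adj :: "('h::chilbert \<Rightarrow> 'h) \<Rightarrow> ('h \<Rightarrow> 'h)" where
  "adj T = (THE S. \<forall>x y. cinner (T x) y = cinner x (S y))"

definition opnorm :: "('h::chilbert \<Rightarrow> 'h) \<Rightarrow> real" where
  "opnorm T = Sup ((\<lambda>x. cnorm (T x)) ` {x. cnorm x \<le> 1})"

definition op_add :: "('h::chilbert \<Rightarrow> 'h) \<Rightarrow> ('h \<Rightarrow> 'h) \<Rightarrow> ('h \<Rightarrow> 'h)" where
  "op_add S R = (\<lambda>x. S x + R x)"

definition op_scale :: "complex \<Rightarrow> ('h::chilbert \<Rightarrow> 'h) \<Rightarrow> ('h \<Rightarrow> 'h)" where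
  "op_scale c S = (\<lambda>x. scaleC c (S x))"

inductive_set cstar :: "('h::chilbert \<Rightarrow> 'h) \<Rightarrow> ('h \<Rightarrow> 'h) set" for T where
  cstar_id: "id \<in> cstar T"
| cstar_gen: "T \<in> cstar T"
| cstar_adj: "S \<in> cstar T \<Longrightarrow> adj S \<in> cstar T"
| cstar_add: "S \<in> cstar T \<Longrightarrow> R \<in> cstar T \<Longrightarrow> op_add S R \<in> cstar T"
| cstar_scale: "S \<in> cstar T \<Longrightarrow> op_scale c S \<in> cstar T"
| cstar_mult: "S \<in> cstar T \<Longrightarrow> R \<in> cstar T \<Longrightarrow> S \<circ> R \<in> cstar T"
| cstar_lim: "(\<forall>n. F n \<in> cstar T) \<Longrightarrow> bounded_op S \<Longrightarrow>
     (\<lambda>n. opnorm (\<lambda>x. F n x - S x)) \<longlonglongrightarrow> 0 \<Longrightarrow> S \<in> cstar T"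

definition op_sys :: "('h::chilbert \<Rightarrow> 'h) \<Rightarrow> ('h \<Rightarrow> 'h) set" where
  "op_sys T = {op_add (op_add (op_scale a id) (op_scale b T)) (op_scale c (adj T)) | a b c. True}"

definition nonneg_real :: "complex \<Rightarrow> bool" where
  "nonneg_real z \<longleftrightarrow> Im z = 0 \<and> 0 \<le> Re z"

text \<open>Positivity of an m x m operator matrix [A i j] in M_m(B(H)) = B(H^m).\<close>
definition op_mat_pos :: "nat \<Rightarrow> (nat \<Rightarrow> nat \<Rightarrow> ('h::chilbert \<Rightarrow> 'h)) \<Rightarrow> bool" where
  "op_mat_pos m A \<longleftrightarrow> (\<forall>x :: nat \<Rightarrow> 'h.
      nonneg_real (\<Sum>i<m. \<Sum>j<m. cinner (x i) (A i j (x j))))"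

definition vinner :: "complex vec \<Rightarrow> complex vec \<Rightarrow> complex" where
  "vinner v w = (\<Sum>l<dim_vec v. cnj (v $ l) * w $ l)"

definition blk_mat_pos :: "nat \<Rightarrow> nat \<Rightarrow> (nat \<Rightarrow> nat \<Rightarrow> complex mat) \<Rightarrow> bool" where
  "blk_mat_pos n m B \<longleftrightarrow> (\<forall>v :: nat \<Rightarrow> complex vec. (\<forall>i<m. v i \<in> carrier_vec n) \<longrightarrow>
      nonneg_real (\<Sum>i<m. \<Sum>j<m. vinner (v i) (B i j *\<^sub>v v j)))"

text \<open>A completely positive map from an operator system S \<subseteq> B(H) to M_n(C);
  the map is only relevant on S.\<close>
definition cp_map :: "('h::chilbert \<Rightarrow> 'h) set \<Rightarrow> nat \<Rightarrow> (('h \<Rightarrow> 'h) \<Rightarrow> complex mat) \<Rightarrow> bool" where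
  "cp_map S n \<phi> \<longleftrightarrow>
     (\<forall>a\<in>S. \<phi> a \<in> carrier_mat n n)
   \<and> (\<forall>a\<in>S. \<forall>b\<in>S. \<phi> (op_add a b) = \<phi> a + \<phi> b)
   \<and> (\<forall>a\<in>S. \<forall>c. \<phi> (op_scale c a) = c \<cdot>\<^sub>m \<phi> a)
   \<and> (\<forall>m A. (\<forall>i<m. \<forall>j<m. A i j \<in> S) \<longrightarrow> op_mat_pos m A \<longrightarrow>
          blk_mat_pos n m (\<lambda>i j. \<phi> (A i j)))"

definition ucp_map :: "('h::chilbert \<Rightarrow> 'h) set \<Rightarrow> nat \<Rightarrow> (('h \<Rightarrow> 'h) \<Rightarrow> complex mat) \<Rightarrow> bool" where
  "ucp_map S n \<phi> \<longleftrightarrow> cp_map S n \<phi> \<and> \<phi> id = 1\<^sub>m n"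

definition cp_le :: "('h::chilbert \<Rightarrow> 'h) set \<Rightarrow> nat \<Rightarrow> (('h \<Rightarrow> 'h) \<Rightarrow> complex mat)
     \<Rightarrow> (('h \<Rightarrow> 'h) \<Rightarrow> complex mat) \<Rightarrow> bool" where
  "cp_le S n \<psi> \<phi> \<longleftrightarrow> cp_map S n \<psi> \<and> cp_map S n \<phi> \<and> cp_map S n (\<lambda>a. \<phi> a - \<psi> a)"

definition pure_map :: "('h::chilbert \<Rightarrow> 'h) set \<Rightarrow> nat \<Rightarrow> (('h \<Rightarrow> 'h) \<Rightarrow> complex mat) \<Rightarrow> bool" where
  "pure_map S n \<phi> \<longleftrightarrow> cp_map S n \<phi> \<and>
     (\<forall>\<psi>. cp_le S n \<psi> \<phi> \<longrightarrow> (\<exists>t::real. 0 \<le> t \<and> t \<le> 1 \<and> (\<forall>a\<in>S. \<psi> a = complex_of_real t \<cdot>\<^sub>m \<phi> a)))"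

definition W :: "nat \<Rightarrow> ('h::chilbert \<Rightarrow> 'h) \<Rightarrow> complex mat set" where
  "W n T = {\<phi> T | \<phi>. ucp_map (op_sys T) n \<phi>}"

primrec msum :: "nat \<Rightarrow> (nat \<Rightarrow> complex mat) \<Rightarrow> nat \<Rightarrow> complex mat" where
  "msum k f 0 = 0\<^sub>m k k"
| "msum k f (Suc m) = msum k f m + f m"

definition unitary_mat :: "nat \<Rightarrow> complex mat \<Rightarrow> bool" where
  "unitary_mat k U \<longleftrightarrow> U \<in> carrier_mat k k \<and> U * mat_adjoint U = 1\<^sub>m k \<and> mat_adjoint U * U = 1\<^sub>m k"

definition matrix_extreme :: "('h::chilbert \<Rightarrow> 'h) \<Rightarrow> nat \<Rightarrow> complex mat \<Rightarrow> bool" where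
  "matrix_extreme T k X \<longleftrightarrow> X \<in> W k T \<and>
    (\<forall>m nn XX AA.
       (\<forall>j<m. 1 \<le> nn j \<and> XX j \<in> W (nn j) T \<and> AA j \<in> carrier_mat (nn j) k
              \<and> vec_space.rank (nn j) (AA j) = nn j)
       \<and> msum k (\<lambda>j. mat_adjoint (AA j) * AA j) m = 1\<^sub>m k
       \<and> X = msum k (\<lambda>j. mat_adjoint (AA j) * XX j * AA j) m
     \<longrightarrow> (\<forall>j<m. nn j = k \<and> (\<exists>U. unitary_mat k U \<and> XX j = mat_adjoint U * X * U)))"

definition mat_rep :: "('h::chilbert \<Rightarrow> 'h) \<Rightarrow> nat \<Rightarrow> (('h \<Rightarrow> 'h) \<Rightarrow> complex mat) \<Rightarrow> bool" where
  "mat_rep T k \<rho> \<longleftrightarrow>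
     (\<forall>a\<in>cstar T. \<rho> a \<in> carrier_mat k k) \<and> \<rho> id = 1\<^sub>m k
   \<and> (\<forall>a\<in>cstar T. \<forall>b\<in>cstar T. \<rho> (op_add a b) = \<rho> a + \<rho> b \<and> \<rho> (a \<circ> b) = \<rho> a * \<rho> b)
   \<and> (\<forall>a\<in>cstar T. \<forall>c. \<rho> (op_scale c a) = c \<cdot>\<^sub>m \<rho> a)
   \<and> (\<forall>a\<in>cstar T. \<rho> (adj a) = mat_adjoint (\<rho> a))"

definition irreducible_mat_rep :: "('h::chilbert \<Rightarrow> 'h) \<Rightarrow> nat \<Rightarrow> (('h \<Rightarrow> 'h) \<Rightarrow> complex mat) \<Rightarrow> bool" where
  "irreducible_mat_rep T k \<rho> \<longleftrightarrow> 1 \<le> k \<and> mat_rep T k \<rho> \<and>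
     (\<forall>V. V \<subseteq> carrier_vec k \<and> 0\<^sub>v k \<in> V \<and> (\<forall>v\<in>V. \<forall>w\<in>V. v + w \<in> V) \<and> (\<forall>v\<in>V. \<forall>c. c \<cdot>\<^sub>v v \<in> V)
        \<and> (\<forall>a\<in>cstar T. \<forall>v\<in>V. \<rho> a *\<^sub>v v \<in> V)
        \<longrightarrow> V = {0\<^sub>v k} \<or> V = carrier_vec k)"

definition boundary_rep :: "('h::chilbert \<Rightarrow> 'h) \<Rightarrow> nat \<Rightarrow> (('h \<Rightarrow> 'h) \<Rightarrow> complex mat) \<Rightarrow> bool" where
  "boundary_rep T k \<rho> \<longleftrightarrow> irreducible_mat_rep T k \<rho> \<and>
     (\<forall>\<psi>. ucp_map (cstar T) k \<psi> \<and> (\<forall>a\<in>op_sys T. \<psi> a = \<rho> a) \<longrightarrow> (\<forall>a\<in>cstar T. \<psi> a = \<rho> a))"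

definition l2 :: "(nat \<Rightarrow> complex) set" where
  "l2 = {f. summable (\<lambda>n. (cmod (f n))\<^sup>2)}"

definition l2inner :: "(nat \<Rightarrow> complex) \<Rightarrow> (nat \<Rightarrow> complex) \<Rightarrow> complex" where
  "l2inner f g = (\<Sum>n. cnj (f n) * g n)"

definition l2norm :: "(nat \<Rightarrow> complex) \<Rightarrow> real" where
  "l2norm f = sqrt (\<Sum>n. (cmod (f n))\<^sup>2)"

definition l2_rep :: "('h::chilbert \<Rightarrow> 'h) \<Rightarrow> (('h \<Rightarrow> 'h) \<Rightarrow> (nat \<Rightarrow> complex) \<Rightarrow> (nat \<Rightarrow> complex)) \<Rightarrow> bool" where
  "l2_rep T \<pi> \<longleftrightarrow>
     (\<forall>a\<in>cstar T. (\<forall>x\<in>l2. \<pi> a x \<in> l2)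
        \<and> (\<forall>x\<in>l2. \<forall>y\<in>l2. \<pi> a (\<lambda>n. x n + y n) = (\<lambda>n. \<pi> a x n + \<pi> a y n))
        \<and> (\<forall>x\<in>l2. \<forall>c. \<pi> a (\<lambda>n. c * x n) = (\<lambda>n. c * \<pi> a x n))
        \<and> (\<exists>C. \<forall>x\<in>l2. l2norm (\<pi> a x) \<le> C * l2norm x))
   \<and> (\<forall>x\<in>l2. \<pi> id x = x)
   \<and> (\<forall>a\<in>cstar T. \<forall>b\<in>cstar T. \<forall>x\<in>l2.
        \<pi> (op_add a b) x = (\<lambda>n. \<pi> a x n + \<pi> b x n) \<and> \<pi> (a \<circ> b) x = \<pi> a (\<pi> b x))
   \<and> (\<forall>a\<in>cstar T. \<forall>c. \<forall>x\<in>l2. \<pi> (op_scale c a) x = (\<lambda>n. c * \<pi> a x n))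
   \<and> (\<forall>a\<in>cstar T. \<forall>x\<in>l2. \<forall>y\<in>l2. l2inner (\<pi> a x) y = l2inner x (\<pi> (adj a) y))"

definition irreducible_l2_rep :: "('h::chilbert \<Rightarrow> 'h) \<Rightarrow> (('h \<Rightarrow> 'h) \<Rightarrow> (nat \<Rightarrow> complex) \<Rightarrow> (nat \<Rightarrow> complex)) \<Rightarrow> bool" where
  "irreducible_l2_rep T \<pi> \<longleftrightarrow> l2_rep T \<pi> \<and>
     (\<forall>V. V \<subseteq> l2 \<and> (\<lambda>n. 0) \<in> V \<and> (\<forall>v\<in>V. \<forall>w\<in>V. (\<lambda>n. v n + w n) \<in> V) \<and> (\<forall>v\<in>V. \<forall>c. (\<lambda>n. c * v n) \<in> V)
        \<and> (\<forall>f g. (\<forall>n. f n \<in> V) \<and> g \<in> l2 \<and> (\<lambda>n. l2norm (\<lambda>i. f n i - g i)) \<longlonglongrightarrow> 0 \<longrightarrow> g \<in> V)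
        \<and> (\<forall>a\<in>cstar T. \<forall>v\<in>V. \<pi> a v \<in> V)
        \<longrightarrow> V = {\<lambda>n. 0} \<or> V = l2)"

text \<open>k-subhomogeneity of C*(T): every irreducible representation acts on a space of
  dimension at most k.  Finite-dimensional irreducible representations are (up to unitary
  equivalence) maps into M_m(C); since C*(T) is separable, every infinite-dimensional one is
  unitarily equivalent to one on l^2(N).\<close>
definition subhomogeneous :: "('h::chilbert \<Rightarrow> 'h) \<Rightarrow> nat \<Rightarrow> bool" where
  "subhomogeneous T k \<longleftrightarrow>
     (\<forall>m \<rho>. irreducible_mat_rep T m \<rho> \<longrightarrow> m \<le> k) \<and> \<not> (\<exists>\<pi>. irreducible_l2_rep T \<pi>)"

end

theory Submission
  imports Defs "HOL-Library.Function_Algebras" "HOL-Library.Countable" "Jordan_Normal_Form.Spectral_Radius"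
begin

text \<open>A completely positive map into \<open>M\<^sub>n\<close> is the same as a positive functional on \<open>n \<times> n\<close> operator
  matrices, so extension theorems reduce to the M. Riesz extension theorem.

  (1) If \<open>\<psi> \<le> \<rho>\<close> on the operator system, extend \<open>\<psi>\<close> and \<open>\<rho> - \<psi>\<close> to the algebra. The sum of the
  extensions is \<open>\<rho>\<close> by the unique extension property, and a map below an irreducible representation
  satisfies \<open>\<psi>(b) = \<psi>(1) \<rho>(b) = \<rho>(b) \<psi>(1)\<close>, hence is a multiple of \<open>\<rho>\<close> by Schur's lemma. For a matrix
  convex combination the summands \<open>A\<^sub>j\<^sup>* \<phi>\<^sub>j A\<^sub>j\<close> lie below \<open>\<rho>\<close>, so purity forces every \<open>A\<^sub>j\<close> to be a
  multiple of a unitary.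

  (2) If \<open>\<rho>\<close> had another extension, choosing the largest possible value at every step of the Riesz
  extension would give an extension \<open>\<omega> \<noteq> \<rho>\<close> that is extreme, and therefore pure because \<open>\<rho>\<close> is pure
  on the operator system. The Stinespring representation of \<open>\<omega>\<close> is then irreducible, so it has
  dimension at most \<open>k\<close>. It contains the isometric image of a \<open>k\<close>-dimensional space, so \<open>\<omega>\<close> is
  multiplicative and agrees with \<open>\<rho>\<close> on the generator, a contradiction.\<close>

text \<open>Subhomogeneity speaks only of representations on C^m and on l2, so the Stinespring space
  has to be realised in coordinates. It is never formed as a completed quotient: tuples over C*(T)
  carry a semi-inner product, a countable dense family is orthonormalised, and a tuple is replaced
  by its coefficient sequence. The unit vectors occupy an initial segment of indices, so the space
  is either all of l2 or a C^d. Why extreme gives pure: if \<omega> = \<theta>1 + \<theta>2, purity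
  of \<rho> makes \<theta>1 and \<theta>2 extend t \<rho> and (1 - t) \<rho>. Where the extension
  step assigned the largest value p, the two parts can reach at most t p and (1 - t) p; their sum is
  p, so both bounds are attained. Making the first step at a vector where the rival extension
  exceeds \<rho> keeps \<omega> different from \<rho>. A representation is given purely
  algebraically. Its positivity has to come from factorisations a + l = b* b with l > 0 inside
  C*(T), hence the square root iteration.\<close>

lemma quadratic_nonneg_imp_discrim:
  fixes z :: complex
  assumes "\<And>c. 0 \<le> A + 2 * Re (c * z) + (cmod c)\<^sup>2 * B"
  shows "(cmod z)\<^sup>2 \<le> A * B"
proof (cases "z = 0")
  case True
  have "0 \<le> A" using assms[of 0] by simp
  moreover have "0 \<le> B"
  proof (rule ccontr)
    assume "\<not> 0 \<le> B"
    then have B: "B < 0" by simp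
    \<comment> \<open>Scaling c by \<open>sqrt r\<close> turns the quadratic term into -(A + 1),
      which beats A.\<close>
    define r where "r = (A + 1) / (- B)"
    have "r > 0" using B \<open>0 \<le> A\<close> unfolding r_def by (intro divide_pos_pos) auto
    then have "(cmod (complex_of_real (sqrt r)))\<^sup>2 = r" by simp
    then have "0 \<le> A + r * B" using assms[of "complex_of_real (sqrt r)"] True by simp
    moreover have "r * B = - (A + 1)" using B by (simp add: r_def)
    ultimately show False by simp
  qed
  ultimately show ?thesis using True by simp
next
  case False
  \<comment> \<open>The phase u aligns c * z with the modulus of z and leaves a real quadratic in
    t.\<close>
  define u where "u = cnj z / cmod z"
  have u: "cmod u = 1" "u * z = cmod z"
    using False by (auto simp: u_def norm_divide complex_norm_square[symmetric] power2_eq_square mult.commute)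
  have q: "0 \<le> A + 2 * t * cmod z + t\<^sup>2 * B" for t :: real
  proof -
    have "complex_of_real t * u * z = complex_of_real (t * cmod z)" using u by (simp add: mult.assoc)
    then have "Re (complex_of_real t * u * z) = t * cmod z" by (metis Re_complex_of_real mult.left_commute)
    moreover have "(cmod (complex_of_real t * u))\<^sup>2 = t\<^sup>2" using u by (simp add: norm_mult)
    ultimately show ?thesis using assms[of "complex_of_real t * u"] by (metis mult.assoc)
  qed
  have "B > 0"
  proof (rule ccontr)
    assume "\<not> B > 0"
    define t where "t = - (A + 1) / (2 * cmod z)"
    have "2 * t * cmod z = - (A + 1)" using False by (simp add: t_def)
    moreover have "t\<^sup>2 * B \<le> 0" using \<open>\<not> B > 0\<close> by (simp add: mult_nonneg_nonpos)
    ultimately show False using q[of t] by linarith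
  qed
  \<comment> \<open>t = - cmod z / B is the minimiser of the quadratic.\<close>
  have "0 \<le> A - (cmod z)\<^sup>2 / B"
    using q[of "- cmod z / B"] \<open>B > 0\<close> by (simp add: power2_eq_square field_simps)
  then show ?thesis using \<open>B > 0\<close> by (simp add: field_simps)
qed

lemma null_le_tendsto:
  fixes f :: "'a \<Rightarrow> 'b::real_normed_vector"
  assumes "eventually (\<lambda>x. norm (f x) \<le> g x) F" "(g \<longlongrightarrow> (0::real)) F"
  shows "(f \<longlongrightarrow> 0) F"
  by (rule tendsto_0_le[OF assms(2), of _ 1]) (use assms(1) in \<open>auto elim!: eventually_mono\<close>)

section \<open>Complex Hilbert spaces\<close>

lemma scaleC_zero_right [simp]: "scaleC a (0::'h::chilbert) = 0"
  using scaleC_add_right[of a 0 "0::'h"] by simp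

lemma scaleC_zero_left [simp]: "scaleC 0 (x::'h::chilbert) = 0"
  using scaleC_add_left[of 0 0 x] by simp

lemma scaleC_minus_right: "scaleC a (- x :: 'h::chilbert) = - scaleC a x"
  using scaleC_add_right[of a x "- x"] by (simp add: eq_neg_iff_add_eq_0 add.commute)

lemma scaleC_minus_left: "scaleC (- a) (x :: 'h::chilbert) = - scaleC a x"
  using scaleC_add_left[of a "- a" x] by (simp add: eq_neg_iff_add_eq_0 add.commute)

lemma scaleC_diff_right: "scaleC a (x - y :: 'h::chilbert) = scaleC a x - scaleC a y"
  using scaleC_add_right[of a x "- y"] by (simp add: scaleC_minus_right)

lemma cinner_add_left: "cinner (x + y) (z::'h::chilbert) = cinner x z + cinner y z"
  by (metis cinner_add_right cinner_conj complex_cnj_add)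

lemma cinner_scaleC_left: "cinner (scaleC a x) (y::'h::chilbert) = cnj a * cinner x y"
  by (metis cinner_scaleC_right cinner_conj complex_cnj_mult)

lemma cinner_zero_right [simp]: "cinner x (0::'h::chilbert) = 0"
  using cinner_add_right[of x 0 0] by simp

lemma cinner_zero_left [simp]: "cinner 0 (x::'h::chilbert) = 0"
  using cinner_add_left[of 0 0 x] by simp

lemma cinner_minus_right: "cinner x (- y::'h::chilbert) = - cinner x y"
  using cinner_add_right[of x y "- y"] by (simp add: eq_neg_iff_add_eq_0 add.commute)

lemma cinner_minus_left: "cinner (- x) (y::'h::chilbert) = - cinner x y"
  using cinner_add_left[of x "- x" y] by (simp add: eq_neg_iff_add_eq_0 add.commute)

lemma cinner_diff_right: "cinner x (y - z::'h::chilbert) = cinner x y - cinner x z"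
  using cinner_add_right[of x y "- z"] by (simp add: cinner_minus_right)

lemma cinner_diff_left: "cinner (x - y) (z::'h::chilbert) = cinner x z - cinner y z"
  using cinner_add_left[of x "- y" z] by (simp add: cinner_minus_left)

lemma cinner_sum_right: "cinner x (sum f I :: 'h::chilbert) = (\<Sum>i\<in>I. cinner x (f i))"
  by (induction I rule: infinite_finite_induct) (auto simp: cinner_add_right)

lemma cinner_sum_left: "cinner (sum f I) (x :: 'h::chilbert) = (\<Sum>i\<in>I. cinner (f i) x)"
  by (induction I rule: infinite_finite_induct) (auto simp: cinner_add_left)

lemmas cinner_linear = cinner_add_left cinner_add_right cinner_diff_left cinner_diff_right
  cinner_scaleC_left cinner_scaleC_right cinner_minus_left cinner_minus_right

lemma cnorm_ge_zero [simp]: "0 \<le> cnorm (x::'h::chilbert)"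
  by (simp add: cnorm_def cinner_nonneg)

lemma cnorm_power2: "(cnorm (x::'h::chilbert))\<^sup>2 = Re (cinner x x)"
  by (simp add: cnorm_def cinner_nonneg)

lemma cinner_self: "cinner x (x::'h::chilbert) = complex_of_real ((cnorm x)\<^sup>2)"
proof -
  have "Im (cinner x x) = - Im (cinner x x)"
    using arg_cong[OF cinner_conj[of x x], of Im] by simp
  then show ?thesis unfolding cnorm_power2 by (simp add: complex_eq_iff)
qed

lemma cnorm_zero [simp]: "cnorm (0::'h::chilbert) = 0"
  by (simp add: cnorm_def)

lemma cnorm_eq_zero [simp]: "cnorm (x::'h::chilbert) = 0 \<longleftrightarrow> x = 0"
  by (metis cinner_eq_zero cinner_self cnorm_zero of_real_0 zero_power2)

lemma cnorm_scaleC: "cnorm (scaleC a (x::'h::chilbert)) = cmod a * cnorm x"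
proof -
  have "cnj a * (a * complex_of_real ((cnorm x)\<^sup>2)) = complex_of_real ((cmod a * cnorm x)\<^sup>2)"
    by (simp add: power_mult_distrib complex_norm_square[symmetric] mult_ac del: of_real_power)
  then have "Re (cinner (scaleC a x) (scaleC a x)) = (cmod a * cnorm x)\<^sup>2"
    unfolding cinner_scaleC_left cinner_scaleC_right cinner_self[of x] by (metis Re_complex_of_real mult.left_commute)
  then show ?thesis by (simp add: cnorm_def[of "scaleC a x"])
qed

lemma cnorm_minus [simp]: "cnorm (- x::'h::chilbert) = cnorm x"
  by (simp add: cnorm_def cinner_minus_left cinner_minus_right)

lemma cnorm_minus_commute: "cnorm (x - y::'h::chilbert) = cnorm (y - x)"
  by (metis cnorm_minus minus_diff_eq)

lemma cnorm_add_power2: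
  "(cnorm (x + y::'h::chilbert))\<^sup>2 = (cnorm x)\<^sup>2 + 2 * Re (cinner x y) + (cnorm y)\<^sup>2"
proof -
  have "Re (cinner y x) = Re (cinner x y)" using cinner_conj[of y x] by simp
  then show ?thesis by (simp add: cnorm_power2 cinner_linear)
qed

lemma Cauchy_Schwarz_cinner: "cmod (cinner x (y::'h::chilbert)) \<le> cnorm x * cnorm y"
proof -
  have "(cmod (cinner x y))\<^sup>2 \<le> (cnorm x)\<^sup>2 * (cnorm y)\<^sup>2"
  proof (rule quadratic_nonneg_imp_discrim)
    fix c
    show "0 \<le> (cnorm x)\<^sup>2 + 2 * Re (c * cinner x y) + (cmod c)\<^sup>2 * (cnorm y)\<^sup>2"
      using cnorm_add_power2[of x "scaleC c y"]
      by (simp add: cnorm_scaleC power_mult_distrib cinner_scaleC_right)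
        (metis zero_le_power2)
  qed
  then show ?thesis by (simp add: power_mult_distrib[symmetric] abs_le_square_iff[symmetric])
qed

lemma cnorm_triangle: "cnorm (x + y::'h::chilbert) \<le> cnorm x + cnorm y"
proof -
  have "Re (cinner x y) \<le> cnorm x * cnorm y"
    using Cauchy_Schwarz_cinner[of x y] complex_Re_le_cmod[of "cinner x y"] by linarith
  then have "(cnorm (x + y))\<^sup>2 \<le> (cnorm x + cnorm y)\<^sup>2"
    by (simp add: cnorm_add_power2 power2_sum)
  then show ?thesis by (simp add: abs_le_square_iff[symmetric])
qed

lemma cnorm_triangle_diff: "cnorm (x - y::'h::chilbert) \<le> cnorm x + cnorm y"
  using cnorm_triangle[of x "- y"] by simp

lemma cnorm_triangle_via: "cnorm (x - z::'h::chilbert) \<le> cnorm (x - y) + cnorm (y - z)"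
  using cnorm_triangle[of "x - y" "y - z"] by simp

lemma cnorm_parallelogram:
  "(cnorm (x + y::'h::chilbert))\<^sup>2 + (cnorm (x - y))\<^sup>2 = 2 * (cnorm x)\<^sup>2 + 2 * (cnorm y)\<^sup>2"
  using cnorm_add_power2[of x y] cnorm_add_power2[of x "- y"] by (simp add: cinner_minus_right)

lemma tendsto_cinner_right:
  fixes f :: "nat \<Rightarrow> 'h::chilbert"
  assumes "(\<lambda>n. cnorm (f n - l)) \<longlonglongrightarrow> 0"
  shows "(\<lambda>n. cinner x (f n)) \<longlonglongrightarrow> cinner x l"
proof -
  have "(\<lambda>n. cnorm x * cnorm (f n - l)) \<longlonglongrightarrow> 0"
    using tendsto_mult_right_zero[OF assms] .
  then have "(\<lambda>n. cinner x (f n) - cinner x l) \<longlonglongrightarrow> 0"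
    by (rule null_le_tendsto[rotated])
      (auto simp: cinner_diff_right[symmetric] Cauchy_Schwarz_cinner)
  then show ?thesis by (simp add: LIM_zero_iff)
qed

lemma tendsto_cnorm:
  fixes f :: "nat \<Rightarrow> 'h::chilbert"
  assumes "(\<lambda>n. cnorm (f n - l)) \<longlonglongrightarrow> 0"
  shows "(\<lambda>n. cnorm (f n)) \<longlonglongrightarrow> cnorm l"
proof -
  have "(\<lambda>n. cnorm (f n) - cnorm l) \<longlonglongrightarrow> 0"
  proof (rule null_le_tendsto[OF _ assms], rule always_eventually, rule allI)
    fix n
    show "norm (cnorm (f n) - cnorm l) \<le> cnorm (f n - l)"
      using cnorm_triangle[of "f n - l" l] cnorm_triangle[of "l - f n" "f n"]
      by (simp add: cnorm_minus_commute[of l])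
  qed
  then show ?thesis by (simp add: LIM_zero_iff)
qed

lemma cnorm_tendsto_unique:
  fixes f :: "nat \<Rightarrow> 'h::chilbert"
  assumes "(\<lambda>n. cnorm (f n - l)) \<longlonglongrightarrow> 0" "(\<lambda>n. cnorm (f n - m)) \<longlonglongrightarrow> 0"
  shows "l = m"
proof -
  have "(\<lambda>n. cnorm (f n - l) + cnorm (f n - m)) \<longlonglongrightarrow> 0"
    using tendsto_add[OF assms] by simp
  then have "cnorm (l - m) \<le> 0"
    by (rule LIMSEQ_le_const)
      (metis cnorm_triangle_via cnorm_minus_commute)
  then show ?thesis by (metis cnorm_eq_zero cnorm_ge_zero antisym eq_iff_diff_eq_0)
qed

lemma Cauchy_cnorm_convergent:
  fixes f :: "nat \<Rightarrow> 'h::chilbert"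
  assumes "\<And>e. e > 0 \<Longrightarrow> \<exists>N. \<forall>m\<ge>N. \<forall>n\<ge>N. cnorm (f m - f n) < e"
  obtains l where "(\<lambda>n. cnorm (f n - l)) \<longlonglongrightarrow> 0"
  using cinner_complete[of f] assms unfolding cnorm_def by blast

section \<open>Orthogonal projections and the Riesz representation theorem\<close>

definition csubspace :: "'h::chilbert set \<Rightarrow> bool" where
  "csubspace V \<longleftrightarrow> 0 \<in> V \<and> (\<forall>v\<in>V. \<forall>w\<in>V. v + w \<in> V) \<and> (\<forall>v\<in>V. \<forall>c. scaleC c v \<in> V)"

lemma csubspace_diff: "csubspace V \<Longrightarrow> v \<in> V \<Longrightarrow> w \<in> V \<Longrightarrow> v - w \<in> V"
  unfolding csubspace_def by (metis add_uminus_conv_diff scaleC_minus_left scaleC_one)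

definition orth_proj :: "'h::chilbert set \<Rightarrow> 'h \<Rightarrow> 'h \<Rightarrow> bool" where
  "orth_proj V x p \<longleftrightarrow> p \<in> V \<and> (\<forall>v\<in>V. cinner v (x - p) = 0)"

text \<open>A sequence minimising the distance to V is Cauchy because V contains midpoints.
  Closedness is assumed in sequential form, which is what a kernel and a closed subspace of l2
  supply.\<close>

theorem orth_proj_exists:
  fixes V :: "'h::chilbert set"
  assumes V: "csubspace V"
    and cl: "\<And>f l. (\<forall>n. f n \<in> V) \<Longrightarrow> (\<lambda>n. cnorm (f n - l)) \<longlonglongrightarrow> 0 \<Longrightarrow> l \<in> V"
  shows "\<exists>p. orth_proj V x p"
proof -
  define S where "S = (\<lambda>v. (cnorm (x - v))\<^sup>2) ` V"
  define D where "D = Inf S"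
  have "0 \<in> V" using V by (simp add: csubspace_def)
  have bb: "bdd_below S" by (rule bdd_belowI[of _ 0]) (auto simp: S_def)
  have D: "D \<le> (cnorm (x - v))\<^sup>2" if "v \<in> V" for v
    unfolding D_def by (rule cInf_lower[OF _ bb]) (use that in \<open>auto simp: S_def\<close>)
  have "\<exists>v\<in>V. (cnorm (x - v))\<^sup>2 < D + inverse (real (Suc n))" for n
  proof -
    have "S \<noteq> {}" using \<open>0 \<in> V\<close> by (auto simp: S_def)
    moreover have "Inf S < D + inverse (real (Suc n))" by (simp add: D_def del: of_nat_Suc)
    ultimately obtain s where "s \<in> S" "s < D + inverse (real (Suc n))"
      using cInf_lessD by blast
    then show ?thesis by (auto simp: S_def)
  qed
  then obtain v where v: "\<And>n. v n \<in> V" "\<And>n. (cnorm (x - v n))\<^sup>2 < D + inverse (real (Suc n))"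
    by metis
  \<comment> \<open>Parallelogram law for x - v m and x - v n: the midpoint of v m and v n has
    squared distance at least D from x, so only the two excesses over D remain.\<close>
  have close: "(cnorm (v m - v n))\<^sup>2 \<le> 2 * inverse (real (Suc m)) + 2 * inverse (real (Suc n))" for m n
  proof -
    have mid: "scaleC (1/2) (v m + v n) \<in> V" using V v by (simp add: csubspace_def)
    have half: "scaleC 2 (scaleC (1/2) w) = w" for w :: 'h by (simp add: scaleC_scaleC scaleC_one)
    have two: "scaleC 2 w = w + w" for w :: 'h
      using scaleC_add_left[of 1 1 w] by (simp add: scaleC_one)
    have "(x - v m) + (x - v n) = scaleC 2 (x - scaleC (1/2) (v m + v n))"
      by (simp add: scaleC_diff_right half) (simp add: two algebra_simps)
    then have "(cnorm ((x - v m) + (x - v n)))\<^sup>2 = 4 * (cnorm (x - scaleC (1/2) (v m + v n)))\<^sup>2"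
      by (simp add: cnorm_scaleC power_mult_distrib)
    moreover have "(x - v m) - (x - v n) = v n - v m" by simp
    ultimately show ?thesis
      using cnorm_parallelogram[of "x - v m" "x - v n"] D[OF mid] v(2)[of m] v(2)[of n]
      by (simp add: cnorm_minus_commute[of "v n"] del: of_nat_Suc)
  qed
  have "\<exists>N. \<forall>m\<ge>N. \<forall>n\<ge>N. cnorm (v m - v n) < e" if "e > 0" for e
  proof -
    obtain N where N: "inverse (real (Suc N)) < e\<^sup>2 / 4"
      using reals_Archimedean[of "e\<^sup>2 / 4"] \<open>e > 0\<close> by auto
    have "cnorm (v m - v n) < e" if "m \<ge> N" "n \<ge> N" for m n
    proof -
      have "inverse (real (Suc m)) \<le> inverse (real (Suc N))" "inverse (real (Suc n)) \<le> inverse (real (Suc N))"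
        using that by (auto intro!: le_imp_inverse_le)
      then have "(cnorm (v m - v n))\<^sup>2 < e\<^sup>2" using close[of m n] N by linarith
      then show ?thesis using \<open>e > 0\<close> by (simp add: power2_less_imp_less)
    qed
    then show ?thesis by blast
  qed
  then obtain p where p: "(\<lambda>n. cnorm (v n - p)) \<longlonglongrightarrow> 0" by (rule Cauchy_cnorm_convergent)
  have "p \<in> V" using cl v(1) p by blast
  have "(\<lambda>n. cnorm ((x - v n) - (x - p))) \<longlonglongrightarrow> 0"
    using p by (simp add: cnorm_minus_commute)
  then have "(\<lambda>n. (cnorm (x - v n))\<^sup>2) \<longlonglongrightarrow> (cnorm (x - p))\<^sup>2"
    by (intro tendsto_power tendsto_cnorm)
  moreover have "(\<lambda>n. D + inverse (real (Suc n))) \<longlonglongrightarrow> D + 0"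
    by (intro tendsto_intros LIMSEQ_inverse_real_of_nat)
  ultimately have pD: "(cnorm (x - p))\<^sup>2 \<le> D"
    using LIMSEQ_le v(2) by (metis (no_types, lifting) add.right_neutral less_imp_le)
  have "cinner w (x - p) = 0" if "w \<in> V" for w
  proof -
    \<comment> \<open>Minimality of p against p - c w is a quadratic inequality in c whose constant
      term is zero, so the discriminant bound is zero as well.\<close>
    have "(cmod (cinner (x - p) w))\<^sup>2 \<le> 0 * (cnorm w)\<^sup>2"
    proof (rule quadratic_nonneg_imp_discrim)
      fix c
      have "p - scaleC c w \<in> V" using V that \<open>p \<in> V\<close> by (simp add: csubspace_diff csubspace_def)
      moreover have "x - (p - scaleC c w) = (x - p) + scaleC c w" by simp
      ultimately have "(cnorm (x - p))\<^sup>2 \<le> (cnorm ((x - p) + scaleC c w))\<^sup>2"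
        using D[of "p - scaleC c w"] pD by (metis order_trans)
      then show "0 \<le> 0 + 2 * Re (c * cinner (x - p) w) + (cmod c)\<^sup>2 * (cnorm w)\<^sup>2"
        by (simp add: cnorm_add_power2 cnorm_scaleC power_mult_distrib cinner_scaleC_right)
    qed
    then show ?thesis using cinner_conj[of w "x - p"] by simp
  qed
  then show ?thesis using \<open>p \<in> V\<close> unfolding orth_proj_def by blast
qed

text \<open>Serves subspaces of C^d, which are given algebraically and come without closedness.
  Parseval with d vectors of norm at most 1 bounds the size of orthonormal families in V by d; one
  of maximal size spans V, and the projection is a finite Fourier sum.\<close>

lemma orth_proj_exists_finite:
  fixes V :: "'h::chilbert set" and \<delta> :: "nat \<Rightarrow> 'h"
  assumes V: "csubspace V" and \<delta>: "\<And>n. cnorm (\<delta> n) \<le> 1"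
    and norm: "\<And>v. v \<in> V \<Longrightarrow> (cnorm v)\<^sup>2 = (\<Sum>n<d. (cmod (cinner (\<delta> n) v))\<^sup>2)"
  shows "\<exists>p. orth_proj V f p"
proof -
  define ON where "ON g N \<longleftrightarrow> (\<forall>i<N. g i \<in> V) \<and> (\<forall>i<N. \<forall>j<N. cinner (g i) (g j) = (if i = j then 1 else 0))"
    for g :: "nat \<Rightarrow> 'h" and N :: nat
  have sumV: "(\<Sum>i<N. scaleC (c i) (g i)) \<in> V" if "\<And>i. i < N \<Longrightarrow> g i \<in> V" for c and g :: "nat \<Rightarrow> 'h" and N :: nat
    using that by (induction N) (use V in \<open>auto simp: csubspace_def\<close>)
  define R where "R g N x = x - (\<Sum>i<N. scaleC (cinner (g i) x) (g i))" for g :: "nat \<Rightarrow> 'h" and N x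
  have Rorth: "cinner (g j) (R g N x) = 0" if g: "ON g N" and j: "j < N" for g N x j
  proof -
    have "cinner (g j) (\<Sum>i<N. scaleC (cinner (g i) x) (g i)) = (\<Sum>i<N. if i = j then cinner (g i) x else 0)"
      unfolding cinner_sum_right cinner_scaleC_right
      by (intro sum.cong refl) (use g j in \<open>auto simp: ON_def\<close>)
    also have "\<dots> = cinner (g j) x" by (simp only: sum.delta[OF finite_lessThan] lessThan_iff j if_True)
    finally show ?thesis by (simp add: R_def cinner_diff_right)
  qed
  have Rnorm: "(cnorm (R g N x))\<^sup>2 = (cnorm x)\<^sup>2 - (\<Sum>i<N. (cmod (cinner (g i) x))\<^sup>2)" if g: "ON g N" for g N x
  proof -
    have "cinner (R g N x) (R g N x) = cinner x (R g N x)"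
    proof -
      have "cinner (\<Sum>i<N. scaleC (cinner (g i) x) (g i)) (R g N x) = 0"
        unfolding cinner_sum_left cinner_scaleC_left by (intro sum.neutral) (simp add: Rorth[OF g])
      then show ?thesis unfolding R_def[of g N x] by (simp add: cinner_diff_left)
    qed
    also have "\<dots> = cinner x x - (\<Sum>i<N. cinner (g i) x * cinner x (g i))"
      by (simp add: R_def cinner_diff_right cinner_sum_right cinner_scaleC_right)
    also have "(\<Sum>i<N. cinner (g i) x * cinner x (g i)) = complex_of_real (\<Sum>i<N. (cmod (cinner (g i) x))\<^sup>2)"
      unfolding of_real_sum by (intro sum.cong refl) (metis cinner_conj complex_norm_square)
    finally show ?thesis by (simp add: cnorm_power2)
  qed
  have bessel: "(\<Sum>i<N. (cmod (cinner (g i) x))\<^sup>2) \<le> (cnorm x)\<^sup>2" if "ON g N" for g N x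
    using Rnorm[OF that, of x] zero_le_power2[of "cnorm (R g N x)"] by linarith
  \<comment> \<open>Double counting of the squared inner products between g and \<delta>: Parseval
    on V gives N, Bessel for each \<delta> n gives at most d.\<close>
  have card: "N \<le> d" if g: "ON g N" for g N
  proof -
    have "real N = (\<Sum>i<N. (cnorm (g i))\<^sup>2)"
      using g by (simp add: ON_def cnorm_power2)
    also have "\<dots> = (\<Sum>i<N. \<Sum>n<d. (cmod (cinner (\<delta> n) (g i)))\<^sup>2)"
      by (intro sum.cong refl norm) (use g in \<open>auto simp: ON_def\<close>)
    also have "\<dots> = (\<Sum>n<d. \<Sum>i<N. (cmod (cinner (g i) (\<delta> n)))\<^sup>2)"
    proof -
      have "cmod (cinner (\<delta> n) (g i)) = cmod (cinner (g i) (\<delta> n))" for n i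
        by (metis cinner_conj complex_mod_cnj)
      then show ?thesis by (simp only:) (rule sum.swap)
    qed
    also have "\<dots> \<le> (\<Sum>n<d. 1)"
    proof (rule sum_mono)
      fix n
      have "(cnorm (\<delta> n))\<^sup>2 \<le> 1" using \<delta>[of n] by (simp add: power_le_one)
      then show "(\<Sum>i<N. (cmod (cinner (g i) (\<delta> n)))\<^sup>2) \<le> 1" using bessel[OF g, of "\<delta> n"] by linarith
    qed
    finally show ?thesis by simp
  qed
  have "\<exists>N. (\<exists>g. ON g N) \<and> (\<forall>M. (\<exists>g. ON g M) \<longrightarrow> M \<le> N)"
  proof (rule ccontr)
    assume "\<not> ?thesis"
    then have step: "\<exists>M>N. \<exists>g. ON g M" if "\<exists>g. ON g N" for N using that by (meson not_le)
    have "\<exists>N\<ge>n. \<exists>g. ON g N" for n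
    proof (induction n)
      case 0
      show ?case by (intro exI[of _ 0]) (simp add: ON_def)
    next
      case (Suc n)
      then show ?case using step by (meson Suc_leI le_less_trans)
    qed
    then obtain N g where "N \<ge> Suc d" "ON g N" by blast
    then show False using card by fastforce
  qed
  then obtain N g where g: "ON g N" and max: "\<And>M g. ON g M \<Longrightarrow> M \<le> N" by blast
  have gV: "g i \<in> V" if "i < N" for i using g that by (simp add: ON_def)
  \<comment> \<open>A nonzero residual, once normalised, would enlarge the maximal family.\<close>
  have span: "R g N v = 0" if v: "v \<in> V" for v
  proof (rule ccontr)
    assume nz: "R g N v \<noteq> 0"
    define s where "s = cnorm (R g N v)"
    have s: "s > 0" using nz cnorm_ge_zero[of "R g N v"] cnorm_eq_zero[of "R g N v"] unfolding s_def by linarith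
    define h where "h = scaleC (complex_of_real (1 / s)) (R g N v)"
    have RV: "R g N v \<in> V" unfolding R_def by (rule csubspace_diff[OF V v sumV[OF gV]])
    then have hV: "h \<in> V" using V by (simp add: h_def csubspace_def)
    have gh: "cinner (g i) h = 0" if "i < N" for i by (simp add: h_def cinner_scaleC_right Rorth[OF g that])
    have hg: "cinner h (g i) = 0" if "i < N" for i using gh[OF that] cinner_conj[of h "g i"] by simp
    have "cnorm h = 1" using s by (simp add: h_def cnorm_scaleC s_def[symmetric] norm_divide)
    then have hh: "cinner h h = 1" by (simp add: cinner_self)
    have "ON (g(N := h)) (Suc N)"
      using g hV gh hg hh unfolding ON_def by (auto simp: less_Suc_eq)
    then show False using max by fastforce
  qed
  define p where "p = (\<Sum>i<N. scaleC (cinner (g i) f) (g i))"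
  have "orth_proj V f p"
    unfolding orth_proj_def
  proof (intro conjI ballI)
    show "p \<in> V" unfolding p_def by (rule sumV[OF gV])
    fix v assume "v \<in> V"
    then have "v = (\<Sum>i<N. scaleC (cinner (g i) v) (g i))" using span unfolding R_def by simp
    then have "cinner v (f - p) = (\<Sum>i<N. cnj (cinner (g i) v) * cinner (g i) (f - p))"
      by (metis (no_types, lifting) cinner_sum_left cinner_scaleC_left sum.cong)
    also have "\<dots> = 0" using Rorth[OF g, of _ f] by (intro sum.neutral) (simp add: R_def p_def)
    finally show "cinner v (f - p) = 0" .
  qed
  then show ?thesis ..
qed

text \<open>If f is not zero there is z orthogonal to the kernel with f z nonzero. Every x - (f x /
  f z) z lies in the kernel, and its orthogonality to z exhibits f as the inner product with a
  multiple of z.\<close>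

theorem cinner_representation:
  fixes f :: "'h::chilbert \<Rightarrow> complex"
  assumes add: "\<And>x y. f (x + y) = f x + f y" and sc: "\<And>a x. f (scaleC a x) = a * f x"
    and bd: "\<And>x. cmod (f x) \<le> C * cnorm x"
  shows "\<exists>y. \<forall>x. f x = cinner y x"
proof (cases "\<forall>x. f x = 0")
  case True
  then show ?thesis by (intro exI[of _ 0]) simp
next
  case False
  then obtain x0 where x0: "f x0 \<noteq> 0" by blast
  have f0: "f 0 = 0" using sc[of 0 0] by simp
  have fd: "f (x - y) = f x - f y" for x y using add[of "x - y" y] by simp
  define V where "V = {x. f x = 0}"
  have "\<exists>p. orth_proj V x0 p"
  proof (rule orth_proj_exists)
    show "csubspace V" by (auto simp: V_def csubspace_def add sc f0)
    fix g l assume g: "\<forall>n. g n \<in> V" "(\<lambda>n. cnorm (g n - l)) \<longlonglongrightarrow> 0"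
    have "(\<lambda>n. C * cnorm (g n - l)) \<longlonglongrightarrow> 0" using tendsto_mult_right_zero[OF g(2)] .
    then have "cmod (f l) \<le> 0"
    proof (rule LIMSEQ_le_const, intro exI allI impI)
      fix n
      show "cmod (f l) \<le> C * cnorm (g n - l)" using bd[of "g n - l"] g(1) by (simp add: V_def fd)
    qed
    then show "l \<in> V" by (simp add: V_def)
  qed
  then obtain p where p: "f p = 0" "\<And>v. f v = 0 \<Longrightarrow> cinner v (x0 - p) = 0"
    by (auto simp: orth_proj_def V_def)
  define z where "z = x0 - p"
  have fz: "f z \<noteq> 0" using x0 p by (simp add: z_def fd)
  have "z \<noteq> 0" using fz f0 by auto
  then have zz: "cinner z z \<noteq> 0" by (simp add: cinner_eq_zero)
  have key: "cinner z x * f z = f x * cinner z z" for x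
  proof -
    have "f (x - scaleC (f x / f z) z) = 0" using fz by (simp add: fd sc)
    then have "cinner (x - scaleC (f x / f z) z) z = 0" using p(2) by (simp add: z_def)
    then have "cinner z (x - scaleC (f x / f z) z) = 0" by (metis cinner_conj complex_cnj_zero)
    then show ?thesis using fz by (simp add: cinner_linear field_simps)
  qed
  define c where "c = f z / cinner z z"
  have "f x = cinner (scaleC (cnj c) z) x" for x
  proof -
    have "cinner (scaleC (cnj c) z) x = (cinner z x * f z) / cinner z z"
      by (simp add: cinner_scaleC_left c_def)
    then show ?thesis using key zz by simp
  qed
  then show ?thesis by blast
qed

section \<open>Bounded operators\<close>

text \<open>Explicit bounds are tracked instead of \<open>opnorm\<close>: the latter is a
  \<open>Sup\<close>, which carries information only once boundedness is known.\<close>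

definition op_bound :: "('h::chilbert \<Rightarrow> 'h) \<Rightarrow> real \<Rightarrow> bool" where
  "op_bound S c \<longleftrightarrow> 0 \<le> c \<and> (\<forall>x. cnorm (S x) \<le> c * cnorm x)"

lemma bounded_op_add: "bounded_op S \<Longrightarrow> S (x + y) = S x + S y"
  and bounded_op_scaleC: "bounded_op S \<Longrightarrow> S (scaleC a x) = scaleC a (S x)"
  by (auto simp: bounded_op_def)

lemma bounded_op_zero: "bounded_op S \<Longrightarrow> S 0 = 0"
  using bounded_op_scaleC[of S 0 0] by simp

lemma bounded_op_minus: "bounded_op S \<Longrightarrow> S (- x) = - S x"
  using bounded_op_scaleC[of S "-1" x] by (simp add: scaleC_minus_left scaleC_one)

lemma bounded_op_diff: "bounded_op S \<Longrightarrow> S (x - y) = S x - S y"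
  using bounded_op_add[of S x "- y"] by (simp add: bounded_op_minus)

lemma bounded_op_sum: "bounded_op S \<Longrightarrow> S (sum f I) = (\<Sum>i\<in>I. S (f i))"
  by (induction I rule: infinite_finite_induct) (auto simp: bounded_op_zero bounded_op_add)

lemma bounded_op_bound: assumes "bounded_op S" shows "\<exists>c. op_bound S c"
proof -
  obtain C where C: "\<And>x. cnorm (S x) \<le> C * cnorm x" using assms by (auto simp: bounded_op_def)
  have "cnorm (S x) \<le> max C 0 * cnorm x" for x
    using C[of x] mult_right_mono[of C "max C 0" "cnorm x"] by simp
  then show ?thesis unfolding op_bound_def by (metis max.cobounded2)
qed

lemma bounded_opI:
  assumes "\<And>x y. S (x + y) = S x + S y" "\<And>a x. S (scaleC a x) = scaleC a (S x)" "op_bound S c"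
  shows "bounded_op S"
  using assms unfolding bounded_op_def op_bound_def by blast

lemma opnorm_bound: assumes "bounded_op S" shows "op_bound S (opnorm S)"
proof -
  obtain c where c: "op_bound S c" using bounded_op_bound[OF assms] ..
  have bdd: "bdd_above ((\<lambda>x. cnorm (S x)) ` {x. cnorm x \<le> 1})"
  proof (rule bdd_aboveI2)
    fix x :: 'a assume "x \<in> {x. cnorm x \<le> 1}"
    then have "c * cnorm x \<le> c * 1" using c by (intro mult_left_mono) (auto simp: op_bound_def)
    then show "cnorm (S x) \<le> c" using c by (simp add: op_bound_def) (meson order_trans)
  qed
  have le: "cnorm (S x) \<le> opnorm S" if "cnorm x \<le> 1" for x
    unfolding opnorm_def by (rule cSup_upper[OF _ bdd]) (use that in auto)
  have "0 \<le> opnorm S" using le[of 0] order_trans[OF cnorm_ge_zero] by force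
  moreover have "cnorm (S x) \<le> opnorm S * cnorm x" for x
  proof (cases "x = 0")
    case True
    then show ?thesis using assms by (simp add: bounded_op_zero)
  next
    case False
    then have n: "cnorm x > 0" using cnorm_ge_zero[of x] cnorm_eq_zero[of x] by linarith
    have "cnorm (S (scaleC (inverse (cnorm x)) x)) \<le> opnorm S"
      by (rule le) (use n in \<open>simp add: cnorm_scaleC norm_inverse\<close>, simp add: field_simps)
    then show ?thesis using n assms
      by (simp add: bounded_op_scaleC cnorm_scaleC norm_inverse) (simp add: field_simps)
  qed
  ultimately show ?thesis by (simp add: op_bound_def)
qed

lemma opnorm_le: assumes "op_bound S c" shows "opnorm S \<le> c" "0 \<le> opnorm S"
proof -
  have le: "cnorm (S x) \<le> c" if "cnorm x \<le> 1" for x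
  proof -
    have "c * cnorm x \<le> c * 1" using that assms by (intro mult_left_mono) (auto simp: op_bound_def)
    then show ?thesis using assms by (simp add: op_bound_def) (meson order_trans)
  qed
  show "opnorm S \<le> c"
    unfolding opnorm_def by (rule cSUP_least) (use le in \<open>auto intro: exI[of _ 0]\<close>)
  have "cnorm (S 0) \<le> opnorm S"
    unfolding opnorm_def by (rule cSUP_upper) (use le in \<open>auto intro!: bdd_aboveI2\<close>)
  then show "0 \<le> opnorm S" using cnorm_ge_zero order_trans by blast
qed

lemma adj_unique:
  assumes "\<And>x y. cinner (S x) y = cinner x (R y)"
  shows "adj S = (R :: 'h::chilbert \<Rightarrow> 'h)"
  unfolding adj_def
proof (rule the_equality)
  show "\<forall>x y. cinner (S x) y = cinner x (R y)" using assms by simp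
  fix R' assume R': "\<forall>x y. cinner (S x) y = cinner x (R' y)"
  have "cinner (R' y - R y) (R' y - R y) = 0" for y
    using R' assms[of "R' y - R y" y] by (simp add: cinner_diff_right)
  then show "R' = R" by (auto simp: cinner_eq_zero)
qed

text \<open>\<open>adj\<close> is a definite description, so existence must be supplied: for fixed y
  the functional x \<mapsto> <y, S x> is bounded and has a representing vector.\<close>

lemma cinner_adj:
  assumes "bounded_op S"
  shows "cinner (S x) y = cinner x (adj S y)"
proof -
  obtain c where c: "op_bound S c" using bounded_op_bound[OF assms] ..
  have "\<exists>z. \<forall>x. cinner y (S x) = cinner z x" for y
  proof (rule cinner_representation)
    show "cmod (cinner y (S x)) \<le> (cnorm y * c) * cnorm x" for x
      using Cauchy_Schwarz_cinner[of y "S x"] c mult_left_mono[of "cnorm (S x)" "c * cnorm x" "cnorm y"]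
      by (auto simp: op_bound_def mult_ac intro: order_trans)
  qed (use assms in \<open>auto simp: bounded_op_add bounded_op_scaleC cinner_linear\<close>)
  then obtain R where R: "\<And>y x. cinner y (S x) = cinner (R y) x" by metis
  have *: "cinner (S x) y = cinner x (R y)" for x y
    using arg_cong[OF R[of y x], of cnj] by (metis cinner_conj)
  show ?thesis using * adj_unique[of S R] by simp
qed

lemma cinner_adj_left: "bounded_op S \<Longrightarrow> cinner (adj S x) y = cinner x (S y)"
  by (metis cinner_adj cinner_conj)

text \<open>The square of |S* x| equals <S S* x, x>, which is at most c |S* x| |x|; divide by |S*
  x|.\<close>

lemma op_bound_adj:
  assumes "bounded_op S" "op_bound S c"
  shows "op_bound (adj S) c"
proof -
  have "cnorm (adj S x) \<le> c * cnorm x" for x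
  proof (cases "adj S x = 0")
    case True
    then show ?thesis using assms(2) by (simp add: op_bound_def)
  next
    case False
    then have n: "cnorm (adj S x) > 0" using cnorm_ge_zero[of "adj S x"] cnorm_eq_zero[of "adj S x"] by linarith
    have "complex_of_real ((cnorm (adj S x))\<^sup>2) = cinner (S (adj S x)) x"
      using cinner_adj[OF assms(1), of "adj S x" x] by (simp add: cinner_self)
    then have "(cnorm (adj S x))\<^sup>2 \<le> cnorm (S (adj S x)) * cnorm x"
      using Cauchy_Schwarz_cinner[of "S (adj S x)" x] by (metis abs_power2 norm_of_real)
    also have "\<dots> \<le> c * cnorm (adj S x) * cnorm x"
      using assms(2) by (intro mult_right_mono) (auto simp: op_bound_def)
    finally show ?thesis using n by (simp add: power2_eq_square mult_ac)
  qed
  then show ?thesis using assms(2) by (simp add: op_bound_def)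
qed

lemma cinner_left_cancel: "(\<And>x. cinner x y = cinner x z) \<Longrightarrow> y = (z::'h::chilbert)"
  by (metis cinner_diff_right cinner_eq_zero eq_iff_diff_eq_0)

lemma bounded_op_adj: assumes "bounded_op S" shows "bounded_op (adj S)"
proof -
  obtain c where c: "op_bound S c" using bounded_op_bound[OF assms] ..
  show ?thesis
  proof (rule bounded_opI)
    show "adj S (x + y) = adj S x + adj S y" for x y
      by (rule cinner_left_cancel) (simp add: cinner_add_right cinner_adj[OF assms, symmetric])
    show "adj S (scaleC a x) = scaleC a (adj S x)" for a x
      by (rule cinner_left_cancel) (simp add: cinner_scaleC_right cinner_adj[OF assms, symmetric])
    show "op_bound (adj S) c" using op_bound_adj[OF assms c] .
  qed
qed

lemma adj_adj: "bounded_op S \<Longrightarrow> adj (adj S) = S"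
  by (rule adj_unique) (simp add: cinner_adj_left)

lemma adj_id [simp]: "adj id = id"
  by (rule adj_unique) simp

lemma adj_op_add: "bounded_op S \<Longrightarrow> bounded_op R \<Longrightarrow> adj (op_add S R) = op_add (adj S) (adj R)"
  by (rule adj_unique) (simp add: op_add_def cinner_linear cinner_adj)

lemma adj_op_scale: "bounded_op S \<Longrightarrow> adj (op_scale c S) = op_scale (cnj c) (adj S)"
  by (rule adj_unique) (simp add: op_scale_def cinner_linear cinner_adj)

lemma adj_comp: "bounded_op S \<Longrightarrow> bounded_op R \<Longrightarrow> adj (S \<circ> R) = adj R \<circ> adj S"
  by (rule adj_unique) (simp add: cinner_adj)

lemma op_bound_id: "op_bound id 1"
  by (simp add: op_bound_def)

lemma op_bound_add: assumes "op_bound S c" "op_bound R d" shows "op_bound (op_add S R) (c + d)"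
  unfolding op_bound_def
proof (intro conjI allI)
  show "0 \<le> c + d" using assms by (simp add: op_bound_def)
  fix x show "cnorm (op_add S R x) \<le> (c + d) * cnorm x"
    using assms cnorm_triangle[of "S x" "R x"] by (simp add: op_bound_def op_add_def distrib_right) (smt (verit))
qed

lemma op_bound_scale: assumes "op_bound S c" shows "op_bound (op_scale a S) (cmod a * c)"
  using assms by (auto simp: op_bound_def op_scale_def cnorm_scaleC mult.assoc intro!: mult_left_mono)

lemma op_bound_comp: assumes "op_bound S c" "op_bound R d" shows "op_bound (S \<circ> R) (c * d)"
  unfolding op_bound_def
proof (intro conjI allI)
  show "0 \<le> c * d" using assms by (simp add: op_bound_def)
  fix x
  have "cnorm (S (R x)) \<le> c * cnorm (R x)" using assms by (simp add: op_bound_def)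
  also have "\<dots> \<le> c * (d * cnorm x)" using assms by (intro mult_left_mono) (auto simp: op_bound_def)
  finally show "cnorm ((S \<circ> R) x) \<le> c * d * cnorm x" by (simp add: mult.assoc)
qed

lemma bounded_op_id: "bounded_op id"
  by (rule bounded_opI[OF _ _ op_bound_id]) auto

lemma bounded_op_op_add: "bounded_op S \<Longrightarrow> bounded_op R \<Longrightarrow> bounded_op (op_add S R)"
  using bounded_op_bound[of S] bounded_op_bound[of R] op_bound_add[of S _ R]
  by (auto intro!: bounded_opI simp: op_add_def bounded_op_add bounded_op_scaleC scaleC_add_right algebra_simps)

lemma bounded_op_op_scale: "bounded_op S \<Longrightarrow> bounded_op (op_scale c S)"
  using bounded_op_bound[of S] op_bound_scale[of S _ c]
  by (auto intro!: bounded_opI simp: op_scale_def bounded_op_add bounded_op_scaleC scaleC_add_right scaleC_scaleC mult_ac)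

lemma bounded_op_comp: "bounded_op S \<Longrightarrow> bounded_op R \<Longrightarrow> bounded_op (S \<circ> R)"
  using bounded_op_bound[of S] bounded_op_bound[of R] op_bound_comp[of S _ R]
  by (auto intro!: bounded_opI simp: bounded_op_add bounded_op_scaleC)

lemma bounded_op_cstar:
  assumes "bounded_op T" "S \<in> cstar T"
  shows "bounded_op S"
  using assms(2,1)
  by induction (auto intro: bounded_op_id bounded_op_adj bounded_op_op_add bounded_op_op_scale bounded_op_comp)

text \<open>Pointwise limits exist by completeness of the space. Letting m tend to infinity in F n x
  - F m x turns the Cauchy estimate into uniform convergence to S.\<close>

lemma bounded_op_complete:
  fixes F :: "nat \<Rightarrow> 'h::chilbert \<Rightarrow> 'h"
  assumes F: "\<And>n. bounded_op (F n)"
    and C: "\<And>e. e > 0 \<Longrightarrow> \<exists>N. \<forall>m\<ge>N. \<forall>n\<ge>N. op_bound (\<lambda>x. F m x - F n x) e"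
  obtains S where "bounded_op S" "\<And>e. e > 0 \<Longrightarrow> \<exists>N. \<forall>n\<ge>N. op_bound (\<lambda>x. F n x - S x) e"
proof -
  have "\<exists>l. (\<lambda>n. cnorm (F n x - l)) \<longlonglongrightarrow> 0" for x
  proof (rule Cauchy_cnorm_convergent[of "\<lambda>n. F n x"])
    fix e :: real assume "e > 0"
    \<comment> \<open>The added 1 makes e' * cnorm x strictly smaller than e and avoids a case
      distinction at x = 0.\<close>
    define e' where "e' = e / (cnorm x + 1)"
    have pos: "cnorm x + 1 > 0" by (simp add: add_nonneg_pos)
    have "e' > 0" using \<open>e > 0\<close> pos by (simp add: e'_def)
    then obtain N where N: "\<forall>m\<ge>N. \<forall>n\<ge>N. op_bound (\<lambda>x. F m x - F n x) e'" using C by blast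
    have "e' * cnorm x < e" using \<open>e > 0\<close> pos by (simp add: e'_def field_simps)
    then have "\<forall>m\<ge>N. \<forall>n\<ge>N. cnorm (F m x - F n x) < e"
      using N unfolding op_bound_def by (meson le_less_trans)
    then show "\<exists>N. \<forall>m\<ge>N. \<forall>n\<ge>N. cnorm (F m x - F n x) < e" ..
  qed blast
  then obtain S where S: "\<And>x. (\<lambda>n. cnorm (F n x - S x)) \<longlonglongrightarrow> 0" by metis
  have conv: "\<exists>N. \<forall>n\<ge>N. op_bound (\<lambda>x. F n x - S x) e" if "e > 0" for e
  proof -
    obtain N where N: "\<forall>m\<ge>N. \<forall>n\<ge>N. op_bound (\<lambda>x. F m x - F n x) e" using C \<open>e > 0\<close> by blast
    have "cnorm (F n x - S x) \<le> e * cnorm x" if "n \<ge> N" for n x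
    proof -
      have "(\<lambda>m. cnorm ((F n x - F m x) - (F n x - S x))) \<longlonglongrightarrow> 0"
        using S[of x] by (simp add: cnorm_minus_commute)
      then have "(\<lambda>m. cnorm (F n x - F m x)) \<longlonglongrightarrow> cnorm (F n x - S x)" by (rule tendsto_cnorm)
      then show ?thesis
        by (rule LIMSEQ_le_const2) (use N that in \<open>auto simp: op_bound_def\<close>)
    qed
    then show ?thesis using \<open>e > 0\<close> unfolding op_bound_def by (meson less_imp_le)
  qed
  obtain N where N: "\<forall>n\<ge>N. op_bound (\<lambda>x. F n x - S x) 1" using conv[of 1] by auto
  obtain c where c: "op_bound (F N) c" using bounded_op_bound[OF F] ..
  have "bounded_op S"
  proof (rule bounded_opI)
    show "S (x + y) = S x + S y" for x y
    proof (rule cnorm_tendsto_unique[OF S])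
      have "(\<lambda>n. cnorm (F n x - S x) + cnorm (F n y - S y)) \<longlonglongrightarrow> 0"
        using tendsto_add[OF S S] by simp
      then show "(\<lambda>n. cnorm (F n (x + y) - (S x + S y))) \<longlonglongrightarrow> 0"
      proof (rule null_le_tendsto[rotated], intro always_eventually allI)
        fix n
        have "F n (x + y) - (S x + S y) = (F n x - S x) + (F n y - S y)"
          using F[of n] by (simp add: bounded_op_add)
        then show "norm (cnorm (F n (x + y) - (S x + S y))) \<le> cnorm (F n x - S x) + cnorm (F n y - S y)"
          using cnorm_triangle by (metis cnorm_ge_zero abs_of_nonneg real_norm_def)
      qed
    qed
    show "S (scaleC a x) = scaleC a (S x)" for a x
    proof (rule cnorm_tendsto_unique[OF S])
      show "(\<lambda>n. cnorm (F n (scaleC a x) - scaleC a (S x))) \<longlonglongrightarrow> 0"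
        using tendsto_mult_right_zero[OF S, of "cmod a" x] F
        by (simp add: bounded_op_scaleC scaleC_diff_right[symmetric] cnorm_scaleC)
    qed
    have "cnorm (S x) \<le> (c + 1) * cnorm x" for x
    proof -
      have "cnorm (S x) \<le> cnorm (F N x) + cnorm (F N x - S x)"
        using cnorm_triangle_diff[of "F N x" "F N x - S x"] by simp
      moreover have "cnorm (F N x) \<le> c * cnorm x" "cnorm (F N x - S x) \<le> 1 * cnorm x"
        using c N by (auto simp: op_bound_def)
      ultimately show ?thesis by (simp add: distrib_right)
    qed
    then show "op_bound S (c + 1)" using c by (simp add: op_bound_def)
  qed
  then show ?thesis using that conv by blast
qed

lemma cstar_complete:
  fixes F :: "nat \<Rightarrow> 'h::chilbert \<Rightarrow> 'h"
  assumes F: "\<And>n. F n \<in> cstar T"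
    and S: "bounded_op S" and conv: "\<And>e. e > 0 \<Longrightarrow> \<exists>N. \<forall>n\<ge>N. op_bound (\<lambda>x. F n x - S x) e"
  shows "S \<in> cstar T"
proof -
  have "(\<lambda>n. opnorm (\<lambda>x. F n x - S x)) \<longlonglongrightarrow> 0"
  proof (rule LIMSEQ_I)
    fix r :: real assume "r > 0"
    then obtain N where N: "\<forall>n\<ge>N. op_bound (\<lambda>x. F n x - S x) (r/2)" using conv[of "r/2"] by auto
    then have "\<forall>n\<ge>N. norm (opnorm (\<lambda>x. F n x - S x) - 0) < r"
      using opnorm_le \<open>r > 0\<close> by fastforce
    then show "\<exists>no. \<forall>n\<ge>no. norm (opnorm (\<lambda>x. F n x - S x) - 0) < r" ..
  qed
  then show ?thesis using cstar_lim[of F T S] F S by blast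
qed

section \<open>Positive operators and square roots inside C*(T)\<close>

definition op_pos :: "('h::chilbert \<Rightarrow> 'h) \<Rightarrow> bool" where
  "op_pos a \<longleftrightarrow> (\<forall>x. nonneg_real (cinner x (a x)))"

text \<open>The defect h is sesquilinear and vanishes on the diagonal. Evaluating at x + y makes it
  antisymmetric, at x + \<i> y symmetric, hence it is zero.\<close>

lemma op_pos_selfadjoint:
  fixes a :: "'h::chilbert \<Rightarrow> 'h"
  assumes a: "bounded_op a" and real: "\<And>x. Im (cinner x (a x)) = 0"
  shows "adj a = a"
proof (rule adj_unique)
  fix x y
  define h where "h x y = cinner x (a y) - cinner (a x) y" for x y :: 'h
  have h0: "h x x = 0" for x
    using real[of x] cinner_conj[of "a x" x] by (auto simp: h_def complex_eq_iff)
  have 1: "h x y + h y x = 0" using h0[of "x + y"] h0[of x] h0[of y]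
    by (simp add: h_def a bounded_op_add cinner_linear algebra_simps)
  have "\<i> * h x y - \<i> * h y x = 0"
    using h0[of "x + scaleC \<i> y"] h0[of x] h0[of y]
    by (simp add: h_def a bounded_op_add bounded_op_scaleC cinner_linear algebra_simps)
  then have "h x y = h y x" by simp
  then have "h x y = 0" using 1 by simp
  then show "cinner (a x) y = cinner x (a y)" by (simp add: h_def)
qed

text \<open>Cauchy-Schwarz for the form <x, Q y>, taken at y = Q x: its left side is |Q x|^4, and
  the two factors on the right are at most q |x|^2 and q |Q x|^2.\<close>

lemma op_bound_of_form_le:
  fixes Q :: "'h::chilbert \<Rightarrow> 'h"
  assumes Q: "bounded_op Q" and pos: "op_pos Q" and q: "0 \<le> q"
    and le: "\<And>x. Re (cinner x (Q x)) \<le> q * (cnorm x)\<^sup>2"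
  shows "op_bound Q q"
proof -
  have sa: "adj Q = Q" using op_pos_selfadjoint[OF Q] pos by (simp add: op_pos_def nonneg_real_def)
  have sym: "cinner (Q x) y = cinner x (Q y)" for x y using cinner_adj[OF Q] sa by simp
  have "cnorm (Q x) \<le> q * cnorm x" for x
  proof (cases "Q x = 0")
    case True
    then show ?thesis using q by simp
  next
    case False
    define y where "y = Q x"
    have n: "cnorm y > 0" using False cnorm_ge_zero[of y] cnorm_eq_zero[of y] by (simp add: y_def less_le)
    have "(cmod (cinner x (Q y)))\<^sup>2 \<le> Re (cinner x (Q x)) * Re (cinner y (Q y))"
    proof (rule quadratic_nonneg_imp_discrim)
      fix c
      have "cinner y (Q x) = cnj (cinner x (Q y))" by (metis sym cinner_conj)
      then have "Re (cnj c * cinner y (Q x)) = Re (c * cinner x (Q y))" by simp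
      moreover have "Re (cnj c * (c * cinner y (Q y))) = (cmod c)\<^sup>2 * Re (cinner y (Q y))"
      proof -
        have "cnj c * (c * cinner y (Q y)) = complex_of_real ((cmod c)\<^sup>2) * cinner y (Q y)"
          by (metis complex_norm_square mult.assoc mult.commute)
        then show ?thesis by (metis Re_complex_of_real times_complex.simps(1) Im_complex_of_real mult_zero_left diff_zero)
      qed
      moreover have "0 \<le> Re (cinner (x + scaleC c y) (Q (x + scaleC c y)))"
        using pos by (simp add: op_pos_def nonneg_real_def)
      ultimately show "0 \<le> Re (cinner x (Q x)) + 2 * Re (c * cinner x (Q y)) + (cmod c)\<^sup>2 * Re (cinner y (Q y))"
        by (simp add: Q bounded_op_add bounded_op_scaleC cinner_linear distrib_left mult.left_commute[of c "cnj c"] del: times_complex.simps)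
    qed
    also have "\<dots> \<le> (q * (cnorm x)\<^sup>2) * (q * (cnorm y)\<^sup>2)"
      using le pos q by (intro mult_mono) (auto simp: op_pos_def nonneg_real_def)
    finally have "(cmod (cinner x (Q y)))\<^sup>2 \<le> (q * cnorm x * cnorm y)\<^sup>2"
      by (simp add: power_mult_distrib power2_eq_square mult_ac)
    moreover have "cinner x (Q y) = complex_of_real ((cnorm y)\<^sup>2)"
      using sym[of x y] cinner_self[of y] by (simp add: y_def)
    ultimately have "((cnorm y)\<^sup>2)\<^sup>2 \<le> (q * cnorm x * cnorm y)\<^sup>2" by (metis abs_power2 norm_of_real)
    then have "(cnorm y)\<^sup>2 \<le> q * cnorm x * cnorm y"
      by (rule power2_le_imp_le) (simp add: q)
    then have "cnorm y * cnorm y \<le> (q * cnorm x) * cnorm y" by (simp only: power2_eq_square)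
    then show ?thesis using n mult_right_le_imp_le unfolding y_def by blast
  qed
  then show ?thesis using q by (simp add: op_bound_def)
qed

text \<open>The fixed point of \<open>Y = (Q + Y\<^sup>2)/2\<close> is \<open>Y = 1 - sqrt (1 - Q)\<close>; for \<open>\<parallel>Q\<parallel> < 1\<close> the
  iteration is a contraction on the ball of radius \<open>1 - sqrt (1 - \<parallel>Q\<parallel>)\<close>.\<close>

lemma cstar_sqrt_fixpoint:
  assumes T: "bounded_op T" and Q: "Q \<in> cstar T" and sa: "adj Q = Q"
    and b: "op_bound Q q" and q: "q < 1"
  shows "\<exists>Y\<in>cstar T. adj Y = Y \<and> (\<forall>x. Y x = scaleC (1/2) (Q x + Y (Y x)))"
proof -
  \<comment> \<open>The smaller root of y = (q + y * y) / 2, so the iteration preserves the bound y,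
    and y < 1 because q < 1.\<close>
  define y where "y = 1 - sqrt (1 - q)"
  have q0: "0 \<le> q" using b by (simp add: op_bound_def)
  have "sqrt (1 - q) \<le> 1" "sqrt (1 - q) > 0" using q0 q by auto
  then have y: "0 \<le> y" "y < 1" by (auto simp: y_def)
  have "(1 - y)\<^sup>2 = 1 - q" using q by (simp add: y_def)
  then have yq: "(q + y * y) / 2 = y" by (simp add: power2_eq_square algebra_simps)
  \<comment> \<open>The iteration starts at zero, written as \<open>op_scale 0 id\<close> so that
    membership in \<open>cstar T\<close> follows from the closure rules.\<close>
  define F where "F = rec_nat (op_scale 0 id) (\<lambda>_ G. op_scale (1/2) (op_add Q (G \<circ> G)))"
  have F0: "F 0 = op_scale 0 id" and FS: "F (Suc n) = op_scale (1/2) (op_add Q (F n \<circ> F n))" for n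
    by (auto simp: F_def)
  have Fin: "F n \<in> cstar T" for n
    by (induction n) (auto simp: F0 FS intro!: cstar.intros Q)
  have Fb: "bounded_op (F n)" for n using bounded_op_cstar[OF T Fin] .
  have Qb: "bounded_op Q" using bounded_op_cstar[OF T Q] .
  have Fy: "op_bound (F n) y" for n
  proof (induction n)
    case 0
    then show ?case using y by (simp add: F0 op_bound_def op_scale_def)
  next
    case (Suc n)
    have "op_bound (F (Suc n)) (cmod (1/2) * (q + y * y))"
      unfolding FS by (intro op_bound_scale op_bound_add op_bound_comp b Suc)
    moreover have "cmod (1/2) * (q + y * y) = y" using yq by (simp add: norm_divide)
    ultimately show ?case by metis
  qed
  have Fsa: "adj (F n) = F n" for n
  proof (induction n)
    case 0
    then show ?case by (simp add: F0 adj_op_scale bounded_op_id)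
  next
    case (Suc n)
    then show ?case
      by (simp add: FS adj_op_scale adj_op_add adj_comp bounded_op_op_add bounded_op_comp Qb Fb sa)
  qed
  have step: "op_bound (\<lambda>x. F (Suc n) x - F n x) (y ^ Suc n)" for n
  proof (induction n)
    case 0
    then show ?case using Fy[of 1] by (simp add: F0 op_scale_def)
  next
    case (Suc n)
    define d where "d = y ^ Suc n"
    have d: "0 \<le> d" "\<And>x. cnorm (F (Suc n) x - F n x) \<le> d * cnorm x"
      using Suc by (auto simp: op_bound_def d_def)
    have "cnorm (F (Suc (Suc n)) x - F (Suc n) x) \<le> y * d * cnorm x" for x
    proof -
      have "F (Suc (Suc n)) x - F (Suc n) x
          = scaleC (1/2) (F (Suc n) (F (Suc n) x) - F n (F n x))"
        by (simp add: FS[of "Suc n"] FS[of n] op_scale_def op_add_def scaleC_diff_right[symmetric])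
      \<comment> \<open>Difference of squares without commutativity: G G - H H = G (G - H) + (G - H)
        H. Both terms gain a factor y, and the halving in the iteration compensates for there being
        two.\<close>
      also have "F (Suc n) (F (Suc n) x) - F n (F n x)
          = F (Suc n) (F (Suc n) x - F n x) + (F (Suc n) (F n x) - F n (F n x))"
        by (simp add: bounded_op_diff[OF Fb])
      finally have "cnorm (F (Suc (Suc n)) x - F (Suc n) x)
         \<le> 1/2 * (cnorm (F (Suc n) (F (Suc n) x - F n x)) + cnorm (F (Suc n) (F n x) - F n (F n x)))"
        using cnorm_triangle by (simp add: cnorm_scaleC norm_divide)
      moreover have "cnorm (F (Suc n) (F (Suc n) x - F n x)) \<le> y * (d * cnorm x)"
        using Fy[of "Suc n"] d(2)[of x] y
        by (meson mult_left_mono op_bound_def order_trans)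
      moreover have "cnorm (F (Suc n) (F n x) - F n (F n x)) \<le> d * (y * cnorm x)"
        using Fy[of n] d by (meson mult_left_mono op_bound_def order_trans)
      ultimately show ?thesis by (simp add: mult_ac)
    qed
    then show ?case using y d by (simp add: op_bound_def d_def)
  qed
  \<comment> \<open>Partial sum of the geometric series of consecutive differences, with one power
    of y given away to simplify the closed form.\<close>
  have tail: "cnorm (F (n + j) x - F n x) \<le> (y ^ n - y ^ (n + j)) / (1 - y) * cnorm x" for n j x
  proof (induction j)
    case 0
    then show ?case by simp
  next
    case (Suc j)
    have s: "cnorm (F (Suc (n + j)) x - F (n + j) x) \<le> y ^ Suc (n + j) * cnorm x"
      using step[of "n + j"] unfolding op_bound_def by blast
    have "y ^ Suc (n + j) \<le> y ^ (n + j)" using y by (intro power_decreasing) auto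
    also have "y ^ (n + j) = (y ^ (n + j) - y ^ Suc (n + j)) / (1 - y)"
      using y by (simp add: field_simps)
    finally have "y ^ Suc (n + j) * cnorm x \<le> (y ^ (n + j) - y ^ Suc (n + j)) / (1 - y) * cnorm x"
      by (rule mult_right_mono) simp
    moreover have "(y ^ n - y ^ (n + j)) / (1 - y) * cnorm x + (y ^ (n + j) - y ^ Suc (n + j)) / (1 - y) * cnorm x
        = (y ^ n - y ^ Suc (n + j)) / (1 - y) * cnorm x"
      by (simp add: add_divide_distrib[symmetric] distrib_right[symmetric])
    ultimately show ?case
      using Suc s cnorm_triangle_via[of "F (Suc (n + j)) x" "F n x" "F (n + j) x"] by simp
  qed
  have Cau: "\<exists>N. \<forall>m\<ge>N. \<forall>n\<ge>N. op_bound (\<lambda>x. F m x - F n x) e" if "e > 0" for e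
  proof -
    obtain N where N: "y ^ N < e * (1 - y)"
      using real_arch_pow_inv[of "e * (1 - y)" y] y \<open>e > 0\<close> by auto
    have ord: "cnorm (F m x - F n x) \<le> e * cnorm x" if "n \<ge> N" "m \<ge> n" for m n x
    proof -
      have "y ^ n \<le> y ^ N" using y that by (intro power_decreasing) auto
      then have "y ^ n - y ^ m \<le> e * (1 - y)" using N y by (smt (verit) zero_le_power)
      then have "(y ^ n - y ^ m) / (1 - y) \<le> e" using y by (simp add: divide_le_eq)
      then have "(y ^ n - y ^ m) / (1 - y) * cnorm x \<le> e * cnorm x" by (rule mult_right_mono) simp
      moreover have "cnorm (F m x - F n x) \<le> (y ^ n - y ^ m) / (1 - y) * cnorm x"
        using tail[of n "m - n" x] that by simp
      ultimately show ?thesis by linarith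
    qed
    have "cnorm (F m x - F n x) \<le> e * cnorm x" if "n \<ge> N" "m \<ge> N" for m n x
      using ord[of m n x] ord[of n m x] that cnorm_minus_commute[of "F m x" "F n x"] by (metis nat_le_linear)
    then show ?thesis using \<open>e > 0\<close> unfolding op_bound_def by (meson less_imp_le)
  qed
  obtain Y where Y: "bounded_op Y" "\<And>e. e > 0 \<Longrightarrow> \<exists>N. \<forall>n\<ge>N. op_bound (\<lambda>x. F n x - Y x) e"
    using bounded_op_complete[OF Fb Cau] by blast
  have YA: "Y \<in> cstar T" using cstar_complete[OF Fin Y] .
  have lim: "(\<lambda>n. cnorm (F n x - Y x)) \<longlonglongrightarrow> 0" for x
  proof (rule LIMSEQ_I)
    fix r :: real assume "r > 0"
    have pos: "cnorm x + 1 > 0" by (simp add: add_nonneg_pos)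
    then obtain N where N: "\<forall>n\<ge>N. op_bound (\<lambda>x. F n x - Y x) (r / (cnorm x + 1))"
      using Y(2)[of "r / (cnorm x + 1)"] \<open>r > 0\<close> by auto
    have "r / (cnorm x + 1) * cnorm x < r" using \<open>r > 0\<close> pos by (simp add: field_simps)
    then have "\<forall>n\<ge>N. norm (cnorm (F n x - Y x) - 0) < r"
      using N by (auto simp: op_bound_def intro: le_less_trans)
    then show "\<exists>no. \<forall>n\<ge>no. norm (cnorm (F n x - Y x) - 0) < r" ..
  qed
  have "adj Y = Y"
  proof (rule adj_unique)
    fix x z
    have "(\<lambda>n. cinner x (F n z)) \<longlonglongrightarrow> cinner x (Y z)" by (rule tendsto_cinner_right[OF lim])
    moreover have "(\<lambda>n. cnj (cinner z (F n x))) \<longlonglongrightarrow> cnj (cinner z (Y x))"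
      by (intro tendsto_cnj tendsto_cinner_right[OF lim])
    moreover have "cnj (cinner z (F n x)) = cinner x (F n z)" for n
      using cinner_adj[OF Fb, of n x z] Fsa[of n] cinner_conj[of "F n x" z] by simp
    ultimately have "cnj (cinner z (Y x)) = cinner x (Y z)" using LIMSEQ_unique by simp
    then show "cinner (Y x) z = cinner x (Y z)" by (metis cinner_conj)
  qed
  moreover have "Y x = scaleC (1/2) (Q x + Y (Y x))" for x
  proof (rule cnorm_tendsto_unique[OF LIMSEQ_Suc[OF lim[of x]]])
    have "(\<lambda>n. 1/2 * (y * cnorm (F n x - Y x) + cnorm (F n (Y x) - Y (Y x)))) \<longlonglongrightarrow> 1/2 * (y * 0 + 0)"
      by (intro tendsto_intros lim)
    then have l0: "(\<lambda>n. 1/2 * (y * cnorm (F n x - Y x) + cnorm (F n (Y x) - Y (Y x)))) \<longlonglongrightarrow> 0" by simp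
    show "(\<lambda>n. cnorm (F (Suc n) x - scaleC (1/2) (Q x + Y (Y x)))) \<longlonglongrightarrow> 0"
    proof (rule null_le_tendsto[OF _ l0], intro always_eventually allI)
      fix n
      have "F (Suc n) x - scaleC (1/2) (Q x + Y (Y x)) = scaleC (1/2) (F n (F n x - Y x) + (F n (Y x) - Y (Y x)))"
        by (simp add: FS op_scale_def op_add_def scaleC_diff_right[symmetric] bounded_op_diff[OF Fb])
      then have "cnorm (F (Suc n) x - scaleC (1/2) (Q x + Y (Y x)))
          \<le> 1/2 * (cnorm (F n (F n x - Y x)) + cnorm (F n (Y x) - Y (Y x)))"
        using cnorm_triangle by (simp add: cnorm_scaleC norm_divide)
      moreover have "cnorm (F n (F n x - Y x)) \<le> y * cnorm (F n x - Y x)"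
        using Fy[of n] by (simp add: op_bound_def)
      ultimately show "norm (cnorm (F (Suc n) x - scaleC (1/2) (Q x + Y (Y x))))
          \<le> 1/2 * (y * cnorm (F n x - Y x) + cnorm (F n (Y x) - Y (Y x)))"
        by simp
    qed
  qed
  ultimately show ?thesis using YA by blast
qed

text \<open>For Q = 1 - (a + l) / M with M = c + l one has 0 \<le> Q \<le> 1 - l / M, and l > 0
  makes this bound smaller than 1, as the iteration requires. Its fixed point satisfies (1 - Y)^2 =
  1 - Q = (a + l) / M, so b is sqrt M times 1 - Y.\<close>

lemma cstar_pos_factor:
  assumes T: "bounded_op T" and a: "a \<in> cstar T" and pos: "op_pos a" and l: "l > 0"
  shows "\<exists>b\<in>cstar T. op_add a (op_scale (complex_of_real l) id) = adj b \<circ> b"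
proof -
  have ab: "bounded_op a" using bounded_op_cstar[OF T a] .
  have asa: "adj a = a" using op_pos_selfadjoint[OF ab] pos by (simp add: op_pos_def nonneg_real_def)
  obtain c where c: "op_bound a c" using bounded_op_bound[OF ab] ..
  define M where "M = c + l"
  have M: "M > 0" "c \<ge> 0" using c l by (auto simp: M_def op_bound_def)
  define Q where "Q = op_add id (op_scale (complex_of_real (- 1 / M)) (op_add a (op_scale (complex_of_real l) id)))"
  have QA: "Q \<in> cstar T" unfolding Q_def by (intro cstar.intros a)
  have Qb: "bounded_op Q" using bounded_op_cstar[OF T QA] .
  have Qform: "cinner x (Q x) = complex_of_real ((cnorm x)\<^sup>2 - (Re (cinner x (a x)) + l * (cnorm x)\<^sup>2) / M)" for x
  proof -
    have "cinner x (a x) = complex_of_real (Re (cinner x (a x)))"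
      using pos by (simp add: op_pos_def nonneg_real_def complex_eq_iff)
    then show ?thesis
      by (simp add: Q_def op_add_def op_scale_def cinner_linear cinner_self)
  qed
  have ca: "Re (cinner x (a x)) \<le> c * (cnorm x)\<^sup>2" for x
  proof -
    have "Re (cinner x (a x)) \<le> cnorm x * cnorm (a x)"
      using Cauchy_Schwarz_cinner[of x "a x"] complex_Re_le_cmod[of "cinner x (a x)"] by linarith
    also have "\<dots> \<le> cnorm x * (c * cnorm x)" using c by (intro mult_left_mono) (auto simp: op_bound_def)
    finally show ?thesis by (simp add: power2_eq_square mult_ac)
  qed
  have Qpos: "op_pos Q"
    unfolding op_pos_def nonneg_real_def
  proof (intro allI conjI)
    fix x
    show "Im (cinner x (Q x)) = 0" unfolding Qform by simp
    show "0 \<le> Re (cinner x (Q x))"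
      unfolding Qform Re_complex_of_real using ca[of x] M by (simp add: field_simps M_def)
  qed
  define q where "q = 1 - l / M"
  have q: "0 \<le> q" "q < 1" using M l by (auto simp: q_def M_def)
  have "op_bound Q q"
  proof (rule op_bound_of_form_le[OF Qb Qpos q(1)])
    fix x
    have "0 \<le> Re (cinner x (a x)) / M" using pos M by (simp add: op_pos_def nonneg_real_def)
    then show "Re (cinner x (Q x)) \<le> q * (cnorm x)\<^sup>2"
      unfolding Qform Re_complex_of_real by (simp add: q_def add_divide_distrib left_diff_distrib)
  qed
  moreover have "adj Q = Q" using op_pos_selfadjoint[OF Qb] Qpos by (simp add: op_pos_def nonneg_real_def)
  ultimately obtain Y where Y: "Y \<in> cstar T" "adj Y = Y" "\<And>x. Y x = scaleC (1/2) (Q x + Y (Y x))"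
    using cstar_sqrt_fixpoint[OF T QA _ _ q(2)] by blast
  have Yb: "bounded_op Y" using bounded_op_cstar[OF T Y(1)] .
  have two: "scaleC 2 w = w + w" for w :: 'a
    using scaleC_add_left[of 1 1 w] by (simp add: scaleC_one)
  have YY: "Y (Y x) = Y x + Y x - Q x" for x
  proof -
    have "scaleC 2 (Y x) = scaleC 2 (scaleC (1/2) (Q x + Y (Y x)))" using Y(3)[of x] by metis
    then show ?thesis by (simp add: two[of "Y x"] scaleC_scaleC scaleC_one)
  qed
  define b where "b = op_scale (complex_of_real (sqrt M)) (op_add id (op_scale (-1) Y))"
  have bA: "b \<in> cstar T" unfolding b_def by (intro cstar.intros Y)
  have bs: "adj b = b"
    unfolding b_def using Yb Y(2)
    by (simp add: adj_op_scale adj_op_add bounded_op_op_add bounded_op_op_scale bounded_op_id)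
  have bx: "b x = scaleC (complex_of_real (sqrt M)) (x - Y x)" for x
    by (simp add: b_def op_scale_def op_add_def scaleC_minus_left scaleC_one)
  have "(adj b \<circ> b) x = op_add a (op_scale (complex_of_real l) id) x" for x
  proof -
    have "(adj b \<circ> b) x = scaleC (complex_of_real (sqrt M) * complex_of_real (sqrt M)) ((x - Y x) - Y (x - Y x))"
      by (simp add: bs bx bounded_op_scaleC[OF Yb] scaleC_scaleC scaleC_diff_right[symmetric])
    also have "complex_of_real (sqrt M) * complex_of_real (sqrt M) = complex_of_real M"
      using M by (simp flip: of_real_mult)
    also have "(x - Y x) - Y (x - Y x) = x - Q x" by (simp add: bounded_op_diff[OF Yb] YY)
    also have "x - Q x = scaleC (complex_of_real (1 / M)) (a x + scaleC (complex_of_real l) x)"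
      by (simp add: Q_def op_add_def op_scale_def scaleC_minus_left)
    finally show ?thesis using M by (simp add: scaleC_scaleC scaleC_one op_add_def op_scale_def)
  qed
  then show ?thesis using bA by (metis ext)
qed

section \<open>Operator systems and completely positive maps\<close>

text \<open>Identifies operator addition with pointwise addition of functions, so that
  \<open>sum\<close> and group simplification apply to operators.\<close>

lemma op_add_eq_plus: "op_add a b = a + b"
  by (simp add: op_add_def plus_fun_def)

lemma sum_fun_apply: "(sum F I) x = (\<Sum>i\<in>I. F i x)"
  by (induction I rule: infinite_finite_induct) auto

text \<open>Covers both \<open>op_sys T\<close> and \<open>cstar T\<close>, so the extension theory
  is developed once.\<close>

definition op_system :: "('h::chilbert \<Rightarrow> 'h) set \<Rightarrow> bool" where
  "op_system S \<longleftrightarrow> id \<in> S \<and> (\<forall>a\<in>S. \<forall>b\<in>S. op_add a b \<in> S) \<and> (\<forall>a\<in>S. \<forall>c. op_scale c a \<in> S)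
     \<and> (\<forall>a\<in>S. adj a \<in> S) \<and> (\<forall>a\<in>S. bounded_op a)"

definition mat_linear :: "('h::chilbert \<Rightarrow> 'h) set \<Rightarrow> nat \<Rightarrow> (('h \<Rightarrow> 'h) \<Rightarrow> complex mat) \<Rightarrow> bool" where
  "mat_linear S n \<phi> \<longleftrightarrow> (\<forall>a\<in>S. \<phi> a \<in> carrier_mat n n)
   \<and> (\<forall>a\<in>S. \<forall>b\<in>S. \<phi> (op_add a b) = \<phi> a + \<phi> b)
   \<and> (\<forall>a\<in>S. \<forall>c. \<phi> (op_scale c a) = c \<cdot>\<^sub>m \<phi> a)"

lemma op_systemD:
  assumes "op_system S"
  shows "id \<in> S" "a \<in> S \<Longrightarrow> b \<in> S \<Longrightarrow> a + b \<in> S" "a \<in> S \<Longrightarrow> op_scale c a \<in> S"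
    "a \<in> S \<Longrightarrow> adj a \<in> S" "a \<in> S \<Longrightarrow> bounded_op a"
  using assms by (auto simp: op_system_def op_add_eq_plus)

lemma op_scale_zero_left: "op_scale 0 a = 0"
  by (auto simp: op_scale_def)

lemma op_scale_zero_right: "op_scale c 0 = 0"
  by (auto simp: op_scale_def)

lemma op_scale_one: "op_scale 1 a = a"
  by (auto simp: op_scale_def scaleC_one)

lemma op_scale_minus_one: "op_scale (- 1) a = - a"
  by (auto simp: op_scale_def scaleC_one scaleC_minus_left)

lemma op_scale_op_scale: "op_scale c (op_scale d a) = op_scale (c * d) a"
  by (auto simp: op_scale_def scaleC_scaleC)

lemma op_scale_add: "op_scale c (a + b) = op_scale c a + op_scale c b"
  by (auto simp: op_scale_def scaleC_add_right)

lemma op_scale_add_left: "op_scale (c + d) a = op_scale c a + op_scale d a"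
  by (auto simp: op_scale_def scaleC_add_left)

lemma op_system_zero: "op_system S \<Longrightarrow> 0 \<in> S"
  by (metis op_systemD(1,3) op_scale_zero_left)

lemma op_system_minus: "op_system S \<Longrightarrow> a \<in> S \<Longrightarrow> - a \<in> S"
  by (metis op_systemD(3) op_scale_minus_one)

lemma op_system_diff: "op_system S \<Longrightarrow> a \<in> S \<Longrightarrow> b \<in> S \<Longrightarrow> a - b \<in> S"
  using op_systemD(2)[of S a "- b"] op_system_minus[of S b] by simp

lemma op_system_sum: "op_system S \<Longrightarrow> (\<And>i. i \<in> I \<Longrightarrow> F i \<in> S) \<Longrightarrow> sum F I \<in> S"
  by (induction I rule: infinite_finite_induct) (auto simp: op_system_zero op_systemD)

lemma op_system_cstar: "bounded_op T \<Longrightarrow> op_system (cstar T)"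
  unfolding op_system_def by (auto intro: cstar.intros bounded_op_cstar)

lemma op_sys_subset: "op_sys T \<subseteq> cstar T"
  by (auto simp: op_sys_def intro!: cstar.intros)

lemma op_sys_iff: "a \<in> op_sys T \<longleftrightarrow> (\<exists>p q r. a = op_scale p id + op_scale q T + op_scale r (adj T))"
  by (auto simp: op_sys_def op_add_eq_plus)

lemma op_system_op_sys:
  assumes T: "bounded_op T" shows "op_system (op_sys T)"
  unfolding op_system_def
proof (intro conjI ballI allI)
  show "id \<in> op_sys T" unfolding op_sys_iff
    by (rule exI[of _ 1], rule exI[of _ 0], rule exI[of _ 0]) (simp add: op_scale_zero_left op_scale_one)
next
  fix a b assume "a \<in> op_sys T" "b \<in> op_sys T"
  then obtain p q r p' q' r' where ab: "a = op_scale p id + op_scale q T + op_scale r (adj T)"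
    "b = op_scale p' id + op_scale q' T + op_scale r' (adj T)"
    unfolding op_sys_iff by blast
  have "a + b = op_scale (p + p') id + op_scale (q + q') T + op_scale (r + r') (adj T)"
    unfolding ab op_scale_add_left by (simp add: algebra_simps)
  then show "op_add a b \<in> op_sys T" unfolding op_add_eq_plus op_sys_iff by blast
next
  fix a c assume "a \<in> op_sys T"
  then show "op_scale c a \<in> op_sys T" unfolding op_sys_iff
    by (force simp: op_scale_add op_scale_op_scale)
next
  fix a assume "a \<in> op_sys T"
  then obtain p q r where a: "a = op_add (op_add (op_scale p id) (op_scale q T)) (op_scale r (adj T))"
    unfolding op_sys_def by blast
  have "adj a = op_scale (cnj p) id + op_scale (cnj r) T + op_scale (cnj q) (adj T)"
    unfolding a using T
    by (simp add: adj_op_add adj_op_scale bounded_op_op_add bounded_op_op_scale bounded_op_id bounded_op_adj adj_adj)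
      (simp add: op_add_eq_plus algebra_simps)
  then show "adj a \<in> op_sys T" unfolding op_sys_iff by blast
next
  fix a assume "a \<in> op_sys T"
  then show "bounded_op a" using bounded_op_cstar[OF T] op_sys_subset by blast
qed

lemma gen_in_op_sys: "bounded_op T \<Longrightarrow> T \<in> op_sys T"
  unfolding op_sys_iff
  by (rule exI[of _ 0], rule exI[of _ 1], rule exI[of _ 0]) (simp add: op_scale_zero_left op_scale_one)

lemma mat_linearD:
  assumes "mat_linear S n \<phi>"
  shows "a \<in> S \<Longrightarrow> \<phi> a \<in> carrier_mat n n" "a \<in> S \<Longrightarrow> b \<in> S \<Longrightarrow> \<phi> (a + b) = \<phi> a + \<phi> b"
    "a \<in> S \<Longrightarrow> \<phi> (op_scale c a) = c \<cdot>\<^sub>m \<phi> a"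
  using assms by (auto simp: mat_linear_def op_add_eq_plus)

lemma mat_linear_entry_add:
  assumes "mat_linear S n \<phi>" "a \<in> S" "b \<in> S" "i < n" "j < n"
  shows "\<phi> (a + b) $$ (i, j) = \<phi> a $$ (i, j) + \<phi> b $$ (i, j)"
  using mat_linearD(1)[OF assms(1,2)] mat_linearD(1)[OF assms(1,3)] mat_linearD(2)[OF assms(1-3)] assms(4,5)
  by simp

lemma mat_linear_entry_scale:
  assumes "mat_linear S n \<phi>" "a \<in> S" "i < n" "j < n"
  shows "\<phi> (op_scale c a) $$ (i, j) = c * \<phi> a $$ (i, j)"
  using mat_linearD(1)[OF assms(1,2)] mat_linearD(3)[OF assms(1,2)] assms(3,4) by simp

lemma mat_linear_entry_zero:
  assumes "op_system S" "mat_linear S n \<phi>" "i < n" "j < n"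
  shows "\<phi> 0 $$ (i, j) = 0"
  using mat_linear_entry_scale[OF assms(2) op_system_zero[OF assms(1)] assms(3,4), of 0]
  by (simp add: op_scale_zero_left)

lemma mat_linear_entry_diff:
  assumes "op_system S" "mat_linear S n \<phi>" "a \<in> S" "b \<in> S" "i < n" "j < n"
  shows "\<phi> (a - b) $$ (i, j) = \<phi> a $$ (i, j) - \<phi> b $$ (i, j)"
  using mat_linear_entry_add[OF assms(2) op_system_diff[OF assms(1,3,4)] assms(4-6)] by simp

lemma mat_linear_entry_sum:
  assumes "op_system S" "mat_linear S n \<phi>" "i < n" "j < n" "\<And>p. p \<in> I \<Longrightarrow> F p \<in> S"
  shows "\<phi> (sum F I) $$ (i, j) = (\<Sum>p\<in>I. \<phi> (F p) $$ (i, j))"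
  using assms(5)
proof (induction I rule: infinite_finite_induct)
  case (insert x I)
  have "\<phi> (F x + sum F I) $$ (i, j) = \<phi> (F x) $$ (i, j) + \<phi> (sum F I) $$ (i, j)"
    by (rule mat_linear_entry_add[OF assms(2) _ op_system_sum[OF assms(1)] assms(3,4)]) (use insert in auto)
  then show ?case using insert by (simp only: sum.insert[OF insert(1,2)]) simp
qed (use mat_linear_entry_zero[OF assms(1-4)] in auto)

section \<open>Complete positivity in coordinates\<close>

lemma vinner_mult_mat_vec:
  assumes "v \<in> carrier_vec n" "w \<in> carrier_vec n" "A \<in> carrier_mat n n"
  shows "vinner v (A *\<^sub>v w) = (\<Sum>l<n. \<Sum>r<n. cnj (v $ l) * A $$ (l, r) * w $ r)"
  using assms
  by (auto simp: vinner_def mult_mat_vec_def scalar_prod_def sum_distrib_left mult.assoc lessThan_atLeast0 intro!: sum.cong)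

lemma blk_mat_pos_iff:
  assumes "\<And>i j. i < m \<Longrightarrow> j < m \<Longrightarrow> B i j \<in> carrier_mat n n"
  shows "blk_mat_pos n m B \<longleftrightarrow> (\<forall>v :: nat \<Rightarrow> nat \<Rightarrow> complex.
    nonneg_real (\<Sum>i<m. \<Sum>j<m. \<Sum>l<n. \<Sum>r<n. cnj (v i l) * B i j $$ (l, r) * v j r))" (is "_ \<longleftrightarrow> ?R")
proof
  assume L: "blk_mat_pos n m B"
  show ?R
  proof
    fix v :: "nat \<Rightarrow> nat \<Rightarrow> complex"
    define w where "w i = vec n (v i)" for i
    have "(\<Sum>i<m. \<Sum>j<m. vinner (w i) (B i j *\<^sub>v w j))
      = (\<Sum>i<m. \<Sum>j<m. \<Sum>l<n. \<Sum>r<n. cnj (v i l) * B i j $$ (l, r) * v j r)"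
      by (intro sum.cong refl, subst vinner_mult_mat_vec[of _ n]) (auto simp: w_def assms)
    moreover have "nonneg_real (\<Sum>i<m. \<Sum>j<m. vinner (w i) (B i j *\<^sub>v w j))"
      using L by (auto simp: blk_mat_pos_def w_def)
    ultimately show "nonneg_real (\<Sum>i<m. \<Sum>j<m. \<Sum>l<n. \<Sum>r<n. cnj (v i l) * B i j $$ (l, r) * v j r)"
      by simp
  qed
next
  assume R: ?R
  show "blk_mat_pos n m B"
    unfolding blk_mat_pos_def
  proof (intro allI impI)
    fix v :: "nat \<Rightarrow> complex vec" assume v: "\<forall>i<m. v i \<in> carrier_vec n"
    have "(\<Sum>i<m. \<Sum>j<m. vinner (v i) (B i j *\<^sub>v v j))
      = (\<Sum>i<m. \<Sum>j<m. \<Sum>l<n. \<Sum>r<n. cnj (v i $ l) * B i j $$ (l, r) * v j $ r)"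
      by (intro sum.cong refl, subst vinner_mult_mat_vec[of _ n]) (use v in \<open>auto simp: assms\<close>)
    then show "nonneg_real (\<Sum>i<m. \<Sum>j<m. vinner (v i) (B i j *\<^sub>v v j))"
      using R[rule_format, of "\<lambda>i l. v i $ l"] by simp
  qed
qed

lemma cp_map_iff:
  "cp_map S n \<phi> \<longleftrightarrow> mat_linear S n \<phi> \<and>
    (\<forall>m A. (\<forall>i<m. \<forall>j<m. A i j \<in> S) \<longrightarrow> op_mat_pos m A \<longrightarrow> (\<forall>v :: nat \<Rightarrow> nat \<Rightarrow> complex.
      nonneg_real (\<Sum>i<m. \<Sum>j<m. \<Sum>l<n. \<Sum>r<n. cnj (v i l) * \<phi> (A i j) $$ (l, r) * v j r)))"
proof (cases "mat_linear S n \<phi>")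
  case True
  have "blk_mat_pos n m (\<lambda>i j. \<phi> (A i j)) \<longleftrightarrow> (\<forall>v :: nat \<Rightarrow> nat \<Rightarrow> complex.
      nonneg_real (\<Sum>i<m. \<Sum>j<m. \<Sum>l<n. \<Sum>r<n. cnj (v i l) * \<phi> (A i j) $$ (l, r) * v j r))"
    if "\<forall>i<m. \<forall>j<m. A i j \<in> S" for m A
    by (rule blk_mat_pos_iff) (use that mat_linearD(1)[OF True] in auto)
  then show ?thesis using True unfolding cp_map_def mat_linear_def by auto
next
  case False
  then show ?thesis unfolding cp_map_def mat_linear_def by auto
qed

lemma cp_map_mat_linear: "cp_map S n \<phi> \<Longrightarrow> mat_linear S n \<phi>"
  by (simp add: cp_map_iff)

lemma cp_mapD:
  "cp_map S n \<phi> \<Longrightarrow> (\<And>i j. i < m \<Longrightarrow> j < m \<Longrightarrow> A i j \<in> S) \<Longrightarrow> op_mat_pos m A \<Longrightarrow>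
    nonneg_real (\<Sum>i<m. \<Sum>j<m. \<Sum>l<n. \<Sum>r<n. cnj (v i l) * \<phi> (A i j) $$ (l, r) * v j r)"
  unfolding cp_map_iff by blast

lemma sum_delta2:
  fixes M :: "nat \<Rightarrow> nat \<Rightarrow> complex"
  assumes "i < n" "j < n"
  shows "(\<Sum>l<n. \<Sum>r<n. cnj (if l = i then s else 0) * M l r * (if r = j then t else 0)) = cnj s * M i j * t"
proof -
  have "(\<Sum>l<n. \<Sum>r<n. cnj (if l = i then s else 0) * M l r * (if r = j then t else 0))
      = (\<Sum>l<n. if l = i then (\<Sum>r<n. if r = j then cnj s * M l r * t else 0) else 0)"
    by (intro sum.cong refl) (auto intro!: sum.cong simp del: sum.delta sum.delta')
  also have "\<dots> = (\<Sum>r<n. if r = j then cnj s * M i r * t else 0)"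
    by (simp only: sum.delta[OF finite_lessThan] lessThan_iff assms if_True)
  also have "\<dots> = cnj s * M i j * t"
    by (simp only: sum.delta[OF finite_lessThan] lessThan_iff assms if_True)
  finally show ?thesis .
qed

text \<open>Complete positivity at level n, tested on the vector whose i-th block is the i-th unit
  vector.\<close>

lemma cp_map_trace_nonneg:
  assumes "cp_map S n \<phi>" "\<And>i j. i < n \<Longrightarrow> j < n \<Longrightarrow> C i j \<in> S" "op_mat_pos n C"
  shows "nonneg_real (\<Sum>i<n. \<Sum>j<n. \<phi> (C i j) $$ (i, j))"
proof -
  have "nonneg_real (\<Sum>i<n. \<Sum>j<n. \<Sum>l<n. \<Sum>r<n. cnj (if l = i then 1 else 0) * \<phi> (C i j) $$ (l, r) * (if r = j then 1 else 0))"
    by (rule cp_mapD[OF assms, of "\<lambda>i l. if l = i then 1 else 0"])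
  moreover have "(\<Sum>i<n. \<Sum>j<n. \<Sum>l<n. \<Sum>r<n. cnj (if l = i then 1 else 0) * \<phi> (C i j) $$ (l, r) * (if r = j then 1 else 0))
      = (\<Sum>i<n. \<Sum>j<n. \<phi> (C i j) $$ (i, j))"
    by (intro sum.cong refl, subst sum_delta2) auto
  ultimately show ?thesis by metis
qed

lemma sum_swap4:
  fixes f :: "nat \<Rightarrow> nat \<Rightarrow> nat \<Rightarrow> nat \<Rightarrow> 'z::comm_monoid_add"
  shows "(\<Sum>i<m. \<Sum>j<m. \<Sum>l<n. \<Sum>r<n. f i j l r) = (\<Sum>l<n. \<Sum>r<n. \<Sum>i<m. \<Sum>j<m. f i j l r)"
proof -
  have "(\<Sum>i<m. \<Sum>j<m. \<Sum>l<n. \<Sum>r<n. f i j l r) = (\<Sum>i<m. \<Sum>l<n. \<Sum>j<m. \<Sum>r<n. f i j l r)"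
    by (rule sum.cong[OF refl], rule sum.swap)
  also have "\<dots> = (\<Sum>i<m. \<Sum>l<n. \<Sum>r<n. \<Sum>j<m. f i j l r)"
    by (rule sum.cong[OF refl], rule sum.cong[OF refl], rule sum.swap)
  also have "\<dots> = (\<Sum>l<n. \<Sum>i<m. \<Sum>r<n. \<Sum>j<m. f i j l r)" by (rule sum.swap)
  also have "\<dots> = (\<Sum>l<n. \<Sum>r<n. \<Sum>i<m. \<Sum>j<m. f i j l r)"
    by (rule sum.cong[OF refl], rule sum.swap)
  finally show ?thesis .
qed

text \<open>Compressing an operator matrix by scalar vectors turns positivity of the functional
  \<open>C \<mapsto> \<Sum> \<phi>(C i j) i j\<close> into complete positivity of \<open>\<phi>\<close>.\<close>

lemma cp_mapI_trace:
  assumes S: "op_system S" and lin: "mat_linear S n \<phi>"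
    and pos: "\<And>C. (\<And>i j. C i j \<in> S) \<Longrightarrow> op_mat_pos n C \<Longrightarrow> nonneg_real (\<Sum>i<n. \<Sum>j<n. \<phi> (C i j) $$ (i, j))"
  shows "cp_map S n \<phi>"
  unfolding cp_map_iff
proof (intro conjI allI impI)
  show "mat_linear S n \<phi>" by fact
next
  fix m and A :: "nat \<Rightarrow> nat \<Rightarrow> 'a \<Rightarrow> 'a" and v :: "nat \<Rightarrow> nat \<Rightarrow> complex"
  assume A: "\<forall>i<m. \<forall>j<m. A i j \<in> S" and Ap: "op_mat_pos m A"
  define C where "C l r = (\<Sum>p<m. \<Sum>q<m. op_scale (cnj (v p l) * v q r) (A p q))" for l r
  have CS: "C l r \<in> S" for l r
    unfolding C_def by (intro op_system_sum[OF S]) (use A op_systemD[OF S] in auto)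
  have "op_mat_pos n C"
    unfolding op_mat_pos_def
  proof
    fix x :: "nat \<Rightarrow> 'a"
    define y where "y p = (\<Sum>l<n. scaleC (v p l) (x l))" for p
    have e: "cinner (y p) (A p q (y q)) = (\<Sum>l<n. \<Sum>r<n. cinner (x l) (op_scale (cnj (v p l) * v q r) (A p q) (x r)))"
      if "p < m" "q < m" for p q
    proof -
      have b: "bounded_op (A p q)" using A that op_systemD[OF S] by blast
      show ?thesis
        by (simp add: y_def bounded_op_sum[OF b] bounded_op_scaleC[OF b] cinner_sum_left cinner_sum_right
            cinner_scaleC_left cinner_scaleC_right op_scale_def sum_distrib_left mult_ac)
          (rule sum.swap)
    qed
    have "(\<Sum>l<n. \<Sum>r<n. cinner (x l) (C l r (x r)))
        = (\<Sum>p<m. \<Sum>q<m. \<Sum>l<n. \<Sum>r<n. cinner (x l) (op_scale (cnj (v p l) * v q r) (A p q) (x r)))"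
      by (simp add: C_def sum_fun_apply cinner_sum_right) (rule sum_swap4[symmetric])
    also have "\<dots> = (\<Sum>p<m. \<Sum>q<m. cinner (y p) (A p q (y q)))"
      by (intro sum.cong refl) (simp add: e)
    finally show "nonneg_real (\<Sum>l<n. \<Sum>r<n. cinner (x l) (C l r (x r)))"
      using Ap by (simp add: op_mat_pos_def)
  qed
  then have "nonneg_real (\<Sum>l<n. \<Sum>r<n. \<phi> (C l r) $$ (l, r))" using pos CS by blast
  moreover have "\<phi> (C l r) $$ (l, r) = (\<Sum>p<m. \<Sum>q<m. cnj (v p l) * \<phi> (A p q) $$ (l, r) * v q r)"
    if "l < n" "r < n" for l r
  proof -
    have "\<phi> (C l r) $$ (l, r) = (\<Sum>p<m. \<phi> (\<Sum>q<m. op_scale (cnj (v p l) * v q r) (A p q)) $$ (l, r))"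
      unfolding C_def by (rule mat_linear_entry_sum[OF S lin that]) (use A op_systemD[OF S] in \<open>auto intro!: op_system_sum[OF S]\<close>)
    also have "\<dots> = (\<Sum>p<m. \<Sum>q<m. \<phi> (op_scale (cnj (v p l) * v q r) (A p q)) $$ (l, r))"
      by (intro sum.cong refl mat_linear_entry_sum[OF S lin that]) (use A op_systemD[OF S] in auto)
    also have "\<dots> = (\<Sum>p<m. \<Sum>q<m. cnj (v p l) * \<phi> (A p q) $$ (l, r) * v q r)"
      by (intro sum.cong refl, subst mat_linear_entry_scale[OF lin _ that]) (use A in \<open>auto simp: mult_ac\<close>)
    finally show ?thesis .
  qed
  ultimately show "nonneg_real (\<Sum>i<m. \<Sum>j<m. \<Sum>l<n. \<Sum>r<n. cnj (v i l) * \<phi> (A i j) $$ (l, r) * v j r)"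
    by (subst sum_swap4) simp
qed

text \<open>Positivity of \<open>[[c, a], [a*, c]]\<close> yields hermiticity and norm bounds of completely positive maps.\<close>

lemma op_mat_pos_dilation:
  assumes a: "bounded_op a" "op_bound a c"
  shows "op_mat_pos 2 (\<lambda>i j. if i = j then op_scale (complex_of_real c) id else if i = 0 then a else adj a)"
  unfolding op_mat_pos_def
proof
  fix x :: "nat \<Rightarrow> 'a"
  let ?z = "cinner (x 0) (a (x 1))"
  have "cinner (x 1) (adj a (x 0)) = cnj ?z"
    using cinner_adj[OF a(1), of "x 1" "x 0"] cinner_conj[of "a (x 1)" "x 0"] by simp
  then have eq: "(\<Sum>i<2. \<Sum>j<2. cinner (x i) ((if i = j then op_scale (complex_of_real c) id else if i = 0 then a else adj a) (x j)))
     = complex_of_real (c * ((cnorm (x 0))\<^sup>2 + (cnorm (x 1))\<^sup>2)) + (?z + cnj ?z)"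
    by (simp add: numeral_2_eq_2 op_scale_def cinner_scaleC_right cinner_self algebra_simps)
  have "- Re ?z \<le> cmod ?z" using abs_Re_le_cmod[of ?z] by simp
  also have "\<dots> \<le> cnorm (x 0) * cnorm (a (x 1))" by (rule Cauchy_Schwarz_cinner)
  also have "\<dots> \<le> cnorm (x 0) * (c * cnorm (x 1))"
    using a(2) by (intro mult_left_mono) (auto simp: op_bound_def)
  finally have "- 2 * Re ?z \<le> 2 * (cnorm (x 0) * (c * cnorm (x 1)))" by linarith
  then have 1: "- 2 * Re ?z \<le> c * (2 * cnorm (x 0) * cnorm (x 1))" by (simp only: mult_ac)
  have "2 * cnorm (x 0) * cnorm (x 1) \<le> (cnorm (x 0))\<^sup>2 + (cnorm (x 1))\<^sup>2"
    using sum_squares_bound by blast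
  then have "c * (2 * cnorm (x 0) * cnorm (x 1)) \<le> c * ((cnorm (x 0))\<^sup>2 + (cnorm (x 1))\<^sup>2)"
    using a(2) by (intro mult_left_mono) (auto simp: op_bound_def)
  with 1 have "0 \<le> c * ((cnorm (x 0))\<^sup>2 + (cnorm (x 1))\<^sup>2) + 2 * Re ?z" by linarith
  then show "nonneg_real (\<Sum>i<2. \<Sum>j<2. cinner (x i) ((if i = j then op_scale (complex_of_real c) id else if i = 0 then a else adj a) (x j)))"
    unfolding eq by (simp add: nonneg_real_def)
qed

text \<open>The positive 2 by 2 matrix tested on s times the i-th and t times the j-th unit vector.
  The scalars stay free for polarisation and for the discriminant argument.\<close>

lemma cp_map_dilation_entry:
  assumes S: "op_system S" and cp: "cp_map S n \<phi>" and a: "a \<in> S" "op_bound a c" and ij: "i < n" "j < n"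
  shows "nonneg_real (c * ((cmod s)\<^sup>2 * \<phi> id $$ (i, i) + (cmod t)\<^sup>2 * \<phi> id $$ (j, j))
     + cnj s * \<phi> a $$ (i, j) * t + cnj t * \<phi> (adj a) $$ (j, i) * s)"
proof -
  let ?A = "\<lambda>p q::nat. if p = q then op_scale (complex_of_real c) id else if p = 0 then a else adj a"
  define v where "v p l = (if p = 0 then (if l = i then s else 0) else (if l = j then t else 0))" for p l :: nat
  have lin: "mat_linear S n \<phi>" using cp by (rule cp_map_mat_linear)
  have "nonneg_real (\<Sum>p<2. \<Sum>q<2. \<Sum>l<n. \<Sum>r<n. cnj (v p l) * \<phi> (?A p q) $$ (l, r) * v q r)"
    by (rule cp_mapD[OF cp _ op_mat_pos_dilation]) (use op_systemD[OF S] a in auto)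
  moreover have "(\<Sum>l<n. \<Sum>r<n. cnj (v p l) * \<phi> (?A p q) $$ (l, r) * v q r)
      = cnj (if p = 0 then s else t) * \<phi> (?A p q) $$ (if p = 0 then i else j, if q = 0 then i else j) * (if q = 0 then s else t)" for p q
  proof -
    have v': "v p = (\<lambda>l. if l = (if p = 0 then i else j) then (if p = 0 then s else t) else 0)" for p
      by (auto simp: v_def)
    show ?thesis unfolding v' by (rule sum_delta2[where M = "\<lambda>l r. \<phi> (?A p q) $$ (l, r)"]) (use ij in auto)
  qed
  ultimately have "nonneg_real (\<Sum>p<2::nat. \<Sum>q<2::nat. cnj (if p = 0 then s else t) * \<phi> (?A p q) $$ (if p = 0 then i else j, if q = 0 then i else j) * (if q = 0 then s else t))"
    by (simp only:)
  then have "nonneg_real (cnj s * \<phi> (op_scale c id) $$ (i, i) * s + cnj s * \<phi> a $$ (i, j) * t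
      + (cnj t * \<phi> (adj a) $$ (j, i) * s + cnj t * \<phi> (op_scale c id) $$ (j, j) * t))"
    by (simp add: numeral_2_eq_2)
  moreover have "cnj u * \<phi> (op_scale c id) $$ (l, l) * u = c * ((cmod u)\<^sup>2 * \<phi> id $$ (l, l))" if "l < n" for u l
    using mat_linear_entry_scale[OF lin op_systemD(1)[OF S] that that, of c] complex_norm_square[of u]
    by (simp add: mult_ac)
  ultimately show ?thesis using ij by (simp add: distrib_left ac_simps)
qed

lemma cp_map_adj:
  assumes S: "op_system S" and cp: "cp_map S n \<phi>" and a: "a \<in> S" and ij: "i < n" "j < n"
  shows "\<phi> (adj a) $$ (j, i) = cnj (\<phi> a $$ (i, j))"
proof -
  obtain c where c: "op_bound a c" using bounded_op_bound op_systemD(5)[OF S a] by blast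
  let ?z = "\<phi> a $$ (i, j)" and ?w = "\<phi> (adj a) $$ (j, i)"
  let ?D = "\<lambda>s t::complex. complex_of_real c * ((cmod s)\<^sup>2 * \<phi> id $$ (i, i) + (cmod t)\<^sup>2 * \<phi> id $$ (j, j))"
  \<comment> \<open>With t = 1, -1, \<i>, -\<i> the diagonal contribution is always the same, so it
    cancels in differences although it is not yet known to be real.\<close>
  have 1: "Im (?D 1 1 + ?z + ?w) = 0" and 2: "Im (?D 1 1 + \<i> * ?z - \<i> * ?w) = 0"
    using cp_map_dilation_entry[OF S cp a c ij, of 1 1] cp_map_dilation_entry[OF S cp a c ij, of 1 \<i>]
    by (auto simp: nonneg_real_def)
  have 3: "Im (?D 1 1 - ?z - ?w) = 0" and 4: "Im (?D 1 1 - \<i> * ?z + \<i> * ?w) = 0"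
    using cp_map_dilation_entry[OF S cp a c ij, of 1 "-1"] cp_map_dilation_entry[OF S cp a c ij, of 1 "-\<i>"]
    by (auto simp: nonneg_real_def)
  have "Im ?z + Im ?w = 0" using 1 3 by simp
  moreover have "Re ?z - Re ?w = 0" using 2 4 by simp
  ultimately show ?thesis by (simp add: complex_eq_iff)
qed

text \<open>With s = 1 and t free, unitality turns the dilation inequality into a quadratic in t
  with coefficients c, the entry, and c. This gives norm continuity of every entry.\<close>

lemma ucp_map_entry_bound:
  assumes S: "op_system S" and cp: "ucp_map S n \<phi>" and a: "a \<in> S" "op_bound a c" and ij: "i < n" "j < n"
  shows "cmod (\<phi> a $$ (i, j)) \<le> c"
proof -
  let ?z = "\<phi> a $$ (i, j)"
  have cp': "cp_map S n \<phi>" and one: "\<phi> id $$ (l, l) = 1" if "l < n" for l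
    using cp that ij by (auto simp: ucp_map_def)
  have "(cmod ?z)\<^sup>2 \<le> c * c"
  proof (rule quadratic_nonneg_imp_discrim)
    fix t
    have "0 \<le> Re (complex_of_real c * (1 + (cmod t)\<^sup>2) + ?z * t + cnj t * cnj ?z)"
      using cp_map_dilation_entry[OF S cp'[OF ij(1)] a ij, of 1 t] cp_map_adj[OF S cp'[OF ij(1)] a(1) ij] one ij
      by (simp add: nonneg_real_def)
    then show "0 \<le> c + 2 * Re (t * ?z) + (cmod t)\<^sup>2 * c" by (simp add: algebra_simps)
  qed
  then show ?thesis using a(2) by (simp add: op_bound_def power2_eq_square[symmetric] abs_le_square_iff[symmetric])
qed

section \<open>Finite-dimensional irreducible representations\<close>

lemma mat_adjoint_carrier: "A \<in> carrier_mat n m \<Longrightarrow> mat_adjoint A \<in> carrier_mat m n"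
  by (auto simp: mat_adjoint_def mat_of_rows_def)

lemma mat_adjoint_index:
  "A \<in> carrier_mat n m \<Longrightarrow> i < m \<Longrightarrow> j < n \<Longrightarrow> mat_adjoint A $$ (i, j) = cnj (A $$ (j, i))"
  by (auto simp: mat_adjoint_def mat_of_rows_index)

lemma vinner_adjoint:
  assumes "A \<in> carrier_mat n k" "v \<in> carrier_vec k" "w \<in> carrier_vec n"
  shows "vinner v (mat_adjoint A *\<^sub>v w) = vinner (A *\<^sub>v v) w"
proof -
  have "vinner v (mat_adjoint A *\<^sub>v w) = (\<Sum>l<k. \<Sum>r<n. cnj (v $ l) * cnj (A $$ (r, l)) * w $ r)"
    using assms mat_adjoint_carrier[OF assms(1)] mat_adjoint_index[OF assms(1)]
    by (auto simp: vinner_def mult_mat_vec_def scalar_prod_def sum_distrib_left mult.assoc lessThan_atLeast0 intro!: sum.cong)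
  also have "\<dots> = (\<Sum>r<n. \<Sum>l<k. cnj (v $ l) * cnj (A $$ (r, l)) * w $ r)" by (rule sum.swap)
  also have "\<dots> = vinner (A *\<^sub>v v) w"
    using assms by (auto simp: vinner_def mult_mat_vec_def scalar_prod_def sum_distrib_left lessThan_atLeast0 mult_ac intro!: sum.cong)
  finally show ?thesis .
qed

lemma vinner_self: "vinner v v = complex_of_real (\<Sum>l<dim_vec v. (cmod (v $ l))\<^sup>2)"
  unfolding vinner_def of_real_sum by (intro sum.cong refl) (metis complex_norm_square mult.commute)

lemma smult_mult_mat_vec:
  assumes "(A :: complex mat) \<in> carrier_mat n m" "v \<in> carrier_vec m"
  shows "(c \<cdot>\<^sub>m A) *\<^sub>v v = c \<cdot>\<^sub>v (A *\<^sub>v v)"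
  using assms by (intro eq_vecI) (auto simp: scalar_prod_def sum_distrib_left mult_ac)

lemma nonneg_real_vinner_self: "nonneg_real (vinner v v)"
  unfolding vinner_self nonneg_real_def by (simp add: sum_nonneg)

section \<open>Positivity, cyclicity and complete positivity of matrix representations\<close>

lemma mat_repD:
  assumes "mat_rep T k \<rho>"
  shows "a \<in> cstar T \<Longrightarrow> \<rho> a \<in> carrier_mat k k" "\<rho> id = 1\<^sub>m k"
    "a \<in> cstar T \<Longrightarrow> b \<in> cstar T \<Longrightarrow> \<rho> (a + b) = \<rho> a + \<rho> b"
    "a \<in> cstar T \<Longrightarrow> b \<in> cstar T \<Longrightarrow> \<rho> (a \<circ> b) = \<rho> a * \<rho> b"
    "a \<in> cstar T \<Longrightarrow> \<rho> (op_scale c a) = c \<cdot>\<^sub>m \<rho> a"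
    "a \<in> cstar T \<Longrightarrow> \<rho> (adj a) = mat_adjoint (\<rho> a)"
  using assms by (auto simp: mat_rep_def op_add_eq_plus)

lemma mat_rep_mat_linear: "mat_rep T k \<rho> \<Longrightarrow> mat_linear (cstar T) k \<rho>"
  by (auto simp: mat_rep_def mat_linear_def)

text \<open>\<open>mat_rep\<close> only provides algebra. Applying \<rho> to a + l = b* b gives
  positivity of \<rho>(a) + l for each l > 0, and l tends to zero.\<close>

lemma mat_rep_pos:
  assumes T: "bounded_op T" and rep: "mat_rep T k \<rho>" and a: "a \<in> cstar T" "op_pos a"
    and v: "v \<in> carrier_vec k"
  shows "nonneg_real (vinner v (\<rho> a *\<^sub>v v))"
proof -
  let ?N = "\<Sum>l<k. (cmod (v $ l))\<^sup>2"
  have shift: "nonneg_real (vinner v (\<rho> a *\<^sub>v v) + complex_of_real (l * ?N))" if "l > 0" for l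
  proof -
    obtain b where b: "b \<in> cstar T" "op_add a (op_scale (complex_of_real l) id) = adj b \<circ> b"
      using cstar_pos_factor[OF T a \<open>l > 0\<close>] by blast
    have ra: "\<rho> a \<in> carrier_mat k k" "\<rho> b \<in> carrier_mat k k" using mat_repD(1)[OF rep] a b by auto
    have "\<rho> (adj b \<circ> b) = mat_adjoint (\<rho> b) * \<rho> b"
      using mat_repD(4,6)[OF rep] b by (simp add: cstar_adj)
    moreover have "\<rho> (op_add a (op_scale (complex_of_real l) id)) = \<rho> a + complex_of_real l \<cdot>\<^sub>m 1\<^sub>m k"
      using mat_repD(2,3,5)[OF rep] a by (simp add: op_add_eq_plus cstar.intros)
    ultimately have "\<rho> a + complex_of_real l \<cdot>\<^sub>m 1\<^sub>m k = mat_adjoint (\<rho> b) * \<rho> b" using b by simp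
    then have eq: "(\<rho> a + complex_of_real l \<cdot>\<^sub>m 1\<^sub>m k) *\<^sub>v v = mat_adjoint (\<rho> b) *\<^sub>v (\<rho> b *\<^sub>v v)"
      using assoc_mult_mat_vec[OF mat_adjoint_carrier[OF ra(2)] ra(2) v] by simp
    have "vinner v ((\<rho> a + complex_of_real l \<cdot>\<^sub>m 1\<^sub>m k) *\<^sub>v v)
        = vinner v (\<rho> a *\<^sub>v v) + complex_of_real l * vinner v v"
    proof -
      have "(\<rho> a + complex_of_real l \<cdot>\<^sub>m 1\<^sub>m k) *\<^sub>v v = \<rho> a *\<^sub>v v + complex_of_real l \<cdot>\<^sub>v v"
        using ra v smult_mult_mat_vec[OF one_carrier_mat v] by (simp add: add_mult_distrib_mat_vec)
      then show ?thesis using ra v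
        by (simp add: vinner_def distrib_left sum.distrib sum_distrib_left mult_ac)
    qed
    moreover have "vinner v (mat_adjoint (\<rho> b) *\<^sub>v (\<rho> b *\<^sub>v v)) = vinner (\<rho> b *\<^sub>v v) (\<rho> b *\<^sub>v v)"
      using vinner_adjoint[OF ra(2) v] ra v by simp
    moreover have "vinner v v = complex_of_real ?N" using v by (simp add: vinner_self)
    ultimately have "vinner v (\<rho> a *\<^sub>v v) + complex_of_real (l * ?N) = vinner (\<rho> b *\<^sub>v v) (\<rho> b *\<^sub>v v)"
      using eq by simp
    then show ?thesis by (simp only: nonneg_real_vinner_self)
  qed
  have "Im (vinner v (\<rho> a *\<^sub>v v)) = 0" using shift[of 1] by (simp add: nonneg_real_def)
  moreover have "0 \<le> Re (vinner v (\<rho> a *\<^sub>v v))"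
  proof (rule field_le_epsilon)
    fix e :: real assume "e > 0"
    have N: "0 \<le> ?N" by (simp add: sum_nonneg)
    then have p: "?N + 1 > 0" by linarith
    \<comment> \<open>The shift e / (N + 1), multiplied by N, costs at most e; the denominator is
      positive even for v = 0.\<close>
    then have "0 \<le> Re (vinner v (\<rho> a *\<^sub>v v)) + e / (?N + 1) * ?N"
      using shift[of "e / (?N + 1)"] \<open>e > 0\<close> by (simp add: nonneg_real_def)
    also have "e / (?N + 1) * ?N \<le> e" using \<open>e > 0\<close> p by (simp add: field_simps)
    finally show "0 \<le> Re (vinner v (\<rho> a *\<^sub>v v)) + e" by simp
  qed
  ultimately show ?thesis by (simp add: nonneg_real_def)
qed

text \<open>The orbit of x is an invariant subspace that contains x, so irreducibility makes it the
  whole space.\<close>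

lemma irreducible_mat_rep_cyclic:
  assumes T: "bounded_op T" and irr: "irreducible_mat_rep T k \<rho>"
    and x: "x \<in> carrier_vec k" "x \<noteq> 0\<^sub>v k" and v: "v \<in> carrier_vec k"
  shows "\<exists>b\<in>cstar T. \<rho> b *\<^sub>v x = v"
proof -
  have rep: "mat_rep T k \<rho>" using irr by (simp add: irreducible_mat_rep_def)
  note D = mat_repD[OF rep]
  define V where "V = (\<lambda>b. \<rho> b *\<^sub>v x) ` cstar T"
  have "V = {0\<^sub>v k} \<or> V = carrier_vec k"
  proof -
    have "V \<subseteq> carrier_vec k" using D(1) x unfolding V_def by (auto intro!: mult_mat_vec_carrier[of _ k k])
    moreover have "0\<^sub>v k \<in> V"
    proof -
      have "\<rho> (op_scale 0 id) *\<^sub>v x = 0\<^sub>v k" using D(2) D(5)[OF cstar_id, of 0] x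
        by (auto simp: smult_mult_mat_vec)
      then show ?thesis unfolding V_def by (metis cstar_id cstar_scale imageI)
    qed
    moreover have "\<forall>v\<in>V. \<forall>w\<in>V. v + w \<in> V"
    proof (intro ballI)
      fix v w assume "v \<in> V" "w \<in> V"
      then obtain a b where ab: "a \<in> cstar T" "b \<in> cstar T" "v = \<rho> a *\<^sub>v x" "w = \<rho> b *\<^sub>v x"
        by (auto simp: V_def)
      then have "v + w = \<rho> (op_add a b) *\<^sub>v x"
        using D(1)[of a] D(1)[of b] D(3)[of a b] x by (simp add: op_add_eq_plus add_mult_distrib_mat_vec)
      then show "v + w \<in> V" unfolding V_def using cstar_add[of a T b] ab by blast
    qed
    moreover have "\<forall>v\<in>V. \<forall>c. c \<cdot>\<^sub>v v \<in> V"
    proof (intro ballI allI)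
      fix v c assume "v \<in> V"
      then obtain a where a: "a \<in> cstar T" "v = \<rho> a *\<^sub>v x" by (auto simp: V_def)
      then have "c \<cdot>\<^sub>v v = \<rho> (op_scale c a) *\<^sub>v x"
        using D(1)[of a] D(5)[of a c] x by (simp add: smult_mult_mat_vec)
      then show "c \<cdot>\<^sub>v v \<in> V" unfolding V_def using cstar_scale[of a T c] a by blast
    qed
    moreover have "\<forall>a\<in>cstar T. \<forall>v\<in>V. \<rho> a *\<^sub>v v \<in> V"
    proof (intro ballI)
      fix a v assume a: "a \<in> cstar T" and "v \<in> V"
      then obtain b where b: "b \<in> cstar T" "v = \<rho> b *\<^sub>v x" by (auto simp: V_def)
      have "\<rho> a *\<^sub>v v = \<rho> (a \<circ> b) *\<^sub>v x"
        using assoc_mult_mat_vec[OF D(1)[OF a] D(1)[OF b(1)] x(1)] D(4)[OF a b(1)] b by simp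
      then show "\<rho> a *\<^sub>v v \<in> V" unfolding V_def using cstar_mult[OF a b(1)] by blast
    qed
    ultimately show ?thesis using irr unfolding irreducible_mat_rep_def by blast
  qed
  moreover have "x \<in> V" unfolding V_def using D(2) x by (auto intro!: image_eqI[of _ _ id] cstar_id)
  ultimately have "V = carrier_vec k" using x by blast
  then have "v \<in> V" using v by simp
  then show ?thesis unfolding V_def by blast
qed

lemma vinner_mat_linear_sum:
  assumes S: "op_system S" and lin: "mat_linear S n \<phi>" and v: "v \<in> carrier_vec n" "w \<in> carrier_vec n"
    and F: "\<And>p. p \<in> I \<Longrightarrow> F p \<in> S"
  shows "vinner v (\<phi> (sum F I) *\<^sub>v w) = (\<Sum>p\<in>I. vinner v (\<phi> (F p) *\<^sub>v w))"
proof -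
  have "\<phi> (sum F I) \<in> carrier_mat n n" using mat_linearD(1)[OF lin op_system_sum[OF S]] F by blast
  then have "vinner v (\<phi> (sum F I) *\<^sub>v w) = (\<Sum>l<n. \<Sum>r<n. \<Sum>p\<in>I. cnj (v $ l) * \<phi> (F p) $$ (l, r) * w $ r)"
    using v
    by (auto simp: vinner_mult_mat_vec mat_linear_entry_sum[OF S lin _ _ F] sum_distrib_left sum_distrib_right
        intro!: sum.cong)
  also have "\<dots> = (\<Sum>l<n. \<Sum>p\<in>I. \<Sum>r<n. cnj (v $ l) * \<phi> (F p) $$ (l, r) * w $ r)"
    by (intro sum.cong refl sum.swap)
  also have "\<dots> = (\<Sum>p\<in>I. \<Sum>l<n. \<Sum>r<n. cnj (v $ l) * \<phi> (F p) $$ (l, r) * w $ r)" by (rule sum.swap)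
  also have "\<dots> = (\<Sum>p\<in>I. vinner v (\<phi> (F p) *\<^sub>v w))"
    using mat_linearD(1)[OF lin F] v by (auto simp: vinner_mult_mat_vec intro!: sum.cong)
  finally show ?thesis .
qed

text \<open>Writing \<open>v\<^sub>j = \<rho>(b\<^sub>j) \<xi>\<close> for one cyclic vector reduces complete positivity to positivity.\<close>

theorem irreducible_mat_rep_ucp:
  assumes T: "bounded_op T" and irr: "irreducible_mat_rep T k \<rho>"
  shows "ucp_map (cstar T) k \<rho>"
proof -
  have rep: "mat_rep T k \<rho>" and k: "1 \<le> k" using irr by (auto simp: irreducible_mat_rep_def)
  note D = mat_repD[OF rep]
  note S = op_system_cstar[OF T]
  \<comment> \<open>Any nonzero vector is cyclic; k \<ge> 1 provides this one.\<close>
  define x where "x = (unit_vec k 0 :: complex vec)"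
  have x: "x \<in> carrier_vec k" "x \<noteq> 0\<^sub>v k" using k by (auto simp: x_def)
  have pos: "blk_mat_pos k m (\<lambda>i j. \<rho> (A i j))"
    if A: "\<forall>i<m. \<forall>j<m. A i j \<in> cstar T" and Ap: "op_mat_pos m A" for m A
    unfolding blk_mat_pos_def
  proof (intro allI impI)
    fix v :: "nat \<Rightarrow> complex vec" assume v: "\<forall>i<m. v i \<in> carrier_vec k"
    then have "\<forall>i. \<exists>b. i < m \<longrightarrow> b \<in> cstar T \<and> \<rho> b *\<^sub>v x = v i"
      using irreducible_mat_rep_cyclic[OF T irr x] by meson
    then obtain b where b: "\<And>i. i < m \<Longrightarrow> b i \<in> cstar T" "\<And>i. i < m \<Longrightarrow> \<rho> (b i) *\<^sub>v x = v i" by metis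
    \<comment> \<open>The sum a of these compressions is positive: its form at y is the form of the
      matrix A at the vector with entries b i y.\<close>
    define F where "F i j = adj (b i) \<circ> A i j \<circ> b j" for i j
    have FA: "F i j \<in> cstar T" if "i < m" "j < m" for i j
      using b A that by (auto simp: F_def intro!: cstar_mult cstar_adj)
    define a where "a = (\<Sum>i<m. \<Sum>j<m. F i j)"
    have aA: "a \<in> cstar T" unfolding a_def using FA by (auto intro!: op_system_sum[OF S])
    have "op_pos a"
      unfolding op_pos_def
    proof
      fix y
      have "cinner y (a y) = (\<Sum>i<m. \<Sum>j<m. cinner (b i y) (A i j (b j y)))"
        unfolding a_def sum_fun_apply cinner_sum_right
        by (intro sum.cong refl) (use b bounded_op_cstar[OF T] in \<open>auto simp: F_def cinner_adj\<close>)
      then show "nonneg_real (cinner y (a y))"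
        using Ap[unfolded op_mat_pos_def, rule_format, of "\<lambda>i. b i y"] by simp
    qed
    then have "nonneg_real (vinner x (\<rho> a *\<^sub>v x))" using mat_rep_pos[OF T rep aA _ x(1)] by blast
    moreover have "vinner x (\<rho> a *\<^sub>v x) = (\<Sum>i<m. \<Sum>j<m. vinner x (\<rho> (F i j) *\<^sub>v x))"
      unfolding a_def
      by (subst vinner_mat_linear_sum[OF S mat_rep_mat_linear[OF rep] x(1) x(1)],
          use FA in \<open>auto intro!: op_system_sum[OF S]\<close>,
          intro sum.cong refl vinner_mat_linear_sum[OF S mat_rep_mat_linear[OF rep] x(1) x(1)]) (use FA in auto)
    moreover have "vinner x (\<rho> (F i j) *\<^sub>v x) = vinner (v i) (\<rho> (A i j) *\<^sub>v v j)" if ij: "i < m" "j < m" for i j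
    proof -
      have m: "\<rho> (b i) \<in> carrier_mat k k" "\<rho> (b j) \<in> carrier_mat k k" "\<rho> (A i j) \<in> carrier_mat k k"
        "mat_adjoint (\<rho> (b i)) \<in> carrier_mat k k"
        using D(1) b A ij by (auto intro!: mat_adjoint_carrier)
      have "\<rho> (F i j) = mat_adjoint (\<rho> (b i)) * \<rho> (A i j) * \<rho> (b j)"
        using D(4,6) b A ij by (simp add: F_def cstar.intros)
      then have "\<rho> (F i j) *\<^sub>v x = mat_adjoint (\<rho> (b i)) *\<^sub>v (\<rho> (A i j) *\<^sub>v v j)"
        using b(2)[OF ij(2)] m x by (simp add: assoc_mult_mat_vec[where ?n\<^sub>3.0 = k and ?n\<^sub>2.0 = k])
      then show ?thesis
        using vinner_adjoint[OF m(1) x(1), of "\<rho> (A i j) *\<^sub>v v j"] m v ij b(2)[OF ij(1)] by simp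
    qed
    ultimately show "nonneg_real (\<Sum>i<m. \<Sum>j<m. vinner (v i) (\<rho> (A i j) *\<^sub>v v j))" by simp
  qed
  have "cp_map (cstar T) k \<rho>"
    unfolding cp_map_def using rep pos unfolding mat_rep_def by blast
  then show ?thesis using D(2) by (simp add: ucp_map_def)
qed

section \<open>Extremal extension of positive functionals\<close>

text \<open>Functionals are real-valued and real-linear, so that the order of the reals is
  available; complex linearity is recovered by \<open>map_of_functional\<close>.\<close>

definition posfun :: "(real \<Rightarrow> 'v::ab_group_add \<Rightarrow> 'v) \<Rightarrow> 'v set \<Rightarrow> 'v set \<Rightarrow> ('v \<Rightarrow> real) \<Rightarrow> bool" where
  "posfun sc D K g \<longleftrightarrow> (\<forall>x\<in>D. \<forall>y\<in>D. g (x + y) = g x + g y) \<and> (\<forall>x\<in>D. \<forall>r. g (sc r x) = r * g x)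
     \<and> (\<forall>x\<in>K. 0 \<le> g x)"

text \<open>D is the ambient space, K the cone, and D0 the subspace where a functional is
  prescribed. As the order unit lies in D0, every vector of D is bounded above and below by vectors
  of D0, which keeps the infima in the extension step finite.\<close>

locale ordered_cone = vector_space sc for sc :: "real \<Rightarrow> 'v::ab_group_add \<Rightarrow> 'v" +
  fixes D K D0 :: "'v set" and u :: 'v
  assumes D_add: "x \<in> D \<Longrightarrow> y \<in> D \<Longrightarrow> x + y \<in> D" and D_scale: "x \<in> D \<Longrightarrow> sc r x \<in> D"
    and K_sub: "K \<subseteq> D" and K_add: "x \<in> K \<Longrightarrow> y \<in> K \<Longrightarrow> x + y \<in> K"
    and K_scale: "x \<in> K \<Longrightarrow> 0 \<le> r \<Longrightarrow> sc r x \<in> K"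
    and D0_sub: "D0 \<subseteq> D" and D0_add: "x \<in> D0 \<Longrightarrow> y \<in> D0 \<Longrightarrow> x + y \<in> D0"
    and D0_scale: "x \<in> D0 \<Longrightarrow> sc r x \<in> D0" and u_D0: "u \<in> D0"
    and order_unit: "v \<in> D \<Longrightarrow> \<exists>c. sc c u - v \<in> K"
begin

lemma minus_eq_scale: "- x = sc (- 1) x"
  by (metis scale_minus_left scale_one)

lemma D_minus: "x \<in> D \<Longrightarrow> - x \<in> D"
  unfolding minus_eq_scale by (rule D_scale)

lemma D_diff: "x \<in> D \<Longrightarrow> y \<in> D \<Longrightarrow> x - y \<in> D"
  using D_add[of x "- y"] D_minus by simp

lemma zero_K: "0 \<in> K"
proof -
  have "u \<in> D" using u_D0 D0_sub by blast
  then obtain c where "sc c u - u \<in> K" using order_unit by blast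
  then show ?thesis using K_scale[of _ 0] by fastforce
qed

text \<open>Graphs of positive linear functionals extending \<open>f\<close> to a subspace.  The last clause is a
  purity condition; it is preserved by unions of chains and by one-dimensional extensions with the
  largest possible value, which makes Zorn's lemma produce an extreme point directly.\<close>

definition extremal_graph :: "('v \<Rightarrow> real) \<Rightarrow> ('v \<times> real) set \<Rightarrow> bool" where
  "extremal_graph f G \<longleftrightarrow> (\<forall>x r. (x, r) \<in> G \<longrightarrow> x \<in> D) \<and> (\<forall>x\<in>D0. (x, f x) \<in> G)
    \<and> (\<forall>x r y s. (x, r) \<in> G \<longrightarrow> (y, s) \<in> G \<longrightarrow> (x + y, r + s) \<in> G)
    \<and> (\<forall>x r c. (x, r) \<in> G \<longrightarrow> (sc c x, c * r) \<in> G)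
    \<and> (\<forall>x r. (x, r) \<in> G \<longrightarrow> x \<in> K \<longrightarrow> 0 \<le> r)
    \<and> (\<forall>g1 g2 t. posfun sc D K g1 \<longrightarrow> posfun sc D K g2 \<longrightarrow> 0 \<le> t \<longrightarrow> t \<le> 1 \<longrightarrow>
         (\<forall>x r. (x, r) \<in> G \<longrightarrow> g1 x + g2 x = r) \<longrightarrow> (\<forall>x\<in>D0. g1 x = t * f x) \<longrightarrow>
         (\<forall>x r. (x, r) \<in> G \<longrightarrow> g1 x = t * r))"

lemma extremal_graphD:
  assumes "extremal_graph f G"
  shows "(x, r) \<in> G \<Longrightarrow> x \<in> D" "x \<in> D0 \<Longrightarrow> (x, f x) \<in> G"
    "(x, r) \<in> G \<Longrightarrow> (y, s) \<in> G \<Longrightarrow> (x + y, r + s) \<in> G"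
    "(x, r) \<in> G \<Longrightarrow> (sc c x, c * r) \<in> G" "(x, r) \<in> G \<Longrightarrow> x \<in> K \<Longrightarrow> 0 \<le> r"
    "posfun sc D K g1 \<Longrightarrow> posfun sc D K g2 \<Longrightarrow> 0 \<le> t \<Longrightarrow> t \<le> 1 \<Longrightarrow>
         (\<And>x r. (x, r) \<in> G \<Longrightarrow> g1 x + g2 x = r) \<Longrightarrow> (\<And>x. x \<in> D0 \<Longrightarrow> g1 x = t * f x) \<Longrightarrow>
         (x, r) \<in> G \<Longrightarrow> g1 x = t * r"
proof -
  note A = assms[unfolded extremal_graph_def]
  note A2 = A[THEN conjunct2]
  note A3 = A2[THEN conjunct2]
  note A4 = A3[THEN conjunct2]
  note A5 = A4[THEN conjunct2]
  show "(x, r) \<in> G \<Longrightarrow> x \<in> D" using A[THEN conjunct1] by blast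
  show "x \<in> D0 \<Longrightarrow> (x, f x) \<in> G" using A2[THEN conjunct1] by blast
  show "(x, r) \<in> G \<Longrightarrow> (y, s) \<in> G \<Longrightarrow> (x + y, r + s) \<in> G" using A3[THEN conjunct1] by blast
  show "(x, r) \<in> G \<Longrightarrow> (sc c x, c * r) \<in> G" using A4[THEN conjunct1] by blast
  show "(x, r) \<in> G \<Longrightarrow> x \<in> K \<Longrightarrow> 0 \<le> r" using A5[THEN conjunct1] by blast
  show "posfun sc D K g1 \<Longrightarrow> posfun sc D K g2 \<Longrightarrow> 0 \<le> t \<Longrightarrow> t \<le> 1 \<Longrightarrow>
         (\<And>x r. (x, r) \<in> G \<Longrightarrow> g1 x + g2 x = r) \<Longrightarrow> (\<And>x. x \<in> D0 \<Longrightarrow> g1 x = t * f x) \<Longrightarrow>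
         (x, r) \<in> G \<Longrightarrow> g1 x = t * r"
    using A5[THEN conjunct2, rule_format, of g1 g2 t x r] by blast
qed

lemma extremal_graph_diff:
  assumes "extremal_graph f G" "(x, r) \<in> G" "(y, s) \<in> G"
  shows "(x - y, r - s) \<in> G"
  using extremal_graphD(3)[OF assms(1,2) extremal_graphD(4)[OF assms(1,3), of "- 1"]]
  by (simp flip: minus_eq_scale)

text \<open>Single-valuedness is a consequence of positivity: (0, r - s) and (0, s - r) both belong
  to the graph, and 0 lies in the cone.\<close>

lemma extremal_graph_unique:
  assumes "extremal_graph f G" "(x, r) \<in> G" "(x, s) \<in> G"
  shows "r = s"
proof -
  have "(0, r - s) \<in> G" "(0, s - r) \<in> G"
    using extremal_graph_diff[OF assms] extremal_graph_diff[OF assms(1,3,2)] by auto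
  then have "0 \<le> r - s" "0 \<le> s - r" using extremal_graphD(5)[OF assms(1) _ zero_K] by blast+
  then show ?thesis by simp
qed

lemma posfun_diff_le:
  assumes "posfun sc D K g" "y \<in> D" "v \<in> D" "y - v \<in> K"
  shows "g v \<le> g y"
proof -
  have "g ((y - v) + v) = g (y - v) + g v"
    using assms D_diff unfolding posfun_def by blast
  then show ?thesis using assms unfolding posfun_def by simp
qed

text \<open>The value p is the infimum of the upper bounds that positivity imposes at v, hence the
  largest admissible one, as the last conjunct records. If v already has a value, p reproduces it,
  so no case distinction is made.\<close>

lemma extremal_graph_step:
  assumes G: "extremal_graph f G" and v: "v \<in> D"
  shows "\<exists>p. extremal_graph f {(x + sc c v, r + c * p) | x r c. (x, r) \<in> G}
     \<and> (\<forall>q. (\<forall>y s. (y, s) \<in> G \<longrightarrow> y - v \<in> K \<longrightarrow> q \<le> s) \<longrightarrow> q \<le> p)"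
proof -
  define R where "R = {s. \<exists>y. (y, s) \<in> G \<and> y - v \<in> K}"
  define p where "p = Inf R"
  note GD = extremal_graphD[OF G]
  obtain c where c: "sc c u - v \<in> K" using order_unit[OF v] by blast
  have Rne: "R \<noteq> {}" using c GD(2)[OF D0_scale[OF u_D0, of c]] by (auto simp: R_def)
  have opp: "- s \<le> s'" if ys: "(y, s) \<in> G" "y + v \<in> K" "s' \<in> R" for y s s'
  proof -
    obtain y' where y': "(y', s') \<in> G" "y' - v \<in> K" using ys(3) by (auto simp: R_def)
    have "y + y' \<in> K" using K_add[OF ys(2) y'(2)] by simp
    then have "0 \<le> s + s'" using GD(3)[OF ys(1) y'(1)] GD(5) by blast
    then show ?thesis by simp
  qed
  obtain c' where c': "sc c' u - (- v) \<in> K" using order_unit[OF D_minus[OF v]] by blast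
  then have "sc c' u + v \<in> K" by simp
  then have bdd: "bdd_below R"
    using opp[OF GD(2)[OF D0_scale[OF u_D0, of c']]] by (intro bdd_belowI[of R "- f (sc c' u)"]) blast
  have plow: "p \<le> s" if "(y, s) \<in> G" "y - v \<in> K" for y s
    unfolding p_def by (rule cInf_lower[OF _ bdd]) (use that in \<open>auto simp: R_def\<close>)
  have pgr: "q \<le> p" if "\<And>y s. (y, s) \<in> G \<Longrightarrow> y - v \<in> K \<Longrightarrow> q \<le> s" for q
    unfolding p_def by (rule cInf_greatest[OF Rne]) (use that in \<open>auto simp: R_def\<close>)
  have pup: "- s \<le> p" if "(y, s) \<in> G" "y + v \<in> K" for y s
    by (rule pgr, rule opp[OF that]) (auto simp: R_def)
  let ?G' = "{(x + sc c v, r + c * p) | x r c. (x, r) \<in> G}"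
  have GG': "(x, r) \<in> ?G'" if "(x, r) \<in> G" for x r
  proof -
    have "(x + sc 0 v, r + 0 * p) \<in> ?G'" using that by blast
    then show ?thesis by simp
  qed
  have "(0, 0) \<in> G" using GD(4)[OF GD(2)[OF u_D0], of 0] by simp
  then have "(0 + sc 1 v, 0 + 1 * p) \<in> ?G'" by blast
  then have vG': "(v, p) \<in> ?G'" by simp
  have "extremal_graph f ?G'"
    unfolding extremal_graph_def
  proof (intro conjI allI impI ballI)
    fix x r assume "(x, r) \<in> ?G'"
    then show "x \<in> D" using GD(1) v D_add D_scale by blast
  next
    fix x assume "x \<in> D0"
    then show "(x, f x) \<in> ?G'" using GG' GD(2) by blast
  next
    fix x r y s assume "(x, r) \<in> ?G'" "(y, s) \<in> ?G'"
    then obtain x' r' a y' s' b where *: "(x', r') \<in> G" "(y', s') \<in> G"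
      "x = x' + sc a v" "r = r' + a * p" "y = y' + sc b v" "s = s' + b * p" by blast
    have "x + y = (x' + y') + sc (a + b) v" "r + s = (r' + s') + (a + b) * p"
      unfolding * by (auto simp: scale_left_distrib algebra_simps)
    then show "(x + y, r + s) \<in> ?G'" using GD(3)[OF *(1,2)] by blast
  next
    fix x r b assume "(x, r) \<in> ?G'"
    then obtain x' r' a where *: "(x', r') \<in> G" "x = x' + sc a v" "r = r' + a * p" by blast
    have "sc b x = sc b x' + sc (b * a) v" "b * r = b * r' + (b * a) * p"
      unfolding * by (auto simp: scale_right_distrib algebra_simps)
    then show "(sc b x, b * r) \<in> ?G'" using GD(4)[OF *(1)] by blast
  next
    fix x r assume "(x, r) \<in> ?G'" "x \<in> K"
    then obtain x' r' a where *: "(x', r') \<in> G" "x = x' + sc a v" "r = r' + a * p" by blast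
    show "0 \<le> r"
    proof (cases "a = 0")
      case True
      then show ?thesis using * GD(5) \<open>x \<in> K\<close> by simp
    next
      case False
      \<comment> \<open>Normalises the coefficient of v to 1 or -1. The sign decides whether the
        bound of p from below (\<open>pup\<close>) or from above (\<open>plow\<close>)
        applies.\<close>
      define b where "b = inverse \<bar>a\<bar>"
      have b: "b > 0" using False by (simp add: b_def)
      have xK: "sc b x' + sc (b * a) v \<in> K"
        using K_scale[OF \<open>x \<in> K\<close>, of b] b * by (simp add: scale_right_distrib)
      have "0 \<le> b * r"
      proof (cases "a > 0")
        case True
        then have ba: "b * a = 1" by (simp add: b_def)
        then have "sc b x' + v \<in> K" using xK by simp
        then have "- (b * r') \<le> p" using pup[OF GD(4)[OF *(1), of b]] by simp
        moreover have "b * r = b * r' + (b * a) * p" using * by (simp add: algebra_simps)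
        ultimately show ?thesis using ba by simp
      next
        case False
        then have ba: "b * a = - 1" using \<open>a \<noteq> 0\<close> by (simp add: b_def)
        then have "sc b x' - v \<in> K" using xK by simp
        then have "p \<le> b * r'" using plow[OF GD(4)[OF *(1), of b]] by simp
        moreover have "b * r = b * r' + (b * a) * p" using * by (simp add: algebra_simps)
        ultimately show ?thesis using ba by simp
      qed
      then show ?thesis using b by (simp add: zero_le_mult_iff)
    qed
  next
    fix g1 g2 t x r
    assume g: "posfun sc D K g1" "posfun sc D K g2" and t: "(0::real) \<le> t" "t \<le> 1"
      and sum: "\<forall>x r. (x, r) \<in> ?G' \<longrightarrow> g1 x + g2 x = r" and f: "\<forall>x\<in>D0. g1 x = t * f x"
      and xr: "(x, r) \<in> ?G'"
    have on_G: "g1 y = t * s" "g2 y = (1 - t) * s" if "(y, s) \<in> G" for y s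
    proof -
      have "g1 y + g2 y = s" using sum GG'[OF that] by blast
      moreover show "g1 y = t * s"
        by (rule GD(6)[OF g t _ _ that]) (use sum GG' f in blast)+
      ultimately show "g2 y = (1 - t) * s" by (simp add: algebra_simps)
    qed
    \<comment> \<open>By monotonicity g v is at most \<tau> times every upper bound s at v. Division
      by \<tau> compares g v with the infimum p; for \<tau> = 0 a single upper bound
      suffices.\<close>
    have le: "g v \<le> \<tau> * p" if "posfun sc D K g" "0 \<le> \<tau>" "\<And>y s. (y, s) \<in> G \<Longrightarrow> g y = \<tau> * s" for g \<tau>
    proof -
      have bnd: "g v \<le> \<tau> * s" if "(y, s) \<in> G" "y - v \<in> K" for y s
        using posfun_diff_le[OF \<open>posfun sc D K g\<close> GD(1)[OF that(1)] v that(2)] \<open>\<And>y s. (y, s) \<in> G \<Longrightarrow> g y = \<tau> * s\<close>[OF that(1)] by simp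
      show ?thesis
      proof (cases "\<tau> = 0")
        case True
        obtain y s where "(y, s) \<in> G" "y - v \<in> K" using Rne by (auto simp: R_def)
        then show ?thesis using bnd True by fastforce
      next
        case False
        then have "\<tau> > 0" using that by simp
        have "g v / \<tau> \<le> p"
          by (rule pgr) (use bnd \<open>\<tau> > 0\<close> in \<open>auto simp: field_simps\<close>)
        then show ?thesis using \<open>\<tau> > 0\<close> by (simp add: field_simps)
      qed
    qed
    have "g1 v \<le> t * p" using le[OF g(1) t(1) on_G(1)] .
    moreover have "g2 v \<le> (1 - t) * p" using le[OF g(2) _ on_G(2)] t by simp
    moreover have "g1 v + g2 v = p" using sum vG' by blast
    \<comment> \<open>The two upper bounds add up to p, and so do the two values; hence both bounds
      are attained.\<close>
    ultimately have gv: "g1 v = t * p" by (simp add: algebra_simps)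
    obtain x' r' a where *: "(x', r') \<in> G" "x = x' + sc a v" "r = r' + a * p" using xr by blast
    have "g1 x = g1 x' + a * g1 v"
      using g(1) GD(1)[OF *(1)] v D_scale unfolding posfun_def *(2) by simp
    then show "g1 x = t * r" using on_G(1)[OF *(1)] gv * by (simp add: algebra_simps)
  qed
  then show ?thesis using pgr by blast
qed

text \<open>The step at v0 is made first and Zorn's lemma is applied only above it, so F takes at v0
  the largest value of any positive extension. The last clause is the purity condition of a graph
  that has become total.\<close>

theorem extremal_extension:
  assumes f_add: "\<And>x y. x \<in> D0 \<Longrightarrow> y \<in> D0 \<Longrightarrow> f (x + y) = f x + f y"
    and f_scale: "\<And>x r. x \<in> D0 \<Longrightarrow> f (sc r x) = r * f x"
    and f_pos: "\<And>x. x \<in> D0 \<Longrightarrow> x \<in> K \<Longrightarrow> 0 \<le> f x"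
    and v0: "v0 \<in> D"
  obtains F where "posfun sc D K F" "\<And>x. x \<in> D0 \<Longrightarrow> F x = f x"
    "\<And>g. posfun sc D K g \<Longrightarrow> (\<And>x. x \<in> D0 \<Longrightarrow> g x = f x) \<Longrightarrow> g v0 \<le> F v0"
    "\<And>g1 g2 t x. posfun sc D K g1 \<Longrightarrow> posfun sc D K g2 \<Longrightarrow> 0 \<le> t \<Longrightarrow> t \<le> 1 \<Longrightarrow>
      (\<And>x. x \<in> D \<Longrightarrow> g1 x + g2 x = F x) \<Longrightarrow> (\<And>x. x \<in> D0 \<Longrightarrow> g1 x = t * f x) \<Longrightarrow> x \<in> D \<Longrightarrow> g1 x = t * F x"
proof -
  define G0 where "G0 = {(x, f x) | x. x \<in> D0}"
  have G0: "extremal_graph f G0"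
    unfolding extremal_graph_def G0_def
    using D0_sub D0_add D0_scale f_add f_scale f_pos by auto
  obtain p where p: "extremal_graph f {(x + sc c v0, r + c * p) | x r c. (x, r) \<in> G0}"
      "\<And>q. (\<forall>y s. (y, s) \<in> G0 \<longrightarrow> y - v0 \<in> K \<longrightarrow> q \<le> s) \<Longrightarrow> q \<le> p"
    using extremal_graph_step[OF G0 v0] by blast
  define G1 where "G1 = {(x + sc c v0, r + c * p) | x r c. (x, r) \<in> G0}"
  have z0: "(0, 0) \<in> G0" using extremal_graphD(4)[OF G0 extremal_graphD(2)[OF G0 u_D0], of 0] by simp
  then have "(0 + sc 1 v0, 0 + 1 * p) \<in> G1" unfolding G1_def by blast
  then have v0G1: "(v0, p) \<in> G1" by simp
  define \<A> where "\<A> = {G. extremal_graph f G \<and> G1 \<subseteq> G}"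
  have "\<exists>M\<in>\<A>. \<forall>X\<in>\<A>. M \<subseteq> X \<longrightarrow> X = M"
  proof (rule subset_Zorn_nonempty)
    show "\<A> \<noteq> {}" using p(1) unfolding \<A>_def G1_def by blast
    fix C assume C: "C \<noteq> {}" "subset.chain \<A> C"
    have good: "extremal_graph f G" "G1 \<subseteq> G" if "G \<in> C" for G
      using C that by (auto simp: subset.chain_def \<A>_def)
    have two: "\<exists>G\<in>C. a \<in> G \<and> b \<in> G" if "a \<in> \<Union>C" "b \<in> \<Union>C" for a b
      using C that unfolding subset.chain_def by blast
    have "extremal_graph f (\<Union>C)"
      unfolding extremal_graph_def
    proof (intro conjI allI impI ballI)
      fix x r assume "(x, r) \<in> \<Union>C"
      then show "x \<in> D" using good(1) extremal_graphD(1) by blast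
    next
      fix x assume "x \<in> D0"
      then show "(x, f x) \<in> \<Union>C" using C good(1) extremal_graphD(2) by blast
    next
      fix x r y s assume "(x, r) \<in> \<Union>C" "(y, s) \<in> \<Union>C"
      then show "(x + y, r + s) \<in> \<Union>C" using two good(1) extremal_graphD(3) by (metis UnionI)
    next
      fix x r c assume "(x, r) \<in> \<Union>C"
      then show "(sc c x, c * r) \<in> \<Union>C" using good(1) extremal_graphD(4) by blast
    next
      fix x r assume "(x, r) \<in> \<Union>C" "x \<in> K"
      then show "0 \<le> r" using good(1) extremal_graphD(5) by blast
    next
      fix g1 g2 t x r
      assume g: "posfun sc D K g1" "posfun sc D K g2" and t: "(0::real) \<le> t" "t \<le> 1"
        and sum: "\<forall>x r. (x, r) \<in> \<Union>C \<longrightarrow> g1 x + g2 x = r" and f: "\<forall>x\<in>D0. g1 x = t * f x"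
        and xr: "(x, r) \<in> \<Union>C"
      obtain G where G: "G \<in> C" "(x, r) \<in> G" using xr by blast
      have s: "g1 y + g2 y = s" if "(y, s) \<in> G" for y s using sum that G(1) by blast
      show "g1 x = t * r"
        by (rule extremal_graphD(6)[OF good(1)[OF G(1)] g t s _ G(2)]) (use f in blast)+
    qed
    moreover have "G1 \<subseteq> \<Union>C" using C good(2) by blast
    ultimately show "\<Union>C \<in> \<A>" by (simp add: \<A>_def)
  qed
  then obtain M where MA: "M \<in> \<A>" and max: "\<And>X. X \<in> \<A> \<Longrightarrow> M \<subseteq> X \<Longrightarrow> X = M" by blast
  have M: "extremal_graph f M" "G1 \<subseteq> M" using MA unfolding \<A>_def by auto
  note MD = extremal_graphD[OF M(1)]
  \<comment> \<open>A further step at v stays in the family, so by maximality v already has a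
    value.\<close>
  have total: "\<exists>r. (v, r) \<in> M" if vD: "v \<in> D" for v
  proof -
    obtain p where p: "extremal_graph f {(x + sc c v, r + c * p) | x r c. (x, r) \<in> M}"
      using extremal_graph_step[OF M(1) vD] by blast
    let ?M' = "{(x + sc c v, r + c * p) | x r c. (x, r) \<in> M}"
    have sub: "M \<subseteq> ?M'"
    proof
      fix z assume z: "z \<in> M"
      obtain x r where xr: "z = (x, r)" by (cases z)
      have "(x + sc 0 v, r + 0 * p) \<in> ?M'" using z unfolding xr by blast
      then show "z \<in> ?M'" by (simp add: xr)
    qed
    then have "?M' = M" using max[of ?M'] p M(2) unfolding \<A>_def by blast
    moreover have "(v, p) \<in> ?M'"
    proof -
      have "(0, 0) \<in> M" using MD(4)[OF MD(2)[OF u_D0], of 0] by simp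
      then have "(0 + sc 1 v, 0 + 1 * p) \<in> ?M'" by blast
      then show ?thesis by simp
    qed
    ultimately show ?thesis by blast
  qed
  define F where "F v = (SOME r. (v, r) \<in> M)" for v
  have F: "(v, F v) \<in> M" if "v \<in> D" for v
    unfolding F_def using someI_ex[OF total[OF that]] .
  have FM: "F v = r" if "(v, r) \<in> M" for v r
    using extremal_graph_unique[OF M(1) F[OF MD(1)[OF that]] that] .
  show ?thesis
  proof (rule that[of F])
    show "posfun sc D K F"
      unfolding posfun_def
    proof (intro conjI ballI allI)
      fix x y assume "x \<in> D" "y \<in> D"
      then show "F (x + y) = F x + F y" using FM[OF MD(3)[OF F F]] by blast
    next
      fix x r assume "x \<in> D"
      then show "F (sc r x) = r * F x" using FM[OF MD(4)[OF F]] by blast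
    next
      fix x assume "x \<in> K"
      then show "0 \<le> F x" using MD(5)[OF F] K_sub by blast
    qed
    show "F x = f x" if "x \<in> D0" for x using FM[OF MD(2)[OF that]] .
    show "g v0 \<le> F v0" if g: "posfun sc D K g" "\<And>x. x \<in> D0 \<Longrightarrow> g x = f x" for g
    proof -
      have "g v0 \<le> p"
      proof (rule p(2), intro allI impI)
        fix y s assume "(y, s) \<in> G0" "y - v0 \<in> K"
        then have "y \<in> D0" "s = f y" by (auto simp: G0_def)
        then show "g v0 \<le> s"
          using posfun_diff_le[OF g(1) _ v0 \<open>y - v0 \<in> K\<close>] D0_sub g(2) by auto
      qed
      moreover have "F v0 = p" using FM M(2) v0G1 by blast
      ultimately show ?thesis by simp
    qed
    show "g1 x = t * F x"
      if g: "posfun sc D K g1" "posfun sc D K g2" "0 \<le> t" "t \<le> 1"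
        "\<And>x. x \<in> D \<Longrightarrow> g1 x + g2 x = F x" "\<And>x. x \<in> D0 \<Longrightarrow> g1 x = t * f x" "x \<in> D" for g1 g2 t x
      by (rule MD(6)[OF g(1-4) _ g(6) F[OF g(7)]]) (use g(5) FM MD(1) in blast)+
  qed
qed

end

section \<open>Functionals on operator matrices\<close>

text \<open>Entries are indexed by all pairs of naturals, which makes matrices an additive group of
  functions; forms and functionals only look at the n by n block.\<close>

type_synonym 'h opmat = "nat \<Rightarrow> nat \<Rightarrow> 'h \<Rightarrow> 'h"

definition mscale :: "complex \<Rightarrow> 'h::chilbert opmat \<Rightarrow> 'h opmat" where
  "mscale c C = (\<lambda>i j. op_scale c (C i j))"

definition rscale :: "real \<Rightarrow> 'h::chilbert opmat \<Rightarrow> 'h opmat" where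
  "rscale r C = mscale (complex_of_real r) C"

definition entries_in :: "('h::chilbert \<Rightarrow> 'h) set \<Rightarrow> 'h opmat set" where
  "entries_in S = {C. \<forall>i j. C i j \<in> S}"

definition qform :: "nat \<Rightarrow> 'h::chilbert opmat \<Rightarrow> (nat \<Rightarrow> 'h) \<Rightarrow> complex" where
  "qform n C x = (\<Sum>i<n. \<Sum>j<n. cinner (x i) (C i j (x j)))"

text \<open>The cone of accretive matrices contains no condition of self-adjointness, so every operator
  matrix is dominated by a multiple of the identity.\<close>

definition accretive :: "nat \<Rightarrow> ('h::chilbert \<Rightarrow> 'h) set \<Rightarrow> 'h opmat set" where
  "accretive n S = {C \<in> entries_in S. \<forall>x. 0 \<le> Re (qform n C x)}"

text \<open>The functional on matrices that corresponds to \<phi>. It is the amplification of \<phi>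
  evaluated at the vector with blocks e_0, ..., e_(n-1), rather than a trace of \<phi>
  itself.\<close>

definition mtrace :: "nat \<Rightarrow> (('h::chilbert \<Rightarrow> 'h) \<Rightarrow> complex mat) \<Rightarrow> 'h opmat \<Rightarrow> complex" where
  "mtrace n \<phi> C = (\<Sum>i<n. \<Sum>j<n. \<phi> (C i j) $$ (i, j))"

definition eunit :: "nat \<Rightarrow> nat \<Rightarrow> ('h::chilbert \<Rightarrow> 'h) \<Rightarrow> 'h opmat" where
  "eunit i j a = (\<lambda>p q. if p = i \<and> q = j then a else 0)"

text \<open>A complex-linear functional with real part g is h(C) = g(C) - \<i> g(\<i> C); its values
  on matrices with a single nonzero entry are the entries of the map.\<close>

definition map_of_functional :: "nat \<Rightarrow> ('h::chilbert opmat \<Rightarrow> real) \<Rightarrow> ('h \<Rightarrow> 'h) \<Rightarrow> complex mat" where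
  "map_of_functional n g a = mat n n (\<lambda>(i, j). Complex (g (eunit i j a)) (- g (eunit i j (op_scale \<i> a))))"

lemma qform_add: "qform n (C + E) x = qform n C x + qform n E x"
  by (simp add: qform_def cinner_add_right sum.distrib)

lemma qform_mscale: "qform n (mscale c C) x = c * qform n C x"
  by (simp add: qform_def mscale_def op_scale_def cinner_scaleC_right sum_distrib_left)

lemma qform_diff: "qform n (C - E) x = qform n C x - qform n E x"
  by (simp add: qform_def cinner_diff_right sum_subtractf)

lemma op_mat_pos_qform: "op_mat_pos n C \<longleftrightarrow> (\<forall>x. nonneg_real (qform n C x))"
  by (simp add: op_mat_pos_def qform_def)

lemma vector_space_rscale: "vector_space rscale"
  by unfold_locales
    (simp_all add: fun_eq_iff rscale_def mscale_def op_scale_def scaleC_add_right scaleC_add_left scaleC_scaleC scaleC_one)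

lemma entries_in_add: "op_system S \<Longrightarrow> C \<in> entries_in S \<Longrightarrow> E \<in> entries_in S \<Longrightarrow> C + E \<in> entries_in S"
  by (simp add: entries_in_def op_systemD)

lemma entries_in_mscale: "op_system S \<Longrightarrow> C \<in> entries_in S \<Longrightarrow> mscale c C \<in> entries_in S"
  by (simp add: entries_in_def mscale_def op_systemD)

lemma entries_in_eunit: "op_system S \<Longrightarrow> a \<in> S \<Longrightarrow> eunit i j a \<in> entries_in S"
  by (simp add: entries_in_def eunit_def op_system_zero)

definition ident_opmat :: "'h::chilbert opmat" where
  "ident_opmat = (\<lambda>i j. if i = j then id else 0)"

lemma qform_ident: "qform n ident_opmat x = complex_of_real (\<Sum>i<n. (cnorm (x i))\<^sup>2)"
proof -
  have "(\<Sum>j<n. cinner (x i) (ident_opmat i j (x j))) = cinner (x i) (x i)" if "i < n" for i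
  proof -
    have "(\<Sum>j<n. cinner (x i) (ident_opmat i j (x j))) = (\<Sum>j<n. if j = i then cinner (x i) (x j) else 0)"
      by (intro sum.cong refl) (auto simp: ident_opmat_def)
    also have "\<dots> = cinner (x i) (x i)"
      by (simp only: sum.delta[OF finite_lessThan] lessThan_iff that if_True)
    finally show ?thesis .
  qed
  then show ?thesis by (simp add: qform_def cinner_self)
qed

lemma qform_bound:
  assumes C: "\<And>i j. bounded_op (C i j)"
  shows "\<exists>c\<ge>0. \<forall>x. cmod (qform n C x) \<le> c * (\<Sum>i<n. (cnorm (x i))\<^sup>2)"
proof -
  obtain b where b: "\<And>i j. op_bound (C i j) (b i j)" using bounded_op_bound[OF C] by metis
  have b0: "0 \<le> b i j" for i j using b[of i j] by (simp add: op_bound_def)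
  define c where "c = (\<Sum>i<n. \<Sum>j<n. b i j)"
  have "cmod (qform n C x) \<le> c * (\<Sum>i<n. (cnorm (x i))\<^sup>2)" for x
  proof -
    define N where "N = (\<Sum>i<n. (cnorm (x i))\<^sup>2)"
    have e: "cmod (cinner (x i) (C i j (x j))) \<le> b i j * N" if "i < n" "j < n" for i j
    proof -
      have le: "(cnorm (x l))\<^sup>2 \<le> N" if "l < n" for l
        unfolding N_def by (rule member_le_sum) (use that in auto)
      have "cmod (cinner (x i) (C i j (x j))) \<le> cnorm (x i) * cnorm (C i j (x j))" by (rule Cauchy_Schwarz_cinner)
      also have "\<dots> \<le> cnorm (x i) * (b i j * cnorm (x j))"
        using b[of i j] by (intro mult_left_mono) (auto simp: op_bound_def)
      also have "\<dots> = b i j * (cnorm (x i) * cnorm (x j))" by simp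
      also have "\<dots> \<le> b i j * N"
      proof (rule mult_left_mono[OF _ b0])
        have "2 * cnorm (x i) * cnorm (x j) \<le> (cnorm (x i))\<^sup>2 + (cnorm (x j))\<^sup>2"
          by (rule sum_squares_bound)
        then show "cnorm (x i) * cnorm (x j) \<le> N" using le[OF that(1)] le[OF that(2)] by linarith
      qed
      finally show ?thesis .
    qed
    have "cmod (qform n C x) \<le> (\<Sum>i<n. \<Sum>j<n. cmod (cinner (x i) (C i j (x j))))"
      unfolding qform_def by (intro order_trans[OF norm_sum] sum_mono norm_sum)
    also have "\<dots> \<le> (\<Sum>i<n. \<Sum>j<n. b i j * N)" by (intro sum_mono e) auto
    also have "\<dots> = c * N" by (simp add: c_def sum_distrib_right)
    finally show ?thesis by (simp add: N_def)
  qed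
  moreover have "0 \<le> c" unfolding c_def by (intro sum_nonneg b0)
  ultimately show ?thesis by blast
qed

lemma ordered_cone_opmat:
  assumes S: "op_system S" and A: "op_system A" and SA: "S \<subseteq> A"
  shows "ordered_cone rscale (entries_in A) (accretive n A) (entries_in S) ident_opmat"
proof -
  interpret vector_space rscale by (rule vector_space_rscale)
  have sub: "entries_in S \<subseteq> entries_in A" using SA by (auto simp: entries_in_def)
  have id: "ident_opmat \<in> entries_in S"
    using op_system_zero[OF S] op_systemD(1)[OF S] by (simp add: entries_in_def ident_opmat_def)
  show ?thesis
  proof unfold_locales
    fix v assume v: "v \<in> entries_in A"
    then obtain c where c: "0 \<le> c" "\<And>x. cmod (qform n v x) \<le> c * (\<Sum>i<n. (cnorm (x i))\<^sup>2)"
      using qform_bound[of v n] op_systemD(5)[OF A] by (auto simp: entries_in_def)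
    have "0 \<le> Re (qform n (rscale c ident_opmat - v) x)" for x
      using c(2)[of x] complex_Re_le_cmod[of "qform n v x"]
      by (simp add: qform_diff rscale_def qform_mscale qform_ident)
    moreover have "rscale c ident_opmat - v \<in> entries_in A"
      using v A op_systemD[OF A] op_system_zero[OF A]
      by (auto simp: entries_in_def rscale_def mscale_def ident_opmat_def intro!: op_system_diff[OF A])
    ultimately show "\<exists>c. rscale c ident_opmat - v \<in> accretive n A" by (auto simp: accretive_def)
  qed (use sub id in
      \<open>auto simp: accretive_def rscale_def qform_add qform_mscale entries_in_add[OF A] entries_in_mscale[OF A]
        entries_in_add[OF S] entries_in_mscale[OF S]\<close>)
qed

lemma posfun_restrict:
  assumes "posfun rscale (entries_in A) (accretive n A) g" "S \<subseteq> A"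
  shows "posfun rscale (entries_in S) (accretive n S) g"
proof -
  have "entries_in S \<subseteq> entries_in A" "accretive n S \<subseteq> accretive n A"
    using assms(2) by (auto simp: accretive_def entries_in_def)
  then show ?thesis using assms(1) unfolding posfun_def by blast
qed

lemma mtrace_add:
  assumes "mat_linear S n \<phi>" "C \<in> entries_in S" "E \<in> entries_in S"
  shows "mtrace n \<phi> (C + E) = mtrace n \<phi> C + mtrace n \<phi> E"
  using assms by (simp add: mtrace_def entries_in_def mat_linear_entry_add sum.distrib)

lemma mtrace_mscale:
  assumes "mat_linear S n \<phi>" "C \<in> entries_in S"
  shows "mtrace n \<phi> (mscale c C) = c * mtrace n \<phi> C"
  using assms by (simp add: mtrace_def mscale_def entries_in_def mat_linear_entry_scale sum_distrib_left)

lemma mtrace_eunit: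
  assumes "op_system S" "mat_linear S n \<phi>" "i < n" "j < n"
  shows "mtrace n \<phi> (eunit i j a) = \<phi> a $$ (i, j)"
proof -
  have "mtrace n \<phi> (eunit i j a) = (\<Sum>p<n. \<Sum>q<n. cnj (if p = i then 1 else 0) * \<phi> a $$ (p, q) * (if q = j then 1 else 0))"
    unfolding mtrace_def eunit_def
    by (intro sum.cong refl) (auto simp: mat_linear_entry_zero[OF assms(1,2)])
  then show ?thesis using sum_delta2[OF assms(3,4), of 1 "\<lambda>p q. \<phi> a $$ (p, q)" 1] by simp
qed

text \<open>If C is accretive then C + C* is positive, and hermiticity of \<phi> makes the
  functional of C + C* twice the real part at C.\<close>

lemma posfun_of_cp_map:
  assumes S: "op_system S" and cp: "cp_map S n \<phi>"
  shows "posfun rscale (entries_in S) (accretive n S) (\<lambda>C. Re (mtrace n \<phi> C))"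
  unfolding posfun_def
proof (intro conjI ballI allI)
  note lin = cp_map_mat_linear[OF cp]
  show "Re (mtrace n \<phi> (C + E)) = Re (mtrace n \<phi> C) + Re (mtrace n \<phi> E)"
    if "C \<in> entries_in S" "E \<in> entries_in S" for C E
    using mtrace_add[OF lin that] by simp
  show "Re (mtrace n \<phi> (rscale r C)) = r * Re (mtrace n \<phi> C)" if "C \<in> entries_in S" for C r
    using mtrace_mscale[OF lin that] by (simp add: rscale_def)
  fix C assume C: "C \<in> accretive n S"
  then have CS: "C i j \<in> S" for i j by (simp add: accretive_def entries_in_def)
  have Cb: "bounded_op (C i j)" for i j using op_systemD(5)[OF S CS] .
  define Ca where "Ca = (\<lambda>i j. adj (C j i))"
  have Ca: "Ca \<in> entries_in S" using op_systemD(4)[OF S] CS by (simp add: entries_in_def Ca_def)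
  have qa: "qform n Ca x = cnj (qform n C x)" for x
  proof -
    have "cinner (x i) (Ca i j (x j)) = cnj (cinner (x j) (C j i (x i)))" for i j
      using cinner_adj[OF Cb, of j i "x i" "x j"] cinner_conj[of "C j i (x i)" "x j"] by (simp add: Ca_def)
    then have "qform n Ca x = (\<Sum>i<n. \<Sum>j<n. cnj (cinner (x j) (C j i (x i))))" by (simp add: qform_def)
    also have "\<dots> = (\<Sum>j<n. \<Sum>i<n. cnj (cinner (x j) (C j i (x i))))" by (rule sum.swap)
    finally show ?thesis by (simp add: qform_def)
  qed
  have "op_mat_pos n (C + Ca)"
    unfolding op_mat_pos_qform qform_add qa using C by (simp add: nonneg_real_def accretive_def)
  moreover have "C + Ca \<in> entries_in S" using C Ca entries_in_add[OF S] by (simp add: accretive_def)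
  ultimately have "nonneg_real (mtrace n \<phi> (C + Ca))"
    unfolding mtrace_def using cp_map_trace_nonneg[OF cp, of "C + Ca"]
    unfolding entries_in_def mem_Collect_eq by blast
  moreover have "mtrace n \<phi> Ca = cnj (mtrace n \<phi> C)"
  proof -
    have "mtrace n \<phi> Ca = (\<Sum>i<n. \<Sum>j<n. cnj (\<phi> (C j i) $$ (j, i)))"
      unfolding mtrace_def Ca_def by (intro sum.cong refl cp_map_adj[OF S cp CS]) auto
    also have "\<dots> = (\<Sum>j<n. \<Sum>i<n. cnj (\<phi> (C j i) $$ (j, i)))" by (rule sum.swap)
    finally show ?thesis by (simp add: mtrace_def)
  qed
  moreover have "mtrace n \<phi> (C + Ca) = mtrace n \<phi> C + mtrace n \<phi> Ca"
    using mtrace_add[OF lin _ Ca] C by (simp add: accretive_def)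
  ultimately show "0 \<le> Re (mtrace n \<phi> C)" by (simp add: nonneg_real_def)
qed

context
  fixes S :: "('h::chilbert \<Rightarrow> 'h) set" and n :: nat and g :: "'h opmat \<Rightarrow> real"
  assumes S: "op_system S" and g: "posfun rscale (entries_in S) (accretive n S) g"
begin

lemma posfun_add: "C \<in> entries_in S \<Longrightarrow> E \<in> entries_in S \<Longrightarrow> g (C + E) = g C + g E"
  and posfun_scale: "C \<in> entries_in S \<Longrightarrow> g (rscale r C) = r * g C"
  and posfun_nonneg: "C \<in> accretive n S \<Longrightarrow> 0 \<le> g C"
  using g unfolding posfun_def by blast+

text \<open>Both C and -C are accretive. This removes entries outside the n by n block as well as
  \<i> times a positive matrix.\<close>

lemma posfun_null:
  assumes "C \<in> entries_in S" "\<And>x. Re (qform n C x) = 0"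
  shows "g C = 0"
proof -
  have "rscale (-1) C \<in> entries_in S" using assms entries_in_mscale[OF S] by (simp add: rscale_def)
  then have "rscale (-1) C \<in> accretive n S" using assms by (simp add: accretive_def rscale_def qform_mscale)
  then have "0 \<le> - g C" using posfun_nonneg posfun_scale[OF assms(1), of "-1"] by force
  moreover have "0 \<le> g C" using posfun_nonneg assms by (simp add: accretive_def)
  ultimately show ?thesis by simp
qed

lemma posfun_sum:
  assumes "\<And>p. p \<in> I \<Longrightarrow> F p \<in> entries_in S"
  shows "sum F I \<in> entries_in S \<and> g (sum F I) = (\<Sum>p\<in>I. g (F p))"
proof -
  have z: "(0 :: 'h opmat) \<in> entries_in S" using op_system_zero[OF S] by (simp add: entries_in_def)
  then have z0: "g 0 = 0" by (rule posfun_null) (simp add: qform_def)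
  note zero = z z0
  show ?thesis using assms
  proof (induction I rule: infinite_finite_induct)
    case (insert x I)
    then have IH: "sum F I \<in> entries_in S" "g (sum F I) = (\<Sum>p\<in>I. g (F p))" and x: "F x \<in> entries_in S" by auto
    show ?case
      unfolding sum.insert[OF insert(1,2)] posfun_add[OF x IH(1)] IH(2)
      by (intro conjI refl entries_in_add[OF S x IH(1)])
  next
    case (infinite I)
    show ?case unfolding sum.infinite[OF infinite(1)] by (intro conjI zero)
  next
    case empty
    show ?case unfolding sum.empty by (intro conjI zero)
  qed
qed

text \<open>C and the sum of its single-entry matrices agree only on the block, so their difference
  is not zero but has zero form.\<close>

lemma posfun_entries:
  assumes C: "C \<in> entries_in S"
  shows "g C = (\<Sum>i<n. \<Sum>j<n. g (eunit i j (C i j)))"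
proof -
  define E where "E = (\<Sum>i<n. \<Sum>j<n. eunit i j (C i j))"
  have e: "eunit i j (C i j) \<in> entries_in S" for i j
    using C entries_in_eunit[OF S] by (simp add: entries_in_def)
  have E: "E \<in> entries_in S" "g E = (\<Sum>i<n. \<Sum>j<n. g (eunit i j (C i j)))"
    unfolding E_def using e posfun_sum by (simp_all add: posfun_sum)
  have Eij: "E p q = C p q" if "p < n" "q < n" for p q
  proof
    fix x
    have "E p q x = (\<Sum>i<n. \<Sum>j<n. eunit i j (C i j) p q x)" by (simp add: E_def sum_fun_apply)
    also have "\<dots> = (\<Sum>i<n. if i = p then (\<Sum>j<n. if j = q then C p q x else 0) else 0)"
      by (intro sum.cong refl) (auto simp: eunit_def intro!: sum.cong sum.neutral simp del: sum.delta sum.delta')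
    also have "\<dots> = C p q x"
      by (simp only: sum.delta[OF finite_lessThan] lessThan_iff that if_True)
    finally show "E p q x = C p q x" .
  qed
  have D: "C + rscale (-1) E \<in> entries_in S"
    using C E entries_in_mscale[OF S] by (intro entries_in_add[OF S]) (auto simp: rscale_def)
  have "qform n E x = qform n C x" for x
    unfolding qform_def by (intro sum.cong refl) (simp add: Eij)
  then have "g (C + rscale (-1) E) = 0"
    using D by (intro posfun_null) (auto simp: qform_add rscale_def qform_mscale)
  moreover have "g (C + rscale (-1) E) = g C + (-1) * g E"
    using posfun_add[OF C, of "rscale (-1) E"] posfun_scale[OF E(1), of "-1"] entries_in_mscale[OF S E(1)]
    by (simp only: rscale_def)
  ultimately show ?thesis using E by simp
qed

lemma map_of_functional_linear: "mat_linear S n (map_of_functional n g)"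
  unfolding mat_linear_def
proof (intro conjI ballI allI)
  have eadd: "eunit i j (a + b) = eunit i j a + eunit i j b" for i j and a b :: "'h \<Rightarrow> 'h"
    by (intro ext) (auto simp: eunit_def)
  have esc: "eunit i j (op_scale (complex_of_real r) a) = rscale r (eunit i j a)" for i j r and a :: "'h \<Rightarrow> 'h"
    by (intro ext) (auto simp: eunit_def rscale_def mscale_def op_scale_zero_right)
  fix a assume a: "a \<in> S"
  show "map_of_functional n g a \<in> carrier_mat n n" by (simp add: map_of_functional_def)
  have ia: "op_scale \<i> a \<in> S" using a op_systemD(3)[OF S] by blast
  note e = entries_in_eunit[OF S]
  show "map_of_functional n g (op_add a b) = map_of_functional n g a + map_of_functional n g b" if b: "b \<in> S" for b
  proof (rule eq_matI)
    fix i j assume ij: "i < dim_row (map_of_functional n g a + map_of_functional n g b)"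
      "j < dim_col (map_of_functional n g a + map_of_functional n g b)"
    then have ij: "i < n" "j < n" by (auto simp: map_of_functional_def)
    have ib: "op_scale \<i> b \<in> S" using b op_systemD(3)[OF S] by blast
    show "map_of_functional n g (op_add a b) $$ (i, j) = (map_of_functional n g a + map_of_functional n g b) $$ (i, j)"
      using ij posfun_add[OF e[OF a] e[OF b]] posfun_add[OF e[OF ia] e[OF ib]]
      by (simp add: map_of_functional_def op_add_eq_plus op_scale_add eadd complex_eq_iff)
  qed (auto simp: map_of_functional_def)
  show "map_of_functional n g (op_scale c a) = c \<cdot>\<^sub>m map_of_functional n g a" for c
  proof (rule eq_matI)
    fix i j assume "i < dim_row (c \<cdot>\<^sub>m map_of_functional n g a)" "j < dim_col (c \<cdot>\<^sub>m map_of_functional n g a)"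
    then have ij: "i < n" "j < n" by (auto simp: map_of_functional_def)
    have s: "g (eunit i j (op_scale (Complex x y) a)) = x * g (eunit i j a) + y * g (eunit i j (op_scale \<i> a))" for x y
    proof -
      have "op_scale (Complex x y) a = op_scale (complex_of_real x) a + op_scale (complex_of_real y) (op_scale \<i> a)"
        unfolding op_scale_op_scale op_scale_add_left[symmetric]
        by (rule arg_cong[where f = "\<lambda>c. op_scale c a"]) (simp add: complex_eq_iff)
      then show ?thesis
        using posfun_scale[OF e[OF a]] posfun_scale[OF e[OF ia]] entries_in_mscale[OF S e[OF a]] entries_in_mscale[OF S e[OF ia]]
        by (simp add: eadd esc posfun_add rscale_def)
    qed
    have "op_scale \<i> (op_scale c a) = op_scale (Complex (- Im c) (Re c)) a"
      unfolding op_scale_op_scale by (rule arg_cong[where f = "\<lambda>c. op_scale c a"]) (simp add: complex_eq_iff)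
    moreover have "op_scale c a = op_scale (Complex (Re c) (Im c)) a" by simp
    ultimately have "g (eunit i j (op_scale \<i> (op_scale c a))) = - Im c * g (eunit i j a) + Re c * g (eunit i j (op_scale \<i> a))"
      "g (eunit i j (op_scale c a)) = Re c * g (eunit i j a) + Im c * g (eunit i j (op_scale \<i> a))"
      using s by metis+
    then show "map_of_functional n g (op_scale c a) $$ (i, j) = (c \<cdot>\<^sub>m map_of_functional n g a) $$ (i, j)"
      using ij by (simp add: map_of_functional_def complex_eq_iff algebra_simps)
  qed (auto simp: map_of_functional_def)
qed

lemma mtrace_map_of_functional:
  assumes C: "C \<in> entries_in S"
  shows "mtrace n (map_of_functional n g) C = Complex (g C) (- g (mscale \<i> C))"
proof -
  have "g (mscale \<i> C) = (\<Sum>i<n. \<Sum>j<n. g (eunit i j (op_scale \<i> (C i j))))"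
    using posfun_entries[OF entries_in_mscale[OF S C]] by (simp add: mscale_def)
  then show ?thesis
    using posfun_entries[OF C] by (simp add: mtrace_def map_of_functional_def complex_eq_iff sum_negf)
qed

text \<open>For a positive C the matrix \<i> C has purely imaginary form, so g vanishes on it: the
  complex functional is real on C, and nonnegative there because C is accretive.\<close>

lemma map_of_functional_cp: "cp_map S n (map_of_functional n g)"
proof (rule cp_mapI_trace[OF S map_of_functional_linear])
  fix C assume "\<And>i j. C i j \<in> S" and pos: "op_mat_pos n C"
  then have C: "C \<in> entries_in S" by (simp add: entries_in_def)
  have "0 \<le> g C" using C pos posfun_nonneg by (simp add: accretive_def op_mat_pos_qform nonneg_real_def)
  moreover have "g (mscale \<i> C) = 0"
    by (rule posfun_null[OF entries_in_mscale[OF S C]])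
      (use pos in \<open>simp add: qform_mscale op_mat_pos_qform nonneg_real_def\<close>)
  ultimately show "nonneg_real (\<Sum>i<n. \<Sum>j<n. map_of_functional n g (C i j) $$ (i, j))"
    using mtrace_map_of_functional[OF C] by (simp add: mtrace_def nonneg_real_def)
qed

lemma map_of_functional_eq:
  assumes lin: "mat_linear S n \<phi>" and eq: "\<And>C. C \<in> entries_in S \<Longrightarrow> g C = Re (mtrace n \<phi> C)" and a: "a \<in> S"
  shows "map_of_functional n g a = \<phi> a"
proof (rule eq_matI)
  have c: "\<phi> a \<in> carrier_mat n n" using mat_linearD(1)[OF lin a] .
  fix i j assume "i < dim_row (\<phi> a)" "j < dim_col (\<phi> a)"
  then have ij: "i < n" "j < n" using c by auto
  have ia: "op_scale \<i> a \<in> S" using a op_systemD(3)[OF S] by blast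
  note e = entries_in_eunit[OF S]
  show "map_of_functional n g a $$ (i, j) = \<phi> a $$ (i, j)"
    using ij eq[OF e[OF a]] eq[OF e[OF ia]] mtrace_eunit[OF S lin ij] mat_linear_entry_scale[OF lin a ij, of \<i>]
    by (simp add: map_of_functional_def complex_eq_iff)
qed (use mat_linearD(1)[OF lin a] in \<open>auto simp: map_of_functional_def\<close>)

end

text \<open>Arveson's extension theorem for matrix-valued maps: pass to the functional, extend it,
  pass back. Only existence is asked, so 0 serves as the distinguished vector.\<close>

theorem cp_map_extension:
  assumes S: "op_system S" and A: "op_system A" and SA: "S \<subseteq> A" and cp: "cp_map S n \<phi>"
  obtains \<Phi> where "cp_map A n \<Phi>" "\<And>a. a \<in> S \<Longrightarrow> \<Phi> a = \<phi> a"
proof -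
  interpret ordered_cone rscale "entries_in A" "accretive n A" "entries_in S" ident_opmat
    by (rule ordered_cone_opmat[OF S A SA])
  define f where "f C = Re (mtrace n \<phi> C)" for C
  have f: "posfun rscale (entries_in S) (accretive n S) f"
    unfolding f_def by (rule posfun_of_cp_map[OF S cp])
  have zero: "0 \<in> entries_in A" using op_system_zero[OF A] by (simp add: entries_in_def)
  obtain F where F: "posfun rscale (entries_in A) (accretive n A) F" "\<And>x. x \<in> entries_in S \<Longrightarrow> F x = f x"
  proof (rule extremal_extension[of f 0])
    show "0 \<le> f x" if "x \<in> entries_in S" "x \<in> accretive n A" for x
      using that posfun_nonneg[OF S f] by (simp add: accretive_def)
  qed (use posfun_add[OF S f] posfun_scale[OF S f] zero in blast)+
  show ?thesis
  proof (rule that)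
    show "cp_map A n (map_of_functional n F)" by (rule map_of_functional_cp[OF A F(1)])
    show "map_of_functional n F a = \<phi> a" if "a \<in> S" for a
      by (rule map_of_functional_eq[OF S posfun_restrict[OF F(1) SA] cp_map_mat_linear[OF cp] _ that])
        (simp add: F(2) f_def)
  qed
qed

section \<open>Semi-inner products from completely positive maps\<close>

text \<open>Null vectors are kept instead of divided out: being zero in the quotient is expressed as
  Re (B x x) = 0, and \<open>B_null\<close> says that such vectors pair to zero with
  everything.\<close>

locale semi_inner =
  fixes X :: "'x::ab_group_add set" and sc :: "complex \<Rightarrow> 'x \<Rightarrow> 'x" and B :: "'x \<Rightarrow> 'x \<Rightarrow> complex"
  assumes X_zero: "0 \<in> X" and X_add: "x \<in> X \<Longrightarrow> y \<in> X \<Longrightarrow> x + y \<in> X" and X_sc: "x \<in> X \<Longrightarrow> sc c x \<in> X"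
    and sc_minus_one: "sc (- 1) x = - x" and sc_zero: "sc 0 x = 0"
    and B_add: "x \<in> X \<Longrightarrow> y \<in> X \<Longrightarrow> z \<in> X \<Longrightarrow> B x (y + z) = B x y + B x z"
    and B_sc: "x \<in> X \<Longrightarrow> y \<in> X \<Longrightarrow> B x (sc c y) = c * B x y"
    and B_conj: "x \<in> X \<Longrightarrow> y \<in> X \<Longrightarrow> B y x = cnj (B x y)"
    and B_nonneg: "x \<in> X \<Longrightarrow> 0 \<le> Re (B x x)"
begin

lemma X_minus: "x \<in> X \<Longrightarrow> - x \<in> X"
  using X_sc[of x "- 1"] by (simp add: sc_minus_one)

lemma X_diff: "x \<in> X \<Longrightarrow> y \<in> X \<Longrightarrow> x - y \<in> X"
  using X_add[of x "- y"] X_minus by simp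

lemma X_sum: "(\<And>i. i \<in> I \<Longrightarrow> f i \<in> X) \<Longrightarrow> sum f I \<in> X"
  by (induction I rule: infinite_finite_induct) (auto simp: X_zero X_add)

lemma B_zero_right: "x \<in> X \<Longrightarrow> B x 0 = 0"
  using B_sc[of x 0 0] X_zero by (simp add: sc_zero)

lemma B_minus_right: "x \<in> X \<Longrightarrow> y \<in> X \<Longrightarrow> B x (- y) = - B x y"
  using B_sc[of x y "- 1"] by (simp add: sc_minus_one)

lemma B_diff_right: "x \<in> X \<Longrightarrow> y \<in> X \<Longrightarrow> z \<in> X \<Longrightarrow> B x (y - z) = B x y - B x z"
  using B_add[of x y "- z"] B_minus_right X_minus by simp

lemma B_add_left: "x \<in> X \<Longrightarrow> y \<in> X \<Longrightarrow> z \<in> X \<Longrightarrow> B (x + y) z = B x z + B y z"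
  using B_conj[of z "x + y"] B_conj[of z x] B_conj[of z y] B_add[of z x y] X_add by simp

lemma B_diff_left: "x \<in> X \<Longrightarrow> y \<in> X \<Longrightarrow> z \<in> X \<Longrightarrow> B (x - y) z = B x z - B y z"
  using B_conj[of z "x - y"] B_conj[of z x] B_conj[of z y] B_diff_right[of z x y] X_diff by simp

lemma B_sc_left: "x \<in> X \<Longrightarrow> y \<in> X \<Longrightarrow> B (sc c x) y = cnj c * B x y"
  using B_conj[of y "sc c x"] B_conj[of y x] B_sc[of y x c] X_sc by simp

lemma B_zero_left: "x \<in> X \<Longrightarrow> B 0 x = 0"
  using B_conj[of x 0] X_zero B_zero_right by simp

lemma B_sum_right: "x \<in> X \<Longrightarrow> (\<And>i. i \<in> I \<Longrightarrow> f i \<in> X) \<Longrightarrow> B x (sum f I) = (\<Sum>i\<in>I. B x (f i))"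
  by (induction I rule: infinite_finite_induct) (auto simp: B_zero_right B_add X_sum)

lemma B_sum_left: "x \<in> X \<Longrightarrow> (\<And>i. i \<in> I \<Longrightarrow> f i \<in> X) \<Longrightarrow> B (sum f I) x = (\<Sum>i\<in>I. B (f i) x)"
  by (induction I rule: infinite_finite_induct) (auto simp: B_zero_left B_add_left X_sum)

lemma B_self_real: "x \<in> X \<Longrightarrow> B x x = complex_of_real (Re (B x x))"
  using B_conj[of x x] by (simp add: complex_eq_iff)

lemma B_Cauchy_Schwarz:
  assumes "x \<in> X" "y \<in> X"
  shows "(cmod (B x y))\<^sup>2 \<le> Re (B x x) * Re (B y y)"
proof (rule quadratic_nonneg_imp_discrim)
  fix c
  have "B (x + sc c y) (x + sc c y) = B x x + (c * B x y + cnj (c * B x y)) + cnj c * c * B y y"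
    using assms X_add X_sc B_conj[of x y] by (simp add: B_add B_add_left B_sc B_sc_left algebra_simps)
  also have "cnj c * c * B y y = complex_of_real ((cmod c)\<^sup>2 * Re (B y y))"
    using B_self_real[OF assms(2)] by (metis complex_norm_square mult.commute of_real_mult)
  finally have "Re (B (x + sc c y) (x + sc c y)) = Re (B x x) + 2 * Re (c * B x y) + (cmod c)\<^sup>2 * Re (B y y)"
    by simp
  then show "0 \<le> Re (B x x) + 2 * Re (c * B x y) + (cmod c)\<^sup>2 * Re (B y y)"
    using B_nonneg[OF X_add[OF assms(1) X_sc[OF assms(2)]]] by metis
qed

lemma B_null: "x \<in> X \<Longrightarrow> y \<in> X \<Longrightarrow> Re (B y y) = 0 \<Longrightarrow> B x y = 0"
  using B_Cauchy_Schwarz[of x y] by simp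

end

text \<open>The Stinespring space of \<open>\<phi>\<close>: \<open>k\<close>-tuples \<open>x\<close> over the algebra represent \<open>\<Sum> x\<^sub>i \<otimes> e\<^sub>i\<close>.\<close>

definition tuples :: "('h::chilbert \<Rightarrow> 'h) \<Rightarrow> (nat \<Rightarrow> 'h \<Rightarrow> 'h) set" where
  "tuples T = {x. \<forall>i. x i \<in> cstar T}"

definition tscale :: "complex \<Rightarrow> (nat \<Rightarrow> 'h::chilbert \<Rightarrow> 'h) \<Rightarrow> (nat \<Rightarrow> 'h \<Rightarrow> 'h)" where
  "tscale c x = (\<lambda>i. op_scale c (x i))"

definition stine :: "nat \<Rightarrow> (('h::chilbert \<Rightarrow> 'h) \<Rightarrow> complex mat) \<Rightarrow> (nat \<Rightarrow> 'h \<Rightarrow> 'h) \<Rightarrow> (nat \<Rightarrow> 'h \<Rightarrow> 'h) \<Rightarrow> complex" where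
  "stine k \<phi> x y = mtrace k \<phi> (\<lambda>i j. adj (x i) \<circ> y j)"

definition tunit :: "nat \<Rightarrow> ('h::chilbert \<Rightarrow> 'h) \<Rightarrow> (nat \<Rightarrow> 'h \<Rightarrow> 'h)" where
  "tunit i a = (\<lambda>j. if j = i then a else 0)"

lemma adj_zero [simp]: "adj 0 = 0"
  by (rule adj_unique) simp

lemma tunit_in_tuples: "bounded_op T \<Longrightarrow> a \<in> cstar T \<Longrightarrow> tunit i a \<in> tuples T"
  using op_system_zero[OF op_system_cstar] by (auto simp: tuples_def tunit_def)

lemma adj_comp_entries: "x \<in> tuples T \<Longrightarrow> y \<in> tuples T \<Longrightarrow> (\<lambda>i j. adj (x i) \<circ> y j) \<in> entries_in (cstar T)"
  by (simp add: tuples_def entries_in_def cstar_mult cstar_adj)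

lemma op_mat_pos_gram:
  assumes "\<And>i. bounded_op (x i)"
  shows "op_mat_pos n (\<lambda>i j. adj (x i) \<circ> x j)"
  unfolding op_mat_pos_def
proof
  fix v
  have "(\<Sum>i<n. \<Sum>j<n. cinner (v i) ((adj (x i) \<circ> x j) (v j))) = cinner (\<Sum>i<n. x i (v i)) (\<Sum>j<n. x j (v j))"
    by (simp add: cinner_sum_left cinner_sum_right cinner_adj[OF assms]) (rule sum.swap)
  then show "nonneg_real (\<Sum>i<n. \<Sum>j<n. cinner (v i) ((adj (x i) \<circ> x j) (v j)))"
    by (simp add: cinner_self nonneg_real_def)
qed

lemma semi_inner_stine:
  assumes T: "bounded_op T" and cp: "cp_map (cstar T) k \<phi>"
  shows "semi_inner (tuples T) tscale (stine k \<phi>)"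
proof
  note S = op_system_cstar[OF T]
  note lin = cp_map_mat_linear[OF cp]
  have b: "bounded_op (x i)" if "x \<in> tuples T" for x i
    using that bounded_op_cstar[OF T] by (simp add: tuples_def)
  show "0 \<in> tuples T" using op_system_zero[OF S] by (simp add: tuples_def)
  show "x + y \<in> tuples T" if "x \<in> tuples T" "y \<in> tuples T" for x y
    using that op_systemD(2)[OF S] by (simp add: tuples_def)
  show "tscale c x \<in> tuples T" if "x \<in> tuples T" for x c
    using that by (simp add: tuples_def tscale_def cstar_scale)
  show "tscale (- 1) x = - x" for x :: "nat \<Rightarrow> 'a \<Rightarrow> 'a" by (simp add: fun_eq_iff tscale_def op_scale_def scaleC_minus_left scaleC_one)
  show "tscale 0 x = 0" for x :: "nat \<Rightarrow> 'a \<Rightarrow> 'a" by (simp add: fun_eq_iff tscale_def op_scale_def)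
  show "stine k \<phi> x (y + z) = stine k \<phi> x y + stine k \<phi> x z" if "x \<in> tuples T" "y \<in> tuples T" "z \<in> tuples T" for x y z
  proof -
    have "(\<lambda>i j. adj (x i) \<circ> (y + z) j) = (\<lambda>i j. adj (x i) \<circ> y j) + (\<lambda>i j. adj (x i) \<circ> z j)"
      by (simp add: fun_eq_iff bounded_op_add[OF bounded_op_adj[OF b[OF that(1)]]])
    then show ?thesis unfolding stine_def
      using mtrace_add[OF lin adj_comp_entries[OF that(1,2)] adj_comp_entries[OF that(1,3)]] by (simp only:)
  qed
  show "stine k \<phi> x (tscale c y) = c * stine k \<phi> x y" if "x \<in> tuples T" "y \<in> tuples T" for x y c
  proof -
    have "(\<lambda>i j. adj (x i) \<circ> tscale c y j) = mscale c (\<lambda>i j. adj (x i) \<circ> y j)"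
      by (simp add: fun_eq_iff mscale_def tscale_def op_scale_def bounded_op_scaleC[OF bounded_op_adj[OF b[OF that(1)]]])
    then show ?thesis unfolding stine_def
      using mtrace_mscale[OF lin adj_comp_entries[OF that(1,2)]] by (simp only:)
  qed
  show "stine k \<phi> y x = cnj (stine k \<phi> x y)" if "x \<in> tuples T" "y \<in> tuples T" for x y
  proof -
    have "adj (y j) \<circ> x i = adj (adj (x i) \<circ> y j)" for i j
      using b that by (simp add: adj_comp bounded_op_adj adj_adj)
    then have "stine k \<phi> y x = (\<Sum>j<k. \<Sum>i<k. cnj (\<phi> (adj (x i) \<circ> y j) $$ (i, j)))"
      unfolding stine_def mtrace_def using adj_comp_entries[OF that]
      by (intro sum.cong refl) (simp add: cp_map_adj[OF S cp] entries_in_def)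
    also have "\<dots> = (\<Sum>i<k. \<Sum>j<k. cnj (\<phi> (adj (x i) \<circ> y j) $$ (i, j)))" by (rule sum.swap)
    finally show ?thesis by (simp add: stine_def mtrace_def)
  qed
  show "0 \<le> Re (stine k \<phi> x x)" if "x \<in> tuples T" for x
  proof -
    have "nonneg_real (stine k \<phi> x x)"
      unfolding stine_def mtrace_def
      by (rule cp_map_trace_nonneg[OF cp _ op_mat_pos_gram[OF b[OF that]]])
        (use adj_comp_entries[OF that that] in \<open>simp add: entries_in_def\<close>)
    then show ?thesis by (simp add: nonneg_real_def)
  qed
qed

lemma mat_rep_mult_entry:
  assumes rep: "mat_rep T k \<rho>" and "a \<in> cstar T" "b \<in> cstar T" "i < k" "j < k"
  shows "\<rho> (a \<circ> b) $$ (i, j) = (\<Sum>l<k. \<rho> a $$ (i, l) * \<rho> b $$ (l, j))"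
  using assms(4,5) mat_repD(1)[OF rep assms(2)] mat_repD(1)[OF rep assms(3)] mat_repD(4)[OF rep assms(2,3)]
  by (simp add: scalar_prod_def lessThan_atLeast0)

lemma mat_rep_adj_entry:
  assumes rep: "mat_rep T k \<rho>" and "a \<in> cstar T" "i < k" "j < k"
  shows "\<rho> (adj a) $$ (i, j) = cnj (\<rho> a $$ (j, i))"
  using assms mat_repD(1)[OF rep] mat_repD(6)[OF rep assms(2)] by (simp add: mat_adjoint_index[of _ k k])

text \<open>For a representation the Stinespring space is C^k itself: the tuple x stands for the
  vector \<Sum> \<rho>(x i) e_i.\<close>

lemma stine_mat_rep:
  assumes rep: "mat_rep T k \<rho>" and x: "x \<in> tuples T" "y \<in> tuples T"
  shows "stine k \<rho> x y = (\<Sum>l<k. cnj (\<Sum>i<k. \<rho> (x i) $$ (l, i)) * (\<Sum>j<k. \<rho> (y j) $$ (l, j)))"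
proof -
  have "stine k \<rho> x y = (\<Sum>i<k. \<Sum>j<k. \<Sum>l<k. cnj (\<rho> (x i) $$ (l, i)) * \<rho> (y j) $$ (l, j))"
    unfolding stine_def mtrace_def
    by (intro sum.cong refl, subst mat_rep_mult_entry[OF rep])
      (use x in \<open>auto simp: tuples_def cstar_adj mat_rep_adj_entry[OF rep] intro!: sum.cong\<close>)
  also have "\<dots> = (\<Sum>i<k. \<Sum>l<k. \<Sum>j<k. cnj (\<rho> (x i) $$ (l, i)) * \<rho> (y j) $$ (l, j))"
    by (rule sum.cong[OF refl], rule sum.swap)
  also have "\<dots> = (\<Sum>l<k. \<Sum>i<k. \<Sum>j<k. cnj (\<rho> (x i) $$ (l, i)) * \<rho> (y j) $$ (l, j))"
    by (rule sum.swap)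
  also have "\<dots> = (\<Sum>l<k. cnj (\<Sum>i<k. \<rho> (x i) $$ (l, i)) * (\<Sum>j<k. \<rho> (y j) $$ (l, j)))"
    by (simp add: sum_product)
  finally show ?thesis .
qed

section \<open>Irreducible representations are pure\<close>

text \<open>The tuple for b \<otimes> e_q - \<Sum> \<rho>(b)_jq (1 \<otimes> e_j) is null for
  \<rho>, hence null for \<psi> below \<rho>. Pairing it with 1 \<otimes> e_p is the entry (p, q) of
  \<psi>(b) = \<psi>(1) \<rho>(b).\<close>

lemma cp_le_mat_rep_factor:
  assumes T: "bounded_op T" and rep: "mat_rep T k \<rho>"
    and cp: "cp_map (cstar T) k \<psi>" and cp': "cp_map (cstar T) k (\<lambda>a. \<rho> a - \<psi> a)"
    and b: "b \<in> cstar T" and pq: "p < k" "q < k"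
  shows "\<psi> b $$ (p, q) = (\<Sum>j<k. \<psi> id $$ (p, j) * \<rho> b $$ (j, q))"
proof -
  note S = op_system_cstar[OF T]
  note lin = cp_map_mat_linear[OF cp]
  note rlin = mat_rep_mat_linear[OF rep]
  interpret semi_inner "tuples T" tscale "stine k \<psi>" by (rule semi_inner_stine[OF T cp])
  have idA: "id \<in> cstar T" by (rule cstar_id)
  define x where "x = (\<lambda>j. (if j = q then b else 0) - op_scale (\<rho> b $$ (j, q)) id)"
  define e where "e = tunit p (id :: 'a \<Rightarrow> 'a)"
  have x: "x \<in> tuples T"
    using op_system_diff[OF S] op_system_zero[OF S] b idA by (auto simp: x_def tuples_def cstar_scale)
  have e: "e \<in> tuples T" unfolding e_def by (rule tunit_in_tuples[OF T idA])
  have ent: "\<phi> (x j) $$ (l, r) = (if j = q then \<phi> b $$ (l, r) else 0) - \<rho> b $$ (j, q) * \<phi> id $$ (l, r)"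
    if "mat_linear (cstar T) k \<phi>" "l < k" "r < k" for \<phi> j l r
    unfolding x_def using that b idA op_system_zero[OF S]
    by (auto simp: mat_linear_entry_diff[OF S that(1)] cstar_scale mat_linear_entry_scale[OF that(1)] mat_linear_entry_zero[OF S that(1)])
  have delta: "(\<Sum>j<k. (if j = q then f j else 0)) = f q" for f :: "nat \<Rightarrow> complex"
    by (simp only: sum.delta[OF finite_lessThan] lessThan_iff pq if_True)
  have "(\<Sum>j<k. \<rho> (x j) $$ (l, j)) = 0" if "l < k" for l
  proof -
    have "(\<Sum>j<k. \<rho> (x j) $$ (l, j)) = (\<Sum>j<k. if j = q then \<rho> b $$ (l, j) else 0) - (\<Sum>j<k. if j = l then \<rho> b $$ (j, q) else 0)"
      unfolding sum_subtractf[symmetric]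
      by (intro sum.cong refl) (use that in \<open>auto simp: ent[OF rlin] mat_repD(2)[OF rep]\<close>)
    also have "\<dots> = 0"
      using that pq by (simp only: sum.delta[OF finite_lessThan] lessThan_iff if_True) simp
    finally show ?thesis .
  qed
  then have "stine k \<rho> x x = 0" using stine_mat_rep[OF rep x x] by simp
  moreover have "stine k (\<lambda>a. \<rho> a - \<psi> a) x x = stine k \<rho> x x - stine k \<psi> x x"
    unfolding stine_def mtrace_def sum_subtractf[symmetric]
  proof (intro sum.cong refl)
    fix i j assume ij: "i \<in> {..<k}" "j \<in> {..<k}"
    have "adj (x i) \<circ> x j \<in> cstar T" using adj_comp_entries[OF x x] by (simp add: entries_in_def)
    from mat_linearD(1)[OF lin this] ij
    show "(\<rho> (adj (x i) \<circ> x j) - \<psi> (adj (x i) \<circ> x j)) $$ (i, j) = \<rho> (adj (x i) \<circ> x j) $$ (i, j) - \<psi> (adj (x i) \<circ> x j) $$ (i, j)"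
      by simp
  qed
  moreover have "0 \<le> Re (stine k (\<lambda>a. \<rho> a - \<psi> a) x x)"
    using semi_inner.B_nonneg[OF semi_inner_stine[OF T cp'] x] .
  ultimately have "Re (stine k \<psi> x x) = 0" using B_nonneg[OF x] by simp
  then have "stine k \<psi> e x = 0" using B_null[OF e x] by blast
  moreover have "stine k \<psi> e x = (\<Sum>j<k. \<psi> (x j) $$ (p, j))"
  proof -
    have "stine k \<psi> e x = (\<Sum>i<k. if i = p then (\<Sum>j<k. \<psi> (x j) $$ (i, j)) else 0)"
      unfolding stine_def mtrace_def
    proof (intro sum.cong refl)
      fix i assume i: "i \<in> {..<k}"
      show "(\<Sum>j<k. \<psi> (adj (e i) \<circ> x j) $$ (i, j)) = (if i = p then (\<Sum>j<k. \<psi> (x j) $$ (i, j)) else 0)"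
      proof (cases "i = p")
        case True
        then show ?thesis by (simp add: e_def tunit_def)
      next
        case False
        have "(adj (e i) \<circ> x j) = 0" for j using False by (auto simp: e_def tunit_def)
        then show ?thesis using False i mat_linear_entry_zero[OF S lin] by (simp only: if_False) simp
      qed
    qed
    also have "\<dots> = (\<Sum>j<k. \<psi> (x j) $$ (p, j))"
      by (simp only: sum.delta[OF finite_lessThan] lessThan_iff pq if_True)
    finally show ?thesis .
  qed
  moreover have "(\<Sum>j<k. \<psi> (x j) $$ (p, j)) = (\<Sum>j<k. if j = q then \<psi> b $$ (p, j) else 0) - (\<Sum>j<k. \<psi> id $$ (p, j) * \<rho> b $$ (j, q))"
    unfolding sum_subtractf[symmetric]
    by (intro sum.cong refl) (use pq in \<open>auto simp: ent[OF lin]\<close>)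
  ultimately show ?thesis using delta[of "\<lambda>j. \<psi> b $$ (p, j)"] by simp
qed

theorem cp_le_irreducible_mat_rep:
  assumes T: "bounded_op T" and irr: "irreducible_mat_rep T k \<rho>"
    and cp: "cp_map (cstar T) k \<psi>" and cp': "cp_map (cstar T) k (\<lambda>a. \<rho> a - \<psi> a)"
  shows "\<exists>t::real. 0 \<le> t \<and> t \<le> 1 \<and> (\<forall>a\<in>cstar T. \<psi> a = complex_of_real t \<cdot>\<^sub>m \<rho> a)"
proof -
  have rep: "mat_rep T k \<rho>" and k: "1 \<le> k" using irr by (auto simp: irreducible_mat_rep_def)
  note S = op_system_cstar[OF T]
  note lin = cp_map_mat_linear[OF cp]
  note R = mat_repD(1)[OF rep]
  have idA: "id \<in> cstar T" by (rule cstar_id)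
  define P where "P = \<psi> id"
  have Pc: "P \<in> carrier_mat k k" unfolding P_def by (rule mat_linearD(1)[OF lin idA])
  have fac: "\<psi> b = P * \<rho> b" if b: "b \<in> cstar T" for b
  proof (rule eq_matI)
    fix i j assume "i < dim_row (P * \<rho> b)" "j < dim_col (P * \<rho> b)"
    then have ij: "i < k" "j < k" using Pc R[OF b] by auto
    then show "\<psi> b $$ (i, j) = (P * \<rho> b) $$ (i, j)"
      using cp_le_mat_rep_factor[OF T rep cp cp' b ij] Pc R[OF b]
      by (auto simp: P_def scalar_prod_def lessThan_atLeast0 dest!: carrier_matD intro!: sum.cong)
  qed (use mat_linearD(1)[OF lin b] Pc R[OF b] in auto)
  \<comment> \<open>Taking adjoints in the factorisation of \<psi> (adj b) puts P on the other
    side.\<close>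
  have comm: "P * \<rho> b = \<rho> b * P" if b: "b \<in> cstar T" for b
  proof (rule eq_matI)
    fix i j assume "i < dim_row (\<rho> b * P)" "j < dim_col (\<rho> b * P)"
    then have ij: "i < k" "j < k" using Pc R[OF b] by auto
    have ab: "adj b \<in> cstar T" using b by (rule cstar_adj)
    have Ph: "P $$ (l, r) = cnj (P $$ (r, l))" if "l < k" "r < k" for l r
      using cp_map_adj[OF S cp idA that(2,1)] by (simp add: P_def)
    have bb: "adj (adj b) = b" using adj_adj bounded_op_cstar[OF T b] by blast
    have "(P * \<rho> b) $$ (i, j) = \<psi> (adj (adj b)) $$ (i, j)" using fac[OF b] bb by simp
    also have "\<dots> = cnj (\<psi> (adj b) $$ (j, i))" by (rule cp_map_adj[OF S cp ab ij(2,1)])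
    also have "\<dots> = (\<Sum>l<k. cnj (P $$ (j, l)) * cnj (\<rho> (adj b) $$ (l, i)))"
      using cp_le_mat_rep_factor[OF T rep cp cp' ab ij(2,1)] by (simp add: P_def)
    also have "\<dots> = (\<Sum>l<k. \<rho> b $$ (i, l) * P $$ (l, j))"
      by (intro sum.cong refl) (use ij Ph[of _ j] in \<open>auto simp: mat_rep_adj_entry[OF rep b]\<close>)
    also have "\<dots> = (\<rho> b * P) $$ (i, j)"
      using ij Pc R[OF b] by (auto simp: scalar_prod_def lessThan_atLeast0 dest!: carrier_matD intro!: sum.cong)
    finally show "(P * \<rho> b) $$ (i, j) = (\<rho> b * P) $$ (i, j)" .
  qed (use Pc R[OF b] in auto)
  obtain t where "t \<in> spectrum P" using spectrum_non_empty[OF Pc] k by auto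
  then obtain v0 where v0: "v0 \<in> carrier_vec k" "v0 \<noteq> 0\<^sub>v k" "P *\<^sub>v v0 = t \<cdot>\<^sub>v v0"
    using Pc unfolding spectrum_def eigenvalue_def eigenvector_def by auto
  \<comment> \<open>Schur's lemma: the eigenspace is invariant because P commutes with the
    representation, and nonzero because it contains v0.\<close>
  define V where "V = {v \<in> carrier_vec k. P *\<^sub>v v = t \<cdot>\<^sub>v v}"
  have "V = {0\<^sub>v k} \<or> V = carrier_vec k"
  proof -
    have "V \<subseteq> carrier_vec k" by (auto simp: V_def)
    moreover have "0\<^sub>v k \<in> V" using Pc by (auto simp: V_def)
    moreover have "\<forall>v\<in>V. \<forall>w\<in>V. v + w \<in> V"
      using Pc by (auto simp: V_def mult_add_distrib_mat_vec smult_add_distrib_vec)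
    moreover have "\<forall>v\<in>V. \<forall>c. c \<cdot>\<^sub>v v \<in> V"
      using Pc by (auto simp: V_def mult_mat_vec smult_smult_assoc mult.commute)
    moreover have "\<forall>a\<in>cstar T. \<forall>v\<in>V. \<rho> a *\<^sub>v v \<in> V"
    proof (intro ballI)
      fix a v assume a: "a \<in> cstar T" and v: "v \<in> V"
      have vc: "v \<in> carrier_vec k" using v by (simp add: V_def)
      have "P *\<^sub>v (\<rho> a *\<^sub>v v) = (P * \<rho> a) *\<^sub>v v" using assoc_mult_mat_vec[OF Pc R[OF a] vc] by simp
      also have "\<dots> = \<rho> a *\<^sub>v (P *\<^sub>v v)" unfolding comm[OF a] by (rule assoc_mult_mat_vec[OF R[OF a] Pc vc])
      also have "\<dots> = t \<cdot>\<^sub>v (\<rho> a *\<^sub>v v)" using v R[OF a] by (simp add: V_def mult_mat_vec)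
      finally show "\<rho> a *\<^sub>v v \<in> V" using R[OF a] vc by (simp add: V_def)
    qed
    ultimately show ?thesis using irr unfolding irreducible_mat_rep_def by blast
  qed
  moreover have "v0 \<in> V" using v0 by (simp add: V_def)
  ultimately have V: "V = carrier_vec k" using v0 by blast
  have Pt: "P $$ (i, j) = (if i = j then t else 0)" if "i < k" "j < k" for i j
  proof -
    have "unit_vec k j \<in> V" using V by simp
    then have "(P *\<^sub>v unit_vec k j) $ i = (t \<cdot>\<^sub>v unit_vec k j) $ i" by (simp add: V_def)
    then show ?thesis using that Pc by (auto simp: scalar_prod_right_unit)
  qed
  \<comment> \<open>The dilation inequality for the identity with s = 1 and t = 0. Applied to \<psi>
    and to \<rho> - \<psi> it confines the eigenvalue to the unit interval.\<close>
  have t0: "nonneg_real (\<phi> id $$ (0, 0))" if "cp_map (cstar T) k \<phi>" for \<phi>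
    using cp_map_dilation_entry[OF S that idA op_bound_id, of 0 0 1 0] k by simp
  have "nonneg_real t" using t0[OF cp] Pt[of 0 0] k by (simp add: P_def)
  moreover have "nonneg_real (1 - t)"
    using t0[OF cp'] Pt[of 0 0] Pc k mat_repD(2)[OF rep] by (simp add: P_def)
  ultimately have tr: "t = complex_of_real (Re t)" "0 \<le> Re t" "Re t \<le> 1"
    by (auto simp: nonneg_real_def complex_eq_iff)
  have "\<psi> a = complex_of_real (Re t) \<cdot>\<^sub>m \<rho> a" if a: "a \<in> cstar T" for a
  proof (rule eq_matI)
    fix i j assume "i < dim_row (complex_of_real (Re t) \<cdot>\<^sub>m \<rho> a)" "j < dim_col (complex_of_real (Re t) \<cdot>\<^sub>m \<rho> a)"
    then have ij: "i < k" "j < k" using R[OF a] by auto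
    have "\<psi> a $$ (i, j) = (\<Sum>l<k. P $$ (i, l) * \<rho> a $$ (l, j))"
      using cp_le_mat_rep_factor[OF T rep cp cp' a ij] by (simp add: P_def)
    also have "\<dots> = (\<Sum>l<k. if l = i then t * \<rho> a $$ (l, j) else 0)"
      by (intro sum.cong refl) (use ij in \<open>auto simp: Pt\<close>)
    also have "\<dots> = t * \<rho> a $$ (i, j)" using ij by (simp only: sum.delta[OF finite_lessThan] lessThan_iff if_True)
    finally show "\<psi> a $$ (i, j) = (complex_of_real (Re t) \<cdot>\<^sub>m \<rho> a) $$ (i, j)"
      using ij R[OF a] tr(1) by simp
  qed (use mat_linearD(1)[OF lin a] R[OF a] in auto)
  then show ?thesis using tr by blast
qed

lemma nonneg_real_sum: "(\<And>i. i \<in> I \<Longrightarrow> nonneg_real (f i)) \<Longrightarrow> nonneg_real (sum f I)"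
  by (induction I rule: infinite_finite_induct) (auto simp: nonneg_real_def)

text \<open>The index set is arbitrary: a singleton gives congruence, the booleans give binary sums,
  and {..<m} - {j} gives the remainder of a matrix convex combination.\<close>

lemma cp_map_sumI:
  assumes lin: "mat_linear S n \<phi>" and cp: "\<And>p. p \<in> I \<Longrightarrow> cp_map S n (\<psi> p)"
    and ent: "\<And>a i j. a \<in> S \<Longrightarrow> i < n \<Longrightarrow> j < n \<Longrightarrow> \<phi> a $$ (i, j) = (\<Sum>p\<in>I. \<psi> p a $$ (i, j))"
  shows "cp_map S n \<phi>"
  unfolding cp_map_iff
proof (intro conjI allI impI)
  fix m A and v :: "nat \<Rightarrow> nat \<Rightarrow> complex"
  assume A: "\<forall>i<m. \<forall>j<m. A i j \<in> S" "op_mat_pos m A"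
  have "(\<Sum>i<m. \<Sum>j<m. \<Sum>l<n. \<Sum>r<n. cnj (v i l) * \<phi> (A i j) $$ (l, r) * v j r)
      = (\<Sum>i<m. \<Sum>j<m. \<Sum>l<n. \<Sum>r<n. \<Sum>p\<in>I. cnj (v i l) * \<psi> p (A i j) $$ (l, r) * v j r)"
    by (intro sum.cong refl) (use A in \<open>auto simp: ent sum_distrib_left sum_distrib_right\<close>)
  also have "\<dots> = (\<Sum>i<m. \<Sum>j<m. \<Sum>l<n. \<Sum>p\<in>I. \<Sum>r<n. cnj (v i l) * \<psi> p (A i j) $$ (l, r) * v j r)"
    by (rule sum.cong[OF refl], rule sum.cong[OF refl], rule sum.cong[OF refl], rule sum.swap)
  also have "\<dots> = (\<Sum>i<m. \<Sum>j<m. \<Sum>p\<in>I. \<Sum>l<n. \<Sum>r<n. cnj (v i l) * \<psi> p (A i j) $$ (l, r) * v j r)"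
    by (rule sum.cong[OF refl], rule sum.cong[OF refl], rule sum.swap)
  also have "\<dots> = (\<Sum>i<m. \<Sum>p\<in>I. \<Sum>j<m. \<Sum>l<n. \<Sum>r<n. cnj (v i l) * \<psi> p (A i j) $$ (l, r) * v j r)"
    by (rule sum.cong[OF refl], rule sum.swap)
  also have "\<dots> = (\<Sum>p\<in>I. \<Sum>i<m. \<Sum>j<m. \<Sum>l<n. \<Sum>r<n. cnj (v i l) * \<psi> p (A i j) $$ (l, r) * v j r)"
    by (rule sum.swap)
  finally have eq: "(\<Sum>i<m. \<Sum>j<m. \<Sum>l<n. \<Sum>r<n. cnj (v i l) * \<phi> (A i j) $$ (l, r) * v j r)
      = (\<Sum>p\<in>I. \<Sum>i<m. \<Sum>j<m. \<Sum>l<n. \<Sum>r<n. cnj (v i l) * \<psi> p (A i j) $$ (l, r) * v j r)" .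
  show "nonneg_real (\<Sum>i<m. \<Sum>j<m. \<Sum>l<n. \<Sum>r<n. cnj (v i l) * \<phi> (A i j) $$ (l, r) * v j r)"
    unfolding eq by (rule nonneg_real_sum, rule cp_mapD[OF cp]) (use A in auto)
qed (rule lin)

lemma cp_map_cong:
  assumes "cp_map S n \<phi>" "\<And>a. a \<in> S \<Longrightarrow> \<phi> a = \<psi> a"
    "\<And>a b. a \<in> S \<Longrightarrow> b \<in> S \<Longrightarrow> op_add a b \<in> S" "\<And>a c. a \<in> S \<Longrightarrow> op_scale c a \<in> S"
  shows "cp_map S n \<psi>"
proof (rule cp_map_sumI[of _ _ _ "{()}" "\<lambda>_. \<phi>"])
  show "mat_linear S n \<psi>"
    using cp_map_mat_linear[OF assms(1)] assms(2-4) unfolding mat_linear_def by metis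
qed (use assms in auto)

lemma mat_linear_add_maps:
  assumes \<phi>: "mat_linear S n \<phi>" and \<psi>: "mat_linear S n \<psi>"
  shows "mat_linear S n (\<lambda>a. \<phi> a + \<psi> a)"
  unfolding mat_linear_def
proof (intro conjI ballI allI)
  fix a assume a: "a \<in> S"
  note c = mat_linearD(1)[OF \<phi> a] mat_linearD(1)[OF \<psi> a]
  show "\<phi> a + \<psi> a \<in> carrier_mat n n" using c by simp
  show "\<phi> (op_scale c a) + \<psi> (op_scale c a) = c \<cdot>\<^sub>m (\<phi> a + \<psi> a)" for c
    using c mat_linearD(3)[OF \<phi> a] mat_linearD(3)[OF \<psi> a] by (simp add: add_smult_distrib_left_mat)
  show "\<phi> (op_add a b) + \<psi> (op_add a b) = \<phi> a + \<psi> a + (\<phi> b + \<psi> b)" if b: "b \<in> S" for b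
    unfolding op_add_eq_plus mat_linearD(2)[OF \<phi> a b] mat_linearD(2)[OF \<psi> a b]
    using c mat_linearD(1)[OF \<phi> b] mat_linearD(1)[OF \<psi> b] by (intro eq_matI) auto
qed

lemma mat_linear_diff_maps:
  assumes \<phi>: "mat_linear S n \<phi>" and \<psi>: "mat_linear S n \<psi>"
  shows "mat_linear S n (\<lambda>a. \<phi> a - \<psi> a)"
  unfolding mat_linear_def
proof (intro conjI ballI allI)
  fix a assume a: "a \<in> S"
  note c = mat_linearD(1)[OF \<phi> a] mat_linearD(1)[OF \<psi> a]
  show "\<phi> a - \<psi> a \<in> carrier_mat n n" using c(2) by (rule minus_carrier_mat)
  show "\<phi> (op_scale c a) - \<psi> (op_scale c a) = c \<cdot>\<^sub>m (\<phi> a - \<psi> a)" for c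
    using c mat_linearD(3)[OF \<phi> a] mat_linearD(3)[OF \<psi> a] by (intro eq_matI) (auto simp: right_diff_distrib)
  show "\<phi> (op_add a b) - \<psi> (op_add a b) = \<phi> a - \<psi> a + (\<phi> b - \<psi> b)" if b: "b \<in> S" for b
    unfolding op_add_eq_plus mat_linearD(2)[OF \<phi> a b] mat_linearD(2)[OF \<psi> a b]
    using c mat_linearD(1)[OF \<phi> b] mat_linearD(1)[OF \<psi> b] by (intro eq_matI) auto
qed

lemma cp_map_add:
  assumes cp: "cp_map S n \<phi>" "cp_map S n \<psi>"
  shows "cp_map S n (\<lambda>a. \<phi> a + \<psi> a)"
proof (rule cp_map_sumI[of _ _ _ "UNIV :: bool set" "\<lambda>b. if b then \<phi> else \<psi>"])
  show "mat_linear S n (\<lambda>a. \<phi> a + \<psi> a)"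
    by (rule mat_linear_add_maps[OF cp_map_mat_linear[OF cp(1)] cp_map_mat_linear[OF cp(2)]])
  show "(\<phi> a + \<psi> a) $$ (i, j) = (\<Sum>b\<in>UNIV. (if b then \<phi> else \<psi>) a $$ (i, j))"
    if "a \<in> S" "i < n" "j < n" for a i j
    using that mat_linearD(1)[OF cp_map_mat_linear[OF cp(1)] that(1)]
      mat_linearD(1)[OF cp_map_mat_linear[OF cp(2)] that(1)] by (simp add: UNIV_bool)
qed (use cp in auto)

lemma cp_map_restrict: "cp_map A n \<phi> \<Longrightarrow> S \<subseteq> A \<Longrightarrow> cp_map S n \<phi>"
  unfolding cp_map_def by (meson subsetD)

theorem boundary_rep_pure:
  assumes T: "bounded_op T" and bd: "boundary_rep T k \<rho>"
  shows "pure_map (op_sys T) k \<rho>"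
  unfolding pure_map_def
proof (intro conjI allI impI)
  have irr: "irreducible_mat_rep T k \<rho>" using bd by (simp add: boundary_rep_def)
  note A = op_system_cstar[OF T] and S = op_system_op_sys[OF T] and SA = op_sys_subset[of T]
  have rcp: "cp_map (cstar T) k \<rho>" using irreducible_mat_rep_ucp[OF T irr] by (simp add: ucp_map_def)
  have R: "\<rho> a \<in> carrier_mat k k" if "a \<in> cstar T" for a using mat_linearD(1)[OF cp_map_mat_linear[OF rcp] that] .
  show "cp_map (op_sys T) k \<rho>" by (rule cp_map_restrict[OF rcp SA])
  fix \<psi> assume "cp_le (op_sys T) k \<psi> \<rho>"
  then have cp: "cp_map (op_sys T) k \<psi>" "cp_map (op_sys T) k (\<lambda>a. \<rho> a - \<psi> a)" by (auto simp: cp_le_def)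
  obtain \<Psi> where P: "cp_map (cstar T) k \<Psi>" "\<And>a. a \<in> op_sys T \<Longrightarrow> \<Psi> a = \<psi> a"
    using cp_map_extension[OF S A SA cp(1)] by blast
  obtain \<Xi> where X: "cp_map (cstar T) k \<Xi>" "\<And>a. a \<in> op_sys T \<Longrightarrow> \<Xi> a = \<rho> a - \<psi> a"
    using cp_map_extension[OF S A SA cp(2)] by blast
  have Pc: "\<Psi> a \<in> carrier_mat k k" "\<Xi> a \<in> carrier_mat k k" if "a \<in> cstar T" for a
    using mat_linearD(1)[OF cp_map_mat_linear[OF P(1)] that] mat_linearD(1)[OF cp_map_mat_linear[OF X(1)] that] by auto
  have onS: "\<Psi> a + \<Xi> a = \<rho> a" if "a \<in> op_sys T" for a
  proof -
    have "a \<in> cstar T" using that SA by blast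
    then show ?thesis using R[of a] Pc[of a] P(2)[OF that] X(2)[OF that] by (intro eq_matI) auto
  qed
  have "\<Psi> id + \<Xi> id = 1\<^sub>m k"
    using onS[OF op_systemD(1)[OF S]] irr by (simp add: irreducible_mat_rep_def mat_rep_def)
  then have "ucp_map (cstar T) k (\<lambda>a. \<Psi> a + \<Xi> a)" using cp_map_add[OF P(1) X(1)] by (simp add: ucp_map_def)
  then have "\<forall>a\<in>cstar T. \<Psi> a + \<Xi> a = \<rho> a"
    using bd onS unfolding boundary_rep_def by blast
  then have sum: "\<rho> a = \<Psi> a + \<Xi> a" if "a \<in> cstar T" for a using that by simp
  have "\<rho> a - \<Psi> a = \<Xi> a" if "a \<in> cstar T" for a
    unfolding sum[OF that] using Pc[OF that] by (intro eq_matI) auto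
  then have "cp_map (cstar T) k (\<lambda>a. \<rho> a - \<Psi> a)"
    by (intro cp_map_cong[OF X(1)]) (auto intro: cstar_add cstar_scale)
  then obtain t :: real where "0 \<le> t" "t \<le> 1" "\<forall>a\<in>cstar T. \<Psi> a = complex_of_real t \<cdot>\<^sub>m \<rho> a"
    using cp_le_irreducible_mat_rep[OF T irr P(1)] by blast
  then show "\<exists>t::real. 0 \<le> t \<and> t \<le> 1 \<and> (\<forall>a\<in>op_sys T. \<psi> a = complex_of_real t \<cdot>\<^sub>m \<rho> a)"
    using P(2) SA by (metis subsetD)
qed

section \<open>Pure representations are matrix extreme\<close>

lemma msum_index:
  assumes "\<And>l. l < m \<Longrightarrow> f l \<in> carrier_mat k k" "i < k" "j < k"
  shows "msum k f m \<in> carrier_mat k k \<and> msum k f m $$ (i, j) = (\<Sum>l<m. f l $$ (i, j))"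
  using assms(1)
proof (induction m)
  case (Suc m)
  then have "msum k f m \<in> carrier_mat k k \<and> msum k f m $$ (i, j) = (\<Sum>l<m. f l $$ (i, j))" "f m \<in> carrier_mat k k"
    by auto
  then show ?case using assms(2,3) by auto
qed (use assms in auto)

lemma cp_map_compress:
  assumes cp: "cp_map S n \<phi>" and A: "A \<in> carrier_mat n k"
  shows "cp_map S k (\<lambda>a. mat_adjoint A * \<phi> a * A)"
  unfolding cp_map_def
proof (intro conjI ballI allI impI)
  note lin = cp_map_mat_linear[OF cp]
  note Aa = mat_adjoint_carrier[OF A]
  fix a assume a: "a \<in> S"
  note c = mat_linearD(1)[OF lin]
  show "mat_adjoint A * \<phi> a * A \<in> carrier_mat k k" using c[OF a] A Aa by auto
  show "mat_adjoint A * \<phi> (op_add a b) * A = mat_adjoint A * \<phi> a * A + mat_adjoint A * \<phi> b * A" if b: "b \<in> S" for b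
  proof -
    have "mat_adjoint A * (\<phi> a + \<phi> b) * A = (mat_adjoint A * \<phi> a + mat_adjoint A * \<phi> b) * A"
      by (subst mult_add_distrib_mat[OF Aa c[OF a] c[OF b]]) simp
    also have "\<dots> = mat_adjoint A * \<phi> a * A + mat_adjoint A * \<phi> b * A"
      by (rule add_mult_distrib_mat) (use Aa c[OF a] c[OF b] A in auto)
    finally show ?thesis using mat_linearD(2)[OF lin a b] by (simp add: op_add_eq_plus)
  qed
  show "mat_adjoint A * \<phi> (op_scale s a) * A = s \<cdot>\<^sub>m (mat_adjoint A * \<phi> a * A)" for s
  proof -
    have "mat_adjoint A * (s \<cdot>\<^sub>m \<phi> a) * A = (s \<cdot>\<^sub>m (mat_adjoint A * \<phi> a)) * A"
      by (subst mult_smult_distrib[OF Aa c[OF a]]) simp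
    also have "\<dots> = s \<cdot>\<^sub>m (mat_adjoint A * \<phi> a * A)"
      by (rule mult_smult_assoc_mat) (use Aa c[OF a] A in auto)
    finally show ?thesis using mat_linearD(3)[OF lin a] by simp
  qed
next
  note lin = cp_map_mat_linear[OF cp]
  note Aa = mat_adjoint_carrier[OF A]
  note c = mat_linearD(1)[OF lin]
  fix m B assume B: "\<forall>i<m. \<forall>j<m. B i j \<in> S" "op_mat_pos m B"
  show "blk_mat_pos k m (\<lambda>i j. mat_adjoint A * \<phi> (B i j) * A)"
    unfolding blk_mat_pos_def
  proof (intro allI impI)
    fix v :: "nat \<Rightarrow> complex vec" assume v: "\<forall>i<m. v i \<in> carrier_vec k"
    have "blk_mat_pos n m (\<lambda>i j. \<phi> (B i j))" using cp B unfolding cp_map_def by blast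
    then have "nonneg_real (\<Sum>i<m. \<Sum>j<m. vinner (A *\<^sub>v v i) (\<phi> (B i j) *\<^sub>v (A *\<^sub>v v j)))"
      unfolding blk_mat_pos_def using v A by auto
    moreover have "vinner (v i) ((mat_adjoint A * \<phi> (B i j) * A) *\<^sub>v v j) = vinner (A *\<^sub>v v i) (\<phi> (B i j) *\<^sub>v (A *\<^sub>v v j))"
      if "i < m" "j < m" for i j
    proof -
      have Bc: "\<phi> (B i j) \<in> carrier_mat n n" using c B that by blast
      have vc: "v i \<in> carrier_vec k" "v j \<in> carrier_vec k" using v that by auto
      have Av: "A *\<^sub>v v j \<in> carrier_vec n" using A vc by simp
      have "(mat_adjoint A * \<phi> (B i j) * A) *\<^sub>v v j = mat_adjoint A *\<^sub>v (\<phi> (B i j) *\<^sub>v (A *\<^sub>v v j))"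
        using assoc_mult_mat_vec[OF mult_carrier_mat[OF Aa Bc] A vc(2)] assoc_mult_mat_vec[OF Aa Bc Av] by simp
      then show ?thesis using vinner_adjoint[OF A vc(1), of "\<phi> (B i j) *\<^sub>v (A *\<^sub>v v j)"] Bc Av by simp
    qed
    ultimately show "nonneg_real (\<Sum>i<m. \<Sum>j<m. vinner (v i) ((mat_adjoint A * \<phi> (B i j) * A) *\<^sub>v v j))" by simp
  qed
qed

lemma mat_adjoint_mult_index:
  assumes "A \<in> carrier_mat n k" "i < k" "j < k"
  shows "(mat_adjoint A * A) $$ (i, j) = (\<Sum>l<n. cnj (A $$ (l, i)) * A $$ (l, j))"
  using assms mat_adjoint_carrier[OF assms(1)] mat_adjoint_index[OF assms(1)]
  by (auto simp: scalar_prod_def lessThan_atLeast0 dest!: carrier_matD intro!: sum.cong)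

text \<open>Rank n \<ge> 1 excludes t = 0, and it bounds n by k. For t > 0 the matrix A is
  injective, which excludes n < k.\<close>

lemma scalar_gram_full_rank_square:
  assumes A: "A \<in> carrier_mat n k" and n: "1 \<le> n" and rank: "vec_space.rank n A = n"
    and gram: "mat_adjoint A * A = complex_of_real t \<cdot>\<^sub>m 1\<^sub>m k" and t: "0 \<le> t"
  shows "n = k \<and> t > 0"
proof -
  have nk: "n \<le> k" using vec_space.rank_le_nc[OF A] rank by simp
  have g: "(\<Sum>l<n. cnj (A $$ (l, i)) * A $$ (l, j)) = (if i = j then complex_of_real t else 0)" if "i < k" "j < k" for i j
    using mat_adjoint_mult_index[OF A that] that unfolding gram by (auto simp: if_distrib)
  have "t \<noteq> 0"
  proof
    assume "t = 0"
    have "A $$ (l, i) = 0" if "l < n" "i < k" for l i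
    proof -
      have "complex_of_real (\<Sum>l<n. (cmod (A $$ (l, i)))\<^sup>2) = (\<Sum>l<n. cnj (A $$ (l, i)) * A $$ (l, i))"
        unfolding of_real_sum by (intro sum.cong refl) (metis complex_norm_square mult.commute)
      then have "complex_of_real (\<Sum>l<n. (cmod (A $$ (l, i)))\<^sup>2) = 0"
        using g[OF that(2,2)] \<open>t = 0\<close> by simp
      then have "(\<Sum>l<n. (cmod (A $$ (l, i)))\<^sup>2) = 0" unfolding of_real_eq_0_iff .
      then have "\<forall>l\<in>{..<n}. (cmod (A $$ (l, i)))\<^sup>2 = 0" by (subst (asm) sum_nonneg_eq_0_iff) auto
      then show ?thesis using that by simp
    qed
    then have "A = 0\<^sub>m n k" using A by (intro eq_matI) auto
    moreover have "vec_space.rank n (0\<^sub>m n k :: complex mat) = 0" by (rule vec_space.rank_0I)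
    ultimately show False using rank n by simp
  qed
  then have tp: "t > 0" using t by simp
  have "n = k"
  proof (rule ccontr)
    assume "n \<noteq> k"
    then have lt: "n < k" using nk by simp
    \<comment> \<open>Padding with zeros to square matrices: C is a left inverse of B, hence also a
      right inverse, although row n of B is zero.\<close>
    define B where "B = mat k k (\<lambda>(i, j). if i < n then A $$ (i, j) else 0)"
    define C where "C = mat k k (\<lambda>(i, j). if j < n then cnj (A $$ (j, i)) / complex_of_real t else 0)"
    have "C * B = 1\<^sub>m k"
    proof (rule eq_matI)
      fix i j assume "i < dim_row (1\<^sub>m k :: complex mat)" "j < dim_col (1\<^sub>m k :: complex mat)"
      then have ij: "i < k" "j < k" by auto
      have "(C * B) $$ (i, j) = (\<Sum>l<k. if l < n then cnj (A $$ (l, i)) / complex_of_real t * A $$ (l, j) else 0)"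
        using ij by (auto simp: B_def C_def scalar_prod_def lessThan_atLeast0 intro!: sum.cong)
      also have "\<dots> = (\<Sum>l<n. cnj (A $$ (l, i)) / complex_of_real t * A $$ (l, j))"
        using lt by (intro sum.mono_neutral_cong_right) auto
      also have "\<dots> = (\<Sum>l<n. cnj (A $$ (l, i)) * A $$ (l, j)) / complex_of_real t"
        by (simp add: sum_divide_distrib)
      finally show "(C * B) $$ (i, j) = 1\<^sub>m k $$ (i, j)" using g[OF ij] ij tp by simp
    qed (auto simp: B_def C_def)
    then have "B * C = 1\<^sub>m k"
      by (intro mat_mult_left_right_inverse[of C k B]) (auto simp: B_def C_def)
    then have "(B * C) $$ (n, n) = 1" using lt by simp
    moreover have "(B * C) $$ (n, n) = 0"
      using lt by (auto simp: B_def C_def scalar_prod_def)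
    ultimately show False by simp
  qed
  then show ?thesis using tp by simp
qed

theorem pure_mat_rep_matrix_extreme:
  assumes T: "bounded_op T" and ucp: "ucp_map (op_sys T) k \<rho>" and pure: "pure_map (op_sys T) k \<rho>"
  shows "matrix_extreme T k (\<rho> T)"
  unfolding matrix_extreme_def
proof (intro conjI allI impI)
  note S = op_system_op_sys[OF T]
  have TS: "T \<in> op_sys T" by (rule gen_in_op_sys[OF T])
  have idS: "id \<in> op_sys T" by (rule op_systemD(1)[OF S])
  have cp: "cp_map (op_sys T) k \<rho>" and one: "\<rho> id = 1\<^sub>m k" using ucp by (auto simp: ucp_map_def)
  note lin = cp_map_mat_linear[OF cp]
  show "\<rho> T \<in> W k T" using ucp by (auto simp: W_def)
  fix m nn XX AA j
  assume "(\<forall>j<m. 1 \<le> nn j \<and> XX j \<in> W (nn j) T \<and> AA j \<in> carrier_mat (nn j) k \<and> vec_space.rank (nn j) (AA j) = nn j)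
       \<and> msum k (\<lambda>j. mat_adjoint (AA j) * AA j) m = 1\<^sub>m k
       \<and> \<rho> T = msum k (\<lambda>j. mat_adjoint (AA j) * XX j * AA j) m" and j: "j < m"
  then have H: "\<And>j. j < m \<Longrightarrow> 1 \<le> nn j" "\<And>j. j < m \<Longrightarrow> XX j \<in> W (nn j) T" "\<And>j. j < m \<Longrightarrow> AA j \<in> carrier_mat (nn j) k"
      "\<And>j. j < m \<Longrightarrow> vec_space.rank (nn j) (AA j) = nn j"
    and M1: "msum k (\<lambda>j. mat_adjoint (AA j) * AA j) m = 1\<^sub>m k"
    and MT: "\<rho> T = msum k (\<lambda>j. mat_adjoint (AA j) * XX j * AA j) m" by auto
  have "\<forall>j. \<exists>\<phi>. j < m \<longrightarrow> ucp_map (op_sys T) (nn j) \<phi> \<and> XX j = \<phi> T" using H(2) by (auto simp: W_def)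
  then obtain \<phi> where \<phi>: "\<And>j. j < m \<Longrightarrow> ucp_map (op_sys T) (nn j) (\<phi> j)" "\<And>j. j < m \<Longrightarrow> XX j = \<phi> j T" by metis
  define \<psi> where "\<psi> j a = mat_adjoint (AA j) * \<phi> j a * AA j" for j a
  have \<psi>cp: "cp_map (op_sys T) k (\<psi> l)" if "l < m" for l
    unfolding \<psi>_def using \<phi>(1)[OF that] by (intro cp_map_compress[OF _ H(3)[OF that]]) (simp add: ucp_map_def)
  note \<psi>lin = cp_map_mat_linear[OF \<psi>cp]
  have \<psi>id: "\<psi> l id = mat_adjoint (AA l) * AA l" if "l < m" for l
    using \<phi>(1)[OF that] mat_adjoint_carrier[OF H(3)[OF that]] by (simp add: \<psi>_def ucp_map_def)
  have sum_id: "\<rho> id $$ (p, q) = (\<Sum>l<m. \<psi> l id $$ (p, q))" if pq: "p < k" "q < k" for p q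
  proof -
    have "msum k (\<lambda>j. mat_adjoint (AA j) * AA j) m $$ (p, q) = (\<Sum>l<m. (mat_adjoint (AA l) * AA l) $$ (p, q))"
      using msum_index[of m "\<lambda>j. mat_adjoint (AA j) * AA j" k, OF _ pq] H(3) mat_adjoint_carrier by (metis mult_carrier_mat)
    then show ?thesis unfolding M1 one by (simp add: \<psi>id)
  qed
  have sum_T: "\<rho> T $$ (p, q) = (\<Sum>l<m. \<psi> l T $$ (p, q))" if pq: "p < k" "q < k" for p q
  proof -
    have c: "mat_adjoint (AA l) * XX l * AA l = \<psi> l T" if "l < m" for l
      using \<phi>(2)[OF that] by (simp add: \<psi>_def)
    have "\<rho> T $$ (p, q) = (\<Sum>l<m. (mat_adjoint (AA l) * XX l * AA l) $$ (p, q))"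
      unfolding MT using msum_index[of m "\<lambda>j. mat_adjoint (AA j) * XX j * AA j" k, OF _ pq] c mat_linearD(1)[OF \<psi>lin TS] by simp
    then show ?thesis by (simp add: c)
  qed
  \<comment> \<open>The convex combination is given only at T and, through the partition of unity,
    at the identity; hermiticity adds the adjoint of T, and these three span the operator
    system.\<close>
  have sum_Ta: "\<rho> (adj T) $$ (p, q) = (\<Sum>l<m. \<psi> l (adj T) $$ (p, q))" if pq: "p < k" "q < k" for p q
    using cp_map_adj[OF S cp TS pq(2,1)] cp_map_adj[OF S \<psi>cp TS pq(2,1)] sum_T[OF pq(2,1)] by simp
  have Tas: "adj T \<in> op_sys T" using op_systemD(4)[OF S TS] .
  have sum_all: "\<rho> a $$ (p, q) = (\<Sum>l<m. \<psi> l a $$ (p, q))" if a: "a \<in> op_sys T" and pq: "p < k" "q < k" for a p q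
  proof -
    obtain x y z where a': "a = op_scale x id + op_scale y T + op_scale z (adj T)" using a unfolding op_sys_iff by blast
    have ent: "\<chi> a $$ (p, q) = x * \<chi> id $$ (p, q) + y * \<chi> T $$ (p, q) + z * \<chi> (adj T) $$ (p, q)"
      if "mat_linear (op_sys T) k \<chi>" for \<chi>
      unfolding a' using op_systemD(2,3)[OF S] idS TS Tas pq
      by (simp add: mat_linear_entry_add[OF that] mat_linear_entry_scale[OF that])
    have "(\<Sum>l<m. \<psi> l a $$ (p, q)) = (\<Sum>l<m. x * \<psi> l id $$ (p, q) + y * \<psi> l T $$ (p, q) + z * \<psi> l (adj T) $$ (p, q))"
      by (intro sum.cong refl ent \<psi>lin) auto
    then show ?thesis
      unfolding ent[OF lin] sum_id[OF pq] sum_T[OF pq] sum_Ta[OF pq] by (simp add: sum.distrib sum_distrib_left)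
  qed
  \<comment> \<open>Removing the summand j leaves a sum of completely positive maps.\<close>
  have "cp_map (op_sys T) k (\<lambda>a. \<rho> a - \<psi> j a)"
  proof (rule cp_map_sumI[of _ _ _ "{..<m} - {j}" \<psi>])
    show "mat_linear (op_sys T) k (\<lambda>a. \<rho> a - \<psi> j a)" by (rule mat_linear_diff_maps[OF lin \<psi>lin[OF j]])
    show "(\<rho> a - \<psi> j a) $$ (p, q) = (\<Sum>l\<in>{..<m} - {j}. \<psi> l a $$ (p, q))"
      if "a \<in> op_sys T" "p < k" "q < k" for a p q
      using that sum_all[OF that] mat_linearD(1)[OF \<psi>lin[OF j] that(1)] j
      by (simp add: sum.remove[of "{..<m}" j])
  qed (use \<psi>cp in auto)
  then have "cp_le (op_sys T) k (\<psi> j) \<rho>" using cp \<psi>cp[OF j] by (simp add: cp_le_def)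
  then obtain t :: real where t: "0 \<le> t" "\<And>a. a \<in> op_sys T \<Longrightarrow> \<psi> j a = complex_of_real t \<cdot>\<^sub>m \<rho> a"
    using pure unfolding pure_map_def by blast
  have gram: "mat_adjoint (AA j) * AA j = complex_of_real t \<cdot>\<^sub>m 1\<^sub>m k" using t(2)[OF idS] \<psi>id[OF j] one by simp
  then have nk: "nn j = k" and tp: "t > 0"
    using scalar_gram_full_rank_square[OF H(3)[OF j] H(1)[OF j] H(4)[OF j] _ t(1)] by auto
  have Ac: "AA j \<in> carrier_mat k k" using H(3)[OF j] nk by simp
  note Aac = mat_adjoint_carrier[OF Ac]
  define s where "s = complex_of_real (1 / sqrt t)"
  have ss: "s * s * complex_of_real t = 1" using tp by (simp add: s_def flip: of_real_mult)
  \<comment> \<open>The adjoint of AA j, not AA j itself: t \<rho>(T) equals the compression of XX j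
    by AA j, so \<rho>(T) = U XX_j U*, which has to be solved for XX j.\<close>
  define U where "U = s \<cdot>\<^sub>m mat_adjoint (AA j)"
  have Uc: "U \<in> carrier_mat k k" using Aac by (simp add: U_def)
  have Ua: "mat_adjoint U = s \<cdot>\<^sub>m AA j"
  proof (rule eq_matI)
    fix p q assume "p < dim_row (s \<cdot>\<^sub>m AA j)" "q < dim_col (s \<cdot>\<^sub>m AA j)"
    then have pq: "p < k" "q < k" using Ac by auto
    have "cnj s = s" by (simp add: s_def)
    then show "mat_adjoint U $$ (p, q) = (s \<cdot>\<^sub>m AA j) $$ (p, q)"
      using mat_adjoint_index[OF Uc pq] mat_adjoint_index[OF Ac pq(2,1)] pq Aac Ac by (simp add: U_def)
  qed (use Ac mat_adjoint_carrier[OF Uc] in auto)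
  have ssm: "s \<cdot>\<^sub>m (s \<cdot>\<^sub>m M) = (s * s) \<cdot>\<^sub>m M" for M :: "complex mat"
    by (intro eq_matI) (auto simp: mult.assoc)
  have U1: "U * mat_adjoint U = 1\<^sub>m k"
  proof -
    have "U * mat_adjoint U = (s * s) \<cdot>\<^sub>m (mat_adjoint (AA j) * AA j)"
      unfolding Ua unfolding U_def using Ac Aac
      by (simp add: mult_smult_distrib[of _ k k _ k] mult_smult_assoc_mat[of _ k k _ k] ssm)
    then show ?thesis unfolding gram using ss by (intro eq_matI) (auto simp: mult.assoc)
  qed
  have U2: "mat_adjoint U * U = 1\<^sub>m k"
    by (rule mat_mult_left_right_inverse[OF Uc mat_adjoint_carrier[OF Uc] U1])
  have XXc: "XX j \<in> carrier_mat k k"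
    using \<phi>[OF j] nk mat_linearD(1)[OF cp_map_mat_linear TS] by (simp add: ucp_map_def)
  have "mat_adjoint U * \<rho> T * U = XX j"
  proof -
    have "complex_of_real t \<cdot>\<^sub>m \<rho> T = mat_adjoint (AA j) * XX j * AA j"
      using t(2)[OF TS] \<phi>(2)[OF j] by (simp add: \<psi>_def)
    moreover have rc: "\<rho> T \<in> carrier_mat k k" using mat_linearD(1)[OF lin TS] .
    moreover have "\<rho> T = (s * s) \<cdot>\<^sub>m (complex_of_real t \<cdot>\<^sub>m \<rho> T)"
      using ss rc by (intro eq_matI) (auto simp: mult.assoc[symmetric])
    ultimately have "\<rho> T = (s * s) \<cdot>\<^sub>m (mat_adjoint (AA j) * XX j * AA j)" by simp
    also have "\<dots> = U * XX j * mat_adjoint U"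
      unfolding Ua unfolding U_def using Ac Aac XXc
      by (simp add: mult_smult_distrib[of _ k k _ k] mult_smult_assoc_mat[of _ k k _ k] ssm)
    finally have r: "\<rho> T = U * XX j * mat_adjoint U" .
    define V where "V = mat_adjoint U"
    have Vc: "V \<in> carrier_mat k k" unfolding V_def by (rule mat_adjoint_carrier[OF Uc])
    have VU: "V * U = 1\<^sub>m k" using U2 by (simp add: V_def)
    have "V * (U * XX j * V) = V * (U * XX j) * V"
      using assoc_mult_mat[OF Vc mult_carrier_mat[OF Uc XXc] Vc] by simp
    also have "V * (U * XX j) = XX j"
      using assoc_mult_mat[OF Vc Uc XXc] VU XXc by simp
    finally have "V * \<rho> T = XX j * V" by (simp add: r V_def)
    then show ?thesis using assoc_mult_mat[OF XXc Vc Uc] VU XXc by (simp add: V_def)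
  qed
  moreover have "unitary_mat k U" using Uc U1 U2 by (simp add: unitary_mat_def)
  ultimately show "\<exists>U. unitary_mat k U \<and> XX j = mat_adjoint U * \<rho> T * U" by (intro exI[of _ U]) simp
  show "nn j = k" by (rule nk)
qed

section \<open>The Hilbert space of square-summable sequences\<close>

lemma l2_zero: "(\<lambda>n. 0) \<in> l2"
  by (simp add: l2_def)

lemma l2_scale: "f \<in> l2 \<Longrightarrow> (\<lambda>n. c * f n) \<in> l2"
  by (simp add: l2_def norm_mult power_mult_distrib summable_mult)

lemma l2_add:
  assumes "f \<in> l2" "g \<in> l2"
  shows "(\<lambda>n. f n + g n) \<in> l2"
proof -
  have "summable (\<lambda>n. 2 * (cmod (f n))\<^sup>2 + 2 * (cmod (g n))\<^sup>2)"
    using assms by (intro summable_add summable_mult) (auto simp: l2_def)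
  moreover have "norm ((cmod (f n + g n))\<^sup>2) \<le> 2 * (cmod (f n))\<^sup>2 + 2 * (cmod (g n))\<^sup>2" for n
  proof -
    have "(cmod (f n + g n))\<^sup>2 \<le> (cmod (f n) + cmod (g n))\<^sup>2" by (intro power_mono norm_triangle_ineq) simp
    also have "\<dots> \<le> 2 * (cmod (f n))\<^sup>2 + 2 * (cmod (g n))\<^sup>2"
      using sum_squares_bound[of "cmod (f n)" "cmod (g n)"] by (simp add: power2_sum)
    finally show ?thesis by simp
  qed
  ultimately show ?thesis unfolding l2_def mem_Collect_eq by (rule summable_comparison_test'[of _ 0])
qed

lemma l2_prod_summable:
  assumes "f \<in> l2" "g \<in> l2"
  shows "summable (\<lambda>n. cnj (f n) * g n)"
proof -
  have "summable (\<lambda>n. (cmod (f n))\<^sup>2 + (cmod (g n))\<^sup>2)"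
    using assms by (intro summable_add) (auto simp: l2_def)
  moreover have "norm (cnj (f n) * g n) \<le> (cmod (f n))\<^sup>2 + (cmod (g n))\<^sup>2" for n
  proof -
    have "2 * (cmod (f n) * cmod (g n)) \<le> (cmod (f n))\<^sup>2 + (cmod (g n))\<^sup>2"
      using sum_squares_bound[of "cmod (f n)" "cmod (g n)"] by simp
    moreover have "0 \<le> cmod (f n) * cmod (g n)" by simp
    ultimately show ?thesis unfolding norm_mult complex_mod_cnj by linarith
  qed
  ultimately show ?thesis by (rule summable_comparison_test'[of _ 0])
qed

lemma l2inner_self:
  assumes "f \<in> l2"
  shows "l2inner f f = complex_of_real (\<Sum>n. (cmod (f n))\<^sup>2)"
proof -
  have "(\<lambda>n. complex_of_real ((cmod (f n))\<^sup>2)) sums complex_of_real (\<Sum>n. (cmod (f n))\<^sup>2)"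
    using assms by (intro sums_of_real summable_sums) (simp add: l2_def)
  moreover have "(\<lambda>n. complex_of_real ((cmod (f n))\<^sup>2)) = (\<lambda>n. cnj (f n) * f n)"
    by (rule ext) (metis complex_norm_square mult.commute)
  ultimately show ?thesis unfolding l2inner_def by (simp add: sums_iff)
qed

lemma l2_uminus: "f \<in> l2 \<Longrightarrow> (\<lambda>n. - f n) \<in> l2"
  using l2_scale[of f "- 1"] by simp

lemma l2_minus: "f \<in> l2 \<Longrightarrow> g \<in> l2 \<Longrightarrow> (\<lambda>n. f n - g n) \<in> l2"
  using l2_add[of f "\<lambda>n. - g n"] l2_uminus[of g] by simp

text \<open>\<open>l2\<close> is a set of functions; a type is required for the class
  \<open>chilbert\<close>, so that the projection theorem applies to sequences.\<close>

typedef l2t = l2 morphisms l2_fun Abs_l2t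
  using l2_zero by blast

lemma l2t_eq_iff: "x = y \<longleftrightarrow> (\<forall>n. l2_fun x n = l2_fun y n)"
  by (metis l2_fun_inject ext)

text \<open>Limits are taken coordinatewise. The Cauchy bound survives the limit on every finite
  section, uniformly in its length, hence for the full series.\<close>

lemma l2_complete:
  fixes F :: "nat \<Rightarrow> nat \<Rightarrow> complex"
  assumes F: "\<And>m. F m \<in> l2"
    and C: "\<And>e. e > 0 \<Longrightarrow> \<exists>N. \<forall>m\<ge>N. \<forall>n\<ge>N. (\<Sum>i. (cmod (F m i - F n i))\<^sup>2) < e"
  shows "\<exists>G\<in>l2. (\<lambda>m. \<Sum>i. (cmod (F m i - G i))\<^sup>2) \<longlonglongrightarrow> 0"
proof -
  have dl2: "summable (\<lambda>i. (cmod (F m i - F n i))\<^sup>2)" for m n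
    using l2_minus[OF F[of m] F[of n]] by (simp add: l2_def)
  have fin: "(\<Sum>i<M. (cmod (F m i - F n i))\<^sup>2) \<le> (\<Sum>i. (cmod (F m i - F n i))\<^sup>2)" for m n M
    by (rule sum_le_suminf[OF dl2]) auto
  have "\<exists>l. (\<lambda>m. F m i) \<longlonglongrightarrow> l" for i
  proof -
    have "Cauchy (\<lambda>m. F m i)"
      unfolding Cauchy_def dist_norm
    proof (intro allI impI)
      fix e :: real assume "e > 0"
      then obtain N where N: "\<forall>m\<ge>N. \<forall>n\<ge>N. (\<Sum>i. (cmod (F m i - F n i))\<^sup>2) < e\<^sup>2" using C[of "e\<^sup>2"] by auto
      have "cmod (F m i - F n i) < e" if "m \<ge> N" "n \<ge> N" for m n
      proof -
        have "(cmod (F m i - F n i))\<^sup>2 \<le> (\<Sum>i<Suc i. (cmod (F m i - F n i))\<^sup>2)"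
          by (simp add: sum_nonneg)
        also have "\<dots> \<le> (\<Sum>i. (cmod (F m i - F n i))\<^sup>2)" by (rule fin)
        also have "\<dots> < e\<^sup>2" using N that by blast
        finally show ?thesis using \<open>e > 0\<close> by (simp add: power2_less_imp_less)
      qed
      then show "\<exists>M. \<forall>m\<ge>M. \<forall>n\<ge>M. cmod (F m i - F n i) < e" by blast
    qed
    then show ?thesis using Cauchy_convergent_iff convergent_def by blast
  qed
  then obtain G where G: "\<And>i. (\<lambda>m. F m i) \<longlonglongrightarrow> G i" by metis
  have tail: "\<exists>N. \<forall>m\<ge>N. summable (\<lambda>i. (cmod (F m i - G i))\<^sup>2) \<and> (\<Sum>i. (cmod (F m i - G i))\<^sup>2) \<le> e" if "e > 0" for e
  proof -
    obtain N where N: "\<forall>m\<ge>N. \<forall>n\<ge>N. (\<Sum>i. (cmod (F m i - F n i))\<^sup>2) < e" using C \<open>e > 0\<close> by blast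
    have "summable (\<lambda>i. (cmod (F m i - G i))\<^sup>2) \<and> (\<Sum>i. (cmod (F m i - G i))\<^sup>2) \<le> e" if "m \<ge> N" for m
    proof -
      have b: "(\<Sum>i<M. (cmod (F m i - G i))\<^sup>2) \<le> e" for M
      proof (rule LIMSEQ_le_const2)
        show "(\<lambda>n. \<Sum>i<M. (cmod (F m i - F n i))\<^sup>2) \<longlonglongrightarrow> (\<Sum>i<M. (cmod (F m i - G i))\<^sup>2)"
          by (intro tendsto_intros G)
        show "\<exists>N. \<forall>n\<ge>N. (\<Sum>i<M. (cmod (F m i - F n i))\<^sup>2) \<le> e"
          using N that fin by (meson order.trans less_imp_le)
      qed
      have s: "summable (\<lambda>i. (cmod (F m i - G i))\<^sup>2)" by (rule summableI_nonneg_bounded[OF _ b]) simp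
      then show ?thesis using suminf_le_const[OF s b] by simp
    qed
    then show ?thesis by blast
  qed
  obtain N where N: "summable (\<lambda>i. (cmod (F N i - G i))\<^sup>2)" using tail[of 1] by auto
  have "(\<lambda>i. F N i - (F N i - G i)) \<in> l2"
    by (rule l2_minus[OF F]) (use N in \<open>simp add: l2_def\<close>)
  then have "G \<in> l2" by simp
  moreover have "(\<lambda>m. \<Sum>i. (cmod (F m i - G i))\<^sup>2) \<longlonglongrightarrow> 0"
  proof (rule LIMSEQ_I)
    fix r :: real assume "r > 0"
    then obtain N where N: "\<forall>m\<ge>N. summable (\<lambda>i. (cmod (F m i - G i))\<^sup>2) \<and> (\<Sum>i. (cmod (F m i - G i))\<^sup>2) \<le> r/2"
      using tail[of "r/2"] by auto
    have "norm ((\<Sum>i. (cmod (F m i - G i))\<^sup>2) - 0) < r" if "m \<ge> N" for m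
    proof -
      have "0 \<le> (\<Sum>i. (cmod (F m i - G i))\<^sup>2)" using N that by (intro suminf_nonneg) auto
      moreover have "(\<Sum>i. (cmod (F m i - G i))\<^sup>2) \<le> r/2" using N that by blast
      ultimately show ?thesis using \<open>r > 0\<close> by simp
    qed
    then show "\<exists>no. \<forall>n\<ge>no. norm ((\<Sum>i. (cmod (F n i - G i))\<^sup>2) - 0) < r" by blast
  qed
  ultimately show ?thesis by blast
qed

instantiation l2t :: chilbert
begin

definition "0 = Abs_l2t (\<lambda>n. 0)"
definition "x + y = Abs_l2t (\<lambda>n. l2_fun x n + l2_fun y n)"
definition "x - y = Abs_l2t (\<lambda>n. l2_fun x n - l2_fun y n)"
definition "- x = Abs_l2t (\<lambda>n. - l2_fun x n)"
definition "scaleC c x = Abs_l2t (\<lambda>n. c * l2_fun x n)"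
definition "cinner x y = l2inner (l2_fun x) (l2_fun y)"

lemma l2_fun_ops:
  "l2_fun 0 n = 0" "l2_fun (x + y) n = l2_fun x n + l2_fun y n" "l2_fun (x - y) n = l2_fun x n - l2_fun y n"
  "l2_fun (- x) n = - l2_fun x n" "l2_fun (scaleC c x) n = c * l2_fun x n"
  using l2_fun[of x] l2_fun[of y]
  by (simp_all add: zero_l2t_def plus_l2t_def minus_l2t_def uminus_l2t_def scaleC_l2t_def
      Abs_l2t_inverse l2_zero l2_add l2_minus l2_uminus l2_scale)

instance
proof
  fix x y z :: l2t and a b :: complex
  have sm: "summable (\<lambda>n. cnj (l2_fun u n) * l2_fun v n)" for u v :: l2t by (intro l2_prod_summable l2_fun)
  show "x + y + z = x + (y + z)" "x + y = y + x" "0 + x = x" "- x + x = 0" "x - y = x + - y"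
    "scaleC a (x + y) = scaleC a x + scaleC a y" "scaleC (a + b) x = scaleC a x + scaleC b x"
    "scaleC a (scaleC b x) = scaleC (a * b) x" "scaleC 1 x = x"
    by (simp_all add: l2t_eq_iff l2_fun_ops algebra_simps)
  show "cinner x y = cnj (cinner y x)"
  proof -
    have "(\<lambda>n. cnj (cnj (l2_fun y n) * l2_fun x n)) sums cnj (\<Sum>n. cnj (l2_fun y n) * l2_fun x n)"
      using summable_sums[OF sm[of y x]] by (simp only: sums_cnj)
    then show ?thesis by (simp add: cinner_l2t_def l2inner_def sums_iff mult.commute)
  qed
  show "cinner x (y + z) = cinner x y + cinner x z"
    unfolding cinner_l2t_def l2inner_def using suminf_add[OF sm[of x y] sm[of x z]]
    by (simp add: l2_fun_ops distrib_left)
  show "cinner x (scaleC a y) = a * cinner x y"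
    unfolding cinner_l2t_def l2inner_def using suminf_mult[OF sm[of x y], of a]
    by (simp add: l2_fun_ops mult.left_commute)
  have sq: "summable (\<lambda>n. (cmod (l2_fun x n))\<^sup>2)" using l2_fun[of x] by (simp add: l2_def)
  have self: "cinner u u = complex_of_real (\<Sum>n. (cmod (l2_fun u n))\<^sup>2)" for u :: l2t
    unfolding cinner_l2t_def by (rule l2inner_self[OF l2_fun])
  show "0 \<le> Re (cinner x x)" unfolding self by (simp add: suminf_nonneg[OF sq])
  show "cinner x x = 0 \<longleftrightarrow> x = 0"
    unfolding self of_real_eq_0_iff using suminf_eq_zero_iff[OF sq] by (auto simp: l2t_eq_iff l2_fun_ops)
  fix f :: "nat \<Rightarrow> l2t"
  assume C: "\<forall>e>0. \<exists>N. \<forall>m\<ge>N. \<forall>n\<ge>N. sqrt (Re (cinner (f m - f n) (f m - f n))) < e"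
  have n2: "Re (cinner (u - v) (u - v)) = (\<Sum>i. (cmod (l2_fun u i - l2_fun v i))\<^sup>2)" for u v :: l2t
    unfolding self by (simp add: l2_fun_ops)
  have "\<exists>G\<in>l2. (\<lambda>m. \<Sum>i. (cmod (l2_fun (f m) i - G i))\<^sup>2) \<longlonglongrightarrow> 0"
  proof (rule l2_complete[OF l2_fun])
    fix e :: real assume "e > 0"
    then obtain N where N: "\<forall>m\<ge>N. \<forall>n\<ge>N. sqrt (Re (cinner (f m - f n) (f m - f n))) < sqrt e"
      using C[rule_format, of "sqrt e"] by auto
    then show "\<exists>N. \<forall>m\<ge>N. \<forall>n\<ge>N. (\<Sum>i. (cmod (l2_fun (f m) i - l2_fun (f n) i))\<^sup>2) < e"
      unfolding n2 by auto
  qed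
  then obtain G where G: "G \<in> l2" "(\<lambda>m. \<Sum>i. (cmod (l2_fun (f m) i - G i))\<^sup>2) \<longlonglongrightarrow> 0" by blast
  have "(\<lambda>m. sqrt (\<Sum>i. (cmod (l2_fun (f m) i - l2_fun (Abs_l2t G) i))\<^sup>2)) \<longlonglongrightarrow> sqrt 0"
    using G by (intro tendsto_real_sqrt) (simp add: Abs_l2t_inverse)
  then show "\<exists>l. (\<lambda>n. sqrt (Re (cinner (f n - l) (f n - l)))) \<longlonglongrightarrow> 0"
    unfolding n2 by auto
qed

end

lemma cnorm_l2t: "cnorm x = l2norm (l2_fun x)"
  unfolding cnorm_def cinner_l2t_def l2norm_def l2inner_self[OF l2_fun] by simp

section \<open>Gram-Schmidt orthonormalisation for semi-inner products\<close>

context semi_inner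
begin

definition resid :: "(nat \<Rightarrow> 'x) \<Rightarrow> nat \<Rightarrow> 'x \<Rightarrow> 'x" where
  "resid e N x = x - (\<Sum>n<N. sc (B (e n) x) (e n))"

lemma resid_Suc: "resid e (Suc N) x = resid e N x - sc (B (e N) x) (e N)"
  by (simp add: resid_def)

lemma resid_in: "(\<And>n. n < N \<Longrightarrow> e n \<in> X) \<Longrightarrow> x \<in> X \<Longrightarrow> resid e N x \<in> X"
  unfolding resid_def by (intro X_diff X_sum X_sc) auto

lemma lincomb_in: "(\<And>n. n < N \<Longrightarrow> e n \<in> X) \<Longrightarrow> (\<Sum>n<N. sc (c n) (e n)) \<in> X"
  by (intro X_sum X_sc) auto

lemma B_lincomb_right:
  assumes "y \<in> X" "\<And>n. n < N \<Longrightarrow> e n \<in> X"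
  shows "B y (\<Sum>n<N. sc (c n) (e n)) = (\<Sum>n<(N::nat). c n * B y (e n))"
proof -
  have "B y (\<Sum>n<N. sc (c n) (e n)) = (\<Sum>n<N. B y (sc (c n) (e n)))"
    by (rule B_sum_right[OF assms(1)]) (use assms(2) X_sc in auto)
  also have "\<dots> = (\<Sum>n<N. c n * B y (e n))"
    by (intro sum.cong refl B_sc assms) auto
  finally show ?thesis .
qed

lemma B_lincomb_left:
  assumes "y \<in> X" "\<And>n. n < N \<Longrightarrow> e n \<in> X"
  shows "B (\<Sum>n<N. sc (c n) (e n)) y = (\<Sum>n<(N::nat). cnj (c n) * B (e n) y)"
proof -
  have "B (\<Sum>n<N. sc (c n) (e n)) y = (\<Sum>n<N. B (sc (c n) (e n)) y)"
    by (rule B_sum_left[OF assms(1)]) (use assms(2) X_sc in auto)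
  also have "\<dots> = (\<Sum>n<N. cnj (c n) * B (e n) y)"
    by (intro sum.cong refl B_sc_left assms) auto
  finally show ?thesis .
qed

definition semi_orthonormal :: "(nat \<Rightarrow> 'x) \<Rightarrow> nat \<Rightarrow> bool" where
  "semi_orthonormal e N \<longleftrightarrow> (\<forall>n<N. e n \<in> X \<and> (B (e n) (e n) = 1 \<or> B (e n) (e n) = 0))
     \<and> (\<forall>m<N. \<forall>n<N. m \<noteq> n \<longrightarrow> B (e m) (e n) = 0)"

lemma B_resid:
  assumes e: "semi_orthonormal e N" and x: "x \<in> X" and m: "m < N"
  shows "B (e m) (resid e N x) = 0"
proof -
  have eX: "e n \<in> X" if "n < N" for n using e that by (simp add: semi_orthonormal_def)
  have "B (e m) (resid e N x) = B (e m) x - (\<Sum>n<N. B (e n) x * B (e m) (e n))"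
  proof -
    have PX: "(\<Sum>n<N. sc (B (e n) x) (e n)) \<in> X" by (rule lincomb_in[OF eX])
    have "B (e m) (\<Sum>n<N. sc (B (e n) x) (e n)) = (\<Sum>n<N. B (e n) x * B (e m) (e n))"
      by (rule B_lincomb_right[OF eX[OF m] eX])
    then show ?thesis unfolding resid_def B_diff_right[OF eX[OF m] x PX] by simp
  qed
  also have "(\<Sum>n<N. B (e n) x * B (e m) (e n)) = (\<Sum>n<N. if n = m then B (e n) x * B (e m) (e n) else 0)"
    by (intro sum.cong refl) (use e m in \<open>auto simp: semi_orthonormal_def\<close>)
  also have "\<dots> = B (e m) x * B (e m) (e m)"
    by (simp only: sum.delta[OF finite_lessThan] lessThan_iff m if_True)
  also have "\<dots> = B (e m) x"
  \<comment> \<open>If e m is null, both sides vanish because null vectors pair to zero with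
    x.\<close>
  proof (cases "B (e m) (e m) = 1")
    case False
    then have "B (e m) (e m) = 0" using e m by (auto simp: semi_orthonormal_def)
    then have "B x (e m) = 0" using B_null[OF x eX[OF m]] by simp
    then show ?thesis using B_conj[OF x eX[OF m]] by simp
  qed simp
  finally show ?thesis by simp
qed

lemma B_resid_right:
  assumes e: "semi_orthonormal e N" and x: "x \<in> X" "y \<in> X" and z: "\<And>m. m < N \<Longrightarrow> B y (e m) = 0"
  shows "B y (resid e N x) = B y x"
proof -
  have eX: "e n \<in> X" if "n < N" for n using e that by (simp add: semi_orthonormal_def)
  have "(\<Sum>m<N. B (e m) x * B y (e m)) = 0" by (intro sum.neutral) (simp add: z)
  moreover have "B y (\<Sum>n<N. sc (B (e n) x) (e n)) = (\<Sum>n<N. B (e n) x * B y (e n))"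
    by (rule B_lincomb_right[OF x(2) eX])
  moreover have PX: "(\<Sum>n<N. sc (B (e n) x) (e n)) \<in> X" by (rule lincomb_in[OF eX])
  ultimately show ?thesis unfolding resid_def B_diff_right[OF x(2,1) PX] by simp
qed

text \<open>The Bessel identity in polarised form. At x = y it gives monotone residual norms, in
  general it gives Parseval for inner products.\<close>

lemma B_resid_resid:
  assumes e: "semi_orthonormal e N" and x: "x \<in> X" "y \<in> X"
  shows "B (resid e N x) (resid e N y) = B x y - (\<Sum>n<N. cnj (B (e n) x) * B (e n) y)"
proof -
  have eX: "e n \<in> X" if "n < N" for n using e that by (simp add: semi_orthonormal_def)
  have rX: "resid e N x \<in> X" using resid_in eX x by blast
  have "B (resid e N x) (e m) = 0" if "m < N" for m
    using B_resid[OF e x(1) that] B_conj[OF eX[OF that] rX] by simp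
  then have "B (resid e N x) (resid e N y) = B (resid e N x) y"
    by (rule B_resid_right[OF e x(2) rX])
  also have "\<dots> = B x y - (\<Sum>n<N. cnj (B (e n) x) * B (e n) y)"
  proof -
    have PX: "(\<Sum>n<N. sc (B (e n) x) (e n)) \<in> X" by (rule lincomb_in[OF eX])
    have "B (\<Sum>n<N. sc (B (e n) x) (e n)) y = (\<Sum>n<N. cnj (B (e n) x) * B (e n) y)"
      by (rule B_lincomb_left[OF x(2) eX])
    then show ?thesis unfolding resid_def B_diff_left[OF x(1) PX x(2)] by simp
  qed
  finally show ?thesis .
qed

lemma norm_resid:
  assumes e: "semi_orthonormal e N" and x: "x \<in> X"
  shows "Re (B (resid e N x) (resid e N x)) = Re (B x x) - (\<Sum>n<N. (cmod (B (e n) x))\<^sup>2)"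
proof -
  have "Re (cnj z * z) = (cmod z)\<^sup>2" for z using complex_norm_square[of z] by (metis Re_complex_of_real mult.commute)
  then show ?thesis unfolding B_resid_resid[OF e x x] by (simp del: times_complex.simps)
qed

inductive_set lspan :: "(nat \<Rightarrow> 'x) \<Rightarrow> 'x set" for xs where
  lspan_base: "xs n \<in> lspan xs"
| lspan_add: "x \<in> lspan xs \<Longrightarrow> y \<in> lspan xs \<Longrightarrow> x + y \<in> lspan xs"
| lspan_sc: "x \<in> lspan xs \<Longrightarrow> sc c x \<in> lspan xs"

text \<open>At each stage the first \<open>xs j\<close> that is not yet spanned is orthonormalised, so the unit vectors
  occupy an initial segment of the indices.\<close>

theorem gram_schmidt:
  assumes xs: "\<And>n. xs n \<in> X" and dense: "\<And>x \<epsilon>. x \<in> X \<Longrightarrow> \<epsilon> > 0 \<Longrightarrow> \<exists>y\<in>lspan xs. Re (B (x - y) (x - y)) < \<epsilon>"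
  shows "\<exists>e I. (I = UNIV \<or> (\<exists>d. I = {..<d})) \<and> (\<forall>n. e n \<in> X)
     \<and> (\<forall>m n. B (e m) (e n) = (if m = n \<and> n \<in> I then 1 else 0))
     \<and> (\<forall>x\<in>X. (\<lambda>N. Re (B (resid e N x) (resid e N x))) \<longlonglongrightarrow> 0)"
proof -
  let ?N = "\<lambda>x. Re (B x x)"
  define new where "new f n j \<longleftrightarrow> ?N (resid f n (xs j)) \<noteq> 0" for f n j
  \<comment> \<open>The condition on a possible successor r of f 0, ..., f (n - 1): a unit vector
    orthogonal to them that spans, up to a null vector, the residual of the first xs j not yet
    spanned; or 0 if there is none.\<close>
  define P where "P f n r \<longleftrightarrow> r \<in> X \<and> (\<forall>m<n. B (f m) r = 0) \<and>
     (if \<exists>j. new f n j then B r r = 1 \<and>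
        (let y = resid f n (xs (LEAST j. new f n j)) in ?N (y - sc (B r y) r) = 0) else r = 0)" for f n r
  have semi: "semi_orthonormal f n" if "\<And>m. m < n \<Longrightarrow> P f m (f m)" for f n
  proof -
    have fX: "f m \<in> X" if "m < n" for m using \<open>\<And>m. m < n \<Longrightarrow> P f m (f m)\<close>[OF that] by (simp add: P_def)
    have ob: "B (f l) (f m) = 0" if "l < m" "m < n" for l m
      using \<open>\<And>m. m < n \<Longrightarrow> P f m (f m)\<close>[OF that(2)] that(1) by (simp add: P_def)
    have "B (f l) (f m) = 0" if "l \<noteq> m" "l < n" "m < n" for l m
    proof (cases "l < m")
      case False
      then have "B (f m) (f l) = 0" using ob[of m l] that by simp
      then show ?thesis using B_conj[OF fX[OF that(3)] fX[OF that(2)]] by simp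
    qed (use ob that in simp)
    moreover have "B (f m) (f m) = 1 \<or> B (f m) (f m) = 0" if "m < n" for m
      using \<open>\<And>m. m < n \<Longrightarrow> P f m (f m)\<close>[OF that] X_zero by (auto simp: P_def B_zero_right split: if_splits)
    ultimately show ?thesis using fX by (simp add: semi_orthonormal_def)
  qed
  \<comment> \<open>P f n reads f only below n, so dependent choice along the naturals produces the
    whole sequence.\<close>
  have "\<exists>e. \<forall>n. P e n (e n)"
  proof (rule dependent_wellorder_choice)
    fix r :: 'x and f g :: "nat \<Rightarrow> 'x" and n :: nat
    assume fg: "\<And>y. y < n \<Longrightarrow> f y = g y"
    have "resid f n x = resid g n x" for x unfolding resid_def using fg by simp
    then have "new f n = new g n" "resid f n = resid g n" by (auto simp: new_def)
    then show "P f n r = P g n r" using fg by (simp add: P_def)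
  next
    fix n f assume IH: "\<And>y. y < n \<Longrightarrow> P f y (f y)"
    note so = semi[OF IH]
    show "\<exists>r. P f n r"
    proof (cases "\<exists>j. new f n j")
      case False
      have "P f n 0" unfolding P_def using False X_zero IH B_zero_right by (auto simp: P_def)
      then show ?thesis ..
    next
      case True
      define y where "y = resid f n (xs (LEAST j. new f n j))"
      have yX: "y \<in> X" unfolding y_def using so xs by (intro resid_in) (auto simp: semi_orthonormal_def)
      have "new f n (LEAST j. new f n j)" using LeastI_ex[OF True] .
      then have ypos: "?N y > 0" using B_nonneg[OF yX] by (simp add: new_def y_def)
      define s where "s = sqrt (?N y)"
      have s: "s > 0" "s * s = ?N y" using ypos by (auto simp: s_def)
      define r where "r = sc (complex_of_real (1 / s)) y"
      have rX: "r \<in> X" unfolding r_def by (rule X_sc[OF yX])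
      have By: "B y y = complex_of_real (s * s)" using B_self_real[OF yX] s by simp
      have ry: "B r y = complex_of_real s" unfolding r_def B_sc_left[OF yX yX] By using s(1) by simp
      have rr: "B r r = 1" unfolding r_def B_sc[OF rX[unfolded r_def] yX] using ry s by (simp add: r_def)
      have "B (y - sc (B r y) r) (y - sc (B r y) r) = B y y - cnj (B r y) * B r y"
        using yX rX X_sc[OF rX] X_diff[OF yX X_sc[OF rX]] B_conj[OF rX yX]
        by (simp add: B_diff_left B_diff_right B_sc B_sc_left rr algebra_simps)
      then have z: "?N (y - sc (B r y) r) = 0" by (simp add: By ry)
      have orth: "B (f m) r = 0" if "m < n" for m
      proof -
        have "f m \<in> X" using so that by (simp add: semi_orthonormal_def)
        then show ?thesis using B_resid[OF so xs that] B_sc[OF _ yX] by (simp add: r_def y_def)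
      qed
      have "P f n r" unfolding P_def using True rX rr z orth by (simp add: Let_def y_def)
      then show ?thesis ..
    qed
  qed
  then obtain e where e: "\<And>n. P e n (e n)" by blast
  have so: "semi_orthonormal e N" for N using semi e by blast
  have eX: "e n \<in> X" for n using e[of n] by (simp add: P_def)
  define I where "I = {n. \<exists>j. new e n j}"
  have eI: "B (e n) (e n) = (if n \<in> I then 1 else 0)" for n
    using e[of n] X_zero B_zero_right by (auto simp: P_def I_def)
  have ON: "B (e m) (e n) = (if m = n \<and> n \<in> I then 1 else 0)" for m n
  proof (cases "m = n")
    case False
    then have "B (e m) (e n) = 0"
      using so[of "Suc (max m n)"] unfolding semi_orthonormal_def by (simp add: less_Suc_eq_le)
    then show ?thesis using False by simp
  qed (use eI[of n] in simp)
  have rX: "resid e n x \<in> X" if "x \<in> X" for n x using resid_in eX that by blast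
  have mono: "?N (resid e M x) \<le> ?N (resid e N x)" if "N \<le> M" "x \<in> X" for M N x
    unfolding norm_resid[OF so that(2)] using that(1)
    by (simp add: sum_mono2)
  \<comment> \<open>Residual norms decrease with n, so a vector that is still new at Suc n was
    already new at n.\<close>
  have down: "n \<in> I" if Sn: "Suc n \<in> I" for n
  proof -
    obtain j where "?N (resid e (Suc n) (xs j)) \<noteq> 0" using Sn by (auto simp: I_def new_def)
    then have "?N (resid e n (xs j)) \<noteq> 0"
      using mono[of n "Suc n" "xs j"] B_nonneg[OF rX[OF xs], of "Suc n" j] xs by force
    then show ?thesis by (auto simp: I_def new_def)
  qed
  have Iform: "I = UNIV \<or> (\<exists>d. I = {..<d})"
  proof (cases "I = UNIV")
    case False
    then obtain n where n: "n \<notin> I" by blast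
    define d where "d = (LEAST n. n \<notin> I)"
    have dI: "d \<notin> I" unfolding d_def using n by (rule LeastI)
    have "m \<in> I" if "m < d" for m using not_less_Least[of m "\<lambda>n. n \<notin> I"] that by (simp add: d_def)
    moreover have "m \<notin> I" if "d \<le> m" for m
      using that by (induction m rule: dec_induct) (use dI down in auto)
    ultimately have "I = {..<d}" by (metis lessThan_iff not_less subsetI subset_antisym)
    then show ?thesis by blast
  qed simp
  \<comment> \<open>By induction, n stages deal with xs 0, ..., xs (n - 1): if xs j with j \<le> n
    is new at stage n, then j = n is the least new index, and this very stage removes it.\<close>
  have spanned: "?N (resid e n (xs j)) = 0" if "j < n" for n j
    using that
  proof (induction n arbitrary: j)
    case (Suc n)
    show ?case
    proof (cases "new e n j")
      case False
      then have "?N (resid e n (xs j)) = 0" by (simp add: new_def)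
      then show ?thesis using mono[of n "Suc n" "xs j"] B_nonneg[OF rX[OF xs], of "Suc n" j] xs by simp
    next
      case True
      then have jn: "j = n" using Suc by (cases "j < n") (auto simp: new_def)
      have L: "(LEAST j. new e n j) = n"
      proof (rule Least_equality)
        show "new e n n" using True jn by simp
        fix i assume "new e n i"
        then show "n \<le> i" using Suc.IH[of i] by (force simp: new_def)
      qed
      define y where "y = resid e n (xs n)"
      have "?N (y - sc (B (e n) y) (e n)) = 0"
      proof -
        have ex: "\<exists>j. new e n j" using True by blast
        show ?thesis using e[of n] unfolding P_def L if_P[OF ex] Let_def y_def by blast
      qed
      moreover have "B (e n) y = B (e n) (xs n)"
        unfolding y_def by (rule B_resid_right[OF so xs eX]) (simp add: ON)
      ultimately show ?thesis unfolding jn resid_Suc by (simp add: y_def)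
    qed
  qed simp
  have lspanX: "y \<in> X" if "y \<in> lspan xs" for y
    using that by induction (auto intro: xs X_add X_sc)
  have lspan0: "\<exists>N. \<forall>M\<ge>N. ?N (resid e M y) = 0" if "y \<in> lspan xs" for y
    using that
  proof induction
    case (lspan_base n)
    then show ?case using spanned by (intro exI[of _ "Suc n"]) auto
  next
    case (lspan_add x y)
    then obtain N1 N2 where N: "\<forall>M\<ge>N1. ?N (resid e M x) = 0" "\<forall>M\<ge>N2. ?N (resid e M y) = 0" by blast
    have "?N (resid e M (x + y)) = 0" if "M \<ge> max N1 N2" for M
    proof -
      have X: "x \<in> X" "y \<in> X" using lspanX lspan_add.hyps by auto
      have "B (resid e M x) (resid e M x) = 0" "B (resid e M x) (resid e M y) = 0" "B (resid e M y) (resid e M y) = 0"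
        using N that B_null[OF rX[OF X(1)] rX[OF X(1)]] B_null[OF rX[OF X(1)] rX[OF X(2)]] B_null[OF rX[OF X(2)] rX[OF X(2)]] by auto
      moreover have "B (resid e M y) (resid e M x) = 0"
        using N that B_null[OF rX[OF X(2)] rX[OF X(1)]] by auto
      ultimately show ?thesis
        unfolding B_resid_resid[OF so X_add[OF X] X_add[OF X]] B_resid_resid[OF so X(1) X(1)] B_resid_resid[OF so X(1) X(2)]
          B_resid_resid[OF so X(2) X(1)] B_resid_resid[OF so X(2) X(2)]
        using X eX by (simp add: B_add B_add_left X_add distrib_left distrib_right sum.distrib del: times_complex.simps)
    qed
    then show ?case by blast
  next
    case (lspan_sc x c)
    then obtain N where N: "\<forall>M\<ge>N. ?N (resid e M x) = 0" by blast
    have X: "x \<in> X" using lspanX lspan_sc.hyps by auto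
    have "B (resid e M (sc c x)) (resid e M (sc c x)) = cnj c * c * B (resid e M x) (resid e M x)" for M
      unfolding B_resid_resid[OF so X_sc[OF X] X_sc[OF X]] B_resid_resid[OF so X X]
      using X eX by (simp add: B_sc B_sc_left X_sc right_diff_distrib sum_distrib_left mult_ac)
    moreover have "B (resid e M x) (resid e M x) = 0" if "M \<ge> N" for M
      using N that B_null[OF rX[OF X] rX[OF X]] by auto
    ultimately show ?case by (intro exI[of _ N]) simp
  qed
  have conv: "(\<lambda>N. ?N (resid e N x)) \<longlonglongrightarrow> 0" if x: "x \<in> X" for x
  proof (rule LIMSEQ_I)
    fix r :: real assume "r > 0"
    then obtain y where y: "y \<in> lspan xs" "?N (x - y) < r" using dense[OF x] by blast
    obtain N where N: "\<forall>M\<ge>N. ?N (resid e M y) = 0" using lspan0[OF y(1)] by blast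
    have yX: "y \<in> X" by (rule lspanX[OF y(1)])
    have "norm (?N (resid e M x) - 0) < r" if "M \<ge> N" for M
    proof -
      have n: "B u (resid e M y) = 0" if "u \<in> X" for u using B_null[OF that rX[OF yX]] N \<open>M \<ge> N\<close> by blast
      have n': "B (resid e M y) u = 0" if "u \<in> X" for u using n[OF that] B_conj[OF that rX[OF yX]] by simp
      have "B (resid e M (x - y)) (resid e M (x - y)) = B (resid e M x) (resid e M x)"
        using n[OF rX[OF x, of M]] n'[OF rX[OF x, of M]] n[OF rX[OF yX, of M]]
        unfolding B_resid_resid[OF so X_diff[OF x yX] X_diff[OF x yX]] B_resid_resid[OF so x x] B_resid_resid[OF so x yX]
          B_resid_resid[OF so yX x] B_resid_resid[OF so yX yX]
        using x yX eX
        by (simp add: B_diff_left B_diff_right X_diff left_diff_distrib right_diff_distrib sum_subtractf del: times_complex.simps)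
      moreover have "?N (resid e M (x - y)) \<le> ?N (x - y)"
        unfolding norm_resid[OF so X_diff[OF x yX]] by (simp add: sum_nonneg)
      moreover have "0 \<le> ?N (resid e M x)" by (rule B_nonneg[OF rX[OF x]])
      ultimately show ?thesis using y(2) by simp
    qed
    then show "\<exists>no. \<forall>n\<ge>no. norm (?N (resid e n x) - 0) < r" by blast
  qed
  show ?thesis using Iform eX ON conv by blast
qed

end

section \<open>Separability of the generated algebra\<close>

primrec word_op :: "('h::chilbert \<Rightarrow> 'h) \<Rightarrow> bool list \<Rightarrow> 'h \<Rightarrow> 'h" where
  "word_op T [] = id"
| "word_op T (b # w) = (if b then T else adj T) \<circ> word_op T w"

inductive_set star_polys :: "('h::chilbert \<Rightarrow> 'h) \<Rightarrow> ('h \<Rightarrow> 'h) set" for T where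
  star_word: "word_op T w \<in> star_polys T"
| star_add: "p \<in> star_polys T \<Longrightarrow> q \<in> star_polys T \<Longrightarrow> op_add p q \<in> star_polys T"
| star_scale: "p \<in> star_polys T \<Longrightarrow> op_scale c p \<in> star_polys T"

lemma word_op_append: "word_op T (u @ v) = word_op T u \<circ> word_op T v"
  by (induction u) (auto simp: o_assoc)

lemma word_op_cstar: "word_op T w \<in> cstar T"
proof (induction w)
  case Nil
  show ?case unfolding word_op.simps by (rule cstar_id)
next
  case (Cons b w)
  have "(if b then T else adj T) \<in> cstar T" by (simp add: cstar_gen cstar_adj)
  then show ?case unfolding word_op.simps using Cons by (rule cstar_mult)
qed

lemma star_polys_cstar: "p \<in> star_polys T \<Longrightarrow> p \<in> cstar T"
  by (induction rule: star_polys.induct) (auto intro: word_op_cstar cstar_add cstar_scale)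

lemma adj_word_op:
  assumes T: "bounded_op T"
  shows "adj (word_op T w) = word_op T (rev (map Not w))"
proof (induction w)
  case (Cons b w)
  have one: "word_op T [c] = (if c then T else adj T)" for c by (simp add: fun_eq_iff)
  have b: "bounded_op (if b then T else adj T)" using T by (simp add: bounded_op_adj)
  have "adj (word_op T (b # w)) = adj (word_op T w) \<circ> adj (if b then T else adj T)"
    unfolding word_op.simps by (rule adj_comp[OF b bounded_op_cstar[OF T word_op_cstar]])
  also have "adj (if b then T else adj T) = word_op T [\<not> b]" unfolding one using T by (simp add: adj_adj)
  finally show ?case unfolding Cons.IH word_op_append[symmetric] by (simp only: list.map rev.simps)
qed (simp only: word_op.simps adj_id list.map rev.simps)

lemma star_polys_adj:
  assumes T: "bounded_op T" and "p \<in> star_polys T"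
  shows "adj p \<in> star_polys T"
  using assms(2)
proof induction
  case (star_word w)
  then show ?case by (simp add: adj_word_op[OF T] star_polys.star_word)
next
  case (star_add p q)
  then show ?case using bounded_op_cstar[OF T star_polys_cstar] by (simp add: adj_op_add star_polys.star_add)
next
  case (star_scale p c)
  then show ?case using bounded_op_cstar[OF T star_polys_cstar] by (simp add: adj_op_scale star_polys.star_scale)
qed

lemma star_polys_comp:
  assumes T: "bounded_op T" and p: "p \<in> star_polys T" and q: "q \<in> star_polys T"
  shows "p \<circ> q \<in> star_polys T"
  using p
proof induction
  case (star_word w)
  show ?case using q
  proof induction
    case (star_word v)
    show ?case unfolding word_op_append[symmetric] by (rule star_polys.star_word)
  next
    case (star_add p q)
    have eq: "word_op T w \<circ> op_add p q = op_add (word_op T w \<circ> p) (word_op T w \<circ> q)"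
      using bounded_op_add[OF bounded_op_cstar[OF T word_op_cstar]] by (auto simp: op_add_def)
    show ?case unfolding eq by (rule star_polys.star_add[OF star_add.IH])
  next
    case (star_scale p c)
    have eq: "word_op T w \<circ> op_scale c p = op_scale c (word_op T w \<circ> p)"
      using bounded_op_scaleC[OF bounded_op_cstar[OF T word_op_cstar]] by (auto simp: op_scale_def)
    show ?case unfolding eq by (rule star_polys.star_scale[OF star_scale.IH])
  qed
next
  case (star_add p p')
  have eq: "op_add p p' \<circ> q = op_add (p \<circ> q) (p' \<circ> q)" by (auto simp: op_add_def)
  show ?case unfolding eq by (rule star_polys.star_add[OF star_add.IH])
next
  case (star_scale p c)
  have eq: "op_scale c p \<circ> q = op_scale c (p \<circ> q)" by (auto simp: op_scale_def)
  show ?case unfolding eq by (rule star_polys.star_scale[OF star_scale.IH])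
qed

lemma op_bound_mono: "op_bound S c \<Longrightarrow> c \<le> d \<Longrightarrow> op_bound S d"
  unfolding op_bound_def by (meson cnorm_ge_zero mult_right_mono order_trans)

text \<open>The operators approximable by polynomials in T and its adjoint are closed under each
  rule that generates C*(T), norm limits included.\<close>

theorem star_polys_dense:
  assumes T: "bounded_op T" and S: "S \<in> cstar T" and "\<epsilon> > 0"
  shows "\<exists>p\<in>star_polys T. op_bound (S - p) \<epsilon>"
  using S \<open>\<epsilon> > 0\<close>
proof (induction arbitrary: \<epsilon>)
  case cstar_id
  have "op_bound (id - word_op T []) \<epsilon>" using cstar_id by (simp add: op_bound_def)
  then show ?case using star_word[of T "[]"] by blast
next
  case cstar_gen
  have "op_bound (T - word_op T [True]) \<epsilon>" using cstar_gen by (simp add: op_bound_def)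
  then show ?case using star_word[of T "[True]"] by blast
next
  case (cstar_adj S)
  then obtain p where p: "p \<in> star_polys T" "op_bound (S - p) \<epsilon>" by blast
  have b: "bounded_op S" "bounded_op p"
    using bounded_op_cstar[OF T] cstar_adj star_polys_cstar[OF p(1)] by auto
  have eq: "S - p = op_add S (op_scale (-1) p)" by (simp add: op_add_eq_plus op_scale_minus_one)
  have "adj (S - p) = adj S - adj p"
    by (rule adj_unique) (simp add: cinner_diff_left cinner_diff_right cinner_adj b)
  moreover have "bounded_op (S - p)" unfolding eq using b by (simp add: bounded_op_op_add bounded_op_op_scale)
  ultimately have "op_bound (adj S - adj p) \<epsilon>" using op_bound_adj p(2) by metis
  then show ?case using star_polys_adj[OF T p(1)] by blast
next
  case (cstar_add S R)
  then obtain p q where pq: "p \<in> star_polys T" "op_bound (S - p) (\<epsilon>/2)" "q \<in> star_polys T" "op_bound (R - q) (\<epsilon>/2)"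
    using half_gt_zero by meson
  have "op_add S R - op_add p q = op_add (S - p) (R - q)" by (simp add: op_add_eq_plus)
  then have "op_bound (op_add S R - op_add p q) \<epsilon>" using op_bound_add[OF pq(2,4)] by simp
  then show ?case using star_add[OF pq(1,3)] by blast
next
  case (cstar_scale S c)
  have pos: "cmod c + 1 > 0" by (simp add: add_nonneg_pos)
  then have "\<epsilon> / (cmod c + 1) > 0" using cstar_scale.prems by simp
  then obtain p where p: "p \<in> star_polys T" "op_bound (S - p) (\<epsilon> / (cmod c + 1))" using cstar_scale.IH by blast
  have "op_scale c S - op_scale c p = op_scale c (S - p)" by (auto simp: op_scale_def scaleC_diff_right)
  moreover have "cmod c * (\<epsilon> / (cmod c + 1)) \<le> \<epsilon>" using pos cstar_scale.prems by (simp add: field_simps)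
  ultimately have "op_bound (op_scale c S - op_scale c p) \<epsilon>"
    using op_bound_mono[OF op_bound_scale[OF p(2), of c]] by simp
  then show ?case using star_scale[OF p(1)] by blast
next
  case (cstar_mult S R)
  have bS: "bounded_op S" and bR: "bounded_op R" using bounded_op_cstar[OF T] cstar_mult by auto
  obtain s r where s: "op_bound S s" and r: "op_bound R r" using bounded_op_bound bS bR by meson
  have s0: "0 \<le> s" "0 \<le> r" using s r by (auto simp: op_bound_def)
  \<comment> \<open>S R - p q = (S - p) R + p (R - q) has bound \<delta> r + (s + 1) \<delta>, since
    \<delta> \<le> 1 gives p the bound s + 1. The denominator s + r + 2 keeps this below
    \<epsilon>.\<close>
  define \<delta> where "\<delta> = min 1 (\<epsilon> / (s + r + 2))"
  have den: "s + r + 2 > 0" using s0 by simp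
  have \<delta>: "\<delta> > 0" "\<delta> \<le> 1" using den cstar_mult.prems by (auto simp: \<delta>_def)
  have "\<delta> \<le> \<epsilon> / (s + r + 2)" by (simp add: \<delta>_def)
  then have \<delta>s: "\<delta> * (s + r + 2) \<le> \<epsilon>" using pos_le_divide_eq[OF den] by blast
  obtain p q where pq: "p \<in> star_polys T" "op_bound (S - p) \<delta>" "q \<in> star_polys T" "op_bound (R - q) \<delta>"
    using cstar_mult.IH \<delta>(1) by meson
  have bp: "bounded_op p" using bounded_op_cstar[OF T star_polys_cstar[OF pq(1)]] .
  have "op_bound p (s + 1)"
  proof -
    have "op_bound (op_add S (op_scale (-1) (S - p))) (s + cmod (-1) * \<delta>)"
      by (rule op_bound_add[OF s op_bound_scale[OF pq(2)]])
    moreover have "op_add S (op_scale (-1) (S - p)) = p" by (simp add: op_add_eq_plus op_scale_minus_one)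
    ultimately show ?thesis using op_bound_mono \<delta>(2) by force
  qed
  then have "op_bound (op_add ((S - p) \<circ> R) (p \<circ> (R - q))) (\<delta> * r + (s + 1) * \<delta>)"
    by (intro op_bound_add op_bound_comp pq r)
  moreover have "op_add ((S - p) \<circ> R) (p \<circ> (R - q)) = (S \<circ> R) - (p \<circ> q)"
    by (rule ext) (simp add: op_add_def bounded_op_diff[OF bp])
  moreover have "\<delta> * r + (s + 1) * \<delta> \<le> \<epsilon>" using \<delta> \<delta>s by (simp add: algebra_simps)
  ultimately have "op_bound ((S \<circ> R) - (p \<circ> q)) \<epsilon>" using op_bound_mono by metis
  then show ?case using star_polys_comp[OF T pq(1,3)] by blast
next
  case (cstar_lim F S)
  have l: "(\<lambda>n. opnorm (\<lambda>x. F n x - S x)) \<longlonglongrightarrow> 0" and "\<epsilon>/2 > 0" using cstar_lim by auto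
  then obtain n where "norm (opnorm (\<lambda>x. F n x - S x) - 0) < \<epsilon>/2" using LIMSEQ_D by blast
  then have n: "opnorm (\<lambda>x. F n x - S x) < \<epsilon>/2" by simp
  have FA: "F n \<in> cstar T" and IH: "\<And>\<epsilon>. \<epsilon> > 0 \<Longrightarrow> \<exists>p\<in>star_polys T. op_bound (F n - p) \<epsilon>"
    using cstar_lim by blast+
  have bF: "bounded_op (F n)" using bounded_op_cstar[OF T FA] .
  have eq: "(\<lambda>x. F n x - S x) = op_add (F n) (op_scale (-1) S)"
    by (auto simp: op_add_def op_scale_def scaleC_minus_left scaleC_one)
  have "bounded_op (\<lambda>x. F n x - S x)"
    unfolding eq using bF cstar_lim by (intro bounded_op_op_add bounded_op_op_scale) auto
  then have 1: "op_bound (\<lambda>x. F n x - S x) (\<epsilon>/2)" using op_bound_mono[OF opnorm_bound] n by force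
  obtain p where p: "p \<in> star_polys T" "op_bound (F n - p) (\<epsilon>/2)" using IH cstar_lim.prems by (meson half_gt_zero)
  have "op_bound (op_add (F n - p) (op_scale (-1) (\<lambda>x. F n x - S x))) (\<epsilon>/2 + cmod (-1) * (\<epsilon>/2))"
    by (rule op_bound_add[OF p(2) op_bound_scale[OF 1]])
  moreover have "op_add (F n - p) (op_scale (-1) (\<lambda>x. F n x - S x)) = S - p"
    by (auto simp: op_add_def op_scale_def scaleC_minus_left scaleC_one)
  ultimately have "op_bound (S - p) \<epsilon>" by simp
  then show ?case using p(1) by blast
qed

text \<open>Enumerates word \<otimes> e_i through the countability of pairs of an index and a word.
  Complex coefficients are left to the span, so a sequence suffices.\<close>

definition word_tuple :: "('h::chilbert \<Rightarrow> 'h) \<Rightarrow> nat \<Rightarrow> nat \<Rightarrow> 'h \<Rightarrow> 'h" where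
  "word_tuple T n = (case from_nat n of (i, w) \<Rightarrow> tunit i (word_op T w))"

lemma word_tuple_surj: "\<exists>n. word_tuple T n = tunit i (word_op T w)"
  by (rule exI[of _ "to_nat (i, w)"]) (simp add: word_tuple_def)

lemma word_tuple_in: "bounded_op T \<Longrightarrow> word_tuple T n \<in> tuples T"
  by (auto simp: word_tuple_def tunit_in_tuples word_op_cstar split: prod.split)

text \<open>Approximating each entry of a tuple in norm is enough, because entries of a ucp map are
  bounded by operator bounds.\<close>

lemma word_tuples_dense:
  assumes T: "bounded_op T" and ucp: "ucp_map (cstar T) k \<phi>" and x: "x \<in> tuples T" and "\<epsilon> > 0"
  shows "\<exists>y\<in>semi_inner.lspan tscale (word_tuple T). Re (stine k \<phi> (x - y) (x - y)) < \<epsilon>"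
proof -
  have cp: "cp_map (cstar T) k \<phi>" using ucp by (simp add: ucp_map_def)
  note A = op_system_cstar[OF T]
  interpret semi_inner "tuples T" tscale "stine k \<phi>" by (rule semi_inner_stine[OF T cp])
  have poly: "tunit i p \<in> lspan (word_tuple T)" if "p \<in> star_polys T" for i p
    using that
  proof induction
    case (star_word w)
    then show ?case using word_tuple_surj[of T i w] lspan_base by metis
  next
    case (star_add p q)
    have "tunit i (op_add p q) = tunit i p + tunit i q" by (intro ext) (simp add: tunit_def op_add_def)
    then show ?case using lspan_add[OF star_add.IH] by metis
  next
    case (star_scale p c)
    have "tunit i (op_scale c p) = tscale c (tunit i p)" by (intro ext) (simp add: tunit_def tscale_def op_scale_def)
    then show ?case using lspan_sc[OF star_scale.IH] by metis
  qed
  \<comment> \<open>Each of the k * k summands of the form is at most \<delta> * \<delta>; the added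
    1 keeps the denominator positive for k = 0.\<close>
  define \<delta> where "\<delta> = sqrt (\<epsilon> / (2 * (real k * real k + 1)))"
  have den: "real k * real k + 1 > 0" by (simp add: add_nonneg_pos)
  have \<delta>: "\<delta> > 0" "\<delta> * \<delta> = \<epsilon> / (2 * (real k * real k + 1))" using \<open>\<epsilon> > 0\<close> den by (auto simp: \<delta>_def)
  have "\<forall>i. \<exists>p\<in>star_polys T. op_bound (x i - p) \<delta>"
    using star_polys_dense[OF T _ \<delta>(1)] x by (simp add: tuples_def)
  then obtain p where p: "\<And>i. p i \<in> star_polys T" "\<And>i. op_bound (x i - p i) \<delta>" by metis
  have span: "(\<Sum>i<m. tunit i (p i)) \<in> lspan (word_tuple T)" for m
  proof (induction m)
    case 0
    have "tscale 0 (word_tuple T 0) \<in> lspan (word_tuple T)" by (intro lspan_sc lspan_base)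
    then show ?case by (simp only: sc_zero lessThan_0 sum.empty)
  next
    case (Suc m)
    then show ?case using lspan_add[OF Suc poly[OF p(1)]] by (simp only: sum.lessThan_Suc)
  qed
  define y where "y = (\<Sum>i<k. tunit i (p i))"
  \<comment> \<open>y approximates x at indices below k only, and the form sees no others.\<close>
  have yi: "y i = p i" if "i < k" for i
  proof
    fix v
    have "y i v = (\<Sum>j<k. tunit j (p j) i v)" by (simp only: y_def sum_fun_apply)
    also have "\<dots> = (\<Sum>j<k. if j = i then p j v else 0)" by (intro sum.cong refl) (auto simp: tunit_def)
    also have "\<dots> = p i v" by (simp only: sum.delta[OF finite_lessThan] lessThan_iff that if_True)
    finally show "y i v = p i v" .
  qed
  have ent: "cmod (\<phi> (adj ((x - y) i) \<circ> (x - y) j) $$ (i, j)) \<le> \<delta> * \<delta>" if ij: "i < k" "j < k" for i j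
  proof -
    have z: "(x - y) l = x l - p l" if "l < k" for l using yi[OF that] by simp
    have xp: "x l - p l \<in> cstar T" for l
      using x star_polys_cstar[OF p(1)] op_system_diff[OF A] by (simp add: tuples_def)
    have "op_bound (adj (x i - p i) \<circ> (x j - p j)) (\<delta> * \<delta>)"
      by (intro op_bound_comp op_bound_adj bounded_op_cstar[OF T xp] p)
    then show ?thesis unfolding z[OF ij(1)] z[OF ij(2)]
      by (intro ucp_map_entry_bound[OF A ucp _ _ ij] cstar_mult cstar_adj xp)
  qed
  have "Re (stine k \<phi> (x - y) (x - y)) \<le> cmod (stine k \<phi> (x - y) (x - y))" by (rule complex_Re_le_cmod)
  also have "\<dots> \<le> (\<Sum>i<k. \<Sum>j<k. cmod (\<phi> (adj ((x - y) i) \<circ> (x - y) j) $$ (i, j)))"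
    unfolding stine_def mtrace_def by (intro order_trans[OF norm_sum] sum_mono norm_sum)
  also have "\<dots> \<le> (\<Sum>i<k. \<Sum>j<k. \<delta> * \<delta>)" by (intro sum_mono ent) auto
  also have "\<dots> = real k * real k * (\<delta> * \<delta>)" by simp
  also have "\<dots> < \<epsilon>"
  proof -
    have "real k * real k * \<epsilon> < \<epsilon> * (2 * (real k * real k + 1))" using \<open>\<epsilon> > 0\<close> by (simp add: algebra_simps add_pos_nonneg)
    then show ?thesis unfolding \<delta>(2) using den by (simp add: divide_less_eq)
  qed
  finally show ?thesis using span[of k] unfolding y_def by blast
qed

section \<open>The Stinespring representation\<close>

definition tact :: "('h::chilbert \<Rightarrow> 'h) \<Rightarrow> (nat \<Rightarrow> 'h \<Rightarrow> 'h) \<Rightarrow> (nat \<Rightarrow> 'h \<Rightarrow> 'h)" where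
  "tact a x = (\<lambda>i. a \<circ> x i)"

text \<open>Purity stated for the functional of \<omega>, because an invariant subspace splits this
  functional into two vector functionals.\<close>

definition functional_pure :: "('h::chilbert \<Rightarrow> 'h) set \<Rightarrow> nat \<Rightarrow> (('h \<Rightarrow> 'h) \<Rightarrow> complex mat) \<Rightarrow> bool" where
  "functional_pure A k \<omega> \<longleftrightarrow> (\<forall>g1 g2. posfun rscale (entries_in A) (accretive k A) g1 \<longrightarrow>
     posfun rscale (entries_in A) (accretive k A) g2 \<longrightarrow>
     (\<forall>C\<in>entries_in A. g1 C + g2 C = Re (mtrace k \<omega> C)) \<longrightarrow>
     (\<exists>t. \<forall>C\<in>entries_in A. g1 C = t * Re (mtrace k \<omega> C)))"

text \<open>The output of Gram-Schmidt for the semi-inner product of \<omega>; I is the set of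
  indices at which e is a unit vector and not a null vector.\<close>

locale stinespring =
  fixes T :: "'h::chilbert \<Rightarrow> 'h" and k :: nat and \<omega> :: "('h \<Rightarrow> 'h) \<Rightarrow> complex mat"
    and e :: "nat \<Rightarrow> nat \<Rightarrow> 'h \<Rightarrow> 'h" and I :: "nat set"
  assumes T: "bounded_op T" and ucp: "ucp_map (cstar T) k \<omega>" and e_in: "\<And>n. e n \<in> tuples T"
    and ON: "\<And>m n. stine k \<omega> (e m) (e n) = (if m = n \<and> n \<in> I then 1 else 0)"
    and conv: "\<And>x. x \<in> tuples T \<Longrightarrow>
      (\<lambda>N. Re (stine k \<omega> (semi_inner.resid tscale (stine k \<omega>) e N x) (semi_inner.resid tscale (stine k \<omega>) e N x))) \<longlonglongrightarrow> 0"
begin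

abbreviation "A \<equiv> cstar T"
abbreviation "X \<equiv> tuples T"
abbreviation "B \<equiv> stine k \<omega>"

lemma cp: "cp_map A k \<omega>" and unit: "\<omega> id = 1\<^sub>m k"
  using ucp by (auto simp: ucp_map_def)

lemma A_sys: "op_system A"
  by (rule op_system_cstar[OF T])

lemma A_bounded: "a \<in> A \<Longrightarrow> bounded_op a"
  by (rule bounded_op_cstar[OF T])

sublocale semi_inner "tuples T" tscale "stine k \<omega>"
  by (rule semi_inner_stine[OF T cp])

section \<open>Coordinates of the Stinespring space\<close>

lemma e_semi_orthonormal: "semi_orthonormal e N"
  using e_in ON by (simp add: semi_orthonormal_def)

text \<open>By Cauchy-Schwarz the inner product of the two residuals vanishes in the limit: one of
  them tends to zero while the other stays bounded by y.\<close>

lemma Parseval: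
  assumes x: "x \<in> X" and y: "y \<in> X"
  shows "(\<lambda>n. cnj (B (e n) x) * B (e n) y) sums B x y"
proof -
  have rX: "resid e N z \<in> X" if "z \<in> X" for N z using resid_in e_in that by blast
  have b: "cmod (B (resid e N x) (resid e N y)) \<le> sqrt (Re (B (resid e N x) (resid e N x)) * Re (B y y))" for N
  proof (rule real_le_rsqrt)
    have "(cmod (B (resid e N x) (resid e N y)))\<^sup>2 \<le> Re (B (resid e N x) (resid e N x)) * Re (B (resid e N y) (resid e N y))"
      by (rule B_Cauchy_Schwarz[OF rX[OF x] rX[OF y]])
    also have "\<dots> \<le> Re (B (resid e N x) (resid e N x)) * Re (B y y)"
      by (rule mult_left_mono[OF _ B_nonneg[OF rX[OF x]]])
        (simp add: norm_resid[OF e_semi_orthonormal y] sum_nonneg)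
    finally show "(cmod (B (resid e N x) (resid e N y)))\<^sup>2 \<le> Re (B (resid e N x) (resid e N x)) * Re (B y y)" .
  qed
  have "(\<lambda>N. sqrt (Re (B (resid e N x) (resid e N x)) * Re (B y y))) \<longlonglongrightarrow> sqrt (0 * Re (B y y))"
    by (intro tendsto_intros conv x)
  then have "(\<lambda>N. sqrt (Re (B (resid e N x) (resid e N x)) * Re (B y y))) \<longlonglongrightarrow> 0" by simp
  then have "(\<lambda>N. B (resid e N x) (resid e N y)) \<longlonglongrightarrow> 0"
    by (rule null_le_tendsto[rotated]) (simp add: b)
  then have "(\<lambda>N. B x y - B (resid e N x) (resid e N y)) \<longlonglongrightarrow> B x y - 0" by (intro tendsto_intros)
  then show ?thesis unfolding sums_def B_resid_resid[OF e_semi_orthonormal x y] by simp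
qed

lemma coord_l2: assumes x: "x \<in> X" shows "(\<lambda>n. B (e n) x) \<in> l2"
proof -
  have "(\<Sum>n<N. (cmod (B (e n) x))\<^sup>2) \<le> Re (B x x)" for N
  proof -
    have "resid e N x \<in> X" by (rule resid_in[OF e_in x])
    then show ?thesis using norm_resid[OF e_semi_orthonormal x, of N] B_nonneg[of "resid e N x"] by simp
  qed
  then show ?thesis unfolding l2_def mem_Collect_eq by (intro summableI_nonneg_bounded) auto
qed

text \<open>Replaces the quotient map to the Hilbert space: it preserves inner products and sends
  exactly the null tuples to zero.\<close>

definition U :: "(nat \<Rightarrow> 'h \<Rightarrow> 'h) \<Rightarrow> l2t" where
  "U x = Abs_l2t (\<lambda>n. B (e n) x)"

lemma U_fun: "x \<in> X \<Longrightarrow> l2_fun (U x) n = B (e n) x"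
  by (simp add: U_def Abs_l2t_inverse coord_l2)

lemma U_inner: "x \<in> X \<Longrightarrow> y \<in> X \<Longrightarrow> cinner (U x) (U y) = B x y"
  using Parseval[of x y] by (simp add: cinner_l2t_def l2inner_def U_fun sums_iff)

lemma U_norm: "x \<in> X \<Longrightarrow> (cnorm (U x))\<^sup>2 = Re (B x x)"
  by (simp add: cnorm_power2 U_inner)

lemma U_add: "x \<in> X \<Longrightarrow> y \<in> X \<Longrightarrow> U (x + y) = U x + U y"
  unfolding l2t_eq_iff l2_fun_ops using U_fun[OF X_add] B_add[OF e_in] by (simp add: U_fun)

lemma U_sc: "x \<in> X \<Longrightarrow> U (tscale c x) = scaleC c (U x)"
  unfolding l2t_eq_iff l2_fun_ops using U_fun[OF X_sc] B_sc[OF e_in] by (simp add: U_fun)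

lemma U_zero: "U 0 = 0"
  unfolding l2t_eq_iff l2_fun_ops using U_fun[OF X_zero] B_zero_right[OF e_in] by simp

lemma U_lincomb: "(\<And>m. y m \<in> X) \<Longrightarrow> U (\<Sum>m<(M::nat). tscale (z m) (y m)) = (\<Sum>m<M. scaleC (z m) (U (y m)))"
proof (induction M)
  case 0
  show ?case by (simp only: lessThan_0 sum.empty U_zero)
next
  case (Suc M)
  have "U ((\<Sum>m<M. tscale (z m) (y m)) + tscale (z M) (y M)) = U (\<Sum>m<M. tscale (z m) (y m)) + U (tscale (z M) (y M))"
    by (intro U_add lincomb_in X_sc Suc.prems)
  then show ?case using Suc by (simp only: sum.lessThan_Suc U_sc)
qed

text \<open>The closure of the range of U, hence the Stinespring Hilbert space: all of l2 if I is
  everything, a copy of C^d if I = {..<d}.\<close>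

definition K :: "l2t set" where
  "K = {f. \<forall>n. n \<notin> I \<longrightarrow> l2_fun f n = 0}"

lemma csubspace_K: "csubspace K"
  by (simp add: csubspace_def K_def l2_fun_ops)

lemma U_in_K: assumes x: "x \<in> X" shows "U x \<in> K"
proof -
  have "B (e n) x = 0" if "n \<notin> I" for n
  proof -
    have "B x (e n) = 0" using B_null[OF x e_in] ON that by simp
    then show ?thesis using B_conj[OF x e_in] by simp
  qed
  then show ?thesis by (simp add: K_def U_fun[OF x])
qed

text \<open>Lifts the truncations of a sequence to tuples; this is how density of the range of U in
  K is used.\<close>

definition trunc :: "l2t \<Rightarrow> nat \<Rightarrow> nat \<Rightarrow> 'h \<Rightarrow> 'h" where
  "trunc f N = (\<Sum>n<N. tscale (l2_fun f n) (e n))"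

lemma trunc_in: "trunc f N \<in> X"
  unfolding trunc_def by (rule lincomb_in[OF e_in])

lemma U_trunc_fun:
  assumes f: "f \<in> K"
  shows "l2_fun (U (trunc f N)) m = (if m < N then l2_fun f m else 0)"
proof -
  have "l2_fun (U (trunc f N)) m = (\<Sum>n<N. l2_fun f n * B (e m) (e n))"
    unfolding U_fun[OF trunc_in] unfolding trunc_def by (rule B_lincomb_right[OF e_in e_in])
  also have "\<dots> = (\<Sum>n<N. if n = m then l2_fun f n else 0)"
    by (intro sum.cong refl) (use f in \<open>auto simp: ON K_def\<close>)
  also have "\<dots> = (if m < N then l2_fun f m else 0)"
    by (simp only: sum.delta[OF finite_lessThan] lessThan_iff)
  finally show ?thesis .
qed

lemma trunc_tendsto:
  assumes f: "f \<in> K"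
  shows "(\<lambda>N. cnorm (U (trunc f N) - f)) \<longlonglongrightarrow> 0"
proof -
  have s: "summable (\<lambda>m. (cmod (l2_fun f m))\<^sup>2)" using l2_fun[of f] by (simp add: l2_def)
  have eq: "cnorm (U (trunc f N) - f) = sqrt ((\<Sum>m. (cmod (l2_fun f m))\<^sup>2) - (\<Sum>m<N. (cmod (l2_fun f m))\<^sup>2))" for N
  proof -
    have t: "(\<lambda>m. (cmod (l2_fun (U (trunc f N) - f) m))\<^sup>2)
        = (\<lambda>m. (cmod (l2_fun f m))\<^sup>2 - (if m \<in> {..<N} then (cmod (l2_fun f m))\<^sup>2 else 0))"
      by (rule ext) (simp add: l2_fun_ops U_trunc_fun[OF f])
    have fs: "(\<lambda>m. if m \<in> {..<N} then (cmod (l2_fun f m))\<^sup>2 else 0) sums (\<Sum>m<N. (cmod (l2_fun f m))\<^sup>2)"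
      by (rule sums_If_finite_set) simp
    have "(\<lambda>m. (cmod (l2_fun f m))\<^sup>2 - (if m \<in> {..<N} then (cmod (l2_fun f m))\<^sup>2 else 0)) sums
        ((\<Sum>m. (cmod (l2_fun f m))\<^sup>2) - (\<Sum>m<N. (cmod (l2_fun f m))\<^sup>2))"
      by (rule sums_diff[OF summable_sums[OF s] fs])
    then show ?thesis unfolding cnorm_l2t l2norm_def t by (simp add: sums_iff)
  qed
  have "(\<lambda>N. \<Sum>m<N. (cmod (l2_fun f m))\<^sup>2) \<longlonglongrightarrow> (\<Sum>m. (cmod (l2_fun f m))\<^sup>2)"
    using summable_LIMSEQ[OF s] .
  then have "(\<lambda>N. sqrt ((\<Sum>m. (cmod (l2_fun f m))\<^sup>2) - (\<Sum>m<N. (cmod (l2_fun f m))\<^sup>2)))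
      \<longlonglongrightarrow> sqrt ((\<Sum>m. (cmod (l2_fun f m))\<^sup>2) - (\<Sum>m. (cmod (l2_fun f m))\<^sup>2))"
    by (intro tendsto_intros)
  then show ?thesis unfolding eq by simp
qed

section \<open>The action of the algebra on tuples\<close>

lemma tact_in: "a \<in> A \<Longrightarrow> x \<in> X \<Longrightarrow> tact a x \<in> X"
  by (simp add: tact_def tuples_def cstar_mult)

lemma tact_add: "a \<in> A \<Longrightarrow> tact a (x + y) = tact a x + tact a y"
  by (intro ext) (simp add: tact_def bounded_op_add[OF A_bounded])

lemma tact_sc: "a \<in> A \<Longrightarrow> tact a (tscale c x) = tscale c (tact a x)"
  by (intro ext) (simp add: tact_def tscale_def op_scale_def bounded_op_scaleC[OF A_bounded])

lemma tact_zero: "a \<in> A \<Longrightarrow> tact a 0 = 0"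
  by (intro ext) (simp add: tact_def bounded_op_zero[OF A_bounded])

lemma tact_lincomb: "a \<in> A \<Longrightarrow> tact a (\<Sum>m<(M::nat). tscale (z m) (y m)) = (\<Sum>m<M. tscale (z m) (tact a (y m)))"
  by (induction M) (simp_all only: lessThan_0 sum.empty tact_zero sum.lessThan_Suc tact_add tact_sc)

lemma tact_comp: "tact (a \<circ> b) x = tact a (tact b x)"
  by (simp only: tact_def comp_assoc)

lemma tact_plus: "tact (a + b) x = tact a x + tact b x"
  by (intro ext) (simp add: tact_def)

lemma tact_op_scale: "tact (op_scale c a) x = tscale c (tact a x)"
  by (intro ext) (simp add: tact_def tscale_def op_scale_def)

lemma tact_id: "tact id x = x"
  by (intro ext) (simp add: tact_def)

lemma B_tact:
  assumes "a \<in> A" "x \<in> X" "y \<in> X"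
  shows "B (tact a x) y = B x (tact (adj a) y)"
proof -
  have "adj (tact a x i) \<circ> y j = adj (x i) \<circ> tact (adj a) y j" for i j
    unfolding tact_def using adj_comp[OF A_bounded A_bounded, of a "x i"] assms
    by (simp only: comp_assoc tuples_def mem_Collect_eq)
  then show ?thesis unfolding stine_def by (simp only:)
qed

lemma B_tact_right:
  assumes "a \<in> A" "x \<in> X" "y \<in> X"
  shows "B x (tact a y) = B (tact (adj a) x) y"
  using B_tact[OF cstar_adj[OF assms(1)] assms(2,3)] adj_adj[OF A_bounded[OF assms(1)]] by simp

text \<open>D is the compression y* C y of C by the operator matrix formed from the tuples. It is
  again accretive, and the functional of \<omega> at D is the sum in question.\<close>

lemma accretive_form:
  assumes C: "C \<in> accretive k A" and y: "\<And>p. y p \<in> X"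
  shows "0 \<le> Re (\<Sum>p<k. \<Sum>q<k. B (y p) (tact (C p q) (y q)))"
proof -
  have CA: "C p q \<in> A" for p q using C by (simp add: accretive_def entries_in_def)
  have yA: "y p i \<in> A" for p i using y by (simp add: tuples_def)
  define E where "E p q i j = adj (y p i) \<circ> (C p q \<circ> y q j)" for p q i j
  have EA: "E p q i j \<in> A" for p q i j unfolding E_def by (intro cstar_mult cstar_adj yA CA)
  define D where "D i j = (\<Sum>p<k. \<Sum>q<k. E p q i j)" for i j
  have DA: "D i j \<in> A" for i j unfolding D_def by (intro op_system_sum[OF A_sys] EA)
  have "Re (qform k D v) \<ge> 0" for v
  proof -
    define Y where "Y p = (\<Sum>i<k. y p i (v i))" for p
    have "qform k D v = (\<Sum>i<k. \<Sum>j<k. \<Sum>p<k. \<Sum>q<k. cinner (v i) (E p q i j (v j)))"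
      unfolding qform_def D_def by (simp add: sum_fun_apply cinner_sum_right)
    also have "\<dots> = (\<Sum>p<k. \<Sum>q<k. \<Sum>i<k. \<Sum>j<k. cinner (v i) (E p q i j (v j)))" by (rule sum_swap4)
    also have "\<dots> = (\<Sum>p<k. \<Sum>q<k. cinner (Y p) (C p q (Y q)))"
    proof (rule sum.cong[OF refl], rule sum.cong[OF refl])
      fix p q
      have "(\<Sum>i<k. \<Sum>j<k. cinner (v i) (E p q i j (v j))) = (\<Sum>i<k. \<Sum>j<k. cinner (y p i (v i)) (C p q (y q j (v j))))"
        by (intro sum.cong refl) (simp add: E_def cinner_adj[OF A_bounded[OF yA]])
      also have "\<dots> = cinner (Y p) (C p q (Y q))"
        by (simp add: Y_def cinner_sum_left cinner_sum_right bounded_op_sum[OF A_bounded[OF CA]])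
          (rule sum.swap)
      finally show "(\<Sum>i<k. \<Sum>j<k. cinner (v i) (E p q i j (v j))) = cinner (Y p) (C p q (Y q))" .
    qed
    also have "\<dots> = qform k C Y" by (simp add: qform_def)
    finally show ?thesis using C by (simp add: accretive_def)
  qed
  then have "D \<in> accretive k A" using DA by (simp add: accretive_def entries_in_def)
  then have "0 \<le> Re (mtrace k \<omega> D)" using posfun_nonneg[OF A_sys posfun_of_cp_map[OF A_sys cp]] by blast
  moreover have "mtrace k \<omega> D = (\<Sum>p<k. \<Sum>q<k. B (y p) (tact (C p q) (y q)))"
  proof -
    have lin: "mat_linear A k \<omega>" by (rule cp_map_mat_linear[OF cp])
    have "mtrace k \<omega> D = (\<Sum>i<k. \<Sum>j<k. \<Sum>p<k. \<Sum>q<k. \<omega> (E p q i j) $$ (i, j))"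
      unfolding mtrace_def
    proof (rule sum.cong[OF refl], rule sum.cong[OF refl])
      fix i j assume "i \<in> {..<k}" "j \<in> {..<k}"
      then have ij: "i < k" "j < k" by auto
      have "\<omega> (D i j) $$ (i, j) = (\<Sum>p<k. \<omega> (\<Sum>q<k. E p q i j) $$ (i, j))"
        unfolding D_def by (rule mat_linear_entry_sum[OF A_sys lin ij]) (intro op_system_sum[OF A_sys] EA)
      also have "\<dots> = (\<Sum>p<k. \<Sum>q<k. \<omega> (E p q i j) $$ (i, j))"
        by (rule sum.cong[OF refl], rule mat_linear_entry_sum[OF A_sys lin ij EA])
      finally show "\<omega> (D i j) $$ (i, j) = (\<Sum>p<k. \<Sum>q<k. \<omega> (E p q i j) $$ (i, j))" .
    qed
    also have "\<dots> = (\<Sum>p<k. \<Sum>q<k. \<Sum>i<k. \<Sum>j<k. \<omega> (E p q i j) $$ (i, j))" by (rule sum_swap4)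
    finally show ?thesis unfolding stine_def mtrace_def tact_def E_def .
  qed
  ultimately show ?thesis by simp
qed

text \<open>c^2 - a* a is positive. Placed in the corner of an otherwise zero matrix it is
  accretive, and the accretive form evaluates to the difference of the two sides. For k = 0 the form
  is zero.\<close>

lemma tact_bound:
  assumes a: "a \<in> A" "op_bound a c" and x: "x \<in> X"
  shows "Re (B (tact a x) (tact a x)) \<le> c\<^sup>2 * Re (B x x)"
proof (cases "k = 0")
  case True
  then show ?thesis by (simp add: stine_def mtrace_def)
next
  case False
  have aa: "adj a \<in> A" using a by (simp add: cstar_adj)
  define d where "d = op_scale (complex_of_real (c\<^sup>2)) id + op_scale (-1) (adj a \<circ> a)"
  have dA: "d \<in> A" unfolding d_def by (intro op_systemD(2)[OF A_sys] cstar_scale cstar_id cstar_mult aa a)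
  have C: "eunit 0 0 d \<in> accretive k A"
  proof -
    have "0 \<le> Re (qform k (eunit 0 0 d) v)" for v
    proof -
      have "qform k (eunit 0 0 d) v = (\<Sum>i<k. \<Sum>j<k. if j = 0 then (if i = 0 then cinner (v i) (d (v j)) else 0) else 0)"
        unfolding qform_def by (intro sum.cong refl) (auto simp: eunit_def)
      also have "\<dots> = cinner (v 0) (d (v 0))"
        using False by (simp only: sum.delta[OF finite_lessThan] lessThan_iff) simp
      also have "\<dots> = complex_of_real (c\<^sup>2 * (cnorm (v 0))\<^sup>2 - (cnorm (a (v 0)))\<^sup>2)"
        using cinner_adj[OF A_bounded[OF a(1)], of "v 0" "a (v 0)"]
        by (simp add: d_def op_scale_def cinner_linear cinner_self)
      finally have "Re (qform k (eunit 0 0 d) v) = c\<^sup>2 * (cnorm (v 0))\<^sup>2 - (cnorm (a (v 0)))\<^sup>2" by simp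
      moreover have "(cnorm (a (v 0)))\<^sup>2 \<le> (c * cnorm (v 0))\<^sup>2"
        using a(2) by (intro power_mono) (auto simp: op_bound_def)
      ultimately show ?thesis by (simp add: power_mult_distrib)
    qed
    then show ?thesis using entries_in_eunit[OF A_sys dA] by (simp add: accretive_def)
  qed
  have t0: "tact 0 x = 0" by (intro ext) (simp add: tact_def)
  have "0 \<le> Re (\<Sum>p<k. \<Sum>q<k. B x (tact (eunit 0 0 d p q) x))" by (rule accretive_form[OF C x])
  also have "(\<Sum>p<k. \<Sum>q<k. B x (tact (eunit 0 0 d p q) x)) = (\<Sum>p<k. \<Sum>q<k. if q = 0 then (if p = 0 then B x (tact d x) else 0) else 0)"
    by (intro sum.cong refl) (auto simp: eunit_def t0 B_zero_right[OF x])
  also have "\<dots> = B x (tact d x)"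
    using False by (simp only: sum.delta[OF finite_lessThan] lessThan_iff) simp
  also have "tact d x = tscale (complex_of_real (c\<^sup>2)) x + tscale (-1) (tact (adj a) (tact a x))"
    unfolding d_def tact_plus tact_op_scale tact_id tact_comp ..
  also have "B x \<dots> = complex_of_real (c\<^sup>2) * B x x - B (tact a x) (tact a x)"
    using B_add[OF x X_sc[OF x] X_sc[OF tact_in[OF aa tact_in[OF a(1) x]]]] B_sc[OF x x]
      B_sc[OF x tact_in[OF aa tact_in[OF a(1) x]]] B_tact[OF a(1) x tact_in[OF a(1) x]] by simp
  finally show ?thesis by simp
qed

text \<open>Defined through its coefficients against a* e_m instead of by continuous extension of U
  x \<mapsto> U (a x). This makes it total and linear in f at once, at the price of proving square
  summability. It vanishes on the complement of K, so laws such as \<pi>(1) = 1 are stated on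
  K.\<close>

definition \<pi> :: "('h \<Rightarrow> 'h) \<Rightarrow> l2t \<Rightarrow> l2t" where
  "\<pi> a f = Abs_l2t (\<lambda>m. cinner (U (tact (adj a) (e m))) f)"

text \<open>Duality: with coefficients z_m and g = \<Sum> z_m e_m the partial sum s equals <U (a*
  g), f>. The action bound and |g|^2 \<le> s give s^2 \<le> c^2 s |f|^2, and s cancels.\<close>

lemma \<pi>_partial_sums:
  assumes a: "a \<in> A" "op_bound a c"
  shows "(\<Sum>m<M. (cmod (cinner (U (tact (adj a) (e m))) f))\<^sup>2) \<le> (c * cnorm f)\<^sup>2"
proof -
  define z where "z m = cinner (U (tact (adj a) (e m))) f" for m
  define s where "s = (\<Sum>m<M. (cmod (z m))\<^sup>2)"
  have aa: "adj a \<in> A" using a by (simp add: cstar_adj)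
  have tX: "tact (adj a) (e m) \<in> X" for m by (rule tact_in[OF aa e_in])
  define g where "g = (\<Sum>m<M. tscale (z m) (e m))"
  have gX: "g \<in> X" unfolding g_def by (rule lincomb_in[OF e_in])
  have sq: "cnj w * w = complex_of_real ((cmod w)\<^sup>2)" for w by (metis complex_norm_square mult.commute)
  have "U (tact (adj a) g) = (\<Sum>m<M. scaleC (z m) (U (tact (adj a) (e m))))"
    unfolding g_def tact_lincomb[OF aa] by (rule U_lincomb[OF tX])
  then have "cinner (U (tact (adj a) g)) f = (\<Sum>m<M. cnj (z m) * z m)"
    by (simp add: cinner_sum_left cinner_scaleC_left z_def)
  also have "\<dots> = complex_of_real s" unfolding s_def sq by simp
  finally have E: "cinner (U (tact (adj a) g)) f = complex_of_real s" .
  have s0: "0 \<le> s" by (simp add: s_def sum_nonneg)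
  have "s = cmod (cinner (U (tact (adj a) g)) f)" unfolding E using s0 by simp
  also have "\<dots> \<le> cnorm (U (tact (adj a) g)) * cnorm f" by (rule Cauchy_Schwarz_cinner)
  finally have 1: "s \<le> cnorm (U (tact (adj a) g)) * cnorm f" .
  have "B g g = (\<Sum>m<M. cnj (z m) * B (e m) g)" unfolding g_def using B_lincomb_left[OF gX[unfolded g_def] e_in] by simp
  also have "\<dots> = (\<Sum>m<M. complex_of_real (if m \<in> I then (cmod (z m))\<^sup>2 else 0))"
  proof (rule sum.cong[OF refl])
    fix m assume m: "m \<in> {..<M}"
    have "B (e m) g = (\<Sum>n<M. z n * B (e m) (e n))" unfolding g_def by (rule B_lincomb_right[OF e_in e_in])
    also have "\<dots> = (\<Sum>n<M. if n = m then (if m \<in> I then z n else 0) else 0)"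
      by (intro sum.cong refl) (auto simp: ON)
    also have "\<dots> = (if m \<in> I then z m else 0)"
      using m by (simp only: sum.delta[OF finite_lessThan] if_True)
    finally show "cnj (z m) * B (e m) g = complex_of_real (if m \<in> I then (cmod (z m))\<^sup>2 else 0)"
      by (simp only: sq if_distrib[of "\<lambda>x. cnj (z m) * x"] if_distrib[of complex_of_real] of_real_0 mult_zero_right)
  qed
  finally have "Re (B g g) = (\<Sum>m<M. if m \<in> I then (cmod (z m))\<^sup>2 else 0)" by simp
  \<comment> \<open>Only an inequality, since the e m with m outside I are null.\<close>
  also have "\<dots> \<le> s" unfolding s_def by (intro sum_mono) auto
  finally have 2: "Re (B g g) \<le> s" .
  have "(cnorm (U (tact (adj a) g)))\<^sup>2 \<le> c\<^sup>2 * Re (B g g)"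
    using tact_bound[OF aa op_bound_adj[OF A_bounded[OF a(1)] a(2)] gX] U_norm[OF tact_in[OF aa gX]] by simp
  also have "\<dots> \<le> c\<^sup>2 * s" using 2 by (intro mult_left_mono) auto
  finally have 3: "(cnorm (U (tact (adj a) g)))\<^sup>2 \<le> c\<^sup>2 * s" .
  have "s * s \<le> (cnorm (U (tact (adj a) g)) * cnorm f)\<^sup>2"
    using 1 s0 by (simp only: power2_eq_square) (intro mult_mono, auto)
  also have "\<dots> \<le> (c\<^sup>2 * s) * (cnorm f)\<^sup>2"
    unfolding power_mult_distrib by (rule mult_right_mono[OF 3]) simp
  finally have "s * s \<le> (c * cnorm f)\<^sup>2 * s" by (simp add: power_mult_distrib mult_ac)
  then have "s \<le> (c * cnorm f)\<^sup>2"
  proof (cases "s = 0")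
    case False
    then show ?thesis using s0 \<open>s * s \<le> (c * cnorm f)\<^sup>2 * s\<close> mult_right_le_imp_le[of s s] by simp
  qed simp
  then show ?thesis by (simp add: s_def z_def)
qed

lemma \<pi>_l2: assumes a: "a \<in> A" shows "(\<lambda>m. cinner (U (tact (adj a) (e m))) f) \<in> l2"
proof -
  obtain c where "op_bound a c" using bounded_op_bound[OF A_bounded[OF a]] ..
  then show ?thesis unfolding l2_def mem_Collect_eq
    using \<pi>_partial_sums[OF a] by (intro summableI_nonneg_bounded) auto
qed

lemma \<pi>_fun: "a \<in> A \<Longrightarrow> l2_fun (\<pi> a f) m = cinner (U (tact (adj a) (e m))) f"
  by (simp add: \<pi>_def Abs_l2t_inverse \<pi>_l2)

lemma \<pi>_bound:
  assumes a: "a \<in> A" "op_bound a c"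
  shows "cnorm (\<pi> a f) \<le> c * cnorm f"
proof -
  have s: "summable (\<lambda>m. (cmod (l2_fun (\<pi> a f) m))\<^sup>2)" using l2_fun[of "\<pi> a f"] by (simp add: l2_def)
  have "(\<Sum>m. (cmod (l2_fun (\<pi> a f) m))\<^sup>2) \<le> (c * cnorm f)\<^sup>2"
    by (rule suminf_le_const[OF s]) (use \<pi>_partial_sums[OF a] in \<open>simp add: \<pi>_fun[OF a(1)]\<close>)
  then have "cnorm (\<pi> a f) \<le> sqrt ((c * cnorm f)\<^sup>2)" unfolding cnorm_l2t l2norm_def by (rule real_sqrt_le_mono)
  moreover have "0 \<le> c * cnorm f" using a(2) by (simp add: op_bound_def)
  ultimately show ?thesis by simp
qed

lemma \<pi>_U: "a \<in> A \<Longrightarrow> x \<in> X \<Longrightarrow> \<pi> a (U x) = U (tact a x)"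
  unfolding l2t_eq_iff
  by (simp add: \<pi>_fun U_fun U_inner tact_in cstar_adj e_in B_tact_right)

lemma \<pi>_add_right: "a \<in> A \<Longrightarrow> \<pi> a (f + g) = \<pi> a f + \<pi> a g"
  by (simp add: l2t_eq_iff l2_fun_ops \<pi>_fun cinner_add_right)

lemma \<pi>_scale_right: "a \<in> A \<Longrightarrow> \<pi> a (scaleC c f) = scaleC c (\<pi> a f)"
  by (simp add: l2t_eq_iff l2_fun_ops \<pi>_fun cinner_scaleC_right)

lemma \<pi>_diff_right: "a \<in> A \<Longrightarrow> \<pi> a (f - g) = \<pi> a f - \<pi> a g"
  by (simp add: l2t_eq_iff l2_fun_ops \<pi>_fun cinner_diff_right)

lemma \<pi>_in_K: assumes a: "a \<in> A" shows "\<pi> a f \<in> K"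
proof -
  obtain c where c: "op_bound a c" using bounded_op_bound[OF A_bounded[OF a]] ..
  have "U (tact (adj a) (e m)) = 0" if "m \<notin> I" for m
  proof -
    have aa: "adj a \<in> A" by (rule cstar_adj[OF a])
    have "(cnorm (U (tact (adj a) (e m))))\<^sup>2 \<le> c\<^sup>2 * Re (B (e m) (e m))"
      using tact_bound[OF aa op_bound_adj[OF A_bounded[OF a] c] e_in] U_norm[OF tact_in[OF aa e_in]] by simp
    also have "\<dots> = 0" using that by (simp add: ON)
    finally show ?thesis by simp
  qed
  then show ?thesis by (simp add: K_def \<pi>_fun[OF a])
qed

lemma \<pi>_tendsto:
  assumes a: "a \<in> A" and g: "(\<lambda>N. cnorm (g N - f)) \<longlonglongrightarrow> 0"
  shows "(\<lambda>N. cnorm (\<pi> a (g N) - \<pi> a f)) \<longlonglongrightarrow> 0"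
proof -
  obtain c where c: "op_bound a c" using bounded_op_bound[OF A_bounded[OF a]] ..
  have "(\<lambda>N. c * cnorm (g N - f)) \<longlonglongrightarrow> 0" using tendsto_mult_right_zero[OF g] .
  then show ?thesis
    by (rule null_le_tendsto[rotated]) (simp add: \<pi>_diff_right[OF a, symmetric] \<pi>_bound[OF a c])
qed

text \<open>Identities for the representation are verified on the range of U, where they are
  identities for tuples, and reach K by continuity along truncations.\<close>

lemma dense_eqI:
  assumes F: "\<And>g. (\<lambda>N. cnorm (g N - f)) \<longlonglongrightarrow> 0 \<Longrightarrow> (\<lambda>N. cnorm (F (g N) - F f)) \<longlonglongrightarrow> 0"
    and G: "\<And>g. (\<lambda>N. cnorm (g N - f)) \<longlonglongrightarrow> 0 \<Longrightarrow> (\<lambda>N. cnorm (G (g N) - G f)) \<longlonglongrightarrow> 0"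
    and eq: "\<And>x. x \<in> X \<Longrightarrow> F (U x) = G (U x)" and f: "f \<in> K"
  shows "F f = (G f :: 'z::chilbert)"
  using cnorm_tendsto_unique[OF F[OF trunc_tendsto[OF f]], of "G f"] G[OF trunc_tendsto[OF f]]
  by (simp add: eq[OF trunc_in])

lemma \<pi>_comp:
  assumes a: "a \<in> A" and b: "b \<in> A" and f: "f \<in> K"
  shows "\<pi> (a \<circ> b) f = \<pi> a (\<pi> b f)"
proof (rule dense_eqI[OF _ _ _ f])
  have ab: "a \<circ> b \<in> A" by (rule cstar_mult[OF a b])
  show "\<pi> (a \<circ> b) (U x) = \<pi> a (\<pi> b (U x))" if "x \<in> X" for x
    unfolding \<pi>_U[OF ab that] \<pi>_U[OF b that] \<pi>_U[OF a tact_in[OF b that]] tact_comp ..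
  show "(\<lambda>N. cnorm (\<pi> (a \<circ> b) (g N) - \<pi> (a \<circ> b) f)) \<longlonglongrightarrow> 0" if "(\<lambda>N. cnorm (g N - f)) \<longlonglongrightarrow> 0" for g
    by (rule \<pi>_tendsto[OF ab that])
  show "(\<lambda>N. cnorm (\<pi> a (\<pi> b (g N)) - \<pi> a (\<pi> b f))) \<longlonglongrightarrow> 0" if "(\<lambda>N. cnorm (g N - f)) \<longlonglongrightarrow> 0" for g
    by (rule \<pi>_tendsto[OF a \<pi>_tendsto[OF b that]])
qed

lemma \<pi>_plus:
  assumes a: "a \<in> A" and b: "b \<in> A" and f: "f \<in> K"
  shows "\<pi> (a + b) f = \<pi> a f + \<pi> b f"
proof (rule dense_eqI[OF _ _ _ f])
  have ab: "a + b \<in> A" by (rule op_systemD(2)[OF A_sys a b])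
  show "\<pi> (a + b) (U x) = \<pi> a (U x) + \<pi> b (U x)" if "x \<in> X" for x
    unfolding \<pi>_U[OF ab that] \<pi>_U[OF b that] \<pi>_U[OF a that] tact_plus
    by (rule U_add[OF tact_in[OF a that] tact_in[OF b that]])
  show "(\<lambda>N. cnorm (\<pi> (a + b) (g N) - \<pi> (a + b) f)) \<longlonglongrightarrow> 0" if "(\<lambda>N. cnorm (g N - f)) \<longlonglongrightarrow> 0" for g
    by (rule \<pi>_tendsto[OF ab that])
  show "(\<lambda>N. cnorm (\<pi> a (g N) + \<pi> b (g N) - (\<pi> a f + \<pi> b f))) \<longlonglongrightarrow> 0" if g: "(\<lambda>N. cnorm (g N - f)) \<longlonglongrightarrow> 0" for g
  proof (rule null_le_tendsto)
    show "(\<lambda>N. cnorm (\<pi> a (g N) - \<pi> a f) + cnorm (\<pi> b (g N) - \<pi> b f)) \<longlonglongrightarrow> 0"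
      using tendsto_add[OF \<pi>_tendsto[OF a g] \<pi>_tendsto[OF b g]] by simp
    show "\<forall>\<^sub>F N in sequentially. norm (cnorm (\<pi> a (g N) + \<pi> b (g N) - (\<pi> a f + \<pi> b f)))
        \<le> cnorm (\<pi> a (g N) - \<pi> a f) + cnorm (\<pi> b (g N) - \<pi> b f)"
      using cnorm_triangle[of "\<pi> a (g N) - \<pi> a f" "\<pi> b (g N) - \<pi> b f" for N]
      by (intro always_eventually allI) (simp add: algebra_simps)
  qed
qed

lemma \<pi>_op_scale:
  assumes a: "a \<in> A" and f: "f \<in> K"
  shows "\<pi> (op_scale c a) f = scaleC c (\<pi> a f)"
proof (rule dense_eqI[OF _ _ _ f])
  have ca: "op_scale c a \<in> A" by (rule cstar_scale[OF a])
  show "\<pi> (op_scale c a) (U x) = scaleC c (\<pi> a (U x))" if "x \<in> X" for x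
    unfolding \<pi>_U[OF ca that] \<pi>_U[OF a that] tact_op_scale by (rule U_sc[OF tact_in[OF a that]])
  show "(\<lambda>N. cnorm (\<pi> (op_scale c a) (g N) - \<pi> (op_scale c a) f)) \<longlonglongrightarrow> 0" if "(\<lambda>N. cnorm (g N - f)) \<longlonglongrightarrow> 0" for g
    by (rule \<pi>_tendsto[OF ca that])
  show "(\<lambda>N. cnorm (scaleC c (\<pi> a (g N)) - scaleC c (\<pi> a f))) \<longlonglongrightarrow> 0" if g: "(\<lambda>N. cnorm (g N - f)) \<longlonglongrightarrow> 0" for g
    using tendsto_mult_right_zero[OF \<pi>_tendsto[OF a g], of "cmod c"]
    by (simp add: scaleC_diff_right[symmetric] cnorm_scaleC)
qed

lemma \<pi>_id:
  assumes f: "f \<in> K"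
  shows "\<pi> id f = f"
proof (rule dense_eqI[OF _ _ _ f])
  show "\<pi> id (U x) = U x" if "x \<in> X" for x unfolding \<pi>_U[OF cstar_id that] tact_id ..
  show "(\<lambda>N. cnorm (\<pi> id (g N) - \<pi> id f)) \<longlonglongrightarrow> 0" if "(\<lambda>N. cnorm (g N - f)) \<longlonglongrightarrow> 0" for g
    by (rule \<pi>_tendsto[OF cstar_id that])
qed

lemma \<pi>_zero: "f \<in> K \<Longrightarrow> \<pi> 0 f = 0"
  using \<pi>_op_scale[OF cstar_id, of f 0] by (simp only: op_scale_zero_left scaleC_zero_left)

text \<open>The identity is known on pairs from the range of U; the two arguments are passed to the
  limit one at a time.\<close>

lemma \<pi>_adj:
  assumes a: "a \<in> A" and f: "f \<in> K" and g: "g \<in> K"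
  shows "cinner g (\<pi> a f) = cinner (\<pi> (adj a) g) f"
proof -
  have aa: "adj a \<in> A" by (rule cstar_adj[OF a])
  have 1: "cinner (U x) (\<pi> a f) = cinner (\<pi> (adj a) (U x)) f" if x: "x \<in> X" for x
  proof (rule LIMSEQ_unique)
    show "(\<lambda>N. cinner (U x) (\<pi> a (U (trunc f N)))) \<longlonglongrightarrow> cinner (U x) (\<pi> a f)"
      by (intro tendsto_cinner_right \<pi>_tendsto[OF a] trunc_tendsto[OF f])
    have "cinner (U x) (\<pi> a (U (trunc f N))) = cinner (\<pi> (adj a) (U x)) (U (trunc f N))" for N
      unfolding \<pi>_U[OF a trunc_in] \<pi>_U[OF aa x] U_inner[OF x tact_in[OF a trunc_in]] U_inner[OF tact_in[OF aa x] trunc_in]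
      by (rule B_tact_right[OF a x trunc_in])
    then show "(\<lambda>N. cinner (U x) (\<pi> a (U (trunc f N)))) \<longlonglongrightarrow> cinner (\<pi> (adj a) (U x)) f"
      using tendsto_cinner_right[OF trunc_tendsto[OF f]] by simp
  qed
  have "cinner (\<pi> a f) g = cinner f (\<pi> (adj a) g)"
  proof (rule LIMSEQ_unique)
    show "(\<lambda>N. cinner (\<pi> a f) (U (trunc g N))) \<longlonglongrightarrow> cinner (\<pi> a f) g"
      by (rule tendsto_cinner_right[OF trunc_tendsto[OF g]])
    have "cinner (\<pi> a f) (U (trunc g N)) = cinner f (\<pi> (adj a) (U (trunc g N)))" for N
      using 1[OF trunc_in, of g N] by (metis cinner_conj)
    then show "(\<lambda>N. cinner (\<pi> a f) (U (trunc g N))) \<longlonglongrightarrow> cinner f (\<pi> (adj a) g)"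
      using tendsto_cinner_right[OF \<pi>_tendsto[OF aa trunc_tendsto[OF g]]] by simp
  qed
  then show ?thesis by (metis cinner_conj)
qed

section \<open>The Stinespring isometry, vector functionals and irreducibility\<close>

definition \<xi> :: "nat \<Rightarrow> l2t" where
  "\<xi> i = U (tunit i id)"

lemma tunit_id_in: "tunit i id \<in> X"
  by (rule tunit_in_tuples[OF T cstar_id])

lemma \<xi>_in_K: "\<xi> i \<in> K"
  unfolding \<xi>_def by (rule U_in_K[OF tunit_id_in])

lemma B_tunit:
  assumes a: "a \<in> A" and ij: "i < k" "j < k"
  shows "B (tunit i id) (tact a (tunit j id)) = \<omega> a $$ (i, j)"
proof -
  have "(\<lambda>p q. adj (tunit i id p) \<circ> tact a (tunit j id) q) = eunit i j a"
    by (intro ext) (auto simp: tunit_def tact_def eunit_def bounded_op_zero[OF A_bounded[OF a]])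
  then show ?thesis unfolding stine_def using mtrace_eunit[OF A_sys cp_map_mat_linear[OF cp] ij] by simp
qed

text \<open>The dilation identity \<omega>(a) = V* \<pi>(a) V for the isometry V with V e_i = \<xi>
  i.\<close>

lemma \<xi>_form: "a \<in> A \<Longrightarrow> i < k \<Longrightarrow> j < k \<Longrightarrow> cinner (\<xi> i) (\<pi> a (\<xi> j)) = \<omega> a $$ (i, j)"
  unfolding \<xi>_def using B_tunit by (simp add: \<pi>_U tunit_id_in U_inner tact_in)

text \<open>Cyclicity: the vectors \<xi> j generate the range of U under the algebra, so an operator
  commuting with the action is determined by its values on them.\<close>

lemma U_expand:
  assumes x: "x \<in> X"
  shows "U x = (\<Sum>j<k. \<pi> (x j) (\<xi> j))"
proof -
  have xA: "x j \<in> A" for j using x by (simp add: tuples_def)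
  have tX: "tunit j (x j) \<in> X" for j by (rule tunit_in_tuples[OF T xA])
  have t: "tact (x j) (tunit j id) = tunit j (x j)" for j
    by (intro ext) (auto simp: tact_def tunit_def bounded_op_zero[OF A_bounded[OF xA]])
  define y where "y = (\<Sum>j<k. tscale 1 (tunit j (x j)))"
  have yX: "y \<in> X" unfolding y_def by (rule lincomb_in[OF tX])
  have "U y = (\<Sum>j<k. scaleC 1 (U (tunit j (x j))))" unfolding y_def by (rule U_lincomb[OF tX])
  also have "\<dots> = (\<Sum>j<k. \<pi> (x j) (\<xi> j))"
    by (intro sum.cong refl) (simp add: \<xi>_def \<pi>_U[OF xA tunit_id_in] t scaleC_one)
  finally have Uy: "U y = (\<Sum>j<k. \<pi> (x j) (\<xi> j))" .
  have yi: "y i = x i" if "i < k" for i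
  proof
    fix v
    have "y i v = (\<Sum>j<k. tscale 1 (tunit j (x j)) i v)" by (simp only: y_def sum_fun_apply)
    also have "\<dots> = (\<Sum>j<k. if j = i then x j v else 0)" by (intro sum.cong refl) (auto simp: tunit_def tscale_def op_scale_one)
    also have "\<dots> = x i v" by (simp only: sum.delta[OF finite_lessThan] lessThan_iff that if_True)
    finally show "y i v = x i v" .
  qed
  \<comment> \<open>x and y may differ at indices from k on, where the form does not look; hence
    they have the same image under U.\<close>
  have "B z x = B z y" for z unfolding stine_def mtrace_def by (intro sum.cong refl) (simp only: yi lessThan_iff)
  then have "U x = U y" unfolding l2t_eq_iff by (simp add: U_fun[OF x] U_fun[OF yX])
  then show ?thesis using Uy by simp
qed

definition vecfun :: "(nat \<Rightarrow> l2t) \<Rightarrow> 'h opmat \<Rightarrow> real" where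
  "vecfun \<eta> C = Re (\<Sum>i<k. \<Sum>j<k. cinner (\<eta> i) (\<pi> (C i j) (\<eta> j)))"

lemma vecfun_posfun:
  assumes \<eta>: "\<And>i. \<eta> i \<in> K"
  shows "posfun rscale (entries_in A) (accretive k A) (vecfun \<eta>)"
  unfolding posfun_def
proof (intro conjI ballI allI)
  show "vecfun \<eta> (C + E) = vecfun \<eta> C + vecfun \<eta> E" if "C \<in> entries_in A" "E \<in> entries_in A" for C E
  proof -
    have "cinner (\<eta> i) (\<pi> ((C + E) i j) (\<eta> j)) = cinner (\<eta> i) (\<pi> (C i j) (\<eta> j)) + cinner (\<eta> i) (\<pi> (E i j) (\<eta> j))" for i j
      using that \<pi>_plus[OF _ _ \<eta>] by (simp add: entries_in_def cinner_add_right)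
    then show ?thesis by (simp only: vecfun_def sum.distrib plus_complex.simps)
  qed
  show "vecfun \<eta> (rscale r C) = r * vecfun \<eta> C" if "C \<in> entries_in A" for C r
  proof -
    have "cinner (\<eta> i) (\<pi> (rscale r C i j) (\<eta> j)) = complex_of_real r * cinner (\<eta> i) (\<pi> (C i j) (\<eta> j))" for i j
      using that \<pi>_op_scale[OF _ \<eta>] by (simp add: entries_in_def rscale_def mscale_def cinner_scaleC_right)
    then show ?thesis unfolding vecfun_def by (simp add: sum_distrib_left[symmetric])
  qed
  fix C assume C: "C \<in> accretive k A"
  have CA: "C i j \<in> A" for i j using C by (simp add: accretive_def entries_in_def)
  \<comment> \<open>Both arguments move with N. First the second one is replaced by its limit, at a
    cost controlled by the bounded norms of the first; then the first converges.\<close>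
  have lim: "(\<lambda>N. \<Sum>i<k. \<Sum>j<k. cinner (U (trunc (\<eta> i) N)) (\<pi> (C i j) (U (trunc (\<eta> j) N))))
      \<longlonglongrightarrow> (\<Sum>i<k. \<Sum>j<k. cinner (\<eta> i) (\<pi> (C i j) (\<eta> j)))"
  proof (intro tendsto_sum)
    fix i j
    have conv: "(\<lambda>N. cnorm (\<pi> (C i j) (U (trunc (\<eta> j) N)) - \<pi> (C i j) (\<eta> j))) \<longlonglongrightarrow> 0"
      by (rule \<pi>_tendsto[OF CA trunc_tendsto[OF \<eta>]])
    have bd: "cmod (cinner (U (trunc (\<eta> i) N)) (\<pi> (C i j) (U (trunc (\<eta> j) N))) - cinner (U (trunc (\<eta> i) N)) (\<pi> (C i j) (\<eta> j)))
       \<le> cnorm (U (trunc (\<eta> i) N)) * cnorm (\<pi> (C i j) (U (trunc (\<eta> j) N)) - \<pi> (C i j) (\<eta> j))" for N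
      unfolding cinner_diff_right[symmetric] by (rule Cauchy_Schwarz_cinner)
    have "(\<lambda>N. cnorm (U (trunc (\<eta> i) N)) * cnorm (\<pi> (C i j) (U (trunc (\<eta> j) N)) - \<pi> (C i j) (\<eta> j))) \<longlonglongrightarrow> cnorm (\<eta> i) * 0"
      by (intro tendsto_mult conv tendsto_cnorm trunc_tendsto[OF \<eta>])
    then have "(\<lambda>N. cnorm (U (trunc (\<eta> i) N)) * cnorm (\<pi> (C i j) (U (trunc (\<eta> j) N)) - \<pi> (C i j) (\<eta> j))) \<longlonglongrightarrow> 0" by simp
    then have d: "(\<lambda>N. cinner (U (trunc (\<eta> i) N)) (\<pi> (C i j) (U (trunc (\<eta> j) N))) - cinner (U (trunc (\<eta> i) N)) (\<pi> (C i j) (\<eta> j))) \<longlonglongrightarrow> 0"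
      by (rule null_le_tendsto[rotated]) (simp add: bd)
    have "(\<lambda>N. cnj (cinner (\<pi> (C i j) (\<eta> j)) (U (trunc (\<eta> i) N)))) \<longlonglongrightarrow> cnj (cinner (\<pi> (C i j) (\<eta> j)) (\<eta> i))"
      by (intro tendsto_cnj tendsto_cinner_right trunc_tendsto[OF \<eta>])
    then have "(\<lambda>N. cinner (U (trunc (\<eta> i) N)) (\<pi> (C i j) (\<eta> j))) \<longlonglongrightarrow> cinner (\<eta> i) (\<pi> (C i j) (\<eta> j))"
      by (simp only: cinner_conj[symmetric])
    from tendsto_add[OF d this]
    show "(\<lambda>N. cinner (U (trunc (\<eta> i) N)) (\<pi> (C i j) (U (trunc (\<eta> j) N)))) \<longlonglongrightarrow> cinner (\<eta> i) (\<pi> (C i j) (\<eta> j))"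
      by simp
  qed
  have "0 \<le> Re (\<Sum>i<k. \<Sum>j<k. cinner (U (trunc (\<eta> i) N)) (\<pi> (C i j) (U (trunc (\<eta> j) N))))" for N
    using accretive_form[OF C trunc_in, of "\<lambda>i. \<eta> i" "\<lambda>_. N"]
    by (simp add: \<pi>_U[OF CA trunc_in] U_inner[OF trunc_in tact_in[OF CA trunc_in]])
  then show "0 \<le> vecfun \<eta> C"
    unfolding vecfun_def using LIMSEQ_le_const[OF tendsto_Re[OF lim]] by blast
qed

lemma vecfun_eunit:
  assumes \<eta>: "\<And>i. \<eta> i \<in> K" and ij: "i < k" "j < k"
  shows "vecfun \<eta> (eunit i j a) = Re (cinner (\<eta> i) (\<pi> a (\<eta> j)))"
proof -
  have "(\<Sum>p<k. \<Sum>q<k. cinner (\<eta> p) (\<pi> (eunit i j a p q) (\<eta> q)))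
      = (\<Sum>p<k. \<Sum>q<k. if q = j then (if p = i then cinner (\<eta> p) (\<pi> a (\<eta> q)) else 0) else 0)"
    by (intro sum.cong refl) (auto simp: eunit_def \<pi>_zero[OF \<eta>])
  also have "\<dots> = cinner (\<eta> i) (\<pi> a (\<eta> j))"
    by (simp only: sum.delta[OF finite_lessThan] lessThan_iff ij if_True)
  finally show ?thesis by (simp add: vecfun_def)
qed

lemma vecfun_\<xi>: "C \<in> entries_in A \<Longrightarrow> vecfun \<xi> C = Re (mtrace k \<omega> C)"
  unfolding vecfun_def mtrace_def by (simp add: entries_in_def \<xi>_form)

definition invariant :: "l2t set \<Rightarrow> bool" where
  "invariant V \<longleftrightarrow> csubspace V \<and> V \<subseteq> K \<and> (\<forall>a\<in>A. \<forall>v\<in>V. \<pi> a v \<in> V)"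

text \<open>Split \<xi> = p + q along V and its complement. By invariance the functional of \<omega>
  is the sum of the vector functionals of p and q, so purity makes the first a multiple t of it.
  Then the projection onto V scales squared norms on the range of U by the constant t, and a nonzero
  v in V forces t = 1.\<close>

theorem irreducible:
  assumes pure: "functional_pure A k \<omega>"
    and V: "invariant V" and proj: "\<And>f. f \<in> K \<Longrightarrow> \<exists>p. orth_proj V f p"
  shows "V = {0} \<or> V = K"
proof -
  have VK: "V \<subseteq> K" and VS: "csubspace V" and Vinv: "\<And>a v. a \<in> A \<Longrightarrow> v \<in> V \<Longrightarrow> \<pi> a v \<in> V"
    using V by (auto simp: invariant_def)
  have "\<forall>i. \<exists>p. orth_proj V (\<xi> i) p" using proj \<xi>_in_K by blast
  then obtain p where "\<And>i. orth_proj V (\<xi> i) (p i)" by metis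
  then have pV: "p i \<in> V" and porth: "v \<in> V \<Longrightarrow> cinner v (\<xi> i - p i) = 0" for i v by (auto simp: orth_proj_def)
  have pK: "p i \<in> K" for i using pV VK by blast
  define q where "q i = \<xi> i - p i" for i
  have qK: "q i \<in> K" for i unfolding q_def by (rule csubspace_diff[OF csubspace_K \<xi>_in_K pK])
  have qorth: "cinner v (q i) = 0" "cinner (q i) v = 0" if "v \<in> V" for i v
  proof -
    show "cinner v (q i) = 0" using porth[OF that] by (simp add: q_def)
    then show "cinner (q i) v = 0" using cinner_conj[of "q i" v] by simp
  qed
  have \<pi>q: "cinner v (\<pi> a (q j)) = 0" if "v \<in> V" "a \<in> A" for v a j
  proof -
    have "v \<in> K" using that VK by blast
    then show ?thesis unfolding \<pi>_adj[OF that(2) qK \<open>v \<in> K\<close>] by (intro qorth Vinv cstar_adj that)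
  qed
  have sum: "vecfun p C + vecfun q C = Re (mtrace k \<omega> C)" if C: "C \<in> entries_in A" for C
  proof -
    have CA: "C i j \<in> A" for i j using C by (simp add: entries_in_def)
    have "cinner (\<xi> i) (\<pi> (C i j) (\<xi> j)) = cinner (p i) (\<pi> (C i j) (p j)) + cinner (q i) (\<pi> (C i j) (q j))" for i j
    proof -
      have x: "\<xi> l = p l + q l" for l by (simp add: q_def)
      show ?thesis unfolding x
        by (simp add: \<pi>_add_right[OF CA] cinner_add_left cinner_add_right \<pi>q[OF pV CA] qorth(2)[OF Vinv[OF CA pV]])
    qed
    then have "vecfun \<xi> C = vecfun p C + vecfun q C" by (simp add: vecfun_def sum.distrib)
    then show ?thesis using vecfun_\<xi>[OF C] by simp
  qed
  obtain t where t: "\<And>C. C \<in> entries_in A \<Longrightarrow> vecfun p C = t * Re (mtrace k \<omega> C)"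
    using pure[unfolded functional_pure_def, rule_format, OF vecfun_posfun[of p, OF pK] vecfun_posfun[of q, OF qK] sum] by blast
  have tRe: "Re (cinner (p i) (\<pi> a (p j))) = t * Re (\<omega> a $$ (i, j))" if "a \<in> A" "i < k" "j < k" for a i j
    using t[OF entries_in_eunit[OF A_sys that(1)], of i j] vecfun_eunit[OF pK that(2,3)]
      mtrace_eunit[OF A_sys cp_map_mat_linear[OF cp] that(2,3)] by simp
  \<comment> \<open>Purity speaks of real parts; replacing a by \<i> a supplies the imaginary
    part.\<close>
  have tt: "cinner (p i) (\<pi> a (p j)) = complex_of_real t * cinner (\<xi> i) (\<pi> a (\<xi> j))" if a: "a \<in> A" and ij: "i < k" "j < k" for a i j
  proof -
    have ia: "op_scale \<i> a \<in> A" by (rule cstar_scale[OF a])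
    have "Re (\<i> * cinner (p i) (\<pi> a (p j))) = t * Re (\<i> * \<omega> a $$ (i, j))"
      using tRe[OF ia ij] \<pi>_op_scale[OF a pK] mat_linear_entry_scale[OF cp_map_mat_linear[OF cp] a ij]
      by (simp only: cinner_scaleC_right)
    then show ?thesis using tRe[OF a ij] \<xi>_form[OF a ij] by (simp add: complex_eq_iff)
  qed
  \<comment> \<open>The projection of U x onto V, computed from the projections of the generators
    because V and its complement are invariant.\<close>
  define P where "P x = (\<Sum>j<k. \<pi> (x j) (p j))" for x
  have sumV: "(\<Sum>j<m. f j) \<in> V" if "\<And>j. f j \<in> V" for f and m :: nat
    by (induction m) (use VS that in \<open>auto simp: csubspace_def\<close>)
  have PV: "P x \<in> V" if "x \<in> X" for x
    unfolding P_def by (rule sumV, rule Vinv[OF _ pV]) (use that in \<open>simp add: tuples_def\<close>)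
  have Porth: "cinner v (U x - P x) = 0" if "v \<in> V" "x \<in> X" for v x
  proof -
    have xA: "x j \<in> A" for j using that by (simp add: tuples_def)
    have "U x - P x = (\<Sum>j<k. \<pi> (x j) (q j))"
      unfolding U_expand[OF that(2)] P_def sum_subtractf[symmetric] q_def \<pi>_diff_right[OF xA] ..
    then show ?thesis by (simp add: cinner_sum_right \<pi>q[OF that(1) xA])
  qed
  have Pnorm: "(cnorm (P x))\<^sup>2 = t * (cnorm (U x))\<^sup>2" if x: "x \<in> X" for x
  proof -
    have xA: "x j \<in> A" for j using x by (simp add: tuples_def)
    have move: "cinner (\<pi> (x i) (f i)) (\<pi> (x j) (f j)) = cinner (f i) (\<pi> (adj (x i) \<circ> x j) (f j))"
      if f: "\<And>i. f i \<in> K" for f i j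
    proof -
      have "cinner (f i) (\<pi> (adj (x i)) (\<pi> (x j) (f j))) = cinner (\<pi> (adj (adj (x i))) (f i)) (\<pi> (x j) (f j))"
        by (rule \<pi>_adj[OF cstar_adj[OF xA] \<pi>_in_K[OF xA] f])
      then show ?thesis using adj_adj[OF A_bounded[OF xA]] \<pi>_comp[OF cstar_adj[OF xA] xA f] by simp
    qed
    have "cinner (P x) (P x) = (\<Sum>i<k. \<Sum>j<k. cinner (\<pi> (x i) (p i)) (\<pi> (x j) (p j)))"
      unfolding P_def cinner_sum_left cinner_sum_right by (rule sum.swap)
    also have "\<dots> = (\<Sum>i<k. \<Sum>j<k. complex_of_real t * cinner (\<pi> (x i) (\<xi> i)) (\<pi> (x j) (\<xi> j)))"
      by (intro sum.cong refl, unfold move[of p, OF pK] move[of \<xi>, OF \<xi>_in_K], rule tt[OF cstar_mult[OF cstar_adj[OF xA] xA]]) auto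
    also have "\<dots> = complex_of_real t * (\<Sum>i<k. \<Sum>j<k. cinner (\<pi> (x i) (\<xi> i)) (\<pi> (x j) (\<xi> j)))"
      by (simp add: sum_distrib_left)
    also have "(\<Sum>i<k. \<Sum>j<k. cinner (\<pi> (x i) (\<xi> i)) (\<pi> (x j) (\<xi> j))) = cinner (U x) (U x)"
      unfolding U_expand[OF x] cinner_sum_left cinner_sum_right by (rule sum.swap)
    finally show ?thesis unfolding cnorm_power2 by simp
  qed
  have pyth: "(cnorm (U x - P x))\<^sup>2 = (cnorm (U x))\<^sup>2 - (cnorm (P x))\<^sup>2" if "x \<in> X" for x
    using cnorm_add_power2[of "P x" "U x - P x"] Porth[OF PV[OF that] that] by simp
  show ?thesis
  proof (cases "V = {0}")
    case False
    then obtain v where v: "v \<in> V" "v \<noteq> 0" using VS by (auto simp: csubspace_def)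
    have vK: "v \<in> K" using v VK by blast
    have lim: "(\<lambda>N. cnorm (U (trunc v N) - v)) \<longlonglongrightarrow> 0" by (rule trunc_tendsto[OF vK])
    \<comment> \<open>P x - v lies in V and U x - P x is orthogonal to V, so projecting does not
      increase the distance to v.\<close>
    have le: "cnorm (P (trunc v N) - v) \<le> cnorm (U (trunc v N) - v)" for N
    proof -
      let ?x = "trunc v N"
      have "P ?x - v \<in> V" by (rule csubspace_diff[OF VS PV[OF trunc_in] v(1)])
      then have "Re (cinner (P ?x - v) (U ?x - P ?x)) = 0" using Porth[OF _ trunc_in] by simp
      then have "(cnorm (P ?x - v))\<^sup>2 \<le> (cnorm ((P ?x - v) + (U ?x - P ?x)))\<^sup>2"
        unfolding cnorm_add_power2 by simp
      moreover have "(P ?x - v) + (U ?x - P ?x) = U ?x - v" by simp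
      ultimately have "(cnorm (P ?x - v))\<^sup>2 \<le> (cnorm (U ?x - v))\<^sup>2" by simp
      then show ?thesis by (rule power2_le_imp_le) simp
    qed
    have "(\<lambda>N. cnorm (P (trunc v N) - v)) \<longlonglongrightarrow> 0"
      by (rule null_le_tendsto[OF _ lim]) (simp add: le)
    then have "(\<lambda>N. (cnorm (P (trunc v N)))\<^sup>2) \<longlonglongrightarrow> (cnorm v)\<^sup>2" by (intro tendsto_power tendsto_cnorm)
    moreover have "(\<lambda>N. t * (cnorm (U (trunc v N)))\<^sup>2) \<longlonglongrightarrow> t * (cnorm v)\<^sup>2"
      by (intro tendsto_mult tendsto_const tendsto_power tendsto_cnorm lim)
    \<comment> \<open>The approximants of v and their projections both converge to v, while their
      squared norms keep the ratio t.\<close>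
    ultimately have "(cnorm v)\<^sup>2 = t * (cnorm v)\<^sup>2" unfolding Pnorm[OF trunc_in] by (rule LIMSEQ_unique)
    then have t1: "t = 1" using v by simp
    have UV: "U x \<in> V" if "x \<in> X" for x
      using pyth[OF that] Pnorm[OF that] PV[OF that] t1 by simp
    have "f \<in> V" if f: "f \<in> K" for f
    proof -
      obtain r where r: "orth_proj V f r" using proj[OF f] by blast
      define g where "g = f - r"
      have gK: "g \<in> K" unfolding g_def using r VK f by (intro csubspace_diff[OF csubspace_K]) (auto simp: orth_proj_def)
      \<comment> \<open>V now contains the range of U, so g is orthogonal to its own approximants
        and must vanish.\<close>
      have "cinner g (U (trunc g N)) = 0" for N
      proof -
        have "cinner (U (trunc g N)) g = 0" using r UV[OF trunc_in] by (simp add: orth_proj_def g_def)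
        then show ?thesis using cinner_conj[of g "U (trunc g N)"] by simp
      qed
      then have "cinner g g = 0"
        using LIMSEQ_unique[OF tendsto_cinner_right[OF trunc_tendsto[OF gK], of g] ] by simp
      then have "f = r" by (simp add: cinner_eq_zero g_def)
      then show ?thesis using r by (simp add: orth_proj_def)
    qed
    then show ?thesis using VK by blast
  qed simp
qed

end

section \<open>Irreducible representations on l2 and on C^d\<close>

context stinespring
begin

text \<open>Here K is all of l2, and the norm-closedness in the definition of irreducibility is what
  provides projections onto V.\<close>

lemma irreducible_l2_rep_of_infinite:
  assumes pure: "functional_pure A k \<omega>"
    and I: "I = UNIV"
  shows "irreducible_l2_rep T (\<lambda>a x. l2_fun (\<pi> a (Abs_l2t x)))"
proof -
  have K: "f \<in> K" for f unfolding K_def by (simp add: I)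
  let ?\<pi> = "\<lambda>a x. l2_fun (\<pi> a (Abs_l2t x))"
  have Abs_add: "Abs_l2t (\<lambda>n. x n + y n) = Abs_l2t x + Abs_l2t y" if "x \<in> l2" "y \<in> l2" for x y
    using that by (simp add: plus_l2t_def Abs_l2t_inverse)
  have Abs_scale: "Abs_l2t (\<lambda>n. c * x n) = scaleC c (Abs_l2t x)" if "x \<in> l2" for x c
    using that by (simp add: scaleC_l2t_def Abs_l2t_inverse)
  have rep: "l2_rep T ?\<pi>"
    unfolding l2_rep_def
  proof (intro conjI ballI allI)
    fix a x y c assume a: "a \<in> A" and x: "x \<in> l2" and y: "y \<in> l2"
    show "?\<pi> a x \<in> l2" by (rule l2_fun)
    show "?\<pi> a (\<lambda>n. x n + y n) = (\<lambda>n. ?\<pi> a x n + ?\<pi> a y n)"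
      by (rule ext) (simp add: Abs_add[OF x y] \<pi>_add_right[OF a] l2_fun_ops)
    show "?\<pi> a (\<lambda>n. c * x n) = (\<lambda>n. c * ?\<pi> a x n)"
      by (rule ext) (simp add: Abs_scale[OF x] \<pi>_scale_right[OF a] l2_fun_ops)
    show "?\<pi> (op_scale c a) x = (\<lambda>n. c * ?\<pi> a x n)"
      by (rule ext) (simp add: \<pi>_op_scale[OF a K] l2_fun_ops)
    have "cinner (Abs_l2t x) (\<pi> (adj a) (Abs_l2t y)) = cinner (\<pi> (adj (adj a)) (Abs_l2t x)) (Abs_l2t y)"
      by (rule \<pi>_adj[OF cstar_adj[OF a] K K])
    then show "l2inner (?\<pi> a x) y = l2inner x (?\<pi> (adj a) y)"
      using adj_adj[OF A_bounded[OF a]] by (simp add: cinner_l2t_def Abs_l2t_inverse x y)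
  next
    fix a assume a: "a \<in> A"
    obtain c where c: "op_bound a c" using bounded_op_bound[OF A_bounded[OF a]] ..
    have "l2norm (?\<pi> a x) \<le> c * l2norm x" if "x \<in> l2" for x
      using \<pi>_bound[OF a c, of "Abs_l2t x"] that by (simp add: cnorm_l2t Abs_l2t_inverse)
    then show "\<exists>C. \<forall>x\<in>l2. l2norm (?\<pi> a x) \<le> C * l2norm x" by blast
  next
    fix x :: "nat \<Rightarrow> complex" assume "x \<in> l2"
    then show "?\<pi> id x = x" using \<pi>_id[OF K] by (simp only: Abs_l2t_inverse)
  next
    fix a b x assume a: "a \<in> A" and b: "b \<in> A" and x: "x \<in> l2"
    show "?\<pi> (op_add a b) x = (\<lambda>n. ?\<pi> a x n + ?\<pi> b x n)"
      by (rule ext) (simp only: op_add_eq_plus \<pi>_plus[OF a b K] l2_fun_ops)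
    show "?\<pi> (a \<circ> b) x = ?\<pi> a (?\<pi> b x)" by (simp only: \<pi>_comp[OF a b K] l2_fun_inverse)
  qed
  have "V = {\<lambda>n. 0} \<or> V = l2"
    if V: "V \<subseteq> l2" "(\<lambda>n. 0) \<in> V" "\<forall>v\<in>V. \<forall>w\<in>V. (\<lambda>n. v n + w n) \<in> V" "\<forall>v\<in>V. \<forall>c. (\<lambda>n. c * v n) \<in> V"
      and cl: "\<forall>f g. (\<forall>n. f n \<in> V) \<and> g \<in> l2 \<and> (\<lambda>n. l2norm (\<lambda>i. f n i - g i)) \<longlonglongrightarrow> 0 \<longrightarrow> g \<in> V"
      and inv: "\<forall>a\<in>A. \<forall>v\<in>V. ?\<pi> a v \<in> V" for V
  proof -
    define V' where "V' = {f. l2_fun f \<in> V}"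
    have fe: "l2_fun 0 = (\<lambda>n. 0)" "l2_fun (v + w) = (\<lambda>n. l2_fun v n + l2_fun w n)"
      "l2_fun (v - w) = (\<lambda>n. l2_fun v n - l2_fun w n)" "l2_fun (scaleC c v) = (\<lambda>n. c * l2_fun v n)" for v w c
      by (auto simp: fun_eq_iff l2_fun_ops)
    have sub: "csubspace V'" using V by (simp add: csubspace_def V'_def fe)
    have "\<pi> a v \<in> V'" if "a \<in> A" "v \<in> V'" for a v
      using inv that by (force simp: V'_def l2_fun_inverse)
    then have invV: "invariant V'" using sub K by (auto simp: invariant_def)
    have "\<exists>p. orth_proj V' f p" for f
    proof (rule orth_proj_exists[OF sub])
      fix F l assume "\<forall>n. F n \<in> V'" and lim: "(\<lambda>n. cnorm (F n - l)) \<longlonglongrightarrow> 0"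
      then have "\<forall>n. l2_fun (F n) \<in> V" by (simp add: V'_def)
      moreover have "(\<lambda>n. l2norm (\<lambda>i. l2_fun (F n) i - l2_fun l i)) \<longlonglongrightarrow> 0"
        using lim by (simp add: cnorm_l2t fe)
      ultimately show "l \<in> V'" using cl[rule_format, of "\<lambda>n. l2_fun (F n)" "l2_fun l"] l2_fun[of l] by (simp add: V'_def)
    qed
    then have "V' = {0} \<or> V' = K" using irreducible[OF pure invV] by blast
    then show ?thesis
    proof
      assume 0: "V' = {0}"
      have "v = (\<lambda>n. 0)" if "v \<in> V" for v
      proof -
        have v2: "v \<in> l2" using that V(1) by blast
        then have "Abs_l2t v \<in> V'" using that by (simp add: V'_def Abs_l2t_inverse)
        then have "Abs_l2t v = 0" using 0 by simp
        then show ?thesis using v2 fe(1) by (metis Abs_l2t_inverse)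
      qed
      then show ?thesis using V(2) by blast
    next
      assume 1: "V' = K"
      have "v \<in> V" if "v \<in> l2" for v
      proof -
        have "Abs_l2t v \<in> V'" using 1 K by simp
        then show ?thesis using that by (simp add: V'_def Abs_l2t_inverse)
      qed
      then show ?thesis using V(1) by blast
    qed
  qed
  then show ?thesis using rep unfolding irreducible_l2_rep_def by blast
qed

section \<open>The finite-dimensional case\<close>

context
  fixes d :: nat
  assumes I: "I = {..<d}"
begin

lemma B_e_outside: assumes "x \<in> X" "d \<le> l" shows "B (e l) x = 0"
proof -
  have "B x (e l) = 0" using B_null[OF assms(1) e_in] assms(2) by (simp add: ON I)
  then show ?thesis using B_conj[OF assms(1) e_in] by simp
qed

lemma Parseval_finite: assumes "x \<in> X" "y \<in> X" shows "B x y = (\<Sum>l<d. cnj (B (e l) x) * B (e l) y)"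
proof -
  have "(\<lambda>l. cnj (B (e l) x) * B (e l) y) sums (\<Sum>l<d. cnj (B (e l) x) * B (e l) y)"
    by (rule sums_finite) (auto simp: B_e_outside[OF assms(2)])
  then show ?thesis using Parseval[OF assms] sums_unique2 by blast
qed

text \<open>The matrix of the representation in the orthonormal basis e 0, ..., e (d - 1).\<close>

definition matrep :: "('h \<Rightarrow> 'h) \<Rightarrow> complex mat" where
  "matrep a = mat d d (\<lambda>(m, n). B (e m) (tact a (e n)))"

lemma matrep_carrier: "matrep a \<in> carrier_mat d d"
  by (simp add: matrep_def)

lemma matrep_index: "m < d \<Longrightarrow> n < d \<Longrightarrow> matrep a $$ (m, n) = B (e m) (tact a (e n))"
  by (simp add: matrep_def)

lemma mat_rep_matrep: "mat_rep T d matrep"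
  unfolding mat_rep_def
proof (intro conjI ballI allI)
  show "matrep a \<in> carrier_mat d d" for a by (rule matrep_carrier)
  show "matrep id = 1\<^sub>m d"
    by (rule eq_matI) (auto simp: matrep_def tact_id[unfolded id_def] tact_id ON I)
  fix a assume a: "a \<in> A"
  have aX: "tact a (e n) \<in> X" for n by (rule tact_in[OF a e_in])
  show "matrep (op_scale c a) = c \<cdot>\<^sub>m matrep a" for c
    by (rule eq_matI) (auto simp: matrep_def tact_op_scale B_sc[OF e_in aX])
  show "matrep (adj a) = mat_adjoint (matrep a)"
  proof (rule eq_matI)
    fix m n assume "m < dim_row (mat_adjoint (matrep a))" "n < dim_col (mat_adjoint (matrep a))"
    then have mn: "m < d" "n < d" using mat_adjoint_carrier[OF matrep_carrier[of a]] by auto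
    have "B (e m) (tact (adj a) (e n)) = B (tact a (e m)) (e n)" using B_tact[OF a e_in e_in] by simp
    also have "\<dots> = cnj (B (e n) (tact a (e m)))" by (rule B_conj[OF e_in aX])
    finally show "matrep (adj a) $$ (m, n) = mat_adjoint (matrep a) $$ (m, n)"
      using mn by (simp add: mat_adjoint_index[OF matrep_carrier] matrep_index)
  qed (use mat_adjoint_carrier[OF matrep_carrier[of a]] in \<open>auto simp: matrep_def\<close>)
  fix b assume b: "b \<in> A"
  have bX: "tact b (e n) \<in> X" for n by (rule tact_in[OF b e_in])
  show "matrep (op_add a b) = matrep a + matrep b"
    by (rule eq_matI) (auto simp: matrep_def op_add_eq_plus tact_plus B_add[OF e_in aX bX])
  show "matrep (a \<circ> b) = matrep a * matrep b"
  proof (rule eq_matI)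
    fix m n assume "m < dim_row (matrep a * matrep b)" "n < dim_col (matrep a * matrep b)"
    then have mn: "m < d" "n < d" by (auto simp: matrep_def)
    have aa: "tact (adj a) (e m) \<in> X" by (rule tact_in[OF cstar_adj[OF a] e_in])
    have "matrep (a \<circ> b) $$ (m, n) = B (e m) (tact a (tact b (e n)))"
      by (simp only: matrep_index[OF mn] tact_comp)
    also have "\<dots> = B (tact (adj a) (e m)) (tact b (e n))" by (rule B_tact_right[OF a e_in bX])
    also have "\<dots> = (\<Sum>l<d. cnj (B (e l) (tact (adj a) (e m))) * B (e l) (tact b (e n)))"
      by (rule Parseval_finite[OF aa bX])
    also have "\<dots> = (\<Sum>l<d. matrep a $$ (m, l) * matrep b $$ (l, n))"
    proof (intro sum.cong refl)
      fix l assume l: "l \<in> {..<d}"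
      have "B (e m) (tact a (e l)) = cnj (B (e l) (tact (adj a) (e m)))"
        unfolding B_tact_right[OF a e_in e_in] by (rule B_conj[OF e_in aa])
      then show "cnj (B (e l) (tact (adj a) (e m))) * B (e l) (tact b (e n)) = matrep a $$ (m, l) * matrep b $$ (l, n)"
        using l mn by (simp add: matrep_index)
    qed
    also have "\<dots> = (matrep a * matrep b) $$ (m, n)"
      using mn matrep_carrier[of a] matrep_carrier[of b] by (simp add: scalar_prod_def lessThan_atLeast0)
    finally show "matrep (a \<circ> b) $$ (m, n) = (matrep a * matrep b) $$ (m, n)" .
  qed (auto simp: matrep_def)
qed

lemma K_eq_U_trunc: assumes f: "f \<in> K" shows "f = U (trunc f d)"
  unfolding l2t_eq_iff U_trunc_fun[OF f] using f unfolding K_def by (auto simp: I)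

definition vecof :: "l2t \<Rightarrow> complex vec" where
  "vecof f = vec d (l2_fun f)"

lemma vecof_\<pi>:
  assumes a: "a \<in> A" and f: "f \<in> K"
  shows "vecof (\<pi> a f) = matrep a *\<^sub>v vecof f"
proof (rule eq_vecI)
  fix m assume "m < dim_vec (matrep a *\<^sub>v vecof f)"
  then have m: "m < d" by (simp add: matrep_def)
  have "\<pi> a f = U (tact a (trunc f d))" using K_eq_U_trunc[OF f] \<pi>_U[OF a trunc_in] by metis
  then have "l2_fun (\<pi> a f) m = B (e m) (tact a (trunc f d))" using U_fun[OF tact_in[OF a trunc_in]] by simp
  also have "\<dots> = (\<Sum>n<d. l2_fun f n * B (e m) (tact a (e n)))"
    unfolding trunc_def tact_lincomb[OF a] by (rule B_lincomb_right[OF e_in tact_in[OF a e_in]])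
  also have "\<dots> = (matrep a *\<^sub>v vecof f) $ m"
    using m by (auto simp: matrep_def vecof_def scalar_prod_def lessThan_atLeast0 mult.commute intro!: sum.cong)
  finally show "vecof (\<pi> a f) $ m = (matrep a *\<^sub>v vecof f) $ m" using m by (simp add: vecof_def)
qed (simp add: vecof_def matrep_def)

lemma vecof_surj:
  assumes v: "v \<in> carrier_vec d"
  shows "\<exists>f\<in>K. vecof f = v"
proof -
  define x where "x = (\<Sum>n<d. tscale (v $ n) (e n))"
  have xX: "x \<in> X" unfolding x_def by (rule lincomb_in[OF e_in])
  have "B (e m) x = v $ m" if m: "m < d" for m
  proof -
    have "B (e m) x = (\<Sum>n<d. v $ n * B (e m) (e n))" unfolding x_def by (rule B_lincomb_right[OF e_in e_in])
    also have "\<dots> = (\<Sum>n<d. if n = m then v $ n else 0)" by (intro sum.cong refl) (auto simp: ON I)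
    also have "\<dots> = v $ m" by (simp only: sum.delta[OF finite_lessThan] lessThan_iff m if_True)
    finally show ?thesis .
  qed
  then have "vecof (U x) = v" using v by (intro eq_vecI) (auto simp: vecof_def U_fun[OF xX])
  then show ?thesis using U_in_K[OF xX] by blast
qed

text \<open>Subspaces of C^d are transported to K through \<open>vecof\<close>; the projections come
  from the finite Parseval identity.\<close>

lemma irreducible_mat_rep_of_finite:
  assumes pure: "functional_pure A k \<omega>"
    and k: "1 \<le> k"
  shows "irreducible_mat_rep T d matrep"
proof -
  \<comment> \<open>For d = 0 the form would be zero, but 1 \<otimes> e_0 is a unit vector as
    \<omega> is unital and k \<ge> 1.\<close>
  have d: "1 \<le> d"
  proof (rule ccontr)
    assume "\<not> 1 \<le> d"
    then have "d = 0" by simp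
    then have "B (tunit 0 id) (tact id (tunit 0 id)) = 0"
      using Parseval_finite[OF tunit_id_in tact_in[OF cstar_id tunit_id_in], of 0 0] by (simp only: lessThan_0 sum.empty)
    moreover have "B (tunit 0 id) (tact id (tunit 0 id)) = 1"
      using B_tunit[OF cstar_id, of 0 0] k unit by (simp only:) simp
    ultimately show False by simp
  qed
  have "V = {0\<^sub>v d} \<or> V = carrier_vec d"
    if V: "V \<subseteq> carrier_vec d" "0\<^sub>v d \<in> V" "\<forall>v\<in>V. \<forall>w\<in>V. v + w \<in> V" "\<forall>v\<in>V. \<forall>c. c \<cdot>\<^sub>v v \<in> V"
      and inv: "\<forall>a\<in>A. \<forall>v\<in>V. matrep a *\<^sub>v v \<in> V" for V
  proof -
    define V' where "V' = {f \<in> K. vecof f \<in> V}"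
    have ve: "vecof 0 = 0\<^sub>v d" "vecof (f + g) = vecof f + vecof g" "vecof (scaleC c f) = c \<cdot>\<^sub>v vecof f" for f g c
      by (auto simp: vecof_def l2_fun_ops)
    have sub: "csubspace V'" using V csubspace_K by (simp add: csubspace_def V'_def ve)
    have "\<pi> a v \<in> V'" if "a \<in> A" "v \<in> V'" for a v
      using inv that \<pi>_in_K[OF that(1)] by (simp add: V'_def vecof_\<pi>)
    then have invV: "invariant V'" using sub by (auto simp: invariant_def V'_def)
    have "\<exists>p. orth_proj V' f p" for f
    proof (rule orth_proj_exists_finite[OF sub, of "\<lambda>n. U (e n)" d])
      show "cnorm (U (e n)) \<le> 1" for n
      proof (rule power2_le_imp_le)
        show "(cnorm (U (e n)))\<^sup>2 \<le> 1\<^sup>2" unfolding U_norm[OF e_in] by (simp add: ON)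
      qed simp
      fix v assume "v \<in> V'"
      then have "v \<in> K" by (simp add: V'_def)
      then obtain x where x: "x \<in> X" "v = U x" using K_eq_U_trunc trunc_in by blast
      have "Re (B x x) = (\<Sum>n<d. (cmod (B (e n) x))\<^sup>2)"
      proof -
        have "B x x = complex_of_real (\<Sum>n<d. (cmod (B (e n) x))\<^sup>2)"
          unfolding Parseval_finite[OF x(1) x(1)] of_real_sum
          by (intro sum.cong refl) (metis complex_norm_square mult.commute)
        then show ?thesis by simp
      qed
      then show "(cnorm v)\<^sup>2 = (\<Sum>n<d. (cmod (cinner (U (e n)) v))\<^sup>2)"
        unfolding x(2) U_norm[OF x(1)] U_inner[OF e_in x(1)] .
    qed
    then have "V' = {0} \<or> V' = K" using irreducible[OF pure invV] by blast
    then show ?thesis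
    proof
      assume 0: "V' = {0}"
      have "v = 0\<^sub>v d" if v: "v \<in> V" for v
      proof -
        obtain f where f: "f \<in> K" "vecof f = v" using vecof_surj V(1) v by blast
        then have "f = 0" using 0 v by (auto simp: V'_def)
        then show ?thesis using f ve(1) by simp
      qed
      then show ?thesis using V(2) by blast
    next
      assume 1: "V' = K"
      have "v \<in> V" if v: "v \<in> carrier_vec d" for v
      proof -
        obtain f where f: "f \<in> K" "vecof f = v" using vecof_surj v by blast
        then have "f \<in> V'" using 1 by simp
        then show ?thesis using f by (simp add: V'_def)
      qed
      then show ?thesis using V(1) by blast
    qed
  qed
  then show ?thesis using d mat_rep_matrep unfolding irreducible_mat_rep_def by blast
qed

text \<open>If \<open>d \<le> k\<close>, counting shows that the orthonormal vectors \<open>1 \<otimes> e\<^sub>l\<close> span the Stinespring space.\<close>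

lemma multiplicative_of_small:
  assumes dk: "d \<le> k" and a: "a \<in> A" and b: "b \<in> A" and ij: "i < k" "j < k"
  shows "\<omega> (a \<circ> b) $$ (i, j) = (\<Sum>l<k. \<omega> a $$ (i, l) * \<omega> b $$ (l, j))"
proof -
  define w where "w l = tunit l (id :: 'h \<Rightarrow> 'h)" for l
  have wX: "w l \<in> X" for l unfolding w_def by (rule tunit_id_in)
  have ww: "B (w p) (w q) = (if p = q then 1 else 0)" if "p < k" "q < k" for p q
    using B_tunit[OF cstar_id that] that unfolding w_def tact_id unit by simp
  have so: "semi_orthonormal w k" using wX ww by (simp add: semi_orthonormal_def)
  have sq: "cmod (B x y) = cmod (B y x)" if "x \<in> X" "y \<in> X" for x y
    using B_conj[OF that] by (metis complex_mod_cnj)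
  \<comment> \<open>Exchanging the sums, Parseval in the basis e gives 1 for each of the k unit
    vectors w l.\<close>
  have tot: "(\<Sum>n<d. \<Sum>l<k. (cmod (B (w l) (e n)))\<^sup>2) = real k"
  proof -
    have "(\<Sum>n<d. \<Sum>l<k. (cmod (B (w l) (e n)))\<^sup>2) = (\<Sum>l<k. \<Sum>n<d. (cmod (B (e n) (w l)))\<^sup>2)"
      by (subst sum.swap) (simp only: sq[OF wX e_in])
    also have "\<dots> = (\<Sum>l<k. 1)"
    proof (intro sum.cong refl)
      fix l assume l: "l \<in> {..<k}"
      have "complex_of_real (\<Sum>n<d. (cmod (B (e n) (w l)))\<^sup>2) = B (w l) (w l)"
        unfolding Parseval_finite[OF wX wX] of_real_sum
        by (intro sum.cong refl) (metis complex_norm_square mult.commute)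
      also have "\<dots> = complex_of_real 1" using ww l by simp
      finally show "(\<Sum>n<d. (cmod (B (e n) (w l)))\<^sup>2) = 1" unfolding of_real_eq_iff .
    qed
    finally show ?thesis by simp
  qed
  have res: "Re (B (resid w k (e n)) (resid w k (e n))) = 1 - (\<Sum>l<k. (cmod (B (w l) (e n)))\<^sup>2)" if "n < d" for n
    unfolding norm_resid[OF so e_in] using that by (simp add: ON I)
  have rX: "resid w k x \<in> X" if "x \<in> X" for x by (rule resid_in[OF wX that])
  \<comment> \<open>The squared distances of the e n from the span of the w l add up to d - k \<le>
    0, so each of them is zero.\<close>
  have null: "Re (B (resid w k (e n)) (resid w k (e n))) = 0" if n: "n < d" for n
  proof -
    have "(\<Sum>n<d. Re (B (resid w k (e n)) (resid w k (e n)))) = (\<Sum>n<d. 1 - (\<Sum>l<k. (cmod (B (w l) (e n)))\<^sup>2))"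
      by (intro sum.cong refl) (simp add: res)
    also have "\<dots> = real d - real k" unfolding sum_subtractf tot by simp
    also have "\<dots> \<le> 0" using dk by simp
    finally have "(\<Sum>n<d. Re (B (resid w k (e n)) (resid w k (e n)))) \<le> 0" .
    moreover have nn: "0 \<le> Re (B (resid w k (e n)) (resid w k (e n)))" for n by (rule B_nonneg[OF rX[OF e_in]])
    ultimately have "(\<Sum>n<d. Re (B (resid w k (e n)) (resid w k (e n)))) = 0"
      using sum_nonneg[of "{..<d}" "\<lambda>n. Re (B (resid w k (e n)) (resid w k (e n)))"] by simp
    then show ?thesis using n nn by (subst (asm) sum_nonneg_eq_0_iff) auto
  qed
  have expand: "B x (e n) = (\<Sum>l<k. B x (w l) * B (w l) (e n))" if x: "x \<in> X" and n: "n < d" for x n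
  proof -
    have PX: "(\<Sum>l<k. tscale (B (w l) (e n)) (w l)) \<in> X" by (rule lincomb_in[OF wX])
    have "0 = B x (resid w k (e n))" using B_null[OF x rX[OF e_in] null[OF n]] by simp
    also have "\<dots> = B x (e n) - (\<Sum>l<k. B (w l) (e n) * B x (w l))"
      unfolding resid_def B_diff_right[OF x e_in PX] using B_lincomb_right[of x k w, OF x wX] by simp
    finally show ?thesis by (simp add: mult.commute)
  qed
  \<comment> \<open>Resolution of the identity by the w l; inserted between a and b it yields the
    matrix product.\<close>
  have complete: "B x y = (\<Sum>l<k. B x (w l) * B (w l) y)" if x: "x \<in> X" and y: "y \<in> X" for x y
  proof -
    have "B x y = (\<Sum>n<d. B x (e n) * B (e n) y)"
      unfolding Parseval_finite[OF x y] using B_conj[OF e_in x] by (intro sum.cong refl) simp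
    also have "\<dots> = (\<Sum>n<d. \<Sum>l<k. B x (w l) * (B (w l) (e n) * B (e n) y))"
      by (intro sum.cong refl) (simp add: expand[OF x] sum_distrib_right mult.assoc)
    also have "\<dots> = (\<Sum>l<k. \<Sum>n<d. B x (w l) * (B (w l) (e n) * B (e n) y))" by (rule sum.swap)
    also have "\<dots> = (\<Sum>l<k. B x (w l) * B (w l) y)"
    proof (intro sum.cong refl)
      fix l
      have "B (w l) y = (\<Sum>n<d. B (w l) (e n) * B (e n) y)"
        unfolding Parseval_finite[OF wX y] using B_conj[OF e_in wX] by (intro sum.cong refl) simp
      then show "(\<Sum>n<d. B x (w l) * (B (w l) (e n) * B (e n) y)) = B x (w l) * B (w l) y"
        by (simp add: sum_distrib_left)
    qed
    finally show ?thesis .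
  qed
  have aX: "tact (adj a) (w i) \<in> X" by (rule tact_in[OF cstar_adj[OF a] wX])
  have bX: "tact b (w j) \<in> X" by (rule tact_in[OF b wX])
  have "\<omega> (a \<circ> b) $$ (i, j) = B (w i) (tact a (tact b (w j)))"
    using B_tunit[OF cstar_mult[OF a b] ij] by (simp only: w_def tact_comp)
  also have "\<dots> = B (tact (adj a) (w i)) (tact b (w j))" by (rule B_tact_right[OF a wX bX])
  also have "\<dots> = (\<Sum>l<k. B (tact (adj a) (w i)) (w l) * B (w l) (tact b (w j)))" by (rule complete[OF aX bX])
  also have "\<dots> = (\<Sum>l<k. \<omega> a $$ (i, l) * \<omega> b $$ (l, j))"
  proof (intro sum.cong refl)
    fix l assume "l \<in> {..<k}"
    then have l: "l < k" by simp
    have "B (tact (adj a) (w i)) (w l) = \<omega> a $$ (i, l)"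
      using B_tact_right[OF a wX wX, of i l] B_tunit[OF a ij(1) l] by (simp add: w_def)
    moreover have "B (w l) (tact b (w j)) = \<omega> b $$ (l, j)" using B_tunit[OF b l ij(2)] by (simp add: w_def)
    ultimately show "B (tact (adj a) (w i)) (w l) * B (w l) (tact b (w j)) = \<omega> a $$ (i, l) * \<omega> b $$ (l, j)" by simp
  qed
  finally show ?thesis .
qed

end

end

section \<open>Pure representations of subhomogeneous algebras\<close>

lemma ucp_pure_multiplicative:
  assumes T: "bounded_op T" and sub: "subhomogeneous T k" and k: "1 \<le> k" and ucp: "ucp_map (cstar T) k \<omega>"
    and pure: "functional_pure (cstar T) k \<omega>"
    and a: "a \<in> cstar T" and b: "b \<in> cstar T" and ij: "i < k" "j < k"
  shows "\<omega> (a \<circ> b) $$ (i, j) = (\<Sum>l<k. \<omega> a $$ (i, l) * \<omega> b $$ (l, j))"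
proof -
  have cp: "cp_map (cstar T) k \<omega>" using ucp by (simp add: ucp_map_def)
  interpret semi_inner "tuples T" tscale "stine k \<omega>" by (rule semi_inner_stine[OF T cp])
  obtain e I where e: "I = UNIV \<or> (\<exists>d. I = {..<d})" "\<And>n. e n \<in> tuples T"
     "\<And>m n. stine k \<omega> (e m) (e n) = (if m = n \<and> n \<in> I then 1 else 0)"
     "\<And>x. x \<in> tuples T \<Longrightarrow> (\<lambda>N. Re (stine k \<omega> (resid e N x) (resid e N x))) \<longlonglongrightarrow> 0"
    using gram_schmidt[of "word_tuple T", OF word_tuple_in[OF T] word_tuples_dense[OF T ucp]] by blast
  have st: "stinespring T k \<omega> e I" by (rule stinespring.intro[OF T ucp e(2-4)])
  have "I \<noteq> UNIV"
    using stinespring.irreducible_l2_rep_of_infinite[OF st pure] sub unfolding subhomogeneous_def by blast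
  then obtain d where d: "I = {..<d}" using e(1) by blast
  have "d \<le> k"
    using stinespring.irreducible_mat_rep_of_finite[OF st d pure k] sub unfolding subhomogeneous_def by blast
  then show ?thesis by (rule stinespring.multiplicative_of_small[OF st d _ a b ij])
qed

text \<open>Induction over the generation of C*(T), entry by entry; in the limit case the entry
  bound of ucp maps gives norm continuity.\<close>

lemma ucp_multiplicative_determined:
  assumes T: "bounded_op T" and ucp: "ucp_map (cstar T) k \<phi>" "ucp_map (cstar T) k \<psi>" and gen: "\<phi> T = \<psi> T"
    and mult: "\<And>a b i j. a \<in> cstar T \<Longrightarrow> b \<in> cstar T \<Longrightarrow> i < k \<Longrightarrow> j < k \<Longrightarrow> \<phi> (a \<circ> b) $$ (i, j) = (\<Sum>l<k. \<phi> a $$ (i, l) * \<phi> b $$ (l, j))"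
      "\<And>a b i j. a \<in> cstar T \<Longrightarrow> b \<in> cstar T \<Longrightarrow> i < k \<Longrightarrow> j < k \<Longrightarrow> \<psi> (a \<circ> b) $$ (i, j) = (\<Sum>l<k. \<psi> a $$ (i, l) * \<psi> b $$ (l, j))"
    and a: "a \<in> cstar T" and ij: "i < k" "j < k"
  shows "\<phi> a $$ (i, j) = \<psi> a $$ (i, j)"
  using a ij
proof (induction arbitrary: i j)
  case cstar_id
  then show ?case using ucp unfolding ucp_map_def by (simp only:)
next
  case cstar_gen
  then show ?case using gen by simp
next
  case (cstar_adj S)
  note A = op_system_cstar[OF T]
  have cp: "cp_map (cstar T) k \<phi>" "cp_map (cstar T) k \<psi>" using ucp by (auto simp: ucp_map_def)
  show ?case
    using cp_map_adj[OF A cp(1) cstar_adj.hyps cstar_adj.prems(2,1)] cp_map_adj[OF A cp(2) cstar_adj.hyps cstar_adj.prems(2,1)]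
      cstar_adj.IH[OF cstar_adj.prems(2,1)] by simp
next
  case (cstar_add S R)
  have lin: "mat_linear (cstar T) k \<phi>" "mat_linear (cstar T) k \<psi>" using ucp cp_map_mat_linear by (auto simp: ucp_map_def)
  show ?case unfolding op_add_eq_plus
      mat_linear_entry_add[OF lin(1) cstar_add.hyps cstar_add.prems] mat_linear_entry_add[OF lin(2) cstar_add.hyps cstar_add.prems]
      cstar_add.IH(1)[OF cstar_add.prems] cstar_add.IH(2)[OF cstar_add.prems] ..
next
  case (cstar_scale S c)
  have lin: "mat_linear (cstar T) k \<phi>" "mat_linear (cstar T) k \<psi>" using ucp cp_map_mat_linear by (auto simp: ucp_map_def)
  show ?case
    using mat_linear_entry_scale[OF lin(1) cstar_scale.hyps cstar_scale.prems] mat_linear_entry_scale[OF lin(2) cstar_scale.hyps cstar_scale.prems]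
      cstar_scale.IH cstar_scale.prems by simp
next
  case (cstar_mult S R)
  show ?case
    unfolding mult(1)[OF cstar_mult.hyps cstar_mult.prems] mult(2)[OF cstar_mult.hyps cstar_mult.prems]
    by (intro sum.cong refl) (use cstar_mult in auto)
next
  case (cstar_lim F S)
  note A = op_system_cstar[OF T]
  have FA: "F n \<in> cstar T" and IH: "\<phi> (F n) $$ (i, j) = \<psi> (F n) $$ (i, j)" for n
    using cstar_lim by blast+
  have lim: "(\<lambda>n. opnorm (\<lambda>x. F n x - S x)) \<longlonglongrightarrow> 0" and Sb: "bounded_op S" using cstar_lim by blast+
  have SA: "S \<in> cstar T" using cstar.cstar_lim[of F T S] FA Sb lim by blast
  have tend: "(\<lambda>n. \<chi> (F n) $$ (i, j)) \<longlonglongrightarrow> \<chi> S $$ (i, j)" if \<chi>: "ucp_map (cstar T) k \<chi>" for \<chi>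
  proof -
    have lin: "mat_linear (cstar T) k \<chi>" using \<chi> cp_map_mat_linear by (auto simp: ucp_map_def)
    have "cmod (\<chi> (F n) $$ (i, j) - \<chi> S $$ (i, j)) \<le> opnorm (\<lambda>x. F n x - S x)" for n
    proof -
      have d: "F n - S \<in> cstar T" by (rule op_system_diff[OF A FA SA])
      have eq: "(\<lambda>x. F n x - S x) = F n - S" by (rule ext) simp
      have "op_bound (F n - S) (opnorm (F n - S))" by (rule opnorm_bound[OF bounded_op_cstar[OF T d]])
      then show ?thesis
        using ucp_map_entry_bound[OF A \<chi> d _ cstar_lim.prems] mat_linear_entry_diff[OF A lin FA SA cstar_lim.prems]
        unfolding eq by metis
    qed
    then have "(\<lambda>n. \<chi> (F n) $$ (i, j) - \<chi> S $$ (i, j)) \<longlonglongrightarrow> 0"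
      by (intro null_le_tendsto[OF _ lim] always_eventually allI)
    then show ?thesis by (simp add: LIM_zero_iff)
  qed
  show ?case using tend[OF ucp(1)] tend[OF ucp(2)] IH LIMSEQ_unique by simp
qed

theorem pure_subhomogeneous_boundary:
  assumes T: "bounded_op T" and irr: "irreducible_mat_rep T k \<rho>" and sub: "subhomogeneous T k"
    and pure: "pure_map (op_sys T) k \<rho>"
  shows "boundary_rep T k \<rho>"
  unfolding boundary_rep_def
proof (intro conjI allI impI ballI irr)
  fix \<psi> a0
  assume \<psi>: "ucp_map (cstar T) k \<psi> \<and> (\<forall>a\<in>op_sys T. \<psi> a = \<rho> a)" and a0: "a0 \<in> cstar T"
  note A = op_system_cstar[OF T] and S = op_system_op_sys[OF T] and SA = op_sys_subset[of T]
  have rep: "mat_rep T k \<rho>" and k: "1 \<le> k" using irr by (auto simp: irreducible_mat_rep_def)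
  have \<rho>u: "ucp_map (cstar T) k \<rho>" by (rule irreducible_mat_rep_ucp[OF T irr])
  have \<rho>cp: "cp_map (cstar T) k \<rho>" and \<psi>cp: "cp_map (cstar T) k \<psi>" using \<rho>u \<psi> by (auto simp: ucp_map_def)
  note \<rho>lin = cp_map_mat_linear[OF \<rho>cp] and \<psi>lin = cp_map_mat_linear[OF \<psi>cp]
  have \<rho>S: "cp_map (op_sys T) k \<rho>" by (rule cp_map_restrict[OF \<rho>cp SA])
  note \<rho>Slin = cp_map_mat_linear[OF \<rho>S]
  have idS: "id \<in> op_sys T" by (rule op_systemD(1)[OF S])
  show "\<psi> a0 = \<rho> a0"
  proof (rule ccontr)
    assume ne: "\<psi> a0 \<noteq> \<rho> a0"
    have "\<exists>i<k. \<exists>j<k. \<psi> a0 $$ (i, j) \<noteq> \<rho> a0 $$ (i, j)"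
    proof (rule ccontr)
      assume "\<not> ?thesis"
      then have "\<psi> a0 = \<rho> a0"
        using mat_linearD(1)[OF \<rho>lin a0] mat_linearD(1)[OF \<psi>lin a0] by (intro eq_matI) auto
      then show False using ne by simp
    qed
    then obtain i j where ij: "i < k" "j < k" and neq: "\<psi> a0 $$ (i, j) \<noteq> \<rho> a0 $$ (i, j)" by blast
    \<comment> \<open>The conjugate factor makes the functionals of \<psi> and \<rho> differ at v0
      by cnj z * z, a positive real number, so maximality at v0 can separate them.\<close>
    define z where "z = \<psi> a0 $$ (i, j) - \<rho> a0 $$ (i, j)"
    define v0 where "v0 = eunit i j (op_scale (cnj z) a0)"
    have za: "op_scale (cnj z) a0 \<in> cstar T" by (rule cstar_scale[OF a0])
    have v0A: "v0 \<in> entries_in (cstar T)" unfolding v0_def by (rule entries_in_eunit[OF A za])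
    have v0tr: "mtrace k \<chi> v0 = cnj z * \<chi> a0 $$ (i, j)" if "mat_linear (cstar T) k \<chi>" for \<chi>
      unfolding v0_def mtrace_eunit[OF A that ij] by (rule mat_linear_entry_scale[OF that a0 ij])
    have gap: "Re (mtrace k \<rho> v0) < Re (mtrace k \<psi> v0)"
    proof -
      have "mtrace k \<psi> v0 - mtrace k \<rho> v0 = cnj z * z"
        unfolding v0tr[OF \<rho>lin] v0tr[OF \<psi>lin] z_def by (simp only: right_diff_distrib)
      also have "\<dots> = complex_of_real ((cmod z)\<^sup>2)" by (metis complex_norm_square mult.commute)
      finally have "Re (mtrace k \<psi> v0) - Re (mtrace k \<rho> v0) = (cmod z)\<^sup>2"
        by (metis Re_complex_of_real minus_complex.simps(1))
      moreover have "(cmod z)\<^sup>2 > 0" using neq by (simp add: z_def)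
      ultimately show ?thesis by linarith
    qed
    interpret ordered_cone rscale "entries_in (cstar T)" "accretive k (cstar T)" "entries_in (op_sys T)" ident_opmat
      by (rule ordered_cone_opmat[OF S A SA])
    define f where "f C = Re (mtrace k \<rho> C)" for C
    have fS: "posfun rscale (entries_in (op_sys T)) (accretive k (op_sys T)) f"
      unfolding f_def by (rule posfun_of_cp_map[OF S \<rho>S])
    show False
    proof (rule extremal_extension[of f v0])
      show "0 \<le> f x" if "x \<in> entries_in (op_sys T)" "x \<in> accretive k (cstar T)" for x
        using that posfun_nonneg[OF S fS] by (simp add: accretive_def)
      show "f (x + y) = f x + f y" if "x \<in> entries_in (op_sys T)" "y \<in> entries_in (op_sys T)" for x y
        by (rule posfun_add[OF S fS that])
      show "f (rscale r x) = r * f x" if "x \<in> entries_in (op_sys T)" for x r by (rule posfun_scale[OF S fS that])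
      show "v0 \<in> entries_in (cstar T)" by (rule v0A)
    next
      fix F
      assume F: "posfun rscale (entries_in (cstar T)) (accretive k (cstar T)) F"
        "\<And>x. x \<in> entries_in (op_sys T) \<Longrightarrow> F x = f x"
        "\<And>g. posfun rscale (entries_in (cstar T)) (accretive k (cstar T)) g \<Longrightarrow> (\<And>x. x \<in> entries_in (op_sys T) \<Longrightarrow> g x = f x) \<Longrightarrow> g v0 \<le> F v0"
        "\<And>g1 g2 t x. posfun rscale (entries_in (cstar T)) (accretive k (cstar T)) g1 \<Longrightarrow> posfun rscale (entries_in (cstar T)) (accretive k (cstar T)) g2 \<Longrightarrow>
          0 \<le> t \<Longrightarrow> t \<le> 1 \<Longrightarrow> (\<And>x. x \<in> entries_in (cstar T) \<Longrightarrow> g1 x + g2 x = F x) \<Longrightarrow>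
          (\<And>x. x \<in> entries_in (op_sys T) \<Longrightarrow> g1 x = t * f x) \<Longrightarrow> x \<in> entries_in (cstar T) \<Longrightarrow> g1 x = t * F x"
      \<comment> \<open>\<psi> competes in the maximum at v0, so F lies strictly above \<rho>
        there.\<close>
      have "Re (mtrace k \<psi> v0) \<le> F v0"
      proof (rule F(3)[OF posfun_of_cp_map[OF A \<psi>cp]])
        fix C assume C: "C \<in> entries_in (op_sys T)"
        then have "\<psi> (C p q) = \<rho> (C p q)" for p q using \<psi> by (simp add: entries_in_def)
        then show "Re (mtrace k \<psi> C) = f C" by (simp add: f_def mtrace_def)
      qed
      then have Fgap: "Re (mtrace k \<rho> v0) < F v0" using gap by simp
      define \<omega> where "\<omega> = map_of_functional k F"
      have \<omega>cp: "cp_map (cstar T) k \<omega>" unfolding \<omega>_def by (rule map_of_functional_cp[OF A F(1)])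
      have \<omega>F: "Re (mtrace k \<omega> C) = F C" if "C \<in> entries_in (cstar T)" for C
        unfolding \<omega>_def mtrace_map_of_functional[OF A F(1) that] by simp
      have FS: "posfun rscale (entries_in (op_sys T)) (accretive k (op_sys T)) F" by (rule posfun_restrict[OF F(1) SA])
      have \<omega>S: "\<omega> a = \<rho> a" if "a \<in> op_sys T" for a
        unfolding \<omega>_def by (rule map_of_functional_eq[OF S FS \<rho>Slin _ that]) (simp add: F(2) f_def)
      have \<omega>u: "ucp_map (cstar T) k \<omega>" using \<omega>cp \<omega>S[OF idS] mat_repD(2)[OF rep] unfolding ucp_map_def by simp
      have pureF: "\<exists>t. \<forall>C\<in>entries_in (cstar T). g1 C = t * Re (mtrace k \<omega> C)"
        if g1: "posfun rscale (entries_in (cstar T)) (accretive k (cstar T)) g1"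
          and g2: "posfun rscale (entries_in (cstar T)) (accretive k (cstar T)) g2"
          and sum: "\<And>C. C \<in> entries_in (cstar T) \<Longrightarrow> g1 C + g2 C = Re (mtrace k \<omega> C)" for g1 g2
      proof -
        \<comment> \<open>g1 and g2 turn into completely positive maps that add up to \<rho> on the
          operator system. Purity supplies t there, and the extremality of F carries the relation to
          the whole algebra.\<close>
        define \<theta>1 where "\<theta>1 = map_of_functional k g1"
        define \<theta>2 where "\<theta>2 = map_of_functional k g2"
        have g1S: "posfun rscale (entries_in (op_sys T)) (accretive k (op_sys T)) g1" by (rule posfun_restrict[OF g1 SA])
        have g2S: "posfun rscale (entries_in (op_sys T)) (accretive k (op_sys T)) g2" by (rule posfun_restrict[OF g2 SA])
        have \<theta>cp: "cp_map (op_sys T) k \<theta>1" "cp_map (op_sys T) k \<theta>2"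
          unfolding \<theta>1_def \<theta>2_def using map_of_functional_cp[OF S g1S] map_of_functional_cp[OF S g2S] by auto
        have \<theta>sum: "\<theta>2 a = \<rho> a - \<theta>1 a" if a: "a \<in> op_sys T" for a
        proof -
          have aA: "a \<in> cstar T" and iaA: "op_scale \<i> a \<in> cstar T" using a SA cstar_scale by blast+
          have "g1 (eunit p q b) + g2 (eunit p q b) = F (eunit p q b)" if "b \<in> cstar T" for p q b
            using sum[OF entries_in_eunit[OF A that]] \<omega>F[OF entries_in_eunit[OF A that]] by simp
          from this[OF aA] this[OF iaA]
          have "\<theta>2 a = \<omega> a - \<theta>1 a"
            by (intro eq_matI) (auto simp: \<theta>1_def \<theta>2_def \<omega>_def map_of_functional_def complex_eq_iff algebra_simps)
          then show ?thesis using \<omega>S[OF a] by simp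
        qed
        have "cp_map (op_sys T) k (\<lambda>a. \<rho> a - \<theta>1 a)"
          by (rule cp_map_cong[OF \<theta>cp(2) \<theta>sum]) (use op_systemD(2,3)[OF S] in \<open>auto simp: op_add_eq_plus\<close>)
        then have "cp_le (op_sys T) k \<theta>1 \<rho>" using \<theta>cp(1) \<rho>S by (simp add: cp_le_def)
        then obtain t :: real where t: "0 \<le> t" "t \<le> 1" "\<And>a. a \<in> op_sys T \<Longrightarrow> \<theta>1 a = complex_of_real t \<cdot>\<^sub>m \<rho> a"
          using pure unfolding pure_map_def by blast
        have g1f: "g1 C = t * f C" if C: "C \<in> entries_in (op_sys T)" for C
        proof -
          have CS: "C p q \<in> op_sys T" for p q using C by (simp add: entries_in_def)
          have "mtrace k \<theta>1 C = complex_of_real t * mtrace k \<rho> C"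
            unfolding mtrace_def sum_distrib_left
          proof (intro sum.cong refl)
            fix p q assume "p \<in> {..<k}" "q \<in> {..<k}"
            then show "\<theta>1 (C p q) $$ (p, q) = complex_of_real t * \<rho> (C p q) $$ (p, q)"
              using carrier_matD[OF mat_linearD(1)[OF \<rho>Slin CS[of p q]]] by (simp add: t(3)[OF CS])
          qed
          moreover have "Re (mtrace k \<theta>1 C) = g1 C"
            unfolding \<theta>1_def mtrace_map_of_functional[OF S g1S C] by simp
          ultimately show ?thesis by (simp add: f_def)
        qed
        have sum': "g1 C + g2 C = F C" if "C \<in> entries_in (cstar T)" for C using sum[OF that] \<omega>F[OF that] by simp
        have "g1 C = t * Re (mtrace k \<omega> C)" if C: "C \<in> entries_in (cstar T)" for C
          unfolding \<omega>F[OF C] by (rule F(4)[OF g1 g2 t(1,2) sum' g1f C])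
        then show ?thesis by blast
      qed
      then have "functional_pure (cstar T) k \<omega>" unfolding functional_pure_def by blast
      note \<omega>mult = ucp_pure_multiplicative[OF T sub k \<omega>u this]
      have gen: "\<omega> T = \<rho> T" by (rule \<omega>S[OF gen_in_op_sys[OF T]])
      have "\<omega> a0 $$ (i, j) = \<rho> a0 $$ (i, j)"
        by (rule ucp_multiplicative_determined[OF T \<omega>u \<rho>u gen \<omega>mult mat_rep_mult_entry[OF rep] a0 ij])
      then have "mtrace k \<omega> v0 = mtrace k \<rho> v0"
        unfolding v0tr[OF \<rho>lin] v0tr[OF cp_map_mat_linear[OF \<omega>cp]] by simp
      then show False using Fgap \<omega>F[OF v0A] by simp
    qed
  qed
qed

theorem mainTheorem14:
  fixes T :: "'h::chilbert \<Rightarrow> 'h" and k :: nat and \<rho> :: "('h \<Rightarrow> 'h) \<Rightarrow> complex mat"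
  assumes "bounded_op T"
    and "irreducible_mat_rep T k \<rho>"
  shows "(boundary_rep T k \<rho> \<longrightarrow>
            matrix_extreme T k (\<rho> T) \<and> ucp_map (op_sys T) k \<rho> \<and> pure_map (op_sys T) k \<rho>)
       \<and> (subhomogeneous T k \<and> ucp_map (op_sys T) k \<rho> \<and> pure_map (op_sys T) k \<rho>
            \<longrightarrow> boundary_rep T k \<rho>)"
proof (intro conjI impI)
  have "ucp_map (cstar T) k \<rho>" by (rule irreducible_mat_rep_ucp[OF assms])
  then have ucp: "ucp_map (op_sys T) k \<rho>"
    using cp_map_restrict[OF _ op_sys_subset] unfolding ucp_map_def by blast
  show "ucp_map (op_sys T) k \<rho>" by (rule ucp)
  assume "boundary_rep T k \<rho>"
  then show pure: "pure_map (op_sys T) k \<rho>" by (rule boundary_rep_pure[OF assms(1)])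
  show "matrix_extreme T k (\<rho> T)" by (rule pure_mat_rep_matrix_extreme[OF assms(1) ucp pure])
next
  assume "subhomogeneous T k \<and> ucp_map (op_sys T) k \<rho> \<and> pure_map (op_sys T) k \<rho>"
  then show "boundary_rep T k \<rho>" using pure_subhomogeneous_boundary[OF assms] by blast
qed

end
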